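(* Let $B\subset(A,\rho)$ be an inclusion of C*-probability spaces such that $B$ is simple and purely infinite, and suppose there is a net $(b_\lambda)_\lambda$ of positive elements of norm $1$ in $B$ that excises $\rho$, i.e. $\|b_\lambda^{1/2}ab_\lambda^{1/2}-\rho(a)b_\lambda\|\to0$ for all $a\in A$, and that also satisfies $\rho(ab_\lambda a^* )\to0$ for all $a\in A$. Then $B\subset(A,\rho)$ is a selfless inclusion.
   Context: **C*-probability spaces.** A C*-probability space $(A,\rho)$ is a unital C*-algebra $A$ with a state $\rho$ whose GNS representation is faithful (standing assumption on all states, except ultrapower states). Morphisms are unital state-preserving *-homomorphisms. An inclusion $B\subset(A,\rho)$ consists of a C*-probability space $(A,\rho)$ and a unital C*-subalgebra $B$ of $A$ with the restricted state $\rho|_B$. For an ultrafilter $\omega$ on a set $I$, $A^\omega=\ell^\infty(I,A)/\{(a_i):\lim_{i\to\omega}\|a_i\|=0\}$, with state $\rho^\omega((a_i)_i)=\lim_{i\to\omega}\rho(a_i)$; $B^\omega\subseteq A^\omega$ naturally. The symbol $*$ denotes the reduced free product of C*-probability spaces, with the free product state. **Selfless inclusions.** $B\subset(A,\rho)$ is selfless if there exist a free ultrafilter $\omega$, a C*-probability space $(C,\kappa)$ with $C\ne\mathbb{C}$, and a state-preserving unital embedding of C*-algebras $\sigma\colon A*C\to A^\omega$ such that the restriction of $\sigma$ to the first factor $A$ is the diagonal inclusion $A\to A^\omega$ and $\sigma(B*C)\subseteq B^\omega$ (equivalently $\sigma(C)\subseteq B^\omega$). *)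

theory Defs
  imports Complex_Main "HOL-Algebra.QuotRing" "HOL-Library.Nonpos_Ints"
begin

section \<open>Unital C*-algebras\<close>

text \<open>C*-algebras are carrier-based, like the rings of HOL-Algebra, because selflessness quantifies
  existentially over C*-algebras and involves quotients of function algebras.\<close>

record 'a cstar = "'a ring" +
  cscale :: "complex \<Rightarrow> 'a \<Rightarrow> 'a"
  star :: "'a \<Rightarrow> 'a"
  nrm :: "'a \<Rightarrow> real"

locale cstar_algebra = ring A for A :: "'a cstar" (structure) +
  assumes cscale_closed: "x \<in> carrier A \<Longrightarrow> cscale A c x \<in> carrier A"
    and cscale_add_right: "\<lbrakk>x \<in> carrier A; y \<in> carrier A\<rbrakk>
      \<Longrightarrow> cscale A c (x \<oplus> y) = cscale A c x \<oplus> cscale A c y"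
    and cscale_add_left: "x \<in> carrier A \<Longrightarrow> cscale A (c + d) x = cscale A c x \<oplus> cscale A d x"
    and cscale_cscale: "x \<in> carrier A \<Longrightarrow> cscale A c (cscale A d x) = cscale A (c * d) x"
    and cscale_one: "x \<in> carrier A \<Longrightarrow> cscale A 1 x = x"
    and cscale_mult_left: "\<lbrakk>x \<in> carrier A; y \<in> carrier A\<rbrakk>
      \<Longrightarrow> cscale A c x \<otimes> y = cscale A c (x \<otimes> y)"
    and cscale_mult_right: "\<lbrakk>x \<in> carrier A; y \<in> carrier A\<rbrakk>
      \<Longrightarrow> x \<otimes> cscale A c y = cscale A c (x \<otimes> y)"
    and star_closed: "x \<in> carrier A \<Longrightarrow> star A x \<in> carrier A"
    and star_star: "x \<in> carrier A \<Longrightarrow> star A (star A x) = x"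
    and star_add: "\<lbrakk>x \<in> carrier A; y \<in> carrier A\<rbrakk> \<Longrightarrow> star A (x \<oplus> y) = star A x \<oplus> star A y"
    and star_cscale: "x \<in> carrier A \<Longrightarrow> star A (cscale A c x) = cscale A (cnj c) (star A x)"
    and star_mult: "\<lbrakk>x \<in> carrier A; y \<in> carrier A\<rbrakk> \<Longrightarrow> star A (x \<otimes> y) = star A y \<otimes> star A x"
    and nrm_nonneg: "x \<in> carrier A \<Longrightarrow> 0 \<le> nrm A x"
    and nrm_eq_0_iff: "x \<in> carrier A \<Longrightarrow> nrm A x = 0 \<longleftrightarrow> x = \<zero>"
    and nrm_triangle: "\<lbrakk>x \<in> carrier A; y \<in> carrier A\<rbrakk> \<Longrightarrow> nrm A (x \<oplus> y) \<le> nrm A x + nrm A y"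
    and nrm_cscale: "x \<in> carrier A \<Longrightarrow> nrm A (cscale A c x) = cmod c * nrm A x"
    and nrm_mult: "\<lbrakk>x \<in> carrier A; y \<in> carrier A\<rbrakk> \<Longrightarrow> nrm A (x \<otimes> y) \<le> nrm A x * nrm A y"
    and cstar_identity: "x \<in> carrier A \<Longrightarrow> nrm A (star A x \<otimes> x) = (nrm A x)\<^sup>2"
    and complete: "\<lbrakk>\<And>n. f n \<in> carrier A;
        \<And>e. 0 < e \<Longrightarrow> \<exists>N. \<forall>m\<ge>N. \<forall>n\<ge>N. nrm A (f m \<ominus> f n) < e\<rbrakk>
      \<Longrightarrow> \<exists>x\<in>carrier A. (\<lambda>n. nrm A (f n \<ominus> x)) \<longlonglongrightarrow> 0"

definition nrm_closed :: "'a cstar \<Rightarrow> 'a set \<Rightarrow> bool" where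
  "nrm_closed A S \<longleftrightarrow>
    (\<forall>x\<in>carrier A. (\<forall>e>0. \<exists>s\<in>S. nrm A (x \<ominus>\<^bsub>A\<^esub> s) < e) \<longrightarrow> x \<in> S)"

text \<open>A C*-subalgebra need not contain the unit; regarded as an algebra in its own right, a
  subalgebra \<open>S\<close> is the structure \<open>A\<lparr>carrier := S\<rparr>\<close>.\<close>

definition cstar_subalgebra :: "'a cstar \<Rightarrow> 'a set \<Rightarrow> bool" where
  "cstar_subalgebra A S \<longleftrightarrow>
    S \<subseteq> carrier A \<and> \<zero>\<^bsub>A\<^esub> \<in> S \<and>
    (\<forall>x\<in>S. \<forall>y\<in>S. x \<oplus>\<^bsub>A\<^esub> y \<in> S \<and> x \<otimes>\<^bsub>A\<^esub> y \<in> S) \<and>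
    (\<forall>c. \<forall>x\<in>S. cscale A c x \<in> S) \<and> (\<forall>x\<in>S. star A x \<in> S) \<and> nrm_closed A S"

definition unital_cstar_subalgebra :: "'a cstar \<Rightarrow> 'a set \<Rightarrow> bool" where
  "unital_cstar_subalgebra A S \<longleftrightarrow> cstar_subalgebra A S \<and> \<one>\<^bsub>A\<^esub> \<in> S"

definition cstar_generated :: "'a cstar \<Rightarrow> 'a set \<Rightarrow> 'a set" where
  "cstar_generated A X = \<Inter> {S. unital_cstar_subalgebra A S \<and> X \<subseteq> S}"

definition star_hom :: "'a cstar \<Rightarrow> 'b cstar \<Rightarrow> ('a \<Rightarrow> 'b) set" where
  "star_hom A B = {h \<in> ring_hom A B.
    (\<forall>c. \<forall>x\<in>carrier A. h (cscale A c x) = cscale B c (h x)) \<and>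
    (\<forall>x\<in>carrier A. h (star A x) = star B (h x))}"

definition cstar_embedding :: "'a cstar \<Rightarrow> 'b cstar \<Rightarrow> ('a \<Rightarrow> 'b) \<Rightarrow> bool" where
  "cstar_embedding A B h \<longleftrightarrow> h \<in> star_hom A B \<and> inj_on h (carrier A)"


section \<open>Positivity, simplicity, pure infiniteness\<close>

definition pos_elems :: "'a cstar \<Rightarrow> 'a set" where
  "pos_elems A = {star A x \<otimes>\<^bsub>A\<^esub> x | x. x \<in> carrier A}"

definition cle :: "'a cstar \<Rightarrow> 'a \<Rightarrow> 'a \<Rightarrow> bool" where
  "cle A x y \<longleftrightarrow> y \<ominus>\<^bsub>A\<^esub> x \<in> pos_elems A"

definition pos_sqrt :: "'a cstar \<Rightarrow> 'a \<Rightarrow> 'a" where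
  "pos_sqrt A x = (THE y. y \<in> pos_elems A \<and> y \<otimes>\<^bsub>A\<^esub> y = x)"

definition projections :: "'a cstar \<Rightarrow> 'a set" where
  "projections A = {p \<in> carrier A. star A p = p \<and> p \<otimes>\<^bsub>A\<^esub> p = p}"

text \<open>A projection is infinite if it is Murray--von Neumann equivalent to a proper subprojection.\<close>

definition infinite_projection :: "'a cstar \<Rightarrow> 'a \<Rightarrow> bool" where
  "infinite_projection A p \<longleftrightarrow> p \<in> projections A \<and>
    (\<exists>q\<in>projections A. cle A q p \<and> q \<noteq> p \<and>
      (\<exists>v\<in>carrier A. star A v \<otimes>\<^bsub>A\<^esub> v = p \<and> v \<otimes>\<^bsub>A\<^esub> star A v = q))"

definition hereditary_subalgebra :: "'a cstar \<Rightarrow> 'a set \<Rightarrow> bool" where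
  "hereditary_subalgebra A H \<longleftrightarrow> cstar_subalgebra A H \<and>
    (\<forall>x\<in>pos_elems A. \<forall>y\<in>pos_elems A \<inter> H. cle A x y \<longrightarrow> x \<in> H)"

definition simple_cstar :: "'a cstar \<Rightarrow> bool" where
  "simple_cstar A \<longleftrightarrow> cstar_algebra A \<and> \<one>\<^bsub>A\<^esub> \<noteq> \<zero>\<^bsub>A\<^esub> \<and>
    (\<forall>J. ideal J A \<and> nrm_closed A J \<longrightarrow> J = {\<zero>\<^bsub>A\<^esub>} \<or> J = carrier A)"

text \<open>Cuntz's definition of pure infiniteness, which is meant for simple C*-algebras.\<close>

definition purely_infinite :: "'a cstar \<Rightarrow> bool" where
  "purely_infinite A \<longleftrightarrow>
    (\<forall>H. hereditary_subalgebra A H \<and> H \<noteq> {\<zero>\<^bsub>A\<^esub>} \<longrightarrow> (\<exists>p\<in>H. infinite_projection A p))"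


section \<open>C*-probability spaces\<close>

definition state :: "'a cstar \<Rightarrow> ('a \<Rightarrow> complex) \<Rightarrow> bool" where
  "state A \<rho> \<longleftrightarrow>
    (\<forall>x\<in>carrier A. \<forall>y\<in>carrier A. \<rho> (x \<oplus>\<^bsub>A\<^esub> y) = \<rho> x + \<rho> y) \<and>
    (\<forall>c. \<forall>x\<in>carrier A. \<rho> (cscale A c x) = c * \<rho> x) \<and>
    (\<forall>x\<in>pos_elems A. \<rho> x \<in> \<real>\<^sub>\<ge>\<^sub>0) \<and> \<rho> \<one>\<^bsub>A\<^esub> = 1"

text \<open>\<open>gns_vec A \<rho> x\<close> is the vector \<open>[x]\<close> of the GNS space: the class of \<open>x\<close> modulo the null space
  of \<open>\<langle>x, y\<rangle> = \<rho>(x* y)\<close>. These vectors are dense in the GNS Hilbert space, and the GNS representation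
  \<open>\<pi>\<close> is \<open>\<pi>(a)[x] = [ax]\<close>; so \<open>gns_faithful\<close> says that \<open>\<pi>\<close> is injective.\<close>

definition gns_vec :: "'a cstar \<Rightarrow> ('a \<Rightarrow> complex) \<Rightarrow> 'a \<Rightarrow> 'a set" where
  "gns_vec A \<rho> x = {y \<in> carrier A. \<rho> (star A (y \<ominus>\<^bsub>A\<^esub> x) \<otimes>\<^bsub>A\<^esub> (y \<ominus>\<^bsub>A\<^esub> x)) = 0}"

definition gns_faithful :: "'a cstar \<Rightarrow> ('a \<Rightarrow> complex) \<Rightarrow> bool" where
  "gns_faithful A \<rho> \<longleftrightarrow> (\<forall>a\<in>carrier A. \<forall>b\<in>carrier A.
    (\<forall>x\<in>carrier A. gns_vec A \<rho> (a \<otimes>\<^bsub>A\<^esub> x) = gns_vec A \<rho> (b \<otimes>\<^bsub>A\<^esub> x)) \<longrightarrow> a = b)"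

definition cstar_prob_space :: "'a cstar \<Rightarrow> ('a \<Rightarrow> complex) \<Rightarrow> bool" where
  "cstar_prob_space A \<rho> \<longleftrightarrow> cstar_algebra A \<and> state A \<rho> \<and> gns_faithful A \<rho>"

text \<open>Faithfulness of the GNS representation is a standing assumption on all states, hence also on
  the restriction of \<open>\<rho>\<close> to \<open>B\<close>; it is automatic if \<open>B\<close> is simple.\<close>

definition cstar_inclusion :: "'a set \<Rightarrow> 'a cstar \<Rightarrow> ('a \<Rightarrow> complex) \<Rightarrow> bool" where
  "cstar_inclusion B A \<rho> \<longleftrightarrow> cstar_prob_space A \<rho> \<and> unital_cstar_subalgebra A B \<and>
    cstar_prob_space (A\<lparr>carrier := B\<rparr>) \<rho>"

definition state_preserving ::
    "'a cstar \<Rightarrow> ('a \<Rightarrow> complex) \<Rightarrow> ('b \<Rightarrow> complex) \<Rightarrow> ('a \<Rightarrow> 'b) \<Rightarrow> bool" where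
  "state_preserving A \<rho> \<phi> h \<longleftrightarrow> (\<forall>x\<in>carrier A. \<phi> (h x) = \<rho> x)"


section \<open>Reduced free products\<close>

text \<open>Freeness of two unital subalgebras \<open>S\<close> and \<open>T\<close>: alternating products of centred elements are
  centred. The Boolean tag of a letter records whether it is taken from \<open>S\<close> or from \<open>T\<close>.\<close>

definition free_pair :: "'d cstar \<Rightarrow> ('d \<Rightarrow> complex) \<Rightarrow> 'd set \<Rightarrow> 'd set \<Rightarrow> bool" where
  "free_pair D \<phi> S T \<longleftrightarrow> (\<forall>w :: (bool \<times> 'd) list.
    w \<noteq> [] \<and> distinct_adj (map fst w) \<and>
    (\<forall>(k, x)\<in>set w. x \<in> (if k then S else T) \<and> \<phi> x = 0) \<longrightarrow>
    \<phi> (foldr (\<lambda>(k, x) y. x \<otimes>\<^bsub>D\<^esub> y) w \<one>\<^bsub>D\<^esub>) = 0)"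

text \<open>\<open>(D, \<phi>)\<close> with the embeddings \<open>iA\<close> and \<open>iC\<close> is the reduced free product of \<open>(A, \<rho>)\<close> and
  \<open>(C, \<kappa>)\<close>. By the theorem of Voiculescu and Avitzour such a \<open>(D, \<phi>, iA, iC)\<close> exists and is unique
  up to a unique isomorphism compatible with the embeddings and the states.\<close>

definition reduced_free_product ::
    "'a cstar \<Rightarrow> ('a \<Rightarrow> complex) \<Rightarrow> 'c cstar \<Rightarrow> ('c \<Rightarrow> complex) \<Rightarrow>
     'd cstar \<Rightarrow> ('d \<Rightarrow> complex) \<Rightarrow> ('a \<Rightarrow> 'd) \<Rightarrow> ('c \<Rightarrow> 'd) \<Rightarrow> bool" where
  "reduced_free_product A \<rho> C \<kappa> D \<phi> iA iC \<longleftrightarrow>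
    cstar_prob_space D \<phi> \<and>
    cstar_embedding A D iA \<and> state_preserving A \<rho> \<phi> iA \<and>
    cstar_embedding C D iC \<and> state_preserving C \<kappa> \<phi> iC \<and>
    cstar_generated D (iA ` carrier A \<union> iC ` carrier C) = carrier D \<and>
    free_pair D \<phi> (iA ` carrier A) (iC ` carrier C)"


section \<open>Ultrapowers\<close>

definition free_ultrafilter :: "'i filter \<Rightarrow> bool" where
  "free_ultrafilter \<omega> \<longleftrightarrow> \<omega> \<noteq> bot \<and>
    (\<forall>P. eventually P \<omega> \<or> eventually (\<lambda>i. \<not> P i) \<omega>) \<and> (\<forall>j. eventually (\<lambda>i. i \<noteq> j) \<omega>)"

definition ell_infty :: "'a cstar \<Rightarrow> ('i \<Rightarrow> 'a) cstar" where
  "ell_infty A = \<lparr>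
    carrier = {f. (\<forall>i. f i \<in> carrier A) \<and> (\<exists>M. \<forall>i. nrm A (f i) \<le> M)},
    mult = \<lambda>f g i. f i \<otimes>\<^bsub>A\<^esub> g i, one = \<lambda>i. \<one>\<^bsub>A\<^esub>, zero = \<lambda>i. \<zero>\<^bsub>A\<^esub>,
    add = \<lambda>f g i. f i \<oplus>\<^bsub>A\<^esub> g i,
    cscale = \<lambda>c f i. cscale A c (f i), star = \<lambda>f i. star A (f i),
    nrm = \<lambda>f. SUP i. nrm A (f i)\<rparr>"

text \<open>Quotient by a closed two-sided ideal \<open>N\<close>, as the ring \<open>L Quot N\<close> of cosets with the quotient
  norm. Adding \<open>N\<close> in \<open>cscale\<close> only matters for the scalar \<open>0\<close>.\<close>

definition cstar_quotient :: "'a cstar \<Rightarrow> 'a set \<Rightarrow> 'a set cstar" where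
  "cstar_quotient L N = ring.extend (L Quot N) (cstar.fields
    (\<lambda>c X. N <+>\<^bsub>L\<^esub> cscale L c ` X) (\<lambda>X. star L ` X) (\<lambda>X. INF f\<in>X. nrm L f))"

definition ultra_null :: "'a cstar \<Rightarrow> 'i filter \<Rightarrow> ('i \<Rightarrow> 'a) set" where
  "ultra_null A \<omega> = {f \<in> carrier (ell_infty A). ((\<lambda>i. nrm A (f i)) \<longlongrightarrow> 0) \<omega>}"

definition ultrapower :: "'a cstar \<Rightarrow> 'i filter \<Rightarrow> ('i \<Rightarrow> 'a) set cstar" where
  "ultrapower A \<omega> = cstar_quotient (ell_infty A) (ultra_null A \<omega>)"

definition ultra_class :: "'a cstar \<Rightarrow> 'i filter \<Rightarrow> ('i \<Rightarrow> 'a) \<Rightarrow> ('i \<Rightarrow> 'a) set" where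
  "ultra_class A \<omega> f = ultra_null A \<omega> +>\<^bsub>ell_infty A\<^esub> f"

definition ultra_state ::
    "('a \<Rightarrow> complex) \<Rightarrow> 'i filter \<Rightarrow> ('i \<Rightarrow> 'a) set \<Rightarrow> complex" where
  "ultra_state \<rho> \<omega> X = (THE z. \<forall>f\<in>X. ((\<lambda>i. \<rho> (f i)) \<longlongrightarrow> z) \<omega>)"

definition ultra_sub :: "'a cstar \<Rightarrow> 'i filter \<Rightarrow> 'a set \<Rightarrow> ('i \<Rightarrow> 'a) set set" where
  "ultra_sub A \<omega> B = ultra_class A \<omega> ` {f \<in> carrier (ell_infty A). \<forall>i. f i \<in> B}"


section \<open>Selfless inclusions\<close>

definition selfless_witness ::
    "'a set \<Rightarrow> 'a cstar \<Rightarrow> ('a \<Rightarrow> complex) \<Rightarrow> 'i filter \<Rightarrow> 'c cstar \<Rightarrow> ('c \<Rightarrow> complex) \<Rightarrow>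
     'd cstar \<Rightarrow> ('d \<Rightarrow> complex) \<Rightarrow> ('a \<Rightarrow> 'd) \<Rightarrow> ('c \<Rightarrow> 'd) \<Rightarrow> ('d \<Rightarrow> ('i \<Rightarrow> 'a) set) \<Rightarrow> bool" where
  "selfless_witness B A \<rho> \<omega> C \<kappa> D \<phi> iA iC \<sigma> \<longleftrightarrow>
    free_ultrafilter \<omega> \<and>
    cstar_prob_space C \<kappa> \<and> carrier C \<noteq> range (\<lambda>z. cscale C z \<one>\<^bsub>C\<^esub>) \<and>
    reduced_free_product A \<rho> C \<kappa> D \<phi> iA iC \<and>
    cstar_embedding D (ultrapower A \<omega>) \<sigma> \<and> state_preserving D \<phi> (ultra_state \<rho> \<omega>) \<sigma> \<and>
    (\<forall>a\<in>carrier A. \<sigma> (iA a) = ultra_class A \<omega> (\<lambda>i. a)) \<and>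
    \<sigma> ` cstar_generated D (iA ` B \<union> iC ` carrier C) \<subseteq> ultra_sub A \<omega> B"

text \<open>HOL cannot quantify over types inside a formula, so the index set and the carriers of \<open>C\<close> and
  of the reduced free product \<open>D\<close> are taken from fixed types that are large enough for this to be no
  restriction. For \<open>C\<close> and \<open>D\<close>: both embed into the ultrapower, whose elements have the type used
  here. For the index set: finitely many norm inequalities and approximate moments at a time suffice
  to produce \<open>\<sigma>\<close>, and \<open>D\<close> may be taken to be of density character at most the cardinality of \<open>A\<close>
  (replace \<open>C\<close> by a separable subalgebra on which \<open>\<kappa>\<close> still has a faithful GNS representation), so
  an arbitrary index set can be replaced by one of cardinality at most that of \<open>A\<close>. An ultrafilter on
  a subset of a type is the same as an ultrafilter on the type that contains the subset.\<close>

definition selfless :: "'a set \<Rightarrow> 'a cstar \<Rightarrow> ('a \<Rightarrow> complex) \<Rightarrow> bool" where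
  "selfless B A \<rho> \<longleftrightarrow>
    (\<exists>(\<omega> :: 'a set filter)
       (C :: ('a set \<Rightarrow> 'a) set cstar) (\<kappa> :: ('a set \<Rightarrow> 'a) set \<Rightarrow> complex)
       (D :: ('a set \<Rightarrow> 'a) set cstar) (\<phi> :: ('a set \<Rightarrow> 'a) set \<Rightarrow> complex) iA iC \<sigma>.
       selfless_witness B A \<rho> \<omega> C \<kappa> D \<phi> iA iC \<sigma>)"


section \<open>Nets and excision\<close>

definition directed_set :: "'l set \<Rightarrow> ('l \<Rightarrow> 'l \<Rightarrow> bool) \<Rightarrow> bool" where
  "directed_set \<Lambda> leq \<longleftrightarrow> \<Lambda> \<noteq> {} \<and> (\<forall>l\<in>\<Lambda>. leq l l) \<and>
    (\<forall>l\<in>\<Lambda>. \<forall>m\<in>\<Lambda>. \<forall>n\<in>\<Lambda>. leq l m \<and> leq m n \<longrightarrow> leq l n) \<and>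
    (\<forall>l\<in>\<Lambda>. \<forall>m\<in>\<Lambda>. \<exists>n\<in>\<Lambda>. leq l n \<and> leq m n)"

text \<open>The filter of tails: convergence of a net indexed by \<open>\<Lambda>\<close> is convergence along it.\<close>

definition net_filter :: "'l set \<Rightarrow> ('l \<Rightarrow> 'l \<Rightarrow> bool) \<Rightarrow> 'l filter" where
  "net_filter \<Lambda> leq = (INF l\<in>\<Lambda>. principal {m \<in> \<Lambda>. leq l m})"

definition excises ::
    "'a cstar \<Rightarrow> ('a \<Rightarrow> complex) \<Rightarrow> 'l filter \<Rightarrow> ('l \<Rightarrow> 'a) \<Rightarrow> bool" where
  "excises A \<rho> F b \<longleftrightarrow> (\<forall>a\<in>carrier A.
    ((\<lambda>l. nrm A (pos_sqrt A (b l) \<otimes>\<^bsub>A\<^esub> a \<otimes>\<^bsub>A\<^esub> pos_sqrt A (b l) \<ominus>\<^bsub>A\<^esub> cscale A (\<rho> a) (b l))) \<longlongrightarrow> 0) F)"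

end

theory Submission
  imports Defs
begin

text \<open>A net that excises \<open>\<rho>\<close> and satisfies \<open>\<rho>(a b a*) \<rightarrow> 0\<close> yields, because \<open>B\<close> is purely infinite, contractions
  \<open>s = b\<^sup>1\<^sup>/\<^sup>2 v\<close> in \<open>B\<close> with \<open>s* a s \<approx> \<rho>(a)\<close> and \<open>\<rho>(a* s s* a) \<approx> 0\<close>; they define \<open>S\<close> in the ultrapower of \<open>B\<close> with
  \<open>S* a S = \<rho>(a)\<close> and \<open>\<rho>(a* S S* a) = 0\<close> for all \<open>a \<in> A\<close>. Take \<open>C = C*(S)\<close>, on which the ultrapower state is the
  vacuum state of the Toeplitz algebra. The relations for \<open>S\<close> imply that \<open>A\<close> and \<open>C\<close> are free, so that the algebra
  \<open>D\<close> generated by \<open>A\<close> and \<open>C\<close> in the ultrapower is the reduced free product, provided that the GNS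
  representation of \<open>D\<close> is faithful. This is the gauge-invariant uniqueness theorem for Pimsner's Toeplitz algebra:
  if a sum of words \<open>a\<^sub>0 S a\<^sub>1 S \<dots> S* a\<^sub>k\<close> is positive in the GNS representation, then its Fejer means
  with respect to the degree are almost positive in every state of the ultrapower, and hence so is the sum itself.\<close>

section \<open>Norm limits and the positive cone\<close>

text \<open>The ultrapower state need not have a faithful GNS representation on the whole
  ultrapower, so an element of D that annihilates all GNS vectors of D is not obviously zero. No
  gauge action on D is given in advance: degrees are read off from words, and positivity is tested
  against limits of vector states of A, which separate the points of the ultrapower. Freeness rests
  on a dichotomy: a reduced word beginning with a centred letter of A becomes null when S* is
  applied, one beginning with a centred letter of C lies, up to null vectors, in the closed range of
  S. Pure infiniteness enters twice: it moves b close to 1, and it supplies two isometries with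
  orthogonal ranges, by which finite sums become single products. Hilbert spaces and spectra are
  avoided: order is handled by a cone defined through the norm and by square roots that commute with
  whatever commutes with the given element, projections in GNS spaces by near minimisers of the
  distance. The ultrafilter concentrates on the finite subsets of A, which gives the index type of
  \<open>selfless\<close>.\<close>

context cstar_algebra
begin

abbreviation scal :: "complex \<Rightarrow> 'a \<Rightarrow> 'a" (infixr "\<cdot>" 75) where "c \<cdot> x \<equiv> cscale A c x"
abbreviation adj :: "'a \<Rightarrow> 'a" ("_\<^sup>\<star>" [1000] 999) where "x\<^sup>\<star> \<equiv> star A x"
abbreviation nm :: "'a \<Rightarrow> real" ("\<parallel>_\<parallel>") where "\<parallel>x\<parallel> \<equiv> nrm A x"

declare cscale_closed [simp, intro] star_closed [simp, intro] star_star [simp] cscale_one [simp]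

lemma cscale_zero_left [simp]: "x \<in> carrier A \<Longrightarrow> 0 \<cdot> x = \<zero>"
  using cscale_add_left[of x 0 0] by (metis add_0 add.r_cancel_one cscale_closed)

lemma cscale_zero_right [simp]: "c \<cdot> \<zero> = \<zero>"
  by (metis cscale_zero_left cscale_cscale mult_zero_right zero_closed)

lemma a_inv_cscale: "x \<in> carrier A \<Longrightarrow> \<ominus> x = (-1) \<cdot> x"
proof -
  assume x: "x \<in> carrier A"
  have "(-1) \<cdot> x \<oplus> x = \<zero>"
    using cscale_add_left[OF x, of "-1" 1] x by simp
  then show ?thesis using x by (metis cscale_closed minus_equality)
qed

lemma minus_cscale: "\<lbrakk>x \<in> carrier A; y \<in> carrier A\<rbrakk> \<Longrightarrow> x \<ominus> y = x \<oplus> (-1) \<cdot> y"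
  by (simp add: minus_eq a_inv_cscale)

lemma star_zero [simp]: "\<zero>\<^sup>\<star> = \<zero>"
  by (metis cscale_zero_left star_cscale complex_cnj_zero star_closed zero_closed)

lemma star_one [simp]: "\<one>\<^sup>\<star> = \<one>"
  by (metis l_one one_closed r_one star_closed star_mult star_star)

lemma star_a_inv: "x \<in> carrier A \<Longrightarrow> (\<ominus> x)\<^sup>\<star> = \<ominus> (x\<^sup>\<star>)"
  by (simp add: a_inv_cscale star_cscale)

lemma star_minus: "\<lbrakk>x \<in> carrier A; y \<in> carrier A\<rbrakk> \<Longrightarrow> (x \<ominus> y)\<^sup>\<star> = x\<^sup>\<star> \<ominus> y\<^sup>\<star>"
  by (simp add: minus_eq star_add star_a_inv)

lemma cscale_a_inv: "x \<in> carrier A \<Longrightarrow> c \<cdot> (\<ominus> x) = \<ominus> (c \<cdot> x)"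
  by (simp add: a_inv_cscale cscale_cscale)

lemma cscale_minus_right: "\<lbrakk>x \<in> carrier A; y \<in> carrier A\<rbrakk> \<Longrightarrow> c \<cdot> (x \<ominus> y) = c \<cdot> x \<ominus> c \<cdot> y"
  by (simp add: minus_eq cscale_add_right cscale_a_inv)

lemma cscale_diff_left: "x \<in> carrier A \<Longrightarrow> (c - d) \<cdot> x = c \<cdot> x \<ominus> d \<cdot> x"
  using cscale_add_left[of x c "- d"] by (simp add: minus_cscale cscale_cscale)

lemma nrm_zero [simp]: "\<parallel>\<zero>\<parallel> = 0"
  by (simp add: nrm_eq_0_iff)

lemma nrm_a_inv [simp]: "x \<in> carrier A \<Longrightarrow> \<parallel>\<ominus> x\<parallel> = \<parallel>x\<parallel>"
  by (simp add: a_inv_cscale nrm_cscale)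

lemma minus_self [simp]: "x \<in> carrier A \<Longrightarrow> x \<ominus> x = \<zero>"
  by (simp add: minus_eq r_neg)

lemma a_inv_minus: "\<lbrakk>x \<in> carrier A; y \<in> carrier A\<rbrakk> \<Longrightarrow> \<ominus> (x \<ominus> y) = y \<ominus> x"
  by algebra

lemma nrm_minus_commute: "\<lbrakk>x \<in> carrier A; y \<in> carrier A\<rbrakk> \<Longrightarrow> \<parallel>x \<ominus> y\<parallel> = \<parallel>y \<ominus> x\<parallel>"
  by (metis a_inv_minus minus_closed nrm_a_inv)

lemma nrm_minus_triangle:
  assumes "x \<in> carrier A" "y \<in> carrier A" "z \<in> carrier A"
  shows "\<parallel>x \<ominus> z\<parallel> \<le> \<parallel>x \<ominus> y\<parallel> + \<parallel>y \<ominus> z\<parallel>"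
proof -
  have "x \<ominus> z = (x \<ominus> y) \<oplus> (y \<ominus> z)"
    using assms by algebra
  then show ?thesis using nrm_triangle[of "x \<ominus> y" "y \<ominus> z"] assms by simp
qed

lemma nrm_le_minus:
  assumes "x \<in> carrier A" "y \<in> carrier A"
  shows "\<parallel>x\<parallel> \<le> \<parallel>y\<parallel> + \<parallel>x \<ominus> y\<parallel>"
proof -
  have "x = (x \<ominus> y) \<oplus> y"
    using assms by algebra
  then show ?thesis using nrm_triangle[of "x \<ominus> y" y] assms by simp
qed

lemma minus_eq_zero_iff: "\<lbrakk>x \<in> carrier A; y \<in> carrier A\<rbrakk> \<Longrightarrow> x \<ominus> y = \<zero> \<longleftrightarrow> x = y"
  by (metis a_inv_minus minus_zero minus_equality minus_eq minus_minus a_inv_closed r_neg add.inv_comm)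

lemma nrm_star [simp]: assumes x: "x \<in> carrier A" shows "\<parallel>x\<^sup>\<star>\<parallel> = \<parallel>x\<parallel>"
proof -
  have le: "\<parallel>y\<parallel> \<le> \<parallel>y\<^sup>\<star>\<parallel>" if y: "y \<in> carrier A" for y
  proof (cases "\<parallel>y\<parallel> = 0")
    case True then show ?thesis using y nrm_nonneg[of "y\<^sup>\<star>"] by simp
  next
    case False
    then have p: "\<parallel>y\<parallel> > 0" using nrm_nonneg[OF y] by simp
    have "\<parallel>y\<parallel> * \<parallel>y\<parallel> \<le> \<parallel>y\<^sup>\<star>\<parallel> * \<parallel>y\<parallel>"
      using cstar_identity[OF y] nrm_mult[of "y\<^sup>\<star>" y] y by (simp add: power2_eq_square)
    then show ?thesis using p by simp
  qed
  show ?thesis using le[OF x] le[of "x\<^sup>\<star>"] x by simp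
qed

lemma nrm_sq: "x \<in> carrier A \<Longrightarrow> x\<^sup>\<star> = x \<Longrightarrow> \<parallel>x \<otimes> x\<parallel> = \<parallel>x\<parallel>\<^sup>2"
  using cstar_identity[of x] by simp

lemma star_mult_zero_iff: "x \<in> carrier A \<Longrightarrow> x\<^sup>\<star> \<otimes> x = \<zero> \<longleftrightarrow> x = \<zero>"
  by (metis cstar_identity nrm_eq_0_iff m_closed star_closed power_eq_0_iff r_null zero_power2)

lemma nrm_one_le: "\<parallel>\<one>\<parallel> \<le> 1"
  using nrm_sq[of \<one>] nrm_nonneg[of \<one>] by (auto simp: power2_eq_square)

lemma nrm_mult_le:
  "\<lbrakk>x \<in> carrier A; y \<in> carrier A; \<parallel>x\<parallel> \<le> s; \<parallel>y\<parallel> \<le> t\<rbrakk> \<Longrightarrow> \<parallel>x \<otimes> y\<parallel> \<le> s * t"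
  by (meson nrm_mult mult_mono nrm_nonneg order_trans)

lemma nrm_add_le:
  "\<lbrakk>x \<in> carrier A; y \<in> carrier A; \<parallel>x\<parallel> \<le> s; \<parallel>y\<parallel> \<le> t\<rbrakk> \<Longrightarrow> \<parallel>x \<oplus> y\<parallel> \<le> s + t"
  by (meson nrm_triangle add_mono order_trans)

definition sc :: "complex \<Rightarrow> 'a" where "sc c = c \<cdot> \<one>"

lemma sc_closed [simp, intro]: "sc c \<in> carrier A" by (simp add: sc_def)
lemma sc_add: "sc c \<oplus> sc d = sc (c + d)" by (simp add: sc_def cscale_add_left)
lemma sc_diff: "sc c \<ominus> sc d = sc (c - d)" by (simp add: sc_def cscale_diff_left)
lemma sc_mult_left: "x \<in> carrier A \<Longrightarrow> sc c \<otimes> x = c \<cdot> x" by (simp add: sc_def cscale_mult_left)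
lemma sc_mult_right: "x \<in> carrier A \<Longrightarrow> x \<otimes> sc c = c \<cdot> x" by (simp add: sc_def cscale_mult_right)
lemma star_sc: "(sc c)\<^sup>\<star> = sc (cnj c)" by (simp add: sc_def star_cscale)
lemma cscale_sc: "c \<cdot> sc d = sc (c * d)" by (simp add: sc_def cscale_cscale)
lemma sc_0 [simp]: "sc 0 = \<zero>" by (simp add: sc_def)
lemma sc_1 [simp]: "sc 1 = \<one>" by (simp add: sc_def)
lemma nrm_sc_le: "\<parallel>sc c\<parallel> \<le> cmod c"
  using nrm_one_le by (simp add: sc_def nrm_cscale mult_left_le)

text \<open>The norm condition puts the spectrum of \<open>a\<close> into \<open>[0, 2t]\<close>; that this cone consists of the elements
  \<open>x* x\<close> is \<open>pos_elems_eq_P\<close>.\<close>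

definition P :: "'a set" where
  "P = {a \<in> carrier A. a\<^sup>\<star> = a \<and> (\<exists>t\<ge>0. \<parallel>sc (of_real t) \<ominus> a\<parallel> \<le> t)}"

lemma P_carrier: "a \<in> P \<Longrightarrow> a \<in> carrier A" by (simp add: P_def)
lemma P_star: "a \<in> P \<Longrightarrow> a\<^sup>\<star> = a" by (simp add: P_def)

lemma P_zero [simp]: "\<zero> \<in> P"
  by (auto simp: P_def intro!: exI[of _ 0])

lemma P_add: assumes "a \<in> P" "b \<in> P" shows "a \<oplus> b \<in> P"
proof -
  obtain s t where s: "s \<ge> 0" "\<parallel>sc (of_real s) \<ominus> a\<parallel> \<le> s" and t: "t \<ge> 0" "\<parallel>sc (of_real t) \<ominus> b\<parallel> \<le> t"
    using assms by (auto simp: P_def)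
  have c: "a \<in> carrier A" "b \<in> carrier A" using assms by (auto simp: P_def)
  have "sc (of_real (s + t)) \<ominus> (a \<oplus> b) = (sc (of_real s) \<ominus> a) \<oplus> (sc (of_real t) \<ominus> b)"
  proof -
    have "sc (of_real (s + t)) = sc (of_real s) \<oplus> sc (of_real t)" by (simp add: sc_add)
    moreover have "\<And>u v. u \<in> carrier A \<Longrightarrow> v \<in> carrier A \<Longrightarrow> (u \<oplus> v) \<ominus> (a \<oplus> b) = (u \<ominus> a) \<oplus> (v \<ominus> b)"
      using c by algebra
    ultimately show ?thesis by simp
  qed
  then have "\<parallel>sc (of_real (s + t)) \<ominus> (a \<oplus> b)\<parallel> \<le> s + t"
    using nrm_triangle[of "sc (of_real s) \<ominus> a" "sc (of_real t) \<ominus> b"] s t c by auto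
  then show ?thesis using assms s t unfolding P_def by (auto simp: star_add intro!: exI[of _ "s + t"])
qed

lemma P_cscale: assumes "a \<in> P" "r \<ge> 0" shows "of_real r \<cdot> a \<in> P"
proof -
  obtain t where t: "t \<ge> 0" "\<parallel>sc (of_real t) \<ominus> a\<parallel> \<le> t" using assms by (auto simp: P_def)
  have c: "a \<in> carrier A" "a\<^sup>\<star> = a" using assms by (auto simp: P_def)
  have "sc (of_real (r * t)) \<ominus> of_real r \<cdot> a = of_real r \<cdot> (sc (of_real t) \<ominus> a)"
    using c by (simp add: cscale_minus_right cscale_sc)
  then have "\<parallel>sc (of_real (r * t)) \<ominus> of_real r \<cdot> a\<parallel> \<le> r * t"
    using t c assms by (simp add: nrm_cscale mult_left_mono)
  then show ?thesis using c assms t unfolding P_def by (auto simp: star_cscale intro!: exI[of _ "r * t"])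
qed

text \<open>The radius \<open>t\<close> is its own witness, because t - (t - x) = x. This turns norm
  bounds into order bounds; the converse is \<open>P_dominated\<close>.\<close>

lemma P_self_adjoint_ball:
  assumes "x \<in> carrier A" "x\<^sup>\<star> = x" "\<parallel>x\<parallel> \<le> t"
  shows "sc (of_real t) \<ominus> x \<in> P"
proof -
  have "sc (of_real t) \<ominus> (sc (of_real t) \<ominus> x) = x"
    using assms sc_closed[of "of_real t"] by algebra
  moreover have "0 \<le> t" using assms nrm_nonneg[of x] by simp
  ultimately show ?thesis using assms unfolding P_def
    by (auto simp: star_minus star_sc intro!: exI[of _ t])
qed

text \<open>A majorant criterion. The increments are compared with those of a convergent real
  sequence \<open>t\<close>, because for square roots the majorant is the scalar iteration itself,
  for which monotonicity and boundedness suffice and no rate is required.\<close>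

lemma limit_exists:
  assumes "\<And>n. f n \<in> carrier A" "\<And>n. \<parallel>f (Suc n) \<ominus> f n\<parallel> \<le> t (Suc n) - t n" "convergent t"
  obtains x where "x \<in> carrier A" "(\<lambda>n. \<parallel>f n \<ominus> x\<parallel>) \<longlonglongrightarrow> 0"
proof -
  have tel: "\<parallel>f (n + k) \<ominus> f n\<parallel> \<le> t (n + k) - t n" for n k
  proof (induction k)
    case 0 then show ?case using assms(1) by simp
  next
    case (Suc k)
    have "\<parallel>f (n + Suc k) \<ominus> f n\<parallel> \<le> \<parallel>f (Suc (n + k)) \<ominus> f (n + k)\<parallel> + \<parallel>f (n + k) \<ominus> f n\<parallel>"
      using nrm_minus_triangle[of "f (Suc (n+k))" "f (n + k)" "f n"] assms(1) by simp
    then show ?case using Suc assms(2)[of "n + k"] by simp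
  qed
  have le: "\<parallel>f m \<ominus> f n\<parallel> \<le> \<bar>t m - t n\<bar>" for m n
  proof (cases "n \<le> m")
    case True then show ?thesis using tel[of n "m - n"] by simp
  next
    case False then show ?thesis using tel[of m "n - m"] nrm_minus_commute[of "f m" "f n"] assms(1) by simp
  qed
  have "Cauchy t" using assms(3) by (simp add: convergent_Cauchy)
  have "\<exists>N. \<forall>m\<ge>N. \<forall>n\<ge>N. \<parallel>f m \<ominus> f n\<parallel> < e" if "0 < e" for e
  proof -
    obtain N where "\<forall>m\<ge>N. \<forall>n\<ge>N. \<bar>t m - t n\<bar> < e"
      using \<open>Cauchy t\<close> \<open>0 < e\<close> unfolding Cauchy_def dist_real_def by blast
    then show ?thesis using le by (meson le_less_trans)
  qed
  then show ?thesis using complete[of f] assms(1) that by blast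
qed

lemma limit_unique:
  assumes "\<And>n. f n \<in> carrier A" "x \<in> carrier A" "y \<in> carrier A"
    "(\<lambda>n. \<parallel>f n \<ominus> x\<parallel>) \<longlonglongrightarrow> 0" "(\<lambda>n. \<parallel>f n \<ominus> y\<parallel>) \<longlonglongrightarrow> 0"
  shows "x = y"
proof -
  have "\<parallel>x \<ominus> y\<parallel> \<le> \<parallel>f n \<ominus> x\<parallel> + \<parallel>f n \<ominus> y\<parallel>" for n
    using nrm_minus_triangle[of x "f n" y] nrm_minus_commute[of x "f n"] assms(1-3) by simp
  moreover have "(\<lambda>n. \<parallel>f n \<ominus> x\<parallel> + \<parallel>f n \<ominus> y\<parallel>) \<longlonglongrightarrow> 0"
    using tendsto_add[OF assms(4,5)] by simp
  ultimately have "\<parallel>x \<ominus> y\<parallel> \<le> 0"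
    by (meson LIMSEQ_le_const)
  then show ?thesis using assms nrm_nonneg[of "x \<ominus> y"] nrm_eq_0_iff[of "x \<ominus> y"] minus_eq_zero_iff by simp
qed

lemma limit_squeeze:
  assumes "\<And>n. f n \<in> carrier A" "x \<in> carrier A" "\<And>n. \<parallel>f n \<ominus> x\<parallel> \<le> g n" "g \<longlonglongrightarrow> 0"
  shows "(\<lambda>n. \<parallel>f n \<ominus> x\<parallel>) \<longlonglongrightarrow> 0"
  by (rule tendsto_sandwich[of "\<lambda>_. 0" _ _ g]) (use assms nrm_nonneg in auto)

lemma limit_mult:
  assumes f: "\<And>n. f n \<in> carrier A" and g: "\<And>n. g n \<in> carrier A" and x: "x \<in> carrier A" and y: "y \<in> carrier A"
    and fx: "(\<lambda>n. \<parallel>f n \<ominus> x\<parallel>) \<longlonglongrightarrow> 0" and gy: "(\<lambda>n. \<parallel>g n \<ominus> y\<parallel>) \<longlonglongrightarrow> 0"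
  shows "(\<lambda>n. \<parallel>f n \<otimes> g n \<ominus> x \<otimes> y\<parallel>) \<longlonglongrightarrow> 0"
proof (rule limit_squeeze)
  fix n
  have "f n \<otimes> g n \<ominus> x \<otimes> y = (f n \<ominus> x) \<otimes> (g n \<ominus> y) \<oplus> (f n \<ominus> x) \<otimes> y \<oplus> x \<otimes> (g n \<ominus> y)"
    using f[of n] g[of n] x y by algebra
  then show "\<parallel>f n \<otimes> g n \<ominus> x \<otimes> y\<parallel> \<le> \<parallel>f n \<ominus> x\<parallel> * \<parallel>g n \<ominus> y\<parallel> + \<parallel>f n \<ominus> x\<parallel> * \<parallel>y\<parallel> + \<parallel>x\<parallel> * \<parallel>g n \<ominus> y\<parallel>"
    using f[of n] g[of n] x y
    by (auto intro!: nrm_add_le nrm_mult)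
next
  show "(\<lambda>n. \<parallel>f n \<ominus> x\<parallel> * \<parallel>g n \<ominus> y\<parallel> + \<parallel>f n \<ominus> x\<parallel> * \<parallel>y\<parallel> + \<parallel>x\<parallel> * \<parallel>g n \<ominus> y\<parallel>) \<longlonglongrightarrow> 0"
    by (rule tendsto_eq_intros fx gy refl | simp)+
qed (use f g x y in auto)

lemma limit_star:
  assumes f: "\<And>n. f n \<in> carrier A" and x: "x \<in> carrier A" and fx: "(\<lambda>n. \<parallel>f n \<ominus> x\<parallel>) \<longlonglongrightarrow> 0"
  shows "(\<lambda>n. \<parallel>(f n)\<^sup>\<star> \<ominus> x\<^sup>\<star>\<parallel>) \<longlonglongrightarrow> 0"
proof -
  have "\<parallel>(f n)\<^sup>\<star> \<ominus> x\<^sup>\<star>\<parallel> = \<parallel>f n \<ominus> x\<parallel>" for n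
    using nrm_star[of "f n \<ominus> x"] f x by (simp add: star_minus)
  then show ?thesis using fx by simp
qed

lemma limit_commute:
  assumes f: "\<And>n. f n \<in> carrier A" and x: "x \<in> carrier A" and w: "w \<in> carrier A"
    and fx: "(\<lambda>n. \<parallel>f n \<ominus> x\<parallel>) \<longlonglongrightarrow> 0" and "\<And>n. w \<otimes> f n = f n \<otimes> w"
  shows "w \<otimes> x = x \<otimes> w"
proof -
  have 1: "(\<lambda>n. \<parallel>w \<otimes> f n \<ominus> w \<otimes> x\<parallel>) \<longlonglongrightarrow> 0"
    using limit_mult[of "\<lambda>_. w" f w x] f x w fx by simp
  have 2: "(\<lambda>n. \<parallel>f n \<otimes> w \<ominus> x \<otimes> w\<parallel>) \<longlonglongrightarrow> 0"
    using limit_mult[of f "\<lambda>_. w" x w] f x w fx by simp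
  show ?thesis
    by (rule limit_unique[where f = "\<lambda>n. f n \<otimes> w"]) (use 1 2 f x w assms(5) in auto)
qed

text \<open>With these rules the method \<open>algebra\<close> normalises scalars and adjoints as
  well: scalars move to the front, adjoints are pushed onto the factors in reversed order.\<close>

lemmas cstar_simprules
  [algebra ring "zero A" "add A" "a_inv A" "a_minus A" "one A" "mult A"] =
  r_one cscale_closed star_closed sc_closed cscale_add_right cscale_a_inv cscale_mult_left cscale_mult_right
  cscale_cscale cscale_zero_right star_add star_mult star_cscale star_a_inv star_star star_one star_zero

end

section \<open>Square roots\<close>

context cstar_algebra
begin

text \<open>The limit \<open>y\<close> satisfies \<open>(1 - y)\<^sup>2 = 1 - x\<close>; the increments are dominated by those of the scalar
  iteration with \<open>x = 1\<close>.\<close>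

primrec sqrt_iter :: "'a \<Rightarrow> nat \<Rightarrow> 'a" where
  "sqrt_iter x 0 = \<zero>"
| "sqrt_iter x (Suc n) = (1/2) \<cdot> (x \<oplus> sqrt_iter x n \<otimes> sqrt_iter x n)"

lemma sqrt_iter_closed [simp, intro]: "x \<in> carrier A \<Longrightarrow> sqrt_iter x n \<in> carrier A"
  by (induction n) auto

lemma sqrt_iter_star: "x \<in> carrier A \<Longrightarrow> x\<^sup>\<star> = x \<Longrightarrow> (sqrt_iter x n)\<^sup>\<star> = sqrt_iter x n"
  by (induction n) (auto simp: star_cscale star_add star_mult)

lemma sqrt_iter_commute:
  "x \<in> carrier A \<Longrightarrow> w \<in> carrier A \<Longrightarrow> w \<otimes> x = x \<otimes> w \<Longrightarrow> w \<otimes> sqrt_iter x n = sqrt_iter x n \<otimes> w"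
proof (induction n)
  case (Suc n)
  have "w \<otimes> (sqrt_iter x n \<otimes> sqrt_iter x n) = (sqrt_iter x n \<otimes> w) \<otimes> sqrt_iter x n"
    using Suc m_assoc[of w "sqrt_iter x n" "sqrt_iter x n"] by simp
  also have "\<dots> = (sqrt_iter x n \<otimes> sqrt_iter x n) \<otimes> w"
    using Suc by (simp add: m_assoc)
  finally show ?case using Suc by (simp add: cscale_mult_left cscale_mult_right l_distr r_distr)
qed auto

end

primrec sqrt_real_iter :: "nat \<Rightarrow> real" where
  "sqrt_real_iter 0 = 0"
| "sqrt_real_iter (Suc n) = (1 + (sqrt_real_iter n)\<^sup>2) / 2"

lemma sqrt_real_iter_bounds: "0 \<le> sqrt_real_iter n \<and> sqrt_real_iter n \<le> 1"
  by (induction n) (auto simp: power_le_one)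

lemma convergent_sqrt_real_iter: "convergent sqrt_real_iter"
proof (rule Bseq_monoseq_convergent)
  show "Bseq sqrt_real_iter"
    using sqrt_real_iter_bounds by (intro BseqI[of 1]) auto
  \<comment> \<open>At the value t the increment is (1 - t)^2 / 2.\<close>
  have "sqrt_real_iter n \<le> sqrt_real_iter (Suc n)" for n
    using zero_le_power2[of "sqrt_real_iter n - 1"] by (simp add: power2_diff)
  then show "monoseq sqrt_real_iter" by (simp add: monoseq_Suc)
qed

context cstar_algebra
begin

lemma sqrt_iter_norm: "x \<in> carrier A \<Longrightarrow> \<parallel>x\<parallel> \<le> 1 \<Longrightarrow> \<parallel>sqrt_iter x n\<parallel> \<le> sqrt_real_iter n"
proof (induction n)
  case (Suc n)
  have "\<parallel>x \<oplus> sqrt_iter x n \<otimes> sqrt_iter x n\<parallel> \<le> 1 + sqrt_real_iter n * sqrt_real_iter n"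
    using Suc by (intro nrm_add_le nrm_mult_le) auto
  then show ?case using Suc by (simp add: nrm_cscale power2_eq_square)
qed simp

text \<open>The factorisation a^2 - b^2 = (a - b) a + b (a - b) needs no commutativity, and the
  bound (s - t) s + t (s - t) = s^2 - t^2 that it gives is exactly what the scalar iteration
  produces.\<close>

lemma sqrt_iter_step:
  assumes x: "x \<in> carrier A" "\<parallel>x\<parallel> \<le> 1"
  shows "\<parallel>sqrt_iter x (Suc n) \<ominus> sqrt_iter x n\<parallel> \<le> sqrt_real_iter (Suc n) - sqrt_real_iter n"
proof (induction n)
  case 0 then show ?case using x by (simp add: nrm_cscale minus_eq)
next
  case (Suc n)
  let ?a = "sqrt_iter x (Suc n)" and ?b = "sqrt_iter x n"
  let ?s = "sqrt_real_iter (Suc n)" and ?t = "sqrt_real_iter n"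
  have c: "?a \<in> carrier A" "?b \<in> carrier A" using x by auto
  have eq: "(x \<oplus> ?a \<otimes> ?a) \<ominus> (x \<oplus> ?b \<otimes> ?b) = (?a \<ominus> ?b) \<otimes> ?a \<oplus> ?b \<otimes> (?a \<ominus> ?b)"
    using c x(1) by algebra
  have "\<parallel>(?a \<ominus> ?b) \<otimes> ?a \<oplus> ?b \<otimes> (?a \<ominus> ?b)\<parallel> \<le> (?s - ?t) * ?s + ?t * (?s - ?t)"
    using c x Suc sqrt_iter_norm[OF x]
    by (intro nrm_add_le nrm_mult_le) (auto simp del: sqrt_real_iter.simps sqrt_iter.simps)
  then have "\<parallel>(x \<oplus> ?a \<otimes> ?a) \<ominus> (x \<oplus> ?b \<otimes> ?b)\<parallel> \<le> ?s\<^sup>2 - ?t\<^sup>2"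
    unfolding eq by (simp only: power2_eq_square) (simp add: algebra_simps del: sqrt_real_iter.simps sqrt_iter.simps)
  moreover have "sqrt_iter x (Suc (Suc n)) \<ominus> ?a = (1/2) \<cdot> ((x \<oplus> ?a \<otimes> ?a) \<ominus> (x \<oplus> ?b \<otimes> ?b))"
    using c x by (simp add: cscale_minus_right)
  moreover have "sqrt_real_iter (Suc (Suc n)) - ?s = (?s\<^sup>2 - ?t\<^sup>2) / 2"
    by (simp add: field_simps)
  moreover have "(x \<oplus> ?a \<otimes> ?a) \<ominus> (x \<oplus> ?b \<otimes> ?b) \<in> carrier A" using c x by blast
  ultimately show ?case by (simp only: nrm_cscale) simp
qed

text \<open>The root is 1 - z for the limit z of the iteration; it lies in \<open>P\<close> because
  z is a self-adjoint contraction. The commutation clause replaces the fact that functional calculus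
  stays in the bicommutant.\<close>

lemma sqrt_one_minus:
  assumes x: "x \<in> carrier A" "x\<^sup>\<star> = x" "\<parallel>x\<parallel> \<le> 1"
  obtains y where "y \<in> P" "y \<otimes> y = \<one> \<ominus> x"
    "\<And>w. w \<in> carrier A \<Longrightarrow> w \<otimes> x = x \<otimes> w \<Longrightarrow> w \<otimes> y = y \<otimes> w"
proof -
  obtain z where z: "z \<in> carrier A" and lim: "(\<lambda>n. \<parallel>sqrt_iter x n \<ominus> z\<parallel>) \<longlonglongrightarrow> 0"
    using limit_exists[of "sqrt_iter x" sqrt_real_iter] sqrt_iter_step[OF x(1,3)] x convergent_sqrt_real_iter by auto
  have cl: "\<And>n. sqrt_iter x n \<in> carrier A" using x by auto
  have star: "z\<^sup>\<star> = z"
    using limit_unique[of "sqrt_iter x" "z\<^sup>\<star>" z] limit_star[OF cl z lim] lim z cl x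
    by (simp add: sqrt_iter_star)
  have norm: "\<parallel>z\<parallel> \<le> 1"
  proof -
    have "\<parallel>z\<parallel> \<le> 1 + \<parallel>sqrt_iter x n \<ominus> z\<parallel>" for n
      using nrm_le_minus[of z "sqrt_iter x n"] nrm_minus_commute[of z "sqrt_iter x n"] z cl[of n]
        sqrt_iter_norm[OF x(1,3), of n] sqrt_real_iter_bounds[of n] by simp
    moreover have "(\<lambda>n. 1 + \<parallel>sqrt_iter x n \<ominus> z\<parallel>) \<longlonglongrightarrow> 1" using tendsto_add[OF tendsto_const lim, of 1] by simp
    ultimately show ?thesis by (meson LIMSEQ_le_const)
  qed
  have sq: "(1/2) \<cdot> (x \<oplus> z \<otimes> z) = z"
  proof (rule limit_unique[where f = "\<lambda>n. sqrt_iter x (Suc n)"])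
    show "(\<lambda>n. \<parallel>sqrt_iter x (Suc n) \<ominus> z\<parallel>) \<longlonglongrightarrow> 0" using LIMSEQ_Suc[OF lim] .
    have l2: "(\<lambda>n. \<parallel>sqrt_iter x n \<otimes> sqrt_iter x n \<ominus> z \<otimes> z\<parallel>) \<longlonglongrightarrow> 0"
      by (rule limit_mult) (use cl z lim in auto)
    have "sqrt_iter x (Suc n) \<ominus> (1/2) \<cdot> (x \<oplus> z \<otimes> z) = (1/2) \<cdot> (sqrt_iter x n \<otimes> sqrt_iter x n \<ominus> z \<otimes> z)" for n
    proof -
      have "(x \<oplus> u) \<ominus> (x \<oplus> v) = u \<ominus> v" if "u \<in> carrier A" "v \<in> carrier A" for u v
        using that x(1) by algebra
      then show ?thesis using cl[of n] z x by (simp add: cscale_minus_right[symmetric])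
    qed
    then show "(\<lambda>n. \<parallel>sqrt_iter x (Suc n) \<ominus> (1/2) \<cdot> (x \<oplus> z \<otimes> z)\<parallel>) \<longlonglongrightarrow> 0"
      using tendsto_mult_right_zero[OF l2, of "1/2"] cl z by (simp add: nrm_cscale del: sqrt_iter.simps)
  qed (use cl z x in auto)
  have sq2: "x \<oplus> z \<otimes> z = z \<oplus> z"
  proof -
    have "2 \<cdot> ((1/2) \<cdot> (x \<oplus> z \<otimes> z)) = 2 \<cdot> z" using sq by simp
    then show ?thesis using z x cscale_add_left[of z 1 1] by (simp add: cscale_cscale)
  qed
  have "(\<one> \<ominus> z) \<otimes> (\<one> \<ominus> z) = \<one> \<ominus> (z \<oplus> z) \<oplus> z \<otimes> z"
    using z by algebra
  also have "\<dots> = \<one> \<ominus> x" unfolding sq2[symmetric] using z x(1) by algebra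
  finally have y2: "(\<one> \<ominus> z) \<otimes> (\<one> \<ominus> z) = \<one> \<ominus> x" .
  have yP: "\<one> \<ominus> z \<in> P" using P_self_adjoint_ball[of z 1] z star norm by simp
  have "w \<otimes> (\<one> \<ominus> z) = (\<one> \<ominus> z) \<otimes> w" if w: "w \<in> carrier A" "w \<otimes> x = x \<otimes> w" for w
  proof -
    have e: "w \<otimes> z = z \<otimes> w"
      by (rule limit_commute[of "sqrt_iter x"]) (use cl z w lim x sqrt_iter_commute in auto)
    have "w \<otimes> (\<one> \<ominus> z) = w \<ominus> w \<otimes> z" using w z by algebra
    also have "\<dots> = (\<one> \<ominus> z) \<otimes> w" unfolding e using w(1) z by algebra
    finally show ?thesis .
  qed
  then show ?thesis using that y2 yP by blast
qed

text \<open>Rescaling by the radius t: a = t (1 - x) with the self-adjoint contraction x = 1 - a/t,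
  so sqrt t times the root of 1 - x is a root of a. Radius 0 forces a = 0.\<close>

lemma P_sqrt:
  assumes "a \<in> P"
  obtains y where "y \<in> P" "y \<otimes> y = a"
    "\<And>w. w \<in> carrier A \<Longrightarrow> w \<otimes> a = a \<otimes> w \<Longrightarrow> w \<otimes> y = y \<otimes> w"
proof -
  obtain t where t: "t \<ge> 0" "\<parallel>sc (of_real t) \<ominus> a\<parallel> \<le> t" and a: "a \<in> carrier A" "a\<^sup>\<star> = a"
    using assms by (auto simp: P_def)
  show ?thesis
  proof (cases "t = 0")
    case True
    then have "a = \<zero>" using t a nrm_nonneg[of "\<zero> \<ominus> a"] nrm_eq_0_iff[of "\<zero> \<ominus> a"] minus_eq_zero_iff[of \<zero> a] by auto
    then show ?thesis using that[of \<zero>] by auto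
  next
    case False
    define r where "r = complex_of_real (1 / t)"
    define x where "x = \<one> \<ominus> r \<cdot> a"
    have rt: "r * complex_of_real t = 1" "cnj r = r" using False by (auto simp: r_def)
    have x: "x \<in> carrier A" "x\<^sup>\<star> = x" using a rt by (auto simp: x_def star_minus star_cscale)
    have "x = r \<cdot> (sc (of_real t) \<ominus> a)" using a rt by (simp add: x_def cscale_minus_right cscale_sc)
    then have "\<parallel>x\<parallel> \<le> 1" using t False a by (simp add: nrm_cscale r_def norm_divide field_simps)
    then obtain y where y: "y \<in> P" "y \<otimes> y = \<one> \<ominus> x"
      "\<And>w. w \<in> carrier A \<Longrightarrow> w \<otimes> x = x \<otimes> w \<Longrightarrow> w \<otimes> y = y \<otimes> w"
      using sqrt_one_minus[OF x] by blast
    have yc: "y \<in> carrier A" using y(1) P_carrier by auto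
    have "\<one> \<ominus> x = r \<cdot> a" unfolding x_def using cscale_closed[OF a(1), of r] by algebra
    define s where "s = complex_of_real (sqrt t)"
    have sr: "s * (s * r) = 1" if "s * s = complex_of_real t" for s
      using that rt by (metis mult.assoc mult.commute)
    have ss: "s * s = complex_of_real t" using t by (simp add: s_def of_real_mult[symmetric] del: of_real_mult)
    show ?thesis
    proof (rule that)
      show "s \<cdot> y \<in> P" unfolding s_def using y(1) t by (intro P_cscale) auto
      show "s \<cdot> y \<otimes> s \<cdot> y = a"
        using yc y(2) \<open>\<one> \<ominus> x = r \<cdot> a\<close> rt a by (simp add: cscale_mult_left cscale_mult_right cscale_cscale mult.commute[of r] sr[OF ss] mult.assoc)
      fix w assume w: "w \<in> carrier A" "w \<otimes> a = a \<otimes> w"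
      have "w \<otimes> x = w \<ominus> w \<otimes> r \<cdot> a" unfolding x_def using w(1) cscale_closed[OF a(1), of r] by algebra
      also have "w \<otimes> r \<cdot> a = r \<cdot> a \<otimes> w" using w a by (simp add: cscale_mult_left cscale_mult_right)
      also have "w \<ominus> r \<cdot> a \<otimes> w = x \<otimes> w" unfolding x_def using w(1) cscale_closed[OF a(1), of r] by algebra
      finally have "w \<otimes> y = y \<otimes> w" using y w by blast
      then show "w \<otimes> s \<cdot> y = s \<cdot> y \<otimes> w" using w yc by (simp add: cscale_mult_left cscale_mult_right)
    qed
  qed
qed

lemma unitary_combination:
  assumes y: "y \<in> carrier A" "y\<^sup>\<star> = y" and w: "w \<in> carrier A" "w\<^sup>\<star> = w" and c: "w \<otimes> y = y \<otimes> w"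
    and s: "y \<otimes> y \<oplus> w \<otimes> w = sc (of_real t)"
  shows "\<parallel>y\<parallel>\<^sup>2 \<le> \<bar>t\<bar>" "\<parallel>w\<parallel>\<^sup>2 \<le> \<bar>t\<bar>"
proof -
  define u where "u = y \<oplus> \<i> \<cdot> w"
  define v where "v = y \<oplus> (- \<i>) \<cdot> w"
  have uc: "u \<in> carrier A" "v \<in> carrier A" using y w by (auto simp: u_def v_def)
  have us: "u\<^sup>\<star> = v" using y w by (simp add: u_def v_def star_add star_cscale)
  have "v \<otimes> u = y \<otimes> y \<oplus> \<i> \<cdot> (y \<otimes> w) \<oplus> ((- \<i>) \<cdot> (y \<otimes> w) \<oplus> w \<otimes> w)"
    using y w by (simp add: u_def v_def l_distr r_distr cscale_mult_left cscale_mult_right cscale_add_right cscale_cscale a_ac c)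
  also have "\<dots> = y \<otimes> y \<oplus> w \<otimes> w \<oplus> (\<i> \<cdot> (y \<otimes> w) \<oplus> (- \<i>) \<cdot> (y \<otimes> w))"
    using y w by (simp add: a_ac)
  also have "\<i> \<cdot> (y \<otimes> w) \<oplus> (- \<i>) \<cdot> (y \<otimes> w) = \<zero>"
    using cscale_add_left[of "y \<otimes> w" \<i> "- \<i>"] y w by simp
  finally have "v \<otimes> u = sc (of_real t)" using y w s by simp
  then have "\<parallel>u\<parallel>\<^sup>2 \<le> \<bar>t\<bar>" using cstar_identity[of u] uc us nrm_sc_le[of "of_real t"] by simp
  then have u: "\<parallel>u\<parallel> \<le> sqrt \<bar>t\<bar>" using real_le_rsqrt by blast
  have v: "\<parallel>v\<parallel> \<le> sqrt \<bar>t\<bar>" using u us uc nrm_star[of u] by simp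
  have "y \<oplus> y = u \<oplus> v"
  proof -
    have "u \<oplus> v = y \<oplus> y \<oplus> (\<i> \<cdot> w \<oplus> (- \<i>) \<cdot> w)" using y w by (simp add: u_def v_def a_ac)
    then show ?thesis using cscale_add_left[of w \<i> "- \<i>"] y w by simp
  qed
  then have "2 \<cdot> y = u \<oplus> v" using cscale_add_left[of y 1 1] y by simp
  then have "2 * \<parallel>y\<parallel> \<le> sqrt \<bar>t\<bar> + sqrt \<bar>t\<bar>" using nrm_add_le[OF uc u v] nrm_cscale[of y 2] y by simp
  then show "\<parallel>y\<parallel>\<^sup>2 \<le> \<bar>t\<bar>" using nrm_nonneg[of y] y power_mono[of "\<parallel>y\<parallel>" "sqrt \<bar>t\<bar>" 2] by simp
  have "(2 * \<i>) \<cdot> w = u \<oplus> (-1) \<cdot> v"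
  proof -
    have "u \<oplus> (-1) \<cdot> v = (y \<oplus> (-1) \<cdot> y) \<oplus> (\<i> \<cdot> w \<oplus> \<i> \<cdot> w)" using y w by (simp add: u_def v_def cscale_add_right cscale_cscale a_ac)
    then show ?thesis using cscale_add_left[of y 1 "-1"] cscale_add_left[of w \<i> \<i>] y w by simp
  qed
  moreover have "\<parallel>u \<oplus> (-1) \<cdot> v\<parallel> \<le> sqrt \<bar>t\<bar> + sqrt \<bar>t\<bar>" using nrm_add_le[of u "(-1) \<cdot> v" "sqrt \<bar>t\<bar>" "sqrt \<bar>t\<bar>"] uc u v nrm_cscale[of v "-1"] by simp
  ultimately have "2 * \<parallel>w\<parallel> \<le> sqrt \<bar>t\<bar> + sqrt \<bar>t\<bar>" using nrm_cscale[of w "2 * \<i>"] w by (simp add: norm_mult)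
  then show "\<parallel>w\<parallel>\<^sup>2 \<le> \<bar>t\<bar>" using nrm_nonneg[of w] w power_mono[of "\<parallel>w\<parallel>" "sqrt \<bar>t\<bar>" 2] by simp
qed

text \<open>For the normalised x the root w of 1 - x^2 commutes with x, and
  \<open>unitary_combination\<close> makes w a contraction. Hence 1 - x^2 = w^2 has norm at most 1,
  which is membership of x^2 in the cone with radius 1.\<close>

lemma P_square:
  assumes "y \<in> carrier A" "y\<^sup>\<star> = y"
  shows "y \<otimes> y \<in> P"
proof -
  define t where "t = \<parallel>y\<parallel>"
  show ?thesis
  proof (cases "t = 0")
    case True
    then have "y = \<zero>" using assms nrm_eq_0_iff by (simp add: t_def)
    then show ?thesis by simp
  next
    case False
    then have tp: "t > 0" using assms nrm_nonneg[of y] by (simp add: t_def)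
    define r where "r = complex_of_real (1 / t)"
    define x where "x = r \<cdot> y"
    have r: "cnj r = r" by (simp add: r_def)
    have x: "x \<in> carrier A" "x\<^sup>\<star> = x" "\<parallel>x\<parallel> \<le> 1"
      using assms r tp by (auto simp: x_def star_cscale nrm_cscale t_def r_def norm_divide)
    have xx: "x \<otimes> x \<in> carrier A" "(x \<otimes> x)\<^sup>\<star> = x \<otimes> x" "\<parallel>x \<otimes> x\<parallel> \<le> 1"
      using x nrm_mult_le[of x x 1 1] by (auto simp: star_mult)
    obtain w where w: "w \<in> P" "w \<otimes> w = \<one> \<ominus> x \<otimes> x"
      "\<And>v. v \<in> carrier A \<Longrightarrow> v \<otimes> (x \<otimes> x) = (x \<otimes> x) \<otimes> v \<Longrightarrow> v \<otimes> w = w \<otimes> v"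
      using sqrt_one_minus[OF xx] by blast
    have wc: "w \<in> carrier A" "w\<^sup>\<star> = w" using w(1) P_carrier P_star by auto
    have "x \<otimes> w = w \<otimes> x" using w(3)[of x] x by (simp add: m_assoc)
    moreover have "x \<otimes> x \<oplus> w \<otimes> w = sc (of_real 1)" unfolding w(2) of_real_1 sc_1 using x(1) by algebra
    ultimately have "\<parallel>w\<parallel>\<^sup>2 \<le> 1" using unitary_combination(2)[of x w 1] x wc by simp
    then have "\<parallel>sc (of_real 1) \<ominus> x \<otimes> x\<parallel> \<le> 1" using nrm_sq[of w] wc w(2) by simp
    then have "x \<otimes> x \<in> P" unfolding P_def using xx by (auto intro!: exI[of _ 1])
    then have "of_real (t\<^sup>2) \<cdot> (x \<otimes> x) \<in> P" by (rule P_cscale) simp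
    moreover have "of_real (t\<^sup>2) \<cdot> (x \<otimes> x) = y \<otimes> y"
      using assms tp by (simp add: x_def cscale_mult_left cscale_mult_right cscale_cscale r_def power2_eq_square)
    ultimately show ?thesis by simp
  qed
qed

text \<open>If y is the root of x and w the root of t - x, then y commutes with t - y^2 and
  therefore with w, while y^2 + w^2 = t. With \<open>t\<close> = 0 this is antisymmetry of the
  order.\<close>

lemma P_dominated:
  assumes x: "x \<in> P" and n: "sc (of_real t) \<ominus> x \<in> P" and t: "t \<ge> 0"
  shows "\<parallel>x\<parallel> \<le> t"
proof -
  obtain y where y: "y \<in> P" "y \<otimes> y = x" using P_sqrt[OF x] by blast
  obtain w where w: "w \<in> P" "w \<otimes> w = sc (of_real t) \<ominus> x"
    "\<And>v. v \<in> carrier A \<Longrightarrow> v \<otimes> (sc (of_real t) \<ominus> x) = (sc (of_real t) \<ominus> x) \<otimes> v \<Longrightarrow> v \<otimes> w = w \<otimes> v"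
    using P_sqrt[OF n] by blast
  have c: "y \<in> carrier A" "y\<^sup>\<star> = y" "w \<in> carrier A" "w\<^sup>\<star> = w" "x \<in> carrier A"
    using y(1) w(1) x P_carrier P_star by auto
  have "y \<otimes> (sc (of_real t) \<ominus> x) = y \<otimes> sc (of_real t) \<ominus> y \<otimes> y \<otimes> y"
    unfolding y(2)[symmetric] using c(1) sc_closed[of "of_real t"] by algebra
  also have "y \<otimes> sc (of_real t) = sc (of_real t) \<otimes> y" using c by (simp add: sc_mult_left sc_mult_right)
  also have "sc (of_real t) \<otimes> y \<ominus> y \<otimes> y \<otimes> y = (sc (of_real t) \<ominus> x) \<otimes> y"
    unfolding y(2)[symmetric] using c(1) sc_closed[of "of_real t"] by algebra
  finally have "y \<otimes> w = w \<otimes> y" using w(3) c by blast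
  moreover have "y \<otimes> y \<oplus> w \<otimes> w = sc (of_real t)"
    unfolding w(2) y(2) using c(5) sc_closed[of "of_real t"] by algebra
  ultimately have "\<parallel>y\<parallel>\<^sup>2 \<le> t" using unitary_combination(1)[of y w t] c t by simp
  then show ?thesis using nrm_sq[of y] c y by simp
qed

lemma P_antisym: assumes "a \<in> P" "\<ominus> a \<in> P" shows "a = \<zero>"
proof -
  have "\<parallel>a\<parallel> \<le> 0"
    using P_dominated[of a 0] assms P_carrier[OF assms(1)] by (simp add: minus_eq)
  then show ?thesis using nrm_nonneg[of a] nrm_eq_0_iff[of a] P_carrier[OF assms(1)] by simp
qed

end

section \<open>Positivity of \<open>x* x\<close>\<close>

text \<open>A linear factor does not affect exponential growth. Only exponents that are powers of 2
  occur, since for those the C*-identity computes the norm of a power of a self-adjoint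
  element.\<close>

lemma power_growth_le:
  fixes x t C :: real
  assumes t: "0 < t" and x: "0 \<le> x" and C: "0 \<le> C"
    and le: "\<And>k. x ^ (2 ^ k) \<le> t ^ (2 ^ k) * (1 + 2 ^ k * C)"
  shows "x \<le> t"
proof (rule ccontr)
  assume "\<not> x \<le> t"
  \<comment> \<open>Bernoulli's inequality for the square root s of x/t bounds (x/t)^N = (s^N)^2
    below by a quadratic polynomial in N, which outgrows the linear bound 1 + N C.\<close>
  define s where "s = sqrt (x / t)"
  have s: "s > 1" using \<open>\<not> x \<le> t\<close> t by (simp add: s_def)
  define h where "h = s - 1"
  have h: "h > 0" using s by (simp add: h_def)
  obtain k :: nat where k: "C / h\<^sup>2 < real k" using reals_Archimedean2 by blast
  define N where "N = (2::nat) ^ k"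
  have kN: "real k < real N" unfolding N_def using less_exp[of k] by linarith
  have "s ^ 2 = x / t" using t x by (simp add: s_def)
  then have "(s ^ N)\<^sup>2 = (x / t) ^ N" by (metis power_mult mult.commute)
  also have "\<dots> \<le> 1 + real N * C" using le[of k] t by (simp add: power_divide N_def field_simps)
  finally have 1: "(s ^ N)\<^sup>2 \<le> 1 + real N * C" .
  have "1 + real N * h \<le> s ^ N" using Bernoulli_inequality[of h N] h by (simp add: h_def)
  then have "(1 + real N * h)\<^sup>2 \<le> (s ^ N)\<^sup>2" using h by (intro power_mono) auto
  then have "1 + 2 * (real N * h) + (real N * h)\<^sup>2 \<le> 1 + real N * C" using 1 by (simp add: power2_sum)
  then have "(real N * h)\<^sup>2 \<le> real N * C" using h by (smt (verit) mult_nonneg_nonneg of_nat_0_le_iff)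
  then have "real N * (real N * h\<^sup>2) \<le> real N * C" by (simp add: power2_eq_square algebra_simps)
  then have "real N * h\<^sup>2 \<le> C" using kN by simp
  then have "real N \<le> C / h\<^sup>2" using h by (simp add: field_simps)
  then show False using k kN by linarith
qed

context cstar_algebra
begin

lemma self_adjoint_pow: "x \<in> carrier A \<Longrightarrow> x\<^sup>\<star> = x \<Longrightarrow> (x [^] (n::nat))\<^sup>\<star> = x [^] n"
proof (induction n)
  case (Suc n)
  have "x \<otimes> x [^] n = x [^] n \<otimes> x" using nat_pow_Suc2[of x n] Suc by simp
  then show ?case using Suc by (simp add: star_mult)
qed simp

lemma nrm_pow_two_pow:
  assumes "x \<in> carrier A" "x\<^sup>\<star> = x" "\<one> \<noteq> \<zero>"
  shows "\<parallel>x [^] ((2::nat) ^ k)\<parallel> = \<parallel>x\<parallel> ^ (2 ^ k)"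
proof (induction k)
  case 0 then show ?case using assms by simp
next
  case (Suc k)
  have "x [^] ((2::nat) ^ Suc k) = x [^] ((2::nat) ^ k) \<otimes> x [^] ((2::nat) ^ k)"
    using assms by (simp add: nat_pow_mult mult_2)
  then show ?case using Suc nrm_sq[of "x [^] ((2::nat) ^ k)"] assms self_adjoint_pow[of x]
    by (simp add: power_mult[symmetric] mult.commute)
qed

text \<open>The inequality \<open>z* z \<le> 0\<close> gives \<open>z z* \<le> 0\<close>, because the powers of \<open>t + z z*\<close> are controlled
  by those of \<open>t + z* z\<close>; this replaces the comparison of the two spectra.\<close>

lemma star_mult_nonpos:
  assumes z: "z \<in> carrier A" and neg: "\<ominus> (z\<^sup>\<star> \<otimes> z) \<in> P"
  shows "\<ominus> (z \<otimes> z\<^sup>\<star>) \<in> P"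
proof (cases "\<one> = \<zero>")
  case True
  have "\<ominus> (z \<otimes> z\<^sup>\<star>) = \<one> \<otimes> (\<ominus> (z \<otimes> z\<^sup>\<star>))" using z by simp
  then have "\<ominus> (z \<otimes> z\<^sup>\<star>) = \<zero>" using True z by (metis a_inv_closed l_null m_closed star_closed)
  then show ?thesis by simp
next
  case False
  obtain t0 where t0: "t0 \<ge> 0" "\<parallel>sc (of_real t0) \<ominus> (\<ominus> (z\<^sup>\<star> \<otimes> z))\<parallel> \<le> t0"
    using neg by (auto simp: P_def)
  \<comment> \<open>Any radius from \<open>t0\<close> on bounds t + z* z by t; being at least 1, it
    also satisfies t^n \<le> t^(n+1), which absorbs the extra term in the recursion below.\<close>
  define t where "t = max 1 t0"
  have t: "t \<ge> 1" by (simp add: t_def)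
  define w where "w = sc (of_real t) \<oplus> z\<^sup>\<star> \<otimes> z"
  define e where "e = sc (of_real t) \<oplus> z \<otimes> z\<^sup>\<star>"
  have wc: "w \<in> carrier A" "e \<in> carrier A" using z by (auto simp: w_def e_def)
  have "w = (sc (of_real t) \<ominus> sc (of_real t0)) \<oplus> (sc (of_real t0) \<ominus> (\<ominus> (z\<^sup>\<star> \<otimes> z)))"
    unfolding w_def using z sc_closed[of "of_real t"] sc_closed[of "of_real t0"] by algebra
  moreover have "sc (of_real t) \<ominus> sc (of_real t0) = sc (of_real (t - t0))" by (simp add: sc_diff)
  moreover have "\<parallel>sc (of_real (t - t0))\<parallel> \<le> t - t0" using nrm_sc_le[of "of_real (t - t0)"] by (simp add: t_def del: of_real_diff)
  ultimately have w: "\<parallel>w\<parallel> \<le> t" using nrm_add_le[OF _ _ _ t0(2), of "sc (of_real (t - t0))" "t - t0"] z by simp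
  \<comment> \<open>The recursion is p' = t^n + p w with w = t + z* z, because z* e = w z*. Thus the
    growth of e^n is governed by the norm of w.\<close>
  have pow: "\<exists>p\<in>carrier A. \<parallel>p\<parallel> \<le> n * t ^ n \<and> e [^] n = sc (of_real (t ^ n)) \<oplus> z \<otimes> p \<otimes> z\<^sup>\<star>" for n :: nat
  proof (induction n)
    case 0 then show ?case using z by (intro bexI[of _ \<zero>]) auto
  next
    case (Suc n)
    then obtain p where p: "p \<in> carrier A" "\<parallel>p\<parallel> \<le> n * t ^ n" "e [^] n = sc (of_real (t ^ n)) \<oplus> z \<otimes> p \<otimes> z\<^sup>\<star>" by blast
    define p' where "p' = sc (of_real (t ^ n)) \<oplus> p \<otimes> w"
    have p'c: "p' \<in> carrier A" using p wc by (auto simp: p'_def)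
    have "\<parallel>p'\<parallel> \<le> t ^ n + (n * t ^ n) * t"
      unfolding p'_def using p w wc t nrm_sc_le[of "of_real (t ^ n)"]
      by (intro nrm_add_le nrm_mult_le) (auto simp: norm_power)
    also have "\<dots> \<le> t ^ n * t + (n * t ^ n) * t" using t by simp
    finally have "\<parallel>p'\<parallel> \<le> Suc n * t ^ Suc n" by (simp add: algebra_simps)
    moreover have "e [^] Suc n = sc (of_real (t ^ Suc n)) \<oplus> z \<otimes> p' \<otimes> z\<^sup>\<star>"
    proof -
      define T where "T = complex_of_real t"
      define Tn where "Tn = complex_of_real (t ^ n)"
      have TT: "complex_of_real (t ^ Suc n) = Tn * T" by (simp add: T_def Tn_def)
      have "e [^] Suc n = (sc Tn \<oplus> z \<otimes> p \<otimes> z\<^sup>\<star>) \<otimes> (sc T \<oplus> z \<otimes> z\<^sup>\<star>)"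
        using p by (simp add: T_def Tn_def e_def)
      also have "\<dots> = sc (Tn * T) \<oplus> (Tn \<cdot> (z \<otimes> z\<^sup>\<star>) \<oplus> T \<cdot> (z \<otimes> p \<otimes> z\<^sup>\<star>) \<oplus> z \<otimes> p \<otimes> z\<^sup>\<star> \<otimes> z \<otimes> z\<^sup>\<star>)"
        using z p(1) by (simp add: l_distr r_distr sc_mult_left sc_mult_right cscale_sc cscale_add_right mult.commute a_ac m_assoc)
      also have "Tn \<cdot> (z \<otimes> z\<^sup>\<star>) \<oplus> T \<cdot> (z \<otimes> p \<otimes> z\<^sup>\<star>) \<oplus> z \<otimes> p \<otimes> z\<^sup>\<star> \<otimes> z \<otimes> z\<^sup>\<star> = z \<otimes> (sc Tn \<oplus> p \<otimes> (sc T \<oplus> z\<^sup>\<star> \<otimes> z)) \<otimes> z\<^sup>\<star>"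
        using z p(1) by (simp add: l_distr r_distr sc_mult_left sc_mult_right cscale_mult_left cscale_mult_right a_ac m_assoc)
      finally show ?thesis by (simp only: TT p'_def Tn_def T_def w_def)
    qed
    ultimately show ?case using p'c by blast
  qed
  define C where "C = \<parallel>z\<parallel> * \<parallel>z\<parallel>"
  have C: "C \<ge> 0" using z nrm_nonneg by (simp add: C_def)
  have bound: "\<parallel>e [^] n\<parallel> \<le> t ^ n * (1 + n * C)" for n :: nat
  proof -
    obtain p where p: "p \<in> carrier A" "\<parallel>p\<parallel> \<le> n * t ^ n" "e [^] n = sc (of_real (t ^ n)) \<oplus> z \<otimes> p \<otimes> z\<^sup>\<star>" using pow by blast
    have "\<parallel>e [^] n\<parallel> \<le> t ^ n + (\<parallel>z\<parallel> * (n * t ^ n)) * \<parallel>z\<parallel>"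
      unfolding p(3) using p z t nrm_sc_le[of "of_real (t ^ n)"]
      by (intro nrm_add_le nrm_mult_le) (auto simp: norm_power)
    then show ?thesis by (simp add: C_def algebra_simps)
  qed
  have es: "e\<^sup>\<star> = e" using z by (simp add: e_def star_add star_sc star_mult)
  have "\<parallel>e\<parallel> \<le> t"
  proof (rule power_growth_le)
    fix k show "\<parallel>e\<parallel> ^ 2 ^ k \<le> t ^ 2 ^ k * (1 + 2 ^ k * C)"
      using bound[of "2 ^ k"] nrm_pow_two_pow[OF wc(2) es False, of k] by simp
  qed (use t C nrm_nonneg wc in auto)
  moreover have "e = sc (of_real t) \<ominus> (\<ominus> (z \<otimes> z\<^sup>\<star>))"
    unfolding e_def using z sc_closed[of "of_real t"] by algebra
  ultimately show ?thesis unfolding P_def using z t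
    by (auto simp: star_a_inv star_mult intro!: exI[of _ t])
qed

lemma half_double: "x \<in> carrier A \<Longrightarrow> (1/2) \<cdot> (x \<oplus> x) = x"
  using cscale_add_left[of x "1/2" "1/2"] by (simp add: cscale_add_right)

text \<open>\<open>h\<close> and \<open>l\<close> are sqrt 2 times the real and imaginary parts of
  z.\<close>

lemma half_decomposition:
  assumes z: "z \<in> carrier A"
  obtains h l where "h \<in> carrier A" "h\<^sup>\<star> = h" "l \<in> carrier A" "l\<^sup>\<star> = l"
    "z\<^sup>\<star> \<otimes> z \<oplus> z \<otimes> z\<^sup>\<star> = h \<otimes> h \<oplus> l \<otimes> l"
proof -
  define r where "r = complex_of_real (sqrt (1/2))"
  have r: "cnj r = r" "r * r = 1/2" by (auto simp: r_def complex_eq_iff)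
  have r': "2 * (r * (r * c)) = c" for c using r(2) by (metis mult.assoc mult.left_commute mult_1 nonzero_mult_div_cancel_left times_divide_eq_left zero_neq_numeral mult.commute mult_2 one_add_one)
  define h where "h = r \<cdot> (z \<oplus> z\<^sup>\<star>)"
  define l where "l = (\<i> * r) \<cdot> (z\<^sup>\<star> \<ominus> z)"
  have c: "h \<in> carrier A" "l \<in> carrier A" using z by (auto simp: h_def l_def)
  have sa: "h\<^sup>\<star> = h" "l\<^sup>\<star> = l"
  proof -
    show "h\<^sup>\<star> = h" using z r by (simp add: h_def star_cscale star_add a_comm)
    have "l\<^sup>\<star> = (- \<i> * r) \<cdot> (z \<ominus> z\<^sup>\<star>)" using z r by (simp add: l_def star_cscale star_minus)
    also have "\<dots> = l" using z by (simp add: l_def minus_cscale cscale_add_right cscale_cscale a_comm)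
    finally show "l\<^sup>\<star> = l" .
  qed
  have hh: "h \<otimes> h = (1/2) \<cdot> ((z \<oplus> z\<^sup>\<star>) \<otimes> (z \<oplus> z\<^sup>\<star>))"
    using z by (simp add: h_def cscale_mult_left cscale_mult_right cscale_cscale r(2))
  have ll: "l \<otimes> l = (1/2) \<cdot> (\<ominus> ((z\<^sup>\<star> \<ominus> z) \<otimes> (z\<^sup>\<star> \<ominus> z)))"
  proof -
    have "\<i> * r * (\<i> * r) = - (1/2)" using r(2) by (simp add: algebra_simps)
    then show ?thesis using z by (simp add: l_def cscale_mult_left cscale_mult_right cscale_cscale a_inv_cscale)
  qed
  have "h \<otimes> h \<oplus> l \<otimes> l = (1/2) \<cdot> ((z \<oplus> z\<^sup>\<star>) \<otimes> (z \<oplus> z\<^sup>\<star>) \<oplus> (\<ominus> ((z\<^sup>\<star> \<ominus> z) \<otimes> (z\<^sup>\<star> \<ominus> z))))"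
    unfolding hh ll using z by (simp add: cscale_add_right)
  also have "(z \<oplus> z\<^sup>\<star>) \<otimes> (z \<oplus> z\<^sup>\<star>) \<oplus> (\<ominus> ((z\<^sup>\<star> \<ominus> z) \<otimes> (z\<^sup>\<star> \<ominus> z))) = (z\<^sup>\<star> \<otimes> z \<oplus> z \<otimes> z\<^sup>\<star>) \<oplus> (z\<^sup>\<star> \<otimes> z \<oplus> z \<otimes> z\<^sup>\<star>)"
    using z by algebra
  also have "(1/2) \<cdot> ((z\<^sup>\<star> \<otimes> z \<oplus> z \<otimes> z\<^sup>\<star>) \<oplus> (z\<^sup>\<star> \<otimes> z \<oplus> z \<otimes> z\<^sup>\<star>)) = z\<^sup>\<star> \<otimes> z \<oplus> z \<otimes> z\<^sup>\<star>"
    using z by (intro half_double) auto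
  finally show ?thesis using that c sa by metis
qed

text \<open>Since z z* is also negative, z* z = (h^2 + l^2) - z z* is a sum of positive elements,
  while its negative is positive by assumption.\<close>

lemma star_mult_nonpos_zero:
  assumes z: "z \<in> carrier A" and neg: "\<ominus> (z\<^sup>\<star> \<otimes> z) \<in> P"
  shows "z = \<zero>"
proof -
  obtain h l where hl: "h \<in> carrier A" "h\<^sup>\<star> = h" "l \<in> carrier A" "l\<^sup>\<star> = l"
    "z\<^sup>\<star> \<otimes> z \<oplus> z \<otimes> z\<^sup>\<star> = h \<otimes> h \<oplus> l \<otimes> l" using half_decomposition[OF z] by blast
  have "z\<^sup>\<star> \<otimes> z = (z\<^sup>\<star> \<otimes> z \<oplus> z \<otimes> z\<^sup>\<star>) \<oplus> (\<ominus> (z \<otimes> z\<^sup>\<star>))" using z by algebra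
  also have "\<dots> \<in> P" unfolding hl(5) using hl P_square P_add star_mult_nonpos[OF z neg] by simp
  finally have "z\<^sup>\<star> \<otimes> z = \<zero>" using P_antisym neg by blast
  then show ?thesis using star_mult_zero_iff z by simp
qed

text \<open>With m = (h^2)^(1/2) the parts are f = (m + h)/2 and g = (m - h)/2. At this stage only
  squares are known to be positive, so only the cubes are obtained: f^3 = f m f = (k f)^2 for the
  root k of m, which commutes with f, and likewise for g. The positivity of f and g themselves waits
  for \<open>star_mult_P\<close>.\<close>

lemma weak_jordan_decomposition:
  assumes h: "h \<in> carrier A" "h\<^sup>\<star> = h"
  obtains f g where "f \<in> carrier A" "f\<^sup>\<star> = f" "g \<in> carrier A" "g\<^sup>\<star> = g" "h = f \<ominus> g" "f \<oplus> g \<in> P"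
    "f \<otimes> g = \<zero>" "g \<otimes> f = \<zero>" "f \<otimes> f \<otimes> f \<in> P" "g \<otimes> g \<otimes> g \<in> P"
proof -
  obtain m where m: "m \<in> P" "m \<otimes> m = h \<otimes> h"
    "\<And>w. w \<in> carrier A \<Longrightarrow> w \<otimes> (h \<otimes> h) = (h \<otimes> h) \<otimes> w \<Longrightarrow> w \<otimes> m = m \<otimes> w"
    using P_sqrt[OF P_square[OF h]] by blast
  obtain k where k: "k \<in> P" "k \<otimes> k = m"
    "\<And>w. w \<in> carrier A \<Longrightarrow> w \<otimes> m = m \<otimes> w \<Longrightarrow> w \<otimes> k = k \<otimes> w"
    using P_sqrt[OF m(1)] by blast
  have c: "m \<in> carrier A" "m\<^sup>\<star> = m" "k \<in> carrier A" "k\<^sup>\<star> = k" using m(1) k(1) P_carrier P_star by auto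
  have hm: "h \<otimes> m = m \<otimes> h" using m(3)[of h] h by (simp add: m_assoc)
  have hk: "h \<otimes> k = k \<otimes> h" using k(3)[of h] h hm by simp
  define g where "g = (1/2) \<cdot> (m \<ominus> h)"
  define f where "f = (1/2) \<cdot> (m \<oplus> h)"
  have gc: "g \<in> carrier A" "f \<in> carrier A" "g\<^sup>\<star> = g" "f\<^sup>\<star> = f" using c h by (auto simp: g_def f_def star_cscale star_minus star_add)
  have "f \<ominus> g = (1/2) \<cdot> ((m \<oplus> h) \<ominus> (m \<ominus> h))" using h c by (simp add: f_def g_def cscale_minus_right)
  also have "(m \<oplus> h) \<ominus> (m \<ominus> h) = h \<oplus> h" using h c by algebra
  finally have "h = f \<ominus> g" using half_double h by simp
  moreover have "f \<otimes> g = \<zero>"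
  proof -
    have "(m \<oplus> h) \<otimes> (m \<ominus> h) = m \<otimes> m \<ominus> m \<otimes> h \<oplus> h \<otimes> m \<ominus> h \<otimes> h" using h c by algebra
    also have "\<dots> = \<zero>" unfolding m(2) hm using h c by algebra
    finally show ?thesis using h c by (simp add: f_def g_def cscale_mult_left cscale_mult_right)
  qed
  moreover have gf: "g \<otimes> f = \<zero>" using \<open>f \<otimes> g = \<zero>\<close> gc by (metis star_mult star_zero)
  moreover have cube: "x \<otimes> m \<otimes> x \<in> P" if "x \<in> carrier A" "x\<^sup>\<star> = x" "x \<otimes> k = k \<otimes> x" for x
  proof -
    have "x \<otimes> m \<otimes> x = (k \<otimes> x) \<otimes> (k \<otimes> x)" unfolding k(2)[symmetric] using that c by (metis m_assoc m_closed)
    then show ?thesis using P_square[of "k \<otimes> x"] that c by (simp add: star_mult)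
  qed
  have gk: "g \<otimes> k = k \<otimes> g" "f \<otimes> k = k \<otimes> f"
    unfolding g_def f_def using h c hk k(3)[OF c(1)]
    by (simp_all add: cscale_mult_left cscale_mult_right l_distr r_distr minus_cscale)
  have fg: "f \<oplus> g = m"
  proof -
    have "f \<oplus> g = (1/2) \<cdot> ((m \<oplus> h) \<oplus> (m \<ominus> h))" using h c by (simp add: f_def g_def cscale_add_right)
    also have "(m \<oplus> h) \<oplus> (m \<ominus> h) = m \<oplus> m" using h c by algebra
    finally show ?thesis using cscale_add_left[of m "1/2" "1/2"] c by (simp add: cscale_add_right)
  qed
  moreover have "g \<otimes> g \<otimes> g \<in> P"
  proof -
    have "g \<otimes> m \<otimes> g = g \<otimes> g \<otimes> g" unfolding fg[symmetric] using gc gf by (simp add: r_distr)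
    then show ?thesis using cube[of g] gc gk by simp
  qed
  moreover have "f \<otimes> f \<otimes> f \<in> P"
  proof -
    have "f \<otimes> m \<otimes> f = f \<otimes> f \<otimes> f" unfolding fg[symmetric] using gc \<open>f \<otimes> g = \<zero>\<close> by (simp add: r_distr)
    then show ?thesis using cube[of f] gc gk by simp
  qed
  ultimately show ?thesis using that gc m(1) by metis
qed

lemma self_adjoint_sq_zero: "x \<in> carrier A \<Longrightarrow> x\<^sup>\<star> = x \<Longrightarrow> x \<otimes> x = \<zero> \<longleftrightarrow> x = \<zero>"
  using star_mult_zero_iff[of x] by simp

text \<open>Let x* x = f - g. Then (x g)* (x g) = g (f - g) g = - g^3 is negative, so x g = 0,
  whence g^2 = - x* x g = 0. Once g vanishes, x* x = f = f + g, which is positive by the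
  decomposition.\<close>

theorem star_mult_P:
  assumes x: "x \<in> carrier A"
  shows "x\<^sup>\<star> \<otimes> x \<in> P"
proof -
  define h where "h = x\<^sup>\<star> \<otimes> x"
  have h: "h \<in> carrier A" "h\<^sup>\<star> = h" using x by (auto simp: h_def star_mult)
  obtain f g where f: "f \<in> carrier A" "f\<^sup>\<star> = f" and g: "g \<in> carrier A" "g\<^sup>\<star> = g" and hfg: "h = f \<ominus> g" "f \<oplus> g \<in> P"
    "f \<otimes> g = \<zero>" "g \<otimes> f = \<zero>" "g \<otimes> g \<otimes> g \<in> P"
    using weak_jordan_decomposition[OF h] by blast
  have hg: "h \<otimes> g = \<ominus> (g \<otimes> g)"
  proof -
    have "h \<otimes> g = f \<otimes> g \<ominus> g \<otimes> g" unfolding hfg(1) using f g by algebra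
    then show ?thesis using hfg(3) g by (simp add: minus_eq)
  qed
  have "(x \<otimes> g)\<^sup>\<star> \<otimes> (x \<otimes> g) = g \<otimes> (h \<otimes> g)" using x g by (simp add: star_mult h_def m_assoc)
  also have "\<dots> = \<ominus> (g \<otimes> g \<otimes> g)" unfolding hg using g by algebra
  finally have "x \<otimes> g = \<zero>" using star_mult_nonpos_zero[of "x \<otimes> g"] hfg(5) x g by simp
  then have "h \<otimes> g = \<zero>" using x g by (simp add: h_def m_assoc)
  then have "g \<otimes> g = \<zero>" using hg g by (metis a_inv_closed m_closed minus_minus minus_zero)
  then have "g = \<zero>" using self_adjoint_sq_zero g by simp
  then show ?thesis using hfg(1,2) f by (simp add: h_def minus_eq)
qed

lemma P_conj:
  assumes "a \<in> P" "x \<in> carrier A"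
  shows "x\<^sup>\<star> \<otimes> a \<otimes> x \<in> P"
proof -
  obtain y where y: "y \<in> P" "y \<otimes> y = a" using P_sqrt assms by blast
  have c: "y \<in> carrier A" "y\<^sup>\<star> = y" using y P_carrier P_star by auto
  have "(y \<otimes> x)\<^sup>\<star> \<otimes> (y \<otimes> x) = x\<^sup>\<star> \<otimes> a \<otimes> x"
    using c assms by (simp add: star_mult m_assoc y(2)[symmetric])
  then show ?thesis using star_mult_P[of "y \<otimes> x"] c assms by simp
qed

lemma pos_elems_eq_P: "pos_elems A = P"
proof
  show "pos_elems A \<subseteq> P" using star_mult_P by (auto simp: pos_elems_def)
  show "P \<subseteq> pos_elems A"
  proof
    fix a assume "a \<in> P"
    then obtain y where y: "y \<in> P" "y \<otimes> y = a" using P_sqrt by blast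
    then show "a \<in> pos_elems A" using P_carrier[of y] P_star[of y] by (auto simp: pos_elems_def intro!: exI[of _ y])
  qed
qed

lemma cube_zero:
  assumes "x \<in> carrier A" "x\<^sup>\<star> = x" "x \<otimes> x \<otimes> x = \<zero>"
  shows "x = \<zero>"
proof -
  have "(x \<otimes> x) \<otimes> (x \<otimes> x) = x \<otimes> x \<otimes> x \<otimes> x" using assms(1) by (simp add: m_assoc)
  then have "x \<otimes> x = \<zero>" using self_adjoint_sq_zero[of "x \<otimes> x"] assms by (simp add: star_mult)
  then show ?thesis using self_adjoint_sq_zero assms by simp
qed

text \<open>Conjugating f^3 by the negative part q gives - q^5, which is positive because f^3 is;
  q^5 is positive because q^3 is. So q^5 = 0 and q = 0.\<close>

lemma P_of_cube:
  assumes f: "f \<in> carrier A" "f\<^sup>\<star> = f" "f \<otimes> f \<otimes> f \<in> P"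
  shows "f \<in> P"
proof -
  obtain p q where p: "p \<in> carrier A" "p\<^sup>\<star> = p" and q: "q \<in> carrier A" "q\<^sup>\<star> = q" and pq: "f = p \<ominus> q" "p \<oplus> q \<in> P"
    "p \<otimes> q = \<zero>" "q \<otimes> p = \<zero>" "q \<otimes> q \<otimes> q \<in> P"
    using weak_jordan_decomposition[OF f(1,2)] by blast
  have fq: "f \<otimes> q = \<ominus> (q \<otimes> q)"
  proof -
    have "f \<otimes> q = p \<otimes> q \<ominus> q \<otimes> q" unfolding pq(1) using p q by algebra
    then show ?thesis using pq(3) q by (simp add: minus_eq)
  qed
  have qf: "q \<otimes> f = \<ominus> (q \<otimes> q)" using arg_cong[OF fq, of "star A"] f q by (simp add: star_mult star_a_inv)
  have 1: "q \<otimes> (f \<otimes> f \<otimes> f) \<otimes> q \<in> P" using P_conj[OF f(3) q(1)] q by simp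
  have "q \<otimes> (f \<otimes> f \<otimes> f) \<otimes> q = (q \<otimes> f) \<otimes> f \<otimes> (f \<otimes> q)" using f q by (simp add: m_assoc)
  also have "\<dots> = (\<ominus> (q \<otimes> q)) \<otimes> f \<otimes> (\<ominus> (q \<otimes> q))" by (simp only: qf fq)
  also have "\<dots> = q \<otimes> (q \<otimes> f) \<otimes> (q \<otimes> q)" using f q by algebra
  also have "\<dots> = \<ominus> (q \<otimes> (q \<otimes> q \<otimes> q) \<otimes> q)" unfolding qf using q by algebra
  finally have "\<ominus> (q \<otimes> (q \<otimes> q \<otimes> q) \<otimes> q) \<in> P" using 1 by simp
  moreover have "q \<otimes> (q \<otimes> q \<otimes> q) \<otimes> q \<in> P" using P_conj[OF pq(5) q(1)] q by simp
  ultimately have z: "q \<otimes> (q \<otimes> q \<otimes> q) \<otimes> q = \<zero>" using P_antisym by blast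
  have "(q \<otimes> q) \<otimes> (q \<otimes> q) \<otimes> (q \<otimes> q) = q \<otimes> (q \<otimes> q \<otimes> q) \<otimes> q \<otimes> q" using q by (simp add: m_assoc)
  then have "q \<otimes> q = \<zero>" using z cube_zero[of "q \<otimes> q"] q by (simp add: star_mult)
  then have "q = \<zero>" using self_adjoint_sq_zero q by simp
  then show ?thesis using pq p by (simp add: minus_eq)
qed

lemma jordan_decomposition:
  assumes h: "h \<in> carrier A" "h\<^sup>\<star> = h"
  obtains f g where "f \<in> P" "g \<in> P" "h = f \<ominus> g" "f \<otimes> g = \<zero>" "g \<otimes> f = \<zero>"
  using weak_jordan_decomposition[OF h] P_of_cube by metis

lemma cle_iff: "cle A x y \<longleftrightarrow> y \<ominus> x \<in> P"
  by (simp add: cle_def pos_elems_eq_P)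

lemma nrm_sq_minus_star_mult_P:
  assumes x: "x \<in> carrier A"
  shows "sc (of_real (\<parallel>x\<parallel>\<^sup>2)) \<ominus> x\<^sup>\<star> \<otimes> x \<in> P"
  using P_self_adjoint_ball[of "x\<^sup>\<star> \<otimes> x" "\<parallel>x\<parallel>\<^sup>2"] x cstar_identity[of x] by (simp add: star_mult)

text \<open>Every positive root u is compared with the root z of \<open>P_sqrt\<close>, which
  commutes with u. For d = u - z one has d (u + z) = 0, so the positive elements d u d and d z d add
  up to 0; both vanish, and so does their difference d^3. This makes the description in
  \<open>pos_sqrt\<close> meaningful.\<close>

lemma pos_sqrt_unique:
  assumes y: "y \<in> P" "y' \<in> P" and eq: "y \<otimes> y = y' \<otimes> y'"
  shows "y = y'"
proof -
  obtain z where z: "z \<in> P" "z \<otimes> z = y \<otimes> y"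
    "\<And>w. w \<in> carrier A \<Longrightarrow> w \<otimes> (y \<otimes> y) = (y \<otimes> y) \<otimes> w \<Longrightarrow> w \<otimes> z = z \<otimes> w"
    using P_sqrt[OF P_square] y(1) P_carrier P_star by metis
  have main: "u = z" if u: "u \<in> P" "u \<otimes> u = y \<otimes> y" for u
  proof -
    have c: "u \<in> carrier A" "u\<^sup>\<star> = u" "z \<in> carrier A" "z\<^sup>\<star> = z" using u z(1) P_carrier P_star by auto
    have uz: "u \<otimes> z = z \<otimes> u" using z(3)[of u] c u(2)[symmetric] by (simp add: m_assoc)
    define d where "d = u \<ominus> z"
    have d: "d \<in> carrier A" "d\<^sup>\<star> = d" using c by (auto simp: d_def star_minus)
    have "d \<otimes> (u \<oplus> z) = u \<otimes> u \<oplus> u \<otimes> z \<ominus> z \<otimes> u \<ominus> z \<otimes> z" unfolding d_def using c by algebra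
    also have "\<dots> = \<zero>" unfolding uz z(2) u(2)[symmetric] using c by algebra
    finally have 0: "d \<otimes> (u \<oplus> z) = \<zero>" .
    have "d \<otimes> u \<otimes> d \<oplus> d \<otimes> z \<otimes> d = d \<otimes> (u \<oplus> z) \<otimes> d" using c d by algebra
    then have s: "d \<otimes> u \<otimes> d \<oplus> d \<otimes> z \<otimes> d = \<zero>" using 0 d by simp
    have p: "d \<otimes> u \<otimes> d \<in> P" "d \<otimes> z \<otimes> d \<in> P" using P_conj[of u d] P_conj[of z d] u z(1) d by auto
    have "d \<otimes> z \<otimes> d = \<ominus> (d \<otimes> u \<otimes> d)" using s c d by (metis a_comm m_closed minus_equality)
    then have "d \<otimes> u \<otimes> d = \<zero>" using P_antisym p by metis
    moreover have "d \<otimes> z \<otimes> d = \<zero>" using s calculation c d by simp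
    moreover have "d \<otimes> d \<otimes> d = d \<otimes> u \<otimes> d \<ominus> d \<otimes> z \<otimes> d"
      using c d by (simp add: d_def) algebra
    ultimately have "d \<otimes> d \<otimes> d = \<zero>" by (simp add: minus_eq)
    then have "d = \<zero>" using cube_zero d by blast
    then show ?thesis using minus_eq_zero_iff c by (simp add: d_def)
  qed
  show ?thesis using main[of y] main[of y'] y eq by simp
qed

lemma pos_sqrt_eq: "\<lbrakk>y \<in> P; y \<otimes> y = x\<rbrakk> \<Longrightarrow> pos_sqrt A x = y"
  unfolding pos_sqrt_def pos_elems_eq_P using pos_sqrt_unique by (intro the_equality) auto

section \<open>Inverses and inverse square roots of elements bounded below\<close>

lemma neumann_inverse:
  assumes c: "c \<in> carrier A" "\<parallel>c\<parallel> \<le> r" "r < 1"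
  obtains g where "g \<in> carrier A" "g \<otimes> (\<one> \<ominus> c) = \<one>" "(\<one> \<ominus> c) \<otimes> g = \<one>"
proof -
  have r: "0 \<le> r" using c nrm_nonneg[of c] by simp
  define s where "s = rec_nat \<zero> (\<lambda>n x. x \<oplus> c [^] n)"
  have s0: "s 0 = \<zero>" and sS: "\<And>n. s (Suc n) = s n \<oplus> c [^] n" by (simp_all add: s_def)
  have sc': "s n \<in> carrier A" for n by (induction n) (use s0 sS c in auto)
  have pw: "\<parallel>c [^] n\<parallel> \<le> r ^ n" for n :: nat
  proof (induction n)
    case 0 then show ?case using nrm_one_le by simp
  next
    case (Suc n)
    then show ?case using nrm_mult_le[of "c [^] n" c "r ^ n" r] c by (simp add: mult.commute)
  qed
  have step: "\<parallel>s (Suc n) \<ominus> s n\<parallel> \<le> (\<Sum>k<Suc n. r ^ k) - (\<Sum>k<n. r ^ k)" for n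
  proof -
    have "s (Suc n) \<ominus> s n = c [^] n" unfolding sS using sc'[of n] nat_pow_closed[OF c(1), of n] by algebra
    then show ?thesis using pw[of n] by simp
  qed
  have conv: "convergent (\<lambda>n. \<Sum>k<n. r ^ k)"
    using summable_geometric[of r] c r by (simp add: summable_iff_convergent)
  obtain g where g: "g \<in> carrier A" "(\<lambda>n. \<parallel>s n \<ominus> g\<parallel>) \<longlonglongrightarrow> 0"
    using limit_exists[OF sc' step conv] by blast
  have L: "s n \<otimes> (\<one> \<ominus> c) = \<one> \<ominus> c [^] n" for n
  proof (induction n)
    case 0 then show ?case using s0 c by simp
  next
    case (Suc n)
    have "s (Suc n) \<otimes> (\<one> \<ominus> c) = s n \<otimes> (\<one> \<ominus> c) \<oplus> (c [^] n \<ominus> c [^] n \<otimes> c)"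
      unfolding sS using sc'[of n] c(1) nat_pow_closed[OF c(1), of n] by algebra
    also have "\<dots> = \<one> \<ominus> c [^] n \<otimes> c" unfolding Suc using c(1) nat_pow_closed[OF c(1), of n] by algebra
    finally show ?case by simp
  qed
  have comm: "c \<otimes> s n = s n \<otimes> c" for n
  proof (induction n)
    case 0 then show ?case using s0 c by simp
  next
    case (Suc n)
    have "c \<otimes> c [^] n = c [^] n \<otimes> c" using nat_pow_Suc2[of c n] c by simp
    then show ?case using Suc sc'[of n] c by (simp add: sS l_distr r_distr)
  qed
  have R: "(\<one> \<ominus> c) \<otimes> s n = s n \<otimes> (\<one> \<ominus> c)" for n
  proof -
    have "(\<one> \<ominus> c) \<otimes> s n = s n \<ominus> c \<otimes> s n" using c(1) sc'[of n] by algebra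
    also have "\<dots> = s n \<otimes> (\<one> \<ominus> c)" unfolding comm using c(1) sc'[of n] by algebra
    finally show ?thesis .
  qed
  have "(\<lambda>n. \<parallel>s n \<otimes> (\<one> \<ominus> c) \<ominus> g \<otimes> (\<one> \<ominus> c)\<parallel>) \<longlonglongrightarrow> 0"
    by (rule limit_mult) (use sc' g c in auto)
  moreover have "(\<lambda>n. \<parallel>s n \<otimes> (\<one> \<ominus> c) \<ominus> \<one>\<parallel>) \<longlonglongrightarrow> 0"
  proof (rule limit_squeeze)
    fix n
    have "s n \<otimes> (\<one> \<ominus> c) \<ominus> \<one> = \<ominus> (c [^] n)" unfolding L using nat_pow_closed[OF c(1), of n] by algebra
    then show "\<parallel>s n \<otimes> (\<one> \<ominus> c) \<ominus> \<one>\<parallel> \<le> r ^ n" using pw[of n] c by simp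
    show "(\<lambda>n. r ^ n) \<longlonglongrightarrow> 0" using LIMSEQ_power_zero[of r] r c by simp
  qed (use sc' c in auto)
  ultimately have "g \<otimes> (\<one> \<ominus> c) = \<one>"
    by (intro limit_unique[of "\<lambda>n. s n \<otimes> (\<one> \<ominus> c)"]) (use sc' g c in auto)
  moreover have "(\<one> \<ominus> c) \<otimes> g = g \<otimes> (\<one> \<ominus> c)"
    by (rule limit_commute[of s]) (use sc' g c R in auto)
  ultimately show ?thesis using that g by metis
qed

lemma sc_P: assumes "0 \<le> r" shows "sc (of_real r) \<in> P"
  unfolding P_def using assms by (auto simp: star_sc intro!: exI[of _ r])

lemma one_P [simp]: "\<one> \<in> P"
  using sc_P[of 1] by simp

text \<open>For N at least 1 and at least the norm of t, the element c = 1 - t/N lies between 0 and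
  1 - 1/N, so a Neumann series inverts t/N = 1 - c. The inverse s = s* t s is positive, and its root
  commutes with t. The product y t y is the form needed to turn v* v = t into an isometry v
  y.\<close>

lemma P_inverse_sqrt:
  assumes t: "t \<in> carrier A" and ge: "t \<ominus> \<one> \<in> P"
  obtains y where "y \<in> P" "y \<otimes> t \<otimes> y = \<one>"
proof -
  have "t = (t \<ominus> \<one>) \<oplus> \<one>" using t by algebra
  then have tP: "t \<in> P" using P_add[OF ge one_P] by simp
  define N where "N = max 1 (\<parallel>t\<parallel>)"
  have N: "N \<ge> 1" "\<parallel>t\<parallel> \<le> N" by (auto simp: N_def)
  define q where "q = complex_of_real (1 / N)"
  have qq: "q * of_real N = 1" using N by (simp add: q_def)
  define c where "c = \<one> \<ominus> q \<cdot> t"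
  have cc: "c \<in> carrier A" using t by (simp add: c_def)
  have "sc (of_real N) \<ominus> t \<in> P" using P_self_adjoint_ball[of t N] t N P_star[OF tP] by simp
  then have "q \<cdot> (sc (of_real N) \<ominus> t) \<in> P" unfolding q_def using N by (intro P_cscale) auto
  moreover have "q \<cdot> (sc (of_real N) \<ominus> t) = c" using t qq by (simp add: c_def cscale_minus_right cscale_sc)
  ultimately have cP: "c \<in> P" by simp
  have "sc (of_real (1 - 1 / N)) \<ominus> c = q \<cdot> (t \<ominus> \<one>)"
  proof -
    have "sc (of_real (1 - 1 / N)) = \<one> \<ominus> q \<cdot> \<one>"
      using sc_diff[of 1 q] by (simp add: q_def sc_def)
    moreover have "(\<one> \<ominus> q \<cdot> \<one>) \<ominus> (\<one> \<ominus> q \<cdot> t) = q \<cdot> t \<ominus> q \<cdot> \<one>"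
      using cscale_closed[OF t, of q] cscale_closed[OF one_closed, of q] one_closed by algebra
    ultimately show ?thesis using t by (simp add: c_def cscale_minus_right)
  qed
  also have "\<dots> \<in> P" unfolding q_def using ge N by (intro P_cscale) auto
  finally have "\<parallel>c\<parallel> \<le> 1 - 1 / N" using P_dominated[OF cP] N by simp
  then obtain g where g: "g \<in> carrier A" "g \<otimes> (\<one> \<ominus> c) = \<one>" "(\<one> \<ominus> c) \<otimes> g = \<one>"
    using neumann_inverse[OF cc] N by (smt (verit) divide_pos_pos)
  have qt: "\<one> \<ominus> c = q \<cdot> t" unfolding c_def using cscale_closed[OF t, of q] by algebra
  define s where "s = q \<cdot> g"
  have s: "s \<in> carrier A" "s \<otimes> t = \<one>" "t \<otimes> s = \<one>"
    using g t unfolding qt by (auto simp: s_def cscale_mult_left cscale_mult_right)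
  have ss: "s\<^sup>\<star> = s"
  proof -
    have "s\<^sup>\<star> \<otimes> t = \<one>" using star_mult[of t s] s t P_star[OF tP] by simp
    then show ?thesis using s t by (metis l_one r_one m_assoc star_closed)
  qed
  have "s\<^sup>\<star> \<otimes> t \<otimes> s \<in> P" using P_conj[OF tP s(1)] .
  then have sP: "s \<in> P" using s ss by simp
  then obtain y where y: "y \<in> P" "y \<otimes> y = s" "\<And>w. w \<in> carrier A \<Longrightarrow> w \<otimes> s = s \<otimes> w \<Longrightarrow> w \<otimes> y = y \<otimes> w"
    using P_sqrt by blast
  have yc: "y \<in> carrier A" using y(1) P_carrier by blast
  have "y \<otimes> t \<otimes> y = t \<otimes> (y \<otimes> y)" using y(3)[OF t] s yc t by (simp add: m_assoc[symmetric])
  then show ?thesis using that y(1) y(2) s by simp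
qed

end

section \<open>States and the GNS seminorm\<close>

locale cstar_state = cstar_algebra A for A :: "'a cstar" (structure) +
  fixes \<phi> :: "'a \<Rightarrow> complex"
  assumes state: "state A \<phi>"
begin

lemma \<phi>_add: "\<lbrakk>x \<in> carrier A; y \<in> carrier A\<rbrakk> \<Longrightarrow> \<phi> (x \<oplus> y) = \<phi> x + \<phi> y"
  using state by (simp add: state_def)

lemma \<phi>_cscale: "x \<in> carrier A \<Longrightarrow> \<phi> (c \<cdot> x) = c * \<phi> x"
  using state by (simp add: state_def)

lemma \<phi>_one [simp]: "\<phi> \<one> = 1"
  using state by (simp add: state_def)

lemma \<phi>_zero [simp]: "\<phi> \<zero> = 0"
  using \<phi>_cscale[of \<zero> 0] by simp

lemma \<phi>_a_inv: "x \<in> carrier A \<Longrightarrow> \<phi> (\<ominus> x) = - \<phi> x"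
  by (simp add: a_inv_cscale \<phi>_cscale)

lemma \<phi>_minus: "\<lbrakk>x \<in> carrier A; y \<in> carrier A\<rbrakk> \<Longrightarrow> \<phi> (x \<ominus> y) = \<phi> x - \<phi> y"
  by (simp add: minus_eq \<phi>_add \<phi>_a_inv)

lemma \<phi>_sc: "\<phi> (sc c) = c"
  by (simp add: sc_def \<phi>_cscale)

lemma \<phi>_P: assumes "x \<in> P" shows "0 \<le> Re (\<phi> x)" "Im (\<phi> x) = 0"
proof -
  have "\<phi> x \<in> \<real>\<^sub>\<ge>\<^sub>0" using assms state by (simp add: state_def pos_elems_eq_P)
  then show "0 \<le> Re (\<phi> x)" "Im (\<phi> x) = 0" by (auto simp: nonneg_Reals_def)
qed

text \<open>Polarisation: the values of \<phi> at (x + c)* (x + c) are real for c = 0, 1, i.\<close>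

lemma \<phi>_star: assumes x: "x \<in> carrier A" shows "\<phi> (x\<^sup>\<star>) = cnj (\<phi> x)"
proof -
  have e: "Im (\<phi> (x\<^sup>\<star> \<otimes> x) + c * \<phi> (x\<^sup>\<star>) + cnj c * \<phi> x + cnj c * c) = 0" for c
  proof -
    have "(x \<oplus> sc c)\<^sup>\<star> \<otimes> (x \<oplus> sc c) = x\<^sup>\<star> \<otimes> x \<oplus> x\<^sup>\<star> \<otimes> sc c \<oplus> sc (cnj c) \<otimes> x \<oplus> sc (cnj c) \<otimes> sc c"
      using x sc_closed[of c] sc_closed[of "cnj c"] unfolding star_add[OF x sc_closed] star_sc by algebra
    also have "\<dots> = x\<^sup>\<star> \<otimes> x \<oplus> c \<cdot> x\<^sup>\<star> \<oplus> cnj c \<cdot> x \<oplus> sc (cnj c * c)"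
      using x by (simp add: sc_mult_left sc_mult_right[of "x\<^sup>\<star>"] cscale_sc)
    finally have "(x \<oplus> sc c)\<^sup>\<star> \<otimes> (x \<oplus> sc c) = x\<^sup>\<star> \<otimes> x \<oplus> c \<cdot> x\<^sup>\<star> \<oplus> cnj c \<cdot> x \<oplus> sc (cnj c * c)" .
    then show ?thesis using \<phi>_P(2)[OF star_mult_P[of "x \<oplus> sc c"]] x
      by (simp add: \<phi>_add \<phi>_cscale \<phi>_sc)
  qed
  show ?thesis using e[of 0] e[of 1] e[of \<i>] by (simp add: complex_eq_iff)
qed

text \<open>The GNS inner product, squared norm and norm of the vector \<open>[x]\<close>. The GNS
  space is never formed; elements of the algebra stand for their vectors and statements about
  vectors are made up to \<open>sn\<close> = 0.\<close>

definition ip :: "'a \<Rightarrow> 'a \<Rightarrow> complex" where "ip x y = \<phi> (x\<^sup>\<star> \<otimes> y)"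
definition sq :: "'a \<Rightarrow> real" where "sq x = Re (ip x x)"
definition sn :: "'a \<Rightarrow> real" where "sn x = sqrt (sq x)"

lemma ip_add_left: "\<lbrakk>x \<in> carrier A; y \<in> carrier A; z \<in> carrier A\<rbrakk> \<Longrightarrow> ip (x \<oplus> y) z = ip x z + ip y z"
  by (simp add: ip_def star_add l_distr \<phi>_add)
lemma ip_add_right: "\<lbrakk>x \<in> carrier A; y \<in> carrier A; z \<in> carrier A\<rbrakk> \<Longrightarrow> ip z (x \<oplus> y) = ip z x + ip z y"
  by (simp add: ip_def r_distr \<phi>_add)
lemma ip_cscale_left: "\<lbrakk>x \<in> carrier A; y \<in> carrier A\<rbrakk> \<Longrightarrow> ip (c \<cdot> x) y = cnj c * ip x y"
  by (simp add: ip_def star_cscale cscale_mult_left \<phi>_cscale)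
lemma ip_cscale_right: "\<lbrakk>x \<in> carrier A; y \<in> carrier A\<rbrakk> \<Longrightarrow> ip x (c \<cdot> y) = c * ip x y"
  by (simp add: ip_def cscale_mult_right \<phi>_cscale)
lemma ip_minus_left: "\<lbrakk>x \<in> carrier A; y \<in> carrier A; z \<in> carrier A\<rbrakk> \<Longrightarrow> ip (x \<ominus> y) z = ip x z - ip y z"
  by (simp add: minus_cscale ip_add_left ip_cscale_left)
lemma ip_zero_left [simp]: "x \<in> carrier A \<Longrightarrow> ip \<zero> x = 0" by (simp add: ip_def)
lemma ip_zero_right [simp]: "x \<in> carrier A \<Longrightarrow> ip x \<zero> = 0" by (simp add: ip_def)
lemma ip_commute: "\<lbrakk>x \<in> carrier A; y \<in> carrier A\<rbrakk> \<Longrightarrow> ip y x = cnj (ip x y)"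
  using \<phi>_star[of "x\<^sup>\<star> \<otimes> y"] by (simp add: ip_def star_mult)
lemma ip_mult_left: "\<lbrakk>a \<in> carrier A; x \<in> carrier A; y \<in> carrier A\<rbrakk> \<Longrightarrow> ip (a \<otimes> x) y = ip x (a\<^sup>\<star> \<otimes> y)"
  by (simp add: ip_def star_mult m_assoc)
lemma sq_nonneg: "x \<in> carrier A \<Longrightarrow> 0 \<le> sq x"
  using \<phi>_P(1)[OF star_mult_P] by (simp add: sq_def ip_def)
lemma ip_self: "x \<in> carrier A \<Longrightarrow> ip x x = of_real (sq x)"
  using \<phi>_P(2)[OF star_mult_P] by (simp add: sq_def ip_def complex_eq_iff)
lemma sq_cscale: "x \<in> carrier A \<Longrightarrow> sq (c \<cdot> x) = (cmod c)\<^sup>2 * sq x"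
proof -
  assume x: "x \<in> carrier A"
  have "ip (c \<cdot> x) (c \<cdot> x) = (c * cnj c) * ip x x" using x by (simp add: ip_cscale_left ip_cscale_right)
  then have "complex_of_real (sq (c \<cdot> x)) = of_real ((cmod c)\<^sup>2 * sq x)"
    using x complex_norm_square[of c] by (simp add: ip_self)
  then show ?thesis using of_real_eq_iff by blast
qed
lemma sq_add: "\<lbrakk>x \<in> carrier A; y \<in> carrier A\<rbrakk> \<Longrightarrow> sq (x \<oplus> y) = sq x + sq y + 2 * Re (ip x y)"
  using ip_commute[of x y] by (simp add: sq_def ip_add_left ip_add_right)

lemma sn_nonneg: "x \<in> carrier A \<Longrightarrow> 0 \<le> sn x" by (simp add: sn_def sq_nonneg)
lemma sn_sq: "x \<in> carrier A \<Longrightarrow> (sn x)\<^sup>2 = sq x" by (simp add: sn_def sq_nonneg)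

lemma cauchy_schwarz_sq:
  assumes x: "x \<in> carrier A" and y: "y \<in> carrier A"
  shows "(cmod (ip x y))\<^sup>2 \<le> sq x * sq y"
proof -
  define a where "a = ip x y"
  have key: "0 \<le> sq x + (t\<^sup>2 * sq y) * (cmod a)\<^sup>2 - 2 * t * (cmod a)\<^sup>2" for t :: real
  proof -
    define c where "c = - (of_real t * cnj a)"
    have "0 \<le> sq (x \<oplus> c \<cdot> y)" using x y by (simp add: sq_nonneg)
    also have "\<dots> = sq x + (cmod c)\<^sup>2 * sq y + 2 * Re (c * a)" using x y by (simp add: sq_add sq_cscale ip_cscale_right a_def)
    also have "Re (c * a) = - t * (cmod a)\<^sup>2" unfolding cmod_power2 by (simp add: c_def power2_eq_square algebra_simps)
    also have "(cmod c)\<^sup>2 = t\<^sup>2 * (cmod a)\<^sup>2" by (simp add: c_def norm_mult power_mult_distrib)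
    finally show ?thesis by (simp add: algebra_simps)
  qed
  show ?thesis
  proof (cases "sq y = 0")
    case True
    then have k: "2 * t * (cmod a)\<^sup>2 \<le> sq x" for t using key[of t] by simp
    have "(cmod a)\<^sup>2 = 0"
    proof (rule ccontr)
      assume "(cmod a)\<^sup>2 \<noteq> 0"
      then show False using k[of "(sq x + 1) / (cmod a)\<^sup>2"] sq_nonneg[OF x] by simp
    qed
    then show ?thesis using True by (simp add: a_def)
  next
    case False
    then have p: "sq y > 0" using sq_nonneg[OF y] by simp
    have "0 \<le> sq x - (cmod a)\<^sup>2 / sq y" using key[of "1 / sq y"] p by (simp add: power2_eq_square field_simps)
    then show ?thesis using p by (simp add: a_def field_simps)
  qed
qed

lemma cauchy_schwarz: "\<lbrakk>x \<in> carrier A; y \<in> carrier A\<rbrakk> \<Longrightarrow> cmod (ip x y) \<le> sn x * sn y"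
  using cauchy_schwarz_sq[of x y] by (simp add: sn_def real_sqrt_mult[symmetric] real_le_rsqrt)

lemma sn_triangle: "\<lbrakk>x \<in> carrier A; y \<in> carrier A\<rbrakk> \<Longrightarrow> sn (x \<oplus> y) \<le> sn x + sn y"
proof -
  assume c: "x \<in> carrier A" "y \<in> carrier A"
  have "sq (x \<oplus> y) \<le> (sn x + sn y)\<^sup>2"
    using cauchy_schwarz[OF c] complex_Re_le_cmod[of "ip x y"] c by (simp add: sq_add power2_sum sn_sq)
  moreover have "0 \<le> sn x + sn y" using c sn_nonneg by simp
  ultimately show ?thesis unfolding sn_def[of "x \<oplus> y"] using real_sqrt_le_mono by fastforce
qed

lemma sn_cscale: "x \<in> carrier A \<Longrightarrow> sn (c \<cdot> x) = cmod c * sn x"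
  by (simp add: sn_def sq_cscale real_sqrt_mult)

lemma sn_a_inv: "x \<in> carrier A \<Longrightarrow> sn (\<ominus> x) = sn x" by (simp add: a_inv_cscale sn_cscale)

lemma sn_minus: "\<lbrakk>x \<in> carrier A; y \<in> carrier A\<rbrakk> \<Longrightarrow> sn (x \<ominus> y) \<le> sn x + sn y"
  using sn_triangle[of x "\<ominus> y"] by (simp add: minus_eq sn_a_inv)

text \<open>The GNS representation is contractive, because conjugating the positive element
  \<parallel>a\<parallel>^2 - a* a by x keeps it positive.\<close>

lemma sn_mult: assumes a: "a \<in> carrier A" and x: "x \<in> carrier A" shows "sn (a \<otimes> x) \<le> \<parallel>a\<parallel> * sn x"
proof -
  define n where "n = complex_of_real (\<parallel>a\<parallel>\<^sup>2)"
  have p: "x\<^sup>\<star> \<otimes> (sc n \<ominus> a\<^sup>\<star> \<otimes> a) \<otimes> x \<in> P"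
    using P_conj[OF nrm_sq_minus_star_mult_P[OF a] x] by (simp add: n_def)
  have "x\<^sup>\<star> \<otimes> (sc n \<ominus> a\<^sup>\<star> \<otimes> a) \<otimes> x = x\<^sup>\<star> \<otimes> (sc n \<otimes> x) \<ominus> (a \<otimes> x)\<^sup>\<star> \<otimes> (a \<otimes> x)"
    using a x sc_closed[of n] by algebra
  then have "0 \<le> Re (n * ip x x - ip (a \<otimes> x) (a \<otimes> x))" using \<phi>_P(1)[OF p] a x
    by (simp add: \<phi>_minus ip_def sc_mult_left cscale_mult_right \<phi>_cscale)
  then have "sq (a \<otimes> x) \<le> \<parallel>a\<parallel>\<^sup>2 * sq x" using x a by (simp add: n_def ip_self)
  then have "sqrt (sq (a \<otimes> x)) \<le> sqrt (\<parallel>a\<parallel>\<^sup>2 * sq x)" by (rule real_sqrt_le_mono)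
  then show ?thesis using nrm_nonneg[OF a] by (simp add: sn_def real_sqrt_mult)
qed

lemma sn_one [simp]: "sn \<one> = 1" by (simp add: sn_def sq_def ip_def)
lemma sn_zero [simp]: "sn \<zero> = 0" by (simp add: sn_def sq_def)
lemma sn_le_nrm: "x \<in> carrier A \<Longrightarrow> sn x \<le> \<parallel>x\<parallel>" using sn_mult[of x \<one>] by simp
lemma \<phi>_le_nrm: "x \<in> carrier A \<Longrightarrow> cmod (\<phi> x) \<le> \<parallel>x\<parallel>"
  using cauchy_schwarz[of \<one> x] sn_le_nrm[of x] by (simp add: ip_def)

text \<open>Both rules are Cauchy-Schwarz. Applied to S* as a null vector, they kill words that end
  in S* and words that begin with S.\<close>

lemma \<phi>_mult_null_right: "\<lbrakk>x \<in> carrier A; y \<in> carrier A; sn y = 0\<rbrakk> \<Longrightarrow> \<phi> (x \<otimes> y) = 0"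
  using cauchy_schwarz[of "x\<^sup>\<star>" y] by (simp add: ip_def)
lemma \<phi>_mult_null_left: "\<lbrakk>x \<in> carrier A; y \<in> carrier A; sn (x\<^sup>\<star>) = 0\<rbrakk> \<Longrightarrow> \<phi> (x \<otimes> y) = 0"
  using cauchy_schwarz[of "x\<^sup>\<star>" y] by (simp add: ip_def)
lemma sn_mult_null: "\<lbrakk>x \<in> carrier A; y \<in> carrier A; sn y = 0\<rbrakk> \<Longrightarrow> sn (x \<otimes> y) = 0"
  using sn_mult[of x y] sn_nonneg[of "x \<otimes> y"] by simp

lemma \<phi>_square_zero_iff: "y \<in> carrier A \<Longrightarrow> \<phi> (y\<^sup>\<star> \<otimes> y) = 0 \<longleftrightarrow> sn y = 0"
  using ip_self[of y] by (simp add: ip_def sn_def)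

text \<open>Injectivity on the classes \<open>gns_vec\<close> becomes triviality of a kernel: the
  class of d x is the class of 0 exactly if d x is a null vector.\<close>

lemma gns_faithful_iff:
  "gns_faithful A \<phi> \<longleftrightarrow> (\<forall>d\<in>carrier A. (\<forall>x\<in>carrier A. sn (d \<otimes> x) = 0) \<longrightarrow> d = \<zero>)"
proof
  assume f: "gns_faithful A \<phi>"
  show "\<forall>d\<in>carrier A. (\<forall>x\<in>carrier A. sn (d \<otimes> x) = 0) \<longrightarrow> d = \<zero>"
  proof (intro ballI impI)
    fix d assume d: "d \<in> carrier A" "\<forall>x\<in>carrier A. sn (d \<otimes> x) = 0"
    have "gns_vec A \<phi> (d \<otimes> x) = gns_vec A \<phi> (\<zero> \<otimes> x)" if x: "x \<in> carrier A" for x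
    proof -
      have "sn (y \<ominus> d \<otimes> x) = 0 \<longleftrightarrow> sn y = 0" if y: "y \<in> carrier A" for y
      proof -
        have z: "sn (d \<otimes> x) = 0" using d x by simp
        have "y = (y \<ominus> d \<otimes> x) \<oplus> d \<otimes> x" using y d(1) x by algebra
        then have "sn y \<le> sn (y \<ominus> d \<otimes> x) + sn (d \<otimes> x)" using sn_triangle[of "y \<ominus> d \<otimes> x" "d \<otimes> x"] y d(1) x by simp
        moreover have "sn (y \<ominus> d \<otimes> x) \<le> sn y + sn (d \<otimes> x)" using sn_minus y d(1) x by simp
        moreover have "0 \<le> sn y" "0 \<le> sn (y \<ominus> d \<otimes> x)" using sn_nonneg y d(1) x by simp_all
        ultimately show ?thesis using z by linarith
      qed
      then show ?thesis using x d(1) by (auto simp: gns_vec_def \<phi>_square_zero_iff minus_eq)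
    qed
    then show "d = \<zero>" using f d(1) unfolding gns_faithful_def by blast
  qed
next
  assume f: "\<forall>d\<in>carrier A. (\<forall>x\<in>carrier A. sn (d \<otimes> x) = 0) \<longrightarrow> d = \<zero>"
  show "gns_faithful A \<phi>" unfolding gns_faithful_def
  proof (intro ballI impI)
    fix a b assume ab: "a \<in> carrier A" "b \<in> carrier A"
      and e: "\<forall>x\<in>carrier A. gns_vec A \<phi> (a \<otimes> x) = gns_vec A \<phi> (b \<otimes> x)"
    have "sn ((a \<ominus> b) \<otimes> x) = 0" if x: "x \<in> carrier A" for x
    proof -
      have "a \<otimes> x \<in> gns_vec A \<phi> (a \<otimes> x)" using ab x by (simp add: gns_vec_def)
      then have "a \<otimes> x \<in> gns_vec A \<phi> (b \<otimes> x)" using e x by blast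
      then have "sn (a \<otimes> x \<ominus> b \<otimes> x) = 0" using ab x by (simp add: gns_vec_def \<phi>_square_zero_iff)
      moreover have "(a \<ominus> b) \<otimes> x = a \<otimes> x \<ominus> b \<otimes> x" using ab x by algebra
      ultimately show ?thesis by simp
    qed
    then have "a \<ominus> b = \<zero>" using f ab by blast
    then show "a = b" using minus_eq_zero_iff ab by blast
  qed
qed

text \<open>A faithful representation detects positivity. For the negative part g = k^2 of h,
  testing at g x gives minus the square of the seminorm of k^3 x; hence k^3 is in the kernel, and k
  = 0.\<close>

lemma faithful_positive:
  assumes f: "gns_faithful A \<phi>" and h: "h \<in> carrier A" "h\<^sup>\<star> = h"
    and pos: "\<And>x. x \<in> carrier A \<Longrightarrow> 0 \<le> Re (\<phi> (x\<^sup>\<star> \<otimes> h \<otimes> x))"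
  shows "h \<in> P"
proof -
  obtain p g where pg: "p \<in> P" "g \<in> P" "h = p \<ominus> g" "p \<otimes> g = \<zero>" "g \<otimes> p = \<zero>"
    using jordan_decomposition[OF h] by blast
  obtain k where k: "k \<in> P" "k \<otimes> k = g" using P_sqrt[OF pg(2)] by blast
  have c: "p \<in> carrier A" "g \<in> carrier A" "k \<in> carrier A" "g\<^sup>\<star> = g" "k\<^sup>\<star> = k" using pg k P_carrier P_star by auto
  have hg: "g \<otimes> h \<otimes> g = \<ominus> (g \<otimes> g \<otimes> g)"
  proof -
    have "g \<otimes> h \<otimes> g = (g \<otimes> p) \<otimes> g \<ominus> g \<otimes> g \<otimes> g" unfolding pg(3) using c(1,2) by algebra
    then show ?thesis using pg(5) c by (simp add: minus_eq)
  qed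
  have "sn (k \<otimes> k \<otimes> k \<otimes> x) = 0" if x: "x \<in> carrier A" for x
  proof -
    have "(g \<otimes> x)\<^sup>\<star> \<otimes> h \<otimes> (g \<otimes> x) = x\<^sup>\<star> \<otimes> (g \<otimes> h \<otimes> g) \<otimes> x" using c x h by (simp add: star_mult m_assoc)
    also have "\<dots> = \<ominus> ((k \<otimes> k \<otimes> k \<otimes> x)\<^sup>\<star> \<otimes> (k \<otimes> k \<otimes> k \<otimes> x))"
      unfolding hg using c x by (simp add: k(2)[symmetric] star_mult m_assoc l_minus r_minus)
    finally have "sq (k \<otimes> k \<otimes> k \<otimes> x) \<le> 0" using pos[of "g \<otimes> x"] c x by (simp add: \<phi>_a_inv sq_def ip_def)
    then show ?thesis using sq_nonneg[of "k \<otimes> k \<otimes> k \<otimes> x"] c x by (simp add: sn_def)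
  qed
  then have "k \<otimes> k \<otimes> k = \<zero>" using f c unfolding gns_faithful_iff by simp
  then have "k = \<zero>" using cube_zero c by blast
  then have "g = \<zero>" using k by simp
  then show ?thesis using pg c by (simp add: minus_eq)
qed

end

lemma cstar_prob_spaceD:
  assumes "cstar_prob_space A \<rho>" shows "cstar_state A \<rho>" "gns_faithful A \<rho>"
  using assms by (auto simp: cstar_prob_space_def cstar_state_def cstar_state_axioms_def)

section \<open>Generated subalgebras\<close>

context cstar_algebra
begin

lemma unital_cstar_subalgebraD:
  assumes "unital_cstar_subalgebra A T"
  shows "T \<subseteq> carrier A" "\<zero> \<in> T" "\<one> \<in> T"
    "\<And>x y. x \<in> T \<Longrightarrow> y \<in> T \<Longrightarrow> x \<oplus> y \<in> T" "\<And>x y. x \<in> T \<Longrightarrow> y \<in> T \<Longrightarrow> x \<otimes> y \<in> T"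
    "\<And>c x. x \<in> T \<Longrightarrow> c \<cdot> x \<in> T" "\<And>x. x \<in> T \<Longrightarrow> x\<^sup>\<star> \<in> T" "nrm_closed A T"
    "\<And>x y. x \<in> T \<Longrightarrow> y \<in> T \<Longrightarrow> x \<ominus> y \<in> T" "\<And>c. sc c \<in> T"
proof -
  show s: "T \<subseteq> carrier A" "\<zero> \<in> T" "\<one> \<in> T"
    "\<And>x y. x \<in> T \<Longrightarrow> y \<in> T \<Longrightarrow> x \<oplus> y \<in> T" "\<And>x y. x \<in> T \<Longrightarrow> y \<in> T \<Longrightarrow> x \<otimes> y \<in> T"
    "\<And>c x. x \<in> T \<Longrightarrow> c \<cdot> x \<in> T" "\<And>x. x \<in> T \<Longrightarrow> x\<^sup>\<star> \<in> T" "nrm_closed A T"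
    using assms by (auto simp: unital_cstar_subalgebra_def cstar_subalgebra_def)
  show "x \<ominus> y \<in> T" if "x \<in> T" "y \<in> T" for x y
    using that s(1) s(4)[OF that(1) s(6)[OF that(2), of "-1"]] by (simp add: minus_cscale subset_iff)
  show "sc c \<in> T" for c using s(3,6) by (simp add: sc_def)
qed

lemma nrm_closedD: "\<lbrakk>nrm_closed A T; x \<in> carrier A; \<And>e. e > 0 \<Longrightarrow> \<exists>s\<in>T. \<parallel>x \<ominus> s\<parallel> < e\<rbrakk> \<Longrightarrow> x \<in> T"
  by (auto simp: nrm_closed_def)

definition clos :: "'a set \<Rightarrow> 'a set" where
  "clos T = {x \<in> carrier A. \<forall>e>0. \<exists>s\<in>T. \<parallel>x \<ominus> s\<parallel> < e}"

lemma closD: "x \<in> clos T \<Longrightarrow> 0 < e \<Longrightarrow> \<exists>s\<in>T. \<parallel>x \<ominus> s\<parallel> < e" by (simp add: clos_def)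
lemma clos_carrier: "x \<in> clos T \<Longrightarrow> x \<in> carrier A" by (simp add: clos_def)
lemma clos_base: "T \<subseteq> carrier A \<Longrightarrow> T \<subseteq> clos T" by (force simp: clos_def)

lemma nrm_closed_clos:
  assumes T: "T \<subseteq> carrier A" shows "nrm_closed A (clos T)"
  unfolding nrm_closed_def
proof (intro ballI impI)
  fix x assume x: "x \<in> carrier A" and a: "\<forall>e>0. \<exists>s\<in>clos T. \<parallel>x \<ominus> s\<parallel> < e"
  have "\<exists>s\<in>T. \<parallel>x \<ominus> s\<parallel> < e" if e: "e > 0" for e
  proof -
    obtain s where s: "s \<in> clos T" "\<parallel>x \<ominus> s\<parallel> < e/2" using a e by (meson half_gt_zero)
    obtain t where t: "t \<in> T" "\<parallel>s \<ominus> t\<parallel> < e/2" using closD[OF s(1), of "e/2"] e by auto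
    have "\<parallel>x \<ominus> t\<parallel> < e" using nrm_minus_triangle[of x s t] x s t T clos_carrier by fastforce
    then show ?thesis using t by blast
  qed
  then show "x \<in> clos T" using x by (simp add: clos_def)
qed

lemma clos_add: assumes T: "T \<subseteq> carrier A" "\<And>x y. x \<in> T \<Longrightarrow> y \<in> T \<Longrightarrow> x \<oplus> y \<in> T" and x: "x \<in> clos T" and y: "y \<in> clos T"
  shows "x \<oplus> y \<in> clos T"
proof -
  have c: "x \<in> carrier A" "y \<in> carrier A" using x y clos_carrier by auto
  have "\<exists>s\<in>T. \<parallel>x \<oplus> y \<ominus> s\<parallel> < e" if e: "e > 0" for e
  proof -
    obtain s where s: "s \<in> T" "\<parallel>x \<ominus> s\<parallel> < e/2" using closD[OF x, of "e/2"] e by auto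
    obtain t where t: "t \<in> T" "\<parallel>y \<ominus> t\<parallel> < e/2" using closD[OF y, of "e/2"] e by auto
    have st: "s \<in> carrier A" "t \<in> carrier A" using s t T by auto
    have "x \<oplus> y \<ominus> (s \<oplus> t) = (x \<ominus> s) \<oplus> (y \<ominus> t)" using c st by algebra
    then have "\<parallel>x \<oplus> y \<ominus> (s \<oplus> t)\<parallel> < e" using nrm_triangle[of "x \<ominus> s" "y \<ominus> t"] c st s t by simp
    then show ?thesis using T(2) s t by blast
  qed
  then show ?thesis using c by (simp add: clos_def)
qed

lemma clos_map:
  assumes T: "T \<subseteq> carrier A" "T' \<subseteq> carrier A" and K: "0 \<le> K"
    and f: "\<And>s. s \<in> T \<Longrightarrow> f s \<in> T'" "\<And>x. x \<in> carrier A \<Longrightarrow> f x \<in> carrier A"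
      "\<And>x s. x \<in> carrier A \<Longrightarrow> s \<in> carrier A \<Longrightarrow> \<parallel>f x \<ominus> f s\<parallel> \<le> K * \<parallel>x \<ominus> s\<parallel>"
    and x: "x \<in> clos T"
  shows "f x \<in> clos T'"
proof -
  have c: "x \<in> carrier A" using x clos_carrier by auto
  have "\<exists>s\<in>T'. \<parallel>f x \<ominus> s\<parallel> < e" if e: "e > 0" for e
  proof -
    obtain s where s: "s \<in> T" "\<parallel>x \<ominus> s\<parallel> < e/(K+1)" using closD[OF x, of "e/(K+1)"] e K by auto
    have sc': "s \<in> carrier A" using s T by auto
    have "\<parallel>f x \<ominus> f s\<parallel> \<le> K * \<parallel>x \<ominus> s\<parallel>" using f(3) c sc' by blast
    also have "\<dots> \<le> K * (e/(K+1))" using s K by (intro mult_left_mono) auto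
    also have "\<dots> < e" using e K by (simp add: field_simps)
    finally show ?thesis using f(1) s by blast
  qed
  then show ?thesis using c f by (simp add: clos_def)
qed

lemma nrm_mult_left_diff: "\<lbrakk>a \<in> carrier A; x \<in> carrier A; s \<in> carrier A\<rbrakk> \<Longrightarrow> \<parallel>a \<otimes> x \<ominus> a \<otimes> s\<parallel> \<le> \<parallel>a\<parallel> * \<parallel>x \<ominus> s\<parallel>"
proof -
  assume c: "a \<in> carrier A" "x \<in> carrier A" "s \<in> carrier A"
  have "a \<otimes> x \<ominus> a \<otimes> s = a \<otimes> (x \<ominus> s)" using c by algebra
  then show ?thesis using nrm_mult c by simp
qed

lemma nrm_mult_right_diff: "\<lbrakk>a \<in> carrier A; x \<in> carrier A; s \<in> carrier A\<rbrakk> \<Longrightarrow> \<parallel>x \<otimes> a \<ominus> s \<otimes> a\<parallel> \<le> \<parallel>a\<parallel> * \<parallel>x \<ominus> s\<parallel>"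
proof -
  assume c: "a \<in> carrier A" "x \<in> carrier A" "s \<in> carrier A"
  have "x \<otimes> a \<ominus> s \<otimes> a = (x \<ominus> s) \<otimes> a" using c by algebra
  then show ?thesis using nrm_mult[of "x \<ominus> s" a] c by (simp add: mult.commute)
qed

lemma clos_mult_left:
  assumes T: "T \<subseteq> carrier A" "T' \<subseteq> carrier A" and a: "a \<in> carrier A" "\<And>s. s \<in> T \<Longrightarrow> a \<otimes> s \<in> T'" and x: "x \<in> clos T"
  shows "a \<otimes> x \<in> clos T'"
  by (rule clos_map[OF T, of "\<parallel>a\<parallel>"]) (use a x nrm_nonneg nrm_mult_left_diff in auto)

lemma clos_mult_right:
  assumes T: "T \<subseteq> carrier A" "T' \<subseteq> carrier A" and a: "a \<in> carrier A" "\<And>s. s \<in> T \<Longrightarrow> s \<otimes> a \<in> T'" and x: "x \<in> clos T"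
  shows "x \<otimes> a \<in> clos T'"
  by (rule clos_map[OF T, of "\<parallel>a\<parallel>"]) (use a x nrm_nonneg nrm_mult_right_diff in auto)

lemma clos_clos: assumes "T \<subseteq> carrier A" shows "clos (clos T) = clos T"
proof
  show "clos (clos T) \<subseteq> clos T"
    using nrm_closed_clos[OF assms] by (force simp: nrm_closed_def clos_def[of "clos T"])
  show "clos T \<subseteq> clos (clos T)" by (intro clos_base) (auto simp: clos_def)
qed

lemma unital_cstar_subalgebra_clos:
  assumes T: "T \<subseteq> carrier A" "\<one> \<in> T"
    "\<And>x y. x \<in> T \<Longrightarrow> y \<in> T \<Longrightarrow> x \<oplus> y \<in> T" "\<And>x y. x \<in> T \<Longrightarrow> y \<in> T \<Longrightarrow> x \<otimes> y \<in> T"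
    "\<And>c x. x \<in> T \<Longrightarrow> c \<cdot> x \<in> T" "\<And>x. x \<in> T \<Longrightarrow> x\<^sup>\<star> \<in> T"
  shows "unital_cstar_subalgebra A (clos T)"
proof -
  have sub: "clos T \<subseteq> carrier A" by (auto simp: clos_def)
  have z: "\<zero> \<in> T" using T(2) T(5)[of \<one> 0] by simp
  have m1: "s \<otimes> x \<in> clos T" if "s \<in> T" "x \<in> clos T" for s x
    using clos_mult_left[of T T s x] T that by auto
  have m2: "x \<otimes> y \<in> clos T" if "x \<in> clos T" "y \<in> clos T" for x y
  proof -
    have "x \<otimes> y \<in> clos (clos T)" by (rule clos_mult_right[of T]) (use T sub that m1 in auto)
    then show ?thesis using clos_clos T by simp
  qed
  have c: "c \<cdot> x \<in> clos T" if "x \<in> clos T" for c x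
    by (rule clos_map[OF T(1,1), of "cmod c"]) (use T(5) that in \<open>simp_all add: cscale_minus_right[symmetric] nrm_cscale\<close>)
  have s: "x\<^sup>\<star> \<in> clos T" if "x \<in> clos T" for x
    by (rule clos_map[OF T(1,1), of 1]) (use T(6) that in \<open>simp_all add: star_minus[symmetric]\<close>)
  have "\<zero> \<in> clos T" "\<one> \<in> clos T" using clos_base[OF T(1)] z T(2) by auto
  moreover have "\<And>x y. x \<in> clos T \<Longrightarrow> y \<in> clos T \<Longrightarrow> x \<oplus> y \<in> clos T" using clos_add[OF T(1,3)] .
  ultimately show ?thesis
    unfolding unital_cstar_subalgebra_def cstar_subalgebra_def
    by (intro conjI ballI allI sub m2 c s nrm_closed_clos[OF T(1)])
qed

lemma cstar_generated_least: "unital_cstar_subalgebra A T \<Longrightarrow> X \<subseteq> T \<Longrightarrow> cstar_generated A X \<subseteq> T"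
  by (auto simp: cstar_generated_def)

lemma cstar_generated_base: "X \<subseteq> cstar_generated A X"
  by (auto simp: cstar_generated_def)

lemma unital_cstar_subalgebra_carrier: "unital_cstar_subalgebra A (carrier A)"
  by (auto simp: unital_cstar_subalgebra_def cstar_subalgebra_def nrm_closed_def)

lemma unital_cstar_subalgebra_generated:
  assumes "X \<subseteq> carrier A" shows "unital_cstar_subalgebra A (cstar_generated A X)"
proof -
  define F where "F = {S. unital_cstar_subalgebra A S \<and> X \<subseteq> S}"
  have F: "carrier A \<in> F" "\<And>S. S \<in> F \<Longrightarrow> unital_cstar_subalgebra A S" using assms unital_cstar_subalgebra_carrier by (auto simp: F_def)
  have "nrm_closed A (\<Inter>F)" unfolding nrm_closed_def
  proof (intro ballI impI InterI)
    fix x S assume x: "x \<in> carrier A" "\<forall>e>0. \<exists>s\<in>\<Inter>F. \<parallel>x \<ominus> s\<parallel> < e" and S: "S \<in> F"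
    show "x \<in> S"
    proof (rule nrm_closedD[OF unital_cstar_subalgebraD(8)[OF F(2)[OF S]] x(1)])
      show "\<exists>s\<in>S. \<parallel>x \<ominus> s\<parallel> < e" if "e > 0" for e using x(2) S that by blast
    qed
  qed
  moreover have "\<Inter>F \<subseteq> carrier A" "\<zero> \<in> \<Inter>F" "\<one> \<in> \<Inter>F"
    using F(1) unital_cstar_subalgebraD(2,3)[OF F(2)] by auto
  moreover have "x \<oplus> y \<in> \<Inter>F" "x \<otimes> y \<in> \<Inter>F" if "x \<in> \<Inter>F" "y \<in> \<Inter>F" for x y
    using that unital_cstar_subalgebraD(4,5)[OF F(2)] by auto
  moreover have "c \<cdot> x \<in> \<Inter>F" "x\<^sup>\<star> \<in> \<Inter>F" if "x \<in> \<Inter>F" for c x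
    using that unital_cstar_subalgebraD(6,7)[OF F(2)] by auto
  ultimately have "unital_cstar_subalgebra A (\<Inter>F)"
    unfolding unital_cstar_subalgebra_def cstar_subalgebra_def by simp
  then show ?thesis by (simp add: cstar_generated_def F_def)
qed

text \<open>Sums over an initial segment in recursive form, so that products, adjoints and states
  pass through by induction on the length.\<close>

primrec lsum :: "(nat \<Rightarrow> 'a) \<Rightarrow> nat \<Rightarrow> 'a" where
  "lsum X 0 = \<zero>"
| "lsum X (Suc n) = lsum X n \<oplus> X n"

lemma lsum_closed: "(\<And>t. t < n \<Longrightarrow> X t \<in> carrier A) \<Longrightarrow> lsum X n \<in> carrier A"
  by (induction n) auto

lemma lsum_cong: "(\<And>t. t < n \<Longrightarrow> X t = Y t) \<Longrightarrow> lsum X n = lsum Y n"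
  by (induction n) auto

lemma lsum_in: "\<lbrakk>\<zero> \<in> T; \<And>x y. x \<in> T \<Longrightarrow> y \<in> T \<Longrightarrow> x \<oplus> y \<in> T; \<And>t. t < n \<Longrightarrow> X t \<in> T\<rbrakk> \<Longrightarrow> lsum X n \<in> T"
  by (induction n) auto

lemma lsum_mult_left: "\<lbrakk>w \<in> carrier A; \<And>t. t < n \<Longrightarrow> X t \<in> carrier A\<rbrakk> \<Longrightarrow> w \<otimes> lsum X n = lsum (\<lambda>t. w \<otimes> X t) n"
  by (induction n) (auto simp: r_distr lsum_closed)

lemma lsum_mult_right: "\<lbrakk>w \<in> carrier A; \<And>t. t < n \<Longrightarrow> X t \<in> carrier A\<rbrakk> \<Longrightarrow> lsum X n \<otimes> w = lsum (\<lambda>t. X t \<otimes> w) n"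
  by (induction n) (auto simp: l_distr lsum_closed)

lemma lsum_star: "(\<And>t. t < n \<Longrightarrow> X t \<in> carrier A) \<Longrightarrow> (lsum X n)\<^sup>\<star> = lsum (\<lambda>t. (X t)\<^sup>\<star>) n"
  by (induction n) (auto simp: star_add lsum_closed)

lemma lsum_append:
  assumes "\<And>t. t < n \<Longrightarrow> X t \<in> carrier A" "\<And>t. t < m \<Longrightarrow> Y t \<in> carrier A"
  shows "lsum X n \<oplus> lsum Y m = lsum (\<lambda>t. if t < n then X t else Y (t - n)) (n + m)"
  using assms(2)
proof (induction m)
  case 0
  have "lsum X n = lsum (\<lambda>t. if t < n then X t else Y (t - n)) n" by (rule lsum_cong) simp
  then show ?case using assms(1) lsum_closed[of n X] by simp
next
  case (Suc m)
  then show ?case using assms(1) lsum_closed[of n X] lsum_closed[of m Y] by (simp add: a_assoc[symmetric])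
qed

end

context cstar_state
begin

lemma \<phi>_lsum: "(\<And>t. t < n \<Longrightarrow> X t \<in> carrier A) \<Longrightarrow> \<phi> (lsum X n) = (\<Sum>t<n. \<phi> (X t))"
  by (induction n) (auto simp: \<phi>_add lsum_closed)

lemma ip_lsum_right: "\<lbrakk>x \<in> carrier A; \<And>t. t < n \<Longrightarrow> X t \<in> carrier A\<rbrakk> \<Longrightarrow> ip x (lsum X n) = (\<Sum>t<n. ip x (X t))"
  by (induction n) (auto simp: ip_add_right lsum_closed)

lemma ip_lsum_left: "\<lbrakk>x \<in> carrier A; \<And>t. t < n \<Longrightarrow> X t \<in> carrier A\<rbrakk> \<Longrightarrow> ip (lsum X n) x = (\<Sum>t<n. ip (X t) x)"
  by (induction n) (auto simp: ip_add_left lsum_closed)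

text \<open>The subspace \<open>N\<close> need not be complete, so instead of the projection of x an
  r in \<open>N\<close> is taken whose squared distance exceeds the infimum by less than \<delta>^2.
  If x - r had an inner product with t larger than \<delta> times the seminorm of t, moving r along
  t would beat the infimum.\<close>

lemma approximate_projection:
  assumes N: "N \<subseteq> carrier A" "\<zero> \<in> N" "\<And>s t. s \<in> N \<Longrightarrow> t \<in> N \<Longrightarrow> s \<oplus> t \<in> N" "\<And>c s. s \<in> N \<Longrightarrow> c \<cdot> s \<in> N"
    and x: "x \<in> carrier A" and \<delta>: "0 < \<delta>"
  obtains r where "r \<in> N" "sn (x \<ominus> r) \<le> sn x + \<delta>" "\<And>t. t \<in> N \<Longrightarrow> cmod (ip (x \<ominus> r) t) \<le> \<delta> * sn t"
proof -
  define I where "I = (INF r\<in>N. sq (x \<ominus> r))"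
  have bdd: "bdd_below ((\<lambda>r. sq (x \<ominus> r)) ` N)"
    using sq_nonneg N x by (intro bdd_belowI[of _ 0]) auto
  have I: "I \<le> sq (x \<ominus> r)" if "r \<in> N" for r
    unfolding I_def using bdd that by (rule cINF_lower)
  have "\<exists>r\<in>N. sq (x \<ominus> r) < I + \<delta>\<^sup>2"
    using cINF_less_iff[of N "\<lambda>r. sq (x \<ominus> r)" "I + \<delta>\<^sup>2"] bdd N \<delta> unfolding I_def by auto
  then obtain r where r: "r \<in> N" "sq (x \<ominus> r) < I + \<delta>\<^sup>2" by blast
  have rc: "r \<in> carrier A" "x \<ominus> r \<in> carrier A" using r N x by auto
  have "I \<le> sq x" using I[of \<zero>] N x by (simp add: minus_eq)
  then have "sq (x \<ominus> r) \<le> (sn x + \<delta>)\<^sup>2"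
    using r \<delta> x sn_nonneg[of x] by (simp add: power2_sum sn_sq) (smt (verit) mult_nonneg_nonneg)
  then have 1: "sn (x \<ominus> r) \<le> sn x + \<delta>"
    unfolding sn_def[of "x \<ominus> r"] using \<delta> sn_nonneg[OF x] real_le_lsqrt sq_nonneg[OF rc(2)] by simp
  have 2: "cmod (ip (x \<ominus> r) t) \<le> \<delta> * sn t" if t: "t \<in> N" for t
  proof (cases "sq t = 0")
    case True
    then show ?thesis using cauchy_schwarz[of "x \<ominus> r" t] N t rc by (auto simp: sn_def)
  next
    case False
    define y where "y = x \<ominus> r"
    have tc: "t \<in> carrier A" and yc: "y \<in> carrier A" using t N rc by (auto simp: y_def)
    have tp: "sq t > 0" using False sq_nonneg[OF tc] by simp
    define a where "a = ip y t"
    \<comment> \<open>The coefficient that minimises the squared seminorm of y + c t; the minimum is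
      lower by |a|^2 / \<open>sq t\<close>.\<close>
    define c where "c = - (cnj a / of_real (sq t))"
    have "y \<oplus> c \<cdot> t = x \<ominus> (r \<oplus> (-c) \<cdot> t)"
    proof -
      have "x \<ominus> (r \<oplus> (-c) \<cdot> t) = (x \<ominus> r) \<oplus> (-1) \<cdot> ((-c) \<cdot> t)"
        using x rc tc by (simp add: minus_cscale cscale_add_right a_assoc)
      then show ?thesis using tc by (simp add: y_def cscale_cscale)
    qed
    moreover have "r \<oplus> (-c) \<cdot> t \<in> N" using N r t by blast
    ultimately have "I \<le> sq (y \<oplus> c \<cdot> t)" using I by metis
    also have "\<dots> = sq y + (cmod c)\<^sup>2 * sq t + 2 * Re (c * a)" using yc tc by (simp add: sq_add sq_cscale ip_cscale_right a_def)
    also have "(cmod c)\<^sup>2 * sq t = (cmod a)\<^sup>2 / sq t" using tp by (simp add: c_def norm_divide power2_eq_square)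
    also have "c * a = - of_real ((cmod a)\<^sup>2 / sq t)"
      using complex_norm_square[of a] by (simp add: c_def mult.commute)
    finally have "(cmod a)\<^sup>2 / sq t \<le> sq y - I" by simp
    also have "\<dots> \<le> \<delta>\<^sup>2" using r by (simp add: y_def)
    finally have "(cmod a)\<^sup>2 \<le> \<delta>\<^sup>2 * sq t" using tp by (simp add: field_simps)
    also have "\<dots> = (\<delta> * sn t)\<^sup>2" using tc by (simp add: power_mult_distrib sn_sq)
    finally show ?thesis using \<delta> sn_nonneg[OF tc] by (simp add: a_def y_def abs_le_square_iff[symmetric])
  qed
  show ?thesis using that r(1) 1 2 by blast
qed

end

section \<open>Isometries that implement a state\<close>

text \<open>Used for two algebras R: the diagonal copy of A in the ultrapower, and the scalars, for
  which the relations say that S is an isometry and S* a null vector. \<open>S_null\<close>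
  expresses \<phi>(a* S S* a) = 0.\<close>

locale toeplitz = cstar_state A \<phi> for A :: "'a cstar" (structure) and \<phi> +
  fixes R :: "'a set" and S :: 'a
  assumes R: "unital_cstar_subalgebra A R"
    and S_closed [simp, intro]: "S \<in> carrier A"
    and S_star_S: "a \<in> R \<Longrightarrow> S\<^sup>\<star> \<otimes> a \<otimes> S = sc (\<phi> a)"
    and S_null: "a \<in> R \<Longrightarrow> sn (S\<^sup>\<star> \<otimes> a) = 0"
begin

lemmas R_sub = unital_cstar_subalgebraD[OF R]

lemma R_carrier [simp]: "a \<in> R \<Longrightarrow> a \<in> carrier A" using R_sub(1) by auto

text \<open>\<open>U k\<close> consists of the sums of words \<open>a\<^sub>0 S a\<^sub>1 S \<dots> S a\<^sub>k\<close>. Since \<open>S* a S = \<phi>(a)\<close>, it behaves like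
  the \<open>k\<close>-fold tensor power of the GNS space of \<open>R\<close>, with \<open>R\<close> acting on the right.\<close>

inductive U :: "nat \<Rightarrow> 'a \<Rightarrow> bool" where
  U_base: "a \<in> R \<Longrightarrow> U 0 a"
| U_step: "a \<in> R \<Longrightarrow> U k u \<Longrightarrow> U (Suc k) (a \<otimes> (S \<otimes> u))"
| U_add: "U k u \<Longrightarrow> U k v \<Longrightarrow> U k (u \<oplus> v)"

lemma U_closed: "U k u \<Longrightarrow> u \<in> carrier A"
  by (induction rule: U.induct) auto

lemma U_0_in_R: "U k u \<Longrightarrow> k = 0 \<Longrightarrow> u \<in> R"
  by (induction rule: U.induct) (auto intro: R_sub(4))

lemma U_left: "U k u \<Longrightarrow> a \<in> R \<Longrightarrow> U k (a \<otimes> u)"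
proof (induction rule: U.induct)
  case (U_base b) then show ?case by (auto intro: U.intros R_sub(5))
next
  case (U_step b k u)
  have "a \<otimes> (b \<otimes> (S \<otimes> u)) = (a \<otimes> b) \<otimes> (S \<otimes> u)" using U_step U_closed by (simp add: m_assoc)
  then show ?case using U_step R_sub(5)[of a b] by (auto intro: U.intros)
next
  case (U_add k u v) then show ?case using U_closed by (simp add: r_distr U.intros)
qed

lemma U_right: "U k u \<Longrightarrow> a \<in> R \<Longrightarrow> U k (u \<otimes> a)"
proof (induction rule: U.induct)
  case (U_base b) then show ?case by (auto intro: U.intros R_sub(5))
next
  case (U_step b k u)
  have "(b \<otimes> (S \<otimes> u)) \<otimes> a = b \<otimes> (S \<otimes> (u \<otimes> a))" using U_step U_closed by (simp add: m_assoc)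
  then show ?case using U_step by (auto intro: U.intros)
next
  case (U_add k u v) then show ?case using U_closed by (simp add: l_distr U.intros)
qed

lemma U_cscale: "U k u \<Longrightarrow> U k (c \<cdot> u)"
  using U_left[of k u "sc c"] R_sub(10) U_closed[of k u] by (simp add: sc_mult_left)

lemma U_zero: "U k \<zero>"
proof (induction k)
  case 0 then show ?case using R_sub(2) by (rule U_base)
next
  case (Suc k) then show ?case using U_step[OF R_sub(2) Suc] by simp
qed

lemma U_mult: "U k u \<Longrightarrow> U l v \<Longrightarrow> U (k + l) (u \<otimes> v)"
proof (induction rule: U.induct)
  case (U_base b) then show ?case using U_left by simp
next
  case (U_step b k u)
  have "(b \<otimes> (S \<otimes> u)) \<otimes> v = b \<otimes> (S \<otimes> (u \<otimes> v))" using U_step U_closed by (simp add: m_assoc)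
  then show ?case using U_step by (auto intro: U.intros)
next
  case (U_add k u w) then show ?case using U_closed by (simp add: l_distr U.intros)
qed

text \<open>S* a acts like an annihilation operator on Fock space: it removes the leading letters b
  S of a word and leaves the scalar \<phi>(a b).\<close>

lemma U_annihilate: "U n v \<Longrightarrow> n = Suc m \<Longrightarrow> a \<in> R \<Longrightarrow> U m (S\<^sup>\<star> \<otimes> (a \<otimes> v))"
proof (induction rule: U.induct)
  case (U_step b k v)
  have "S\<^sup>\<star> \<otimes> (a \<otimes> (b \<otimes> (S \<otimes> v))) = (S\<^sup>\<star> \<otimes> (a \<otimes> b) \<otimes> S) \<otimes> v" using U_step U_closed by (simp add: m_assoc)
  also have "\<dots> = \<phi> (a \<otimes> b) \<cdot> v" using U_step U_closed R_sub(5) by (simp add: S_star_S sc_mult_left)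
  finally show ?case using U_step U_cscale by simp
next
  case (U_add k u v) then show ?case using U_closed by (simp add: r_distr U.intros)
qed simp

text \<open>Each S* of u* cancels one S of v. At equal levels the result is in R, so u* v is an
  inner product with values in R.\<close>

lemma U_star_mult: "U k u \<Longrightarrow> U (k + l) v \<Longrightarrow> U l (u\<^sup>\<star> \<otimes> v)"
proof (induction arbitrary: v rule: U.induct)
  case (U_base b) then show ?case using U_left R_sub(7) by simp
next
  case (U_step b k u)
  have "(b \<otimes> (S \<otimes> u))\<^sup>\<star> \<otimes> v = u\<^sup>\<star> \<otimes> (S\<^sup>\<star> \<otimes> (b\<^sup>\<star> \<otimes> v))" using U_step U_closed by (simp add: star_mult m_assoc)
  moreover have "U (k + l) (S\<^sup>\<star> \<otimes> (b\<^sup>\<star> \<otimes> v))" using U_annihilate U_step R_sub(7) by simp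
  ultimately show ?case using U_step by simp
next
  case (U_add k u w) then show ?case using U_closed by (simp add: star_add l_distr U.intros)
qed

text \<open>The adjoint ends in S* a* for the leading letter a, a null vector by
  \<open>S_null\<close>; consequently \<phi> vanishes on every product that begins with a word of
  positive level.\<close>

lemma U_null: "U k u \<Longrightarrow> 0 < k \<Longrightarrow> sn (u\<^sup>\<star>) = 0"
proof (induction rule: U.induct)
  case (U_step a k u)
  have "(a \<otimes> (S \<otimes> u))\<^sup>\<star> = u\<^sup>\<star> \<otimes> (S\<^sup>\<star> \<otimes> a\<^sup>\<star>)" using U_step U_closed by (simp add: star_mult m_assoc)
  then show ?case using sn_mult_null[of "u\<^sup>\<star>" "S\<^sup>\<star> \<otimes> a\<^sup>\<star>"] S_null R_sub(7) U_closed U_step by simp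
next
  case (U_add k u v)
  then show ?case using sn_triangle[of "u\<^sup>\<star>" "v\<^sup>\<star>"] sn_nonneg[of "u\<^sup>\<star> \<oplus> v\<^sup>\<star>"] U_closed by (simp add: star_add)
qed simp

lemma \<phi>_U_mult: "U k u \<Longrightarrow> 0 < k \<Longrightarrow> z \<in> carrier A \<Longrightarrow> \<phi> (u \<otimes> z) = 0"
  using \<phi>_mult_null_left U_null U_closed by blast

lemma \<phi>_U: "U k u \<Longrightarrow> 0 < k \<Longrightarrow> \<phi> u = 0"
  using \<phi>_U_mult[of k u \<one>] U_closed by simp

text \<open>Normal form of a word: all letters S to the left of all letters S*. It can always be
  reached because S* a S is a scalar. The degree is a - b.\<close>

definition monomial :: "nat \<Rightarrow> nat \<Rightarrow> 'a \<Rightarrow> bool" where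
  "monomial a b x \<longleftrightarrow> (\<exists>u v. U a u \<and> U b v \<and> x = u \<otimes> v\<^sup>\<star>)"

lemma monomial_closed: "monomial a b x \<Longrightarrow> x \<in> carrier A"
  by (auto simp: monomial_def U_closed)

lemma monomial_star: "monomial a b x \<Longrightarrow> monomial b a (x\<^sup>\<star>)"
  unfolding monomial_def using U_closed by (fastforce simp: star_mult)

lemma monomial_scalar: "monomial 0 0 (sc c)"
  unfolding monomial_def using R_sub(3,10) by (intro exI[of _ "sc c"] exI[of _ \<one>]) (auto intro: U.intros)

text \<open>For x = u v* the pairing is (u* \<xi>)* (v* \<zeta>), a pairing of words of levels k - a
  and l - b. Equal levels cancel completely and leave an element of R. If the levels differ, or if u
  or v is longer than the word it meets, a word of positive level is left at one end and \<phi>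
  vanishes. This orthogonality plays the role of gauge invariance of \<phi>.\<close>

lemma monomial_pairing:
  assumes x: "monomial a b x" and \<xi>: "U k \<xi>" and \<zeta>: "U l \<zeta>"
  shows "\<lbrakk>a \<le> k; b \<le> l; k + b = l + a\<rbrakk> \<Longrightarrow> \<xi>\<^sup>\<star> \<otimes> x \<otimes> \<zeta> \<in> R"
    "\<not> (a \<le> k \<and> b \<le> l \<and> k + b = l + a) \<Longrightarrow> \<phi> (\<xi>\<^sup>\<star> \<otimes> x \<otimes> \<zeta>) = 0"
proof -
  obtain u v where uv: "U a u" "U b v" "x = u \<otimes> v\<^sup>\<star>" using x by (auto simp: monomial_def)
  have c: "u \<in> carrier A" "v \<in> carrier A" "\<xi> \<in> carrier A" "\<zeta> \<in> carrier A" using uv \<xi> \<zeta> U_closed by auto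
  have e: "\<xi>\<^sup>\<star> \<otimes> x \<otimes> \<zeta> = (u\<^sup>\<star> \<otimes> \<xi>)\<^sup>\<star> \<otimes> (v\<^sup>\<star> \<otimes> \<zeta>)" using c by (simp add: uv(3) star_mult m_assoc)
  have conj: "\<phi> (\<xi>\<^sup>\<star> \<otimes> x \<otimes> \<zeta>) = cnj (\<phi> ((v\<^sup>\<star> \<otimes> \<zeta>)\<^sup>\<star> \<otimes> (u\<^sup>\<star> \<otimes> \<xi>)))"
    using \<phi>_star[of "(v\<^sup>\<star> \<otimes> \<zeta>)\<^sup>\<star> \<otimes> (u\<^sup>\<star> \<otimes> \<xi>)"] c by (simp add: e star_mult m_assoc)
  have p: "U (k - a) (u\<^sup>\<star> \<otimes> \<xi>)" if "a \<le> k" using U_star_mult[OF uv(1), of "k - a"] \<xi> that by simp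
  have r: "U (l - b) (v\<^sup>\<star> \<otimes> \<zeta>)" if "b \<le> l" using U_star_mult[OF uv(2), of "l - b"] \<zeta> that by simp
  show "\<xi>\<^sup>\<star> \<otimes> x \<otimes> \<zeta> \<in> R" if "a \<le> k" "b \<le> l" "k + b = l + a"
  proof -
    have "l - b = k - a" using that by linarith
    then show ?thesis using U_star_mult[of "k - a" _ 0] p r that U_0_in_R e by simp
  qed
  show "\<phi> (\<xi>\<^sup>\<star> \<otimes> x \<otimes> \<zeta>) = 0" if n: "\<not> (a \<le> k \<and> b \<le> l \<and> k + b = l + a)"
  proof -
    consider "k < a" | "l < b" | "a \<le> k" "b \<le> l" "k - a < l - b" | "a \<le> k" "b \<le> l" "l - b < k - a" using n by linarith
    then show ?thesis
    proof cases
      case 1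
      then have "U (a - k) (\<xi>\<^sup>\<star> \<otimes> u)" using U_star_mult[OF \<xi>, of "a - k"] uv by simp
      then have "\<phi> (\<xi>\<^sup>\<star> \<otimes> u \<otimes> (v\<^sup>\<star> \<otimes> \<zeta>)) = 0" using 1 c by (intro \<phi>_U_mult) auto
      then show ?thesis using c by (simp add: uv(3) m_assoc)
    next
      case 2
      then have "U (b - l) (\<zeta>\<^sup>\<star> \<otimes> v)" using U_star_mult[OF \<zeta>, of "b - l"] uv by simp
      then have "\<phi> (\<zeta>\<^sup>\<star> \<otimes> v \<otimes> (u\<^sup>\<star> \<otimes> \<xi>)) = 0" using 2 c by (intro \<phi>_U_mult) auto
      then show ?thesis using c by (simp add: conj star_mult m_assoc)
    next
      case 3
      then have "U ((l - b) - (k - a)) ((u\<^sup>\<star> \<otimes> \<xi>)\<^sup>\<star> \<otimes> (v\<^sup>\<star> \<otimes> \<zeta>))" using U_star_mult[OF p, of "(l - b) - (k - a)"] r by simp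
      then show ?thesis unfolding e using \<phi>_U 3 by (metis zero_less_diff)
    next
      case 4
      then have "U ((k - a) - (l - b)) ((v\<^sup>\<star> \<otimes> \<zeta>)\<^sup>\<star> \<otimes> (u\<^sup>\<star> \<otimes> \<xi>))" using U_star_mult[OF r, of "(k - a) - (l - b)"] p by simp
      then show ?thesis unfolding conj using \<phi>_U 4 by (metis complex_cnj_zero zero_less_diff)
    qed
  qed
qed

inductive_set words :: "'a set" where
  words_monomial: "monomial a b x \<Longrightarrow> x \<in> words"
| words_add: "x \<in> words \<Longrightarrow> y \<in> words \<Longrightarrow> x \<oplus> y \<in> words"

lemma words_closed: "x \<in> words \<Longrightarrow> x \<in> carrier A"
  by (induction rule: words.induct) (auto intro: monomial_closed)

text \<open>In the middle, v* u' cancels until the shorter of the two words is exhausted, so the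
  product is again a monomial.\<close>

lemma monomial_mult: assumes "monomial a b x" "monomial c d y" shows "x \<otimes> y \<in> words"
proof -
  obtain u v where uv: "U a u" "U b v" "x = u \<otimes> v\<^sup>\<star>" using assms by (auto simp: monomial_def)
  obtain u' v' where uv': "U c u'" "U d v'" "y = u' \<otimes> v'\<^sup>\<star>" using assms by (auto simp: monomial_def)
  have cl: "u \<in> carrier A" "v \<in> carrier A" "u' \<in> carrier A" "v' \<in> carrier A" using uv uv' U_closed by auto
  show ?thesis
  proof (cases "b \<le> c")
    case True
    then have "U (c - b) (v\<^sup>\<star> \<otimes> u')" using U_star_mult[OF uv(2), of "c - b"] uv' by simp
    then have "U (a + (c - b)) (u \<otimes> (v\<^sup>\<star> \<otimes> u'))" using U_mult uv by blast
    moreover have "x \<otimes> y = u \<otimes> (v\<^sup>\<star> \<otimes> u') \<otimes> v'\<^sup>\<star>" using cl by (simp add: uv uv' m_assoc)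
    ultimately show ?thesis using uv' by (blast intro: words_monomial[unfolded monomial_def])
  next
    case False
    then have "U (b - c) (u'\<^sup>\<star> \<otimes> v)" using U_star_mult[OF uv'(1), of "b - c"] uv by simp
    then have "U (d + (b - c)) (v' \<otimes> (u'\<^sup>\<star> \<otimes> v))" using U_mult uv' by blast
    moreover have "x \<otimes> y = u \<otimes> (v' \<otimes> (u'\<^sup>\<star> \<otimes> v))\<^sup>\<star>" using cl by (simp add: uv uv' m_assoc star_mult)
    ultimately show ?thesis using uv by (blast intro: words_monomial[unfolded monomial_def])
  qed
qed

lemma words_mult: assumes "x \<in> words" "y \<in> words" shows "x \<otimes> y \<in> words"
proof -
  have m: "x \<otimes> y \<in> words" if "monomial a b x" "y \<in> words" for a b x y
    using that(2) by (induction rule: words.induct) (use that(1) monomial_mult monomial_closed words_closed in \<open>auto simp: r_distr intro: words_add\<close>)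
  show ?thesis using assms(1)
    by (induction rule: words.induct) (use assms(2) m words_closed in \<open>auto simp: l_distr intro: words_add\<close>)
qed

lemma words_cscale: "x \<in> words \<Longrightarrow> c \<cdot> x \<in> words"
  using words_mult[OF words_monomial[OF monomial_scalar], of x c] words_closed by (simp add: sc_mult_left)

lemma words_star: "x \<in> words \<Longrightarrow> x\<^sup>\<star> \<in> words"
  by (induction rule: words.induct) (use words_closed in \<open>auto simp: star_add intro: words.intros monomial_star\<close>)

lemma U_words: "U k u \<Longrightarrow> u \<in> words"
  using words_monomial[of k 0 u] R_sub(3) U_closed[of k u] by (force simp: monomial_def intro: U.intros)

lemma S_U: "U 1 S"
  using U_step[OF R_sub(3) U_base[OF R_sub(3)]] by simp

lemma clos_words: "unital_cstar_subalgebra A (clos words)"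
proof (rule unital_cstar_subalgebra_clos)
  show "\<one> \<in> words" using words_monomial[OF monomial_scalar[of 1]] by simp
qed (use words_closed words_add words_mult words_cscale words_star in auto)

definition D :: "'a set" where "D = cstar_generated A (R \<union> {S})"

lemma D_sub: "unital_cstar_subalgebra A D"
  unfolding D_def by (rule unital_cstar_subalgebra_generated) (use R_sub(1) in auto)

lemma D_le_clos_words: "D \<subseteq> clos words"
  unfolding D_def
proof (rule cstar_generated_least[OF clos_words])
  have "R \<union> {S} \<subseteq> words" using U_words U_base S_U by auto
  then show "R \<union> {S} \<subseteq> clos words" using clos_base[of words] words_closed by blast
qed

lemma U_in_D: "U k u \<Longrightarrow> u \<in> D"
proof (induction rule: U.induct)
  case (U_base a) then show ?case using cstar_generated_base[of "R \<union> {S}"] by (auto simp: D_def)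
next
  case (U_step a k u)
  have "a \<in> D" "S \<in> D" using U_step cstar_generated_base[of "R \<union> {S}"] by (auto simp: D_def)
  then show ?case using U_step unital_cstar_subalgebraD(5)[OF D_sub] by blast
next
  case (U_add k u v) then show ?case using unital_cstar_subalgebraD(4)[OF D_sub] by blast
qed

lemma words_lsum:
  assumes "x \<in> words"
  obtains n X a b where "x = lsum X n" "\<And>t. t < n \<Longrightarrow> monomial (a t) (b t) (X t)"
proof -
  have "\<exists>n X a b. x = lsum X n \<and> (\<forall>t<n. monomial (a t) (b t) (X t))" using assms
  proof (induction rule: words.induct)
    case (words_monomial a b x)
    then show ?case using monomial_closed
      by (intro exI[of _ "Suc 0"] exI[of _ "\<lambda>_. x"] exI[of _ "\<lambda>_. a"] exI[of _ "\<lambda>_. b"]) auto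
  next
    case (words_add x y)
    obtain n X a b where 1: "x = lsum X n" "\<forall>t<n. monomial (a t) (b t) (X t)" using words_add by blast
    obtain m Y c d where 2: "y = lsum Y m" "\<forall>t<m. monomial (c t) (d t) (Y t)" using words_add by blast
    let ?Z = "\<lambda>t. if t < n then X t else Y (t - n)"
    have "x \<oplus> y = lsum ?Z (n + m)"
      unfolding 1 2 using 1(2) 2(2) monomial_closed by (intro lsum_append) blast+
    moreover have "\<forall>t<n + m. monomial (if t < n then a t else c (t - n)) (if t < n then b t else d (t - n)) (?Z t)"
      using 1(2) 2(2) by auto
    ultimately show ?case by (intro exI conjI)
  qed
  then show ?thesis using that by blast
qed

end

text \<open>The weight of a component of degree a - b in a Fejer sum: the diagonal a + j = b + i
  meets each row of the m by m square at most once, and exactly once if the row is at distance at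
  least n from both ends.\<close>

lemma card_shifted_pairs:
  assumes "a \<le> n" "b \<le> n"
  shows "\<bar>(\<Sum>i<m. \<Sum>j<m. of_bool (a + j = b + i)) - real m\<bar> \<le> 2 * real n"
proof -
  define f :: "nat \<Rightarrow> real" where "f i = (\<Sum>j<m. of_bool (a + j = b + i))" for i
  have f1: "f i \<le> 1" for i
  proof -
    have "f i \<le> (\<Sum>j<m. of_bool (j = b + i - a))" unfolding f_def by (intro sum_mono) auto
    also have "\<dots> \<le> 1" by (simp add: of_bool_def)
    finally show ?thesis .
  qed
  have f0: "0 \<le> f i" for i unfolding f_def by (intro sum_nonneg) auto
  have fi: "f i = 1" if "n \<le> i" "i + n < m" for i
  proof -
    have "f i = (\<Sum>j<m. of_bool (j = b + i - a))" unfolding f_def using that assms by (intro sum.cong) auto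
    also have "\<dots> = 1" using that assms by (simp add: of_bool_def)
    finally show ?thesis .
  qed
  have up: "(\<Sum>i<m. f i) \<le> m" using sum_mono[of "{..<m}" f "\<lambda>_. 1"] f1 by simp
  have "real (m - 2 * n) \<le> (\<Sum>i\<in>{n..<m - n}. f i)"
  proof -
    have "(\<Sum>i\<in>{n..<m - n}. f i) = (\<Sum>i\<in>{n..<m - n}. 1)" by (intro sum.cong) (use fi in auto)
    then show ?thesis by simp
  qed
  also have "\<dots> \<le> (\<Sum>i<m. f i)" using f0 by (intro sum_mono2) auto
  finally show ?thesis using up unfolding f_def by linarith
qed

section \<open>Faithfulness of the GNS representation of D, by Fejer means\<close>

locale toeplitz_faithful = toeplitz A \<phi> R S for A :: "'a cstar" (structure) and \<phi> R S +
  fixes u\<^sub>1 u\<^sub>2 :: 'a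
  assumes u_R: "u\<^sub>1 \<in> R" "u\<^sub>2 \<in> R"
    and u_orth: "u\<^sub>1\<^sup>\<star> \<otimes> u\<^sub>1 = \<one>" "u\<^sub>2\<^sup>\<star> \<otimes> u\<^sub>2 = \<one>" "u\<^sub>1\<^sup>\<star> \<otimes> u\<^sub>2 = \<zero>"
    and faithful_pos: "\<lbrakk>h \<in> R; h\<^sup>\<star> = h; \<And>x. x \<in> R \<Longrightarrow> 0 \<le> Re (\<phi> (x\<^sup>\<star> \<otimes> h \<otimes> x))\<rbrakk> \<Longrightarrow> h \<in> P"
begin

lemma u_orth': "u\<^sub>2\<^sup>\<star> \<otimes> u\<^sub>1 = \<zero>"
  using arg_cong[OF u_orth(3), of "star A"] u_R by (simp add: star_mult)

text \<open>The right ideal generated by \<open>U k\<close>. The isometries \<open>u\<^sub>1, u\<^sub>2 \<in> R\<close> with orthogonal ranges allow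
  finite sums \<open>\<Sum> \<xi>\<^sub>i w\<^sub>i\<close> to be written as a single product.\<close>

definition N :: "nat \<Rightarrow> 'a set" where
  "N k = {\<xi> \<otimes> w | \<xi> w. U k \<xi> \<and> w \<in> carrier A}"

lemma N_closed: "x \<in> N k \<Longrightarrow> x \<in> carrier A"
  by (auto simp: N_def U_closed)

lemma N_intro: "U k \<xi> \<Longrightarrow> w \<in> carrier A \<Longrightarrow> \<xi> \<otimes> w \<in> N k"
  by (auto simp: N_def)

lemma N_zero: "\<zero> \<in> N k"
  using N_intro[OF U_zero zero_closed, of k] by simp

lemma N_0: "x \<in> carrier A \<Longrightarrow> x \<in> N 0"
  using N_intro[OF U_base[OF R_sub(3)], of x] by simp

text \<open>The element u1 w + u2 z encodes the pair w, z, since multiplying by the adjoint of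
  either isometry recovers one component.\<close>

lemma common_factor:
  assumes c: "\<xi> \<in> carrier A" "\<zeta> \<in> carrier A" "w \<in> carrier A" "z \<in> carrier A"
  shows "\<xi> \<otimes> w = (\<xi> \<otimes> u\<^sub>1\<^sup>\<star>) \<otimes> (u\<^sub>1 \<otimes> w \<oplus> u\<^sub>2 \<otimes> z)" "\<zeta> \<otimes> z = (\<zeta> \<otimes> u\<^sub>2\<^sup>\<star>) \<otimes> (u\<^sub>1 \<otimes> w \<oplus> u\<^sub>2 \<otimes> z)"
proof -
  have u: "u\<^sub>1 \<in> carrier A" "u\<^sub>2 \<in> carrier A" using u_R by auto
  have "(\<xi> \<otimes> u\<^sub>1\<^sup>\<star>) \<otimes> (u\<^sub>1 \<otimes> w \<oplus> u\<^sub>2 \<otimes> z) = \<xi> \<otimes> (u\<^sub>1\<^sup>\<star> \<otimes> u\<^sub>1) \<otimes> w \<oplus> \<xi> \<otimes> (u\<^sub>1\<^sup>\<star> \<otimes> u\<^sub>2) \<otimes> z"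
    using u c by algebra
  then show "\<xi> \<otimes> w = (\<xi> \<otimes> u\<^sub>1\<^sup>\<star>) \<otimes> (u\<^sub>1 \<otimes> w \<oplus> u\<^sub>2 \<otimes> z)" using c by (simp add: u_orth)
  have "(\<zeta> \<otimes> u\<^sub>2\<^sup>\<star>) \<otimes> (u\<^sub>1 \<otimes> w \<oplus> u\<^sub>2 \<otimes> z) = \<zeta> \<otimes> (u\<^sub>2\<^sup>\<star> \<otimes> u\<^sub>1) \<otimes> w \<oplus> \<zeta> \<otimes> (u\<^sub>2\<^sup>\<star> \<otimes> u\<^sub>2) \<otimes> z"
    using u c by algebra
  then show "\<zeta> \<otimes> z = (\<zeta> \<otimes> u\<^sub>2\<^sup>\<star>) \<otimes> (u\<^sub>1 \<otimes> w \<oplus> u\<^sub>2 \<otimes> z)" using c by (simp add: u_orth u_orth')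
qed

lemma N_add: assumes "x \<in> N k" "y \<in> N k" shows "x \<oplus> y \<in> N k"
proof -
  obtain \<xi> w where 1: "U k \<xi>" "w \<in> carrier A" "x = \<xi> \<otimes> w" using assms by (auto simp: N_def)
  obtain \<zeta> z where 2: "U k \<zeta>" "z \<in> carrier A" "y = \<zeta> \<otimes> z" using assms by (auto simp: N_def)
  have c: "\<xi> \<in> carrier A" "\<zeta> \<in> carrier A" using 1 2 U_closed by auto
  have u: "u\<^sub>1 \<in> carrier A" "u\<^sub>2 \<in> carrier A" using u_R by auto
  have "x \<oplus> y = (\<xi> \<otimes> u\<^sub>1\<^sup>\<star> \<oplus> \<zeta> \<otimes> u\<^sub>2\<^sup>\<star>) \<otimes> (u\<^sub>1 \<otimes> w \<oplus> u\<^sub>2 \<otimes> z)"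
    unfolding 1(3) 2(3) using common_factor[OF c 1(2) 2(2)] c u 1(2) 2(2) by (simp add: l_distr)
  moreover have "U k (\<xi> \<otimes> u\<^sub>1\<^sup>\<star> \<oplus> \<zeta> \<otimes> u\<^sub>2\<^sup>\<star>)" using 1 2 u_R R_sub(7) by (intro U_add U_right)
  ultimately show ?thesis using N_intro u 1(2) 2(2) by simp
qed

lemma N_right: "x \<in> N k \<Longrightarrow> z \<in> carrier A \<Longrightarrow> x \<otimes> z \<in> N k"
  unfolding N_def using U_closed by (force simp: m_assoc)

lemma N_cscale: "x \<in> N k \<Longrightarrow> c \<cdot> x \<in> N k"
  using N_right[of x k "sc c"] N_closed[of x k] by (simp add: sc_mult_right)

lemma N_U_left: "U a u \<Longrightarrow> x \<in> N k \<Longrightarrow> u \<otimes> x \<in> N (a + k)"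
  unfolding N_def using U_closed U_mult[of a u k] by (force simp: m_assoc[symmetric])

lemma N_U_star_left: assumes u: "U a u" and x: "x \<in> N k" shows "u\<^sup>\<star> \<otimes> x \<in> N (k - a)"
proof (cases "a \<le> k")
  case True
  obtain \<xi> w where 1: "U k \<xi>" "w \<in> carrier A" "x = \<xi> \<otimes> w" using x by (auto simp: N_def)
  have "U (k - a) (u\<^sup>\<star> \<otimes> \<xi>)" using U_star_mult[OF u, of "k - a"] 1 True by simp
  moreover have "u\<^sup>\<star> \<otimes> x = (u\<^sup>\<star> \<otimes> \<xi>) \<otimes> w" using 1 u U_closed by (simp add: m_assoc)
  ultimately show ?thesis using N_intro 1 by simp
next
  case False
  then show ?thesis using N_0[of "u\<^sup>\<star> \<otimes> x"] u x U_closed N_closed by simp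
qed

text \<open>The factor v* lowers the level by b and u raises it by a. Truncated subtraction is the
  right bound, because \<open>N\<close> 0 is the whole algebra.\<close>

lemma N_monomial: assumes m: "monomial a b x" and y: "y \<in> N k" shows "x \<otimes> y \<in> N (a + (k - b))"
proof -
  obtain u v where uv: "U a u" "U b v" "x = u \<otimes> v\<^sup>\<star>" using m by (auto simp: monomial_def)
  have "x \<otimes> y = u \<otimes> (v\<^sup>\<star> \<otimes> y)" using uv y U_closed N_closed by (simp add: m_assoc)
  then show ?thesis using N_U_left[OF uv(1) N_U_star_left[OF uv(2) y]] by simp
qed

lemma U_in_N: "U l u \<Longrightarrow> k \<le> l \<Longrightarrow> u \<in> N k"
proof (induction arbitrary: k rule: U.induct)
  case (U_base a) then show ?case using N_0 by simp
next
  case (U_step a l u)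
  show ?case
  proof (cases k)
    case 0 then show ?thesis using N_0 U_step U_closed by simp
  next
    case (Suc k')
    then have "u \<in> N k'" using U_step by simp
    then obtain \<xi> w where 1: "U k' \<xi>" "w \<in> carrier A" "u = \<xi> \<otimes> w" by (auto simp: N_def)
    have "a \<otimes> (S \<otimes> u) = (a \<otimes> (S \<otimes> \<xi>)) \<otimes> w" using 1 U_step U_closed by (simp add: m_assoc)
    moreover have "U k (a \<otimes> (S \<otimes> \<xi>))" using U.U_step[OF U_step(1) 1(1)] Suc by simp
    ultimately show ?thesis using N_intro 1 by simp
  qed
next
  case (U_add l u v) then show ?case using N_add by simp
qed

lemma N_antimono: "k \<le> l \<Longrightarrow> N l \<subseteq> N k"
  using U_in_N N_right by (force simp: N_def)

text \<open>All vectors of a finite family, of possibly different levels, become words times one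
  common W. A form in these vectors is then W* c W with c built from words only, so that positivity
  of c is inherited.\<close>

lemma N_common_factor:
  assumes "\<And>i. i < (m::nat) \<Longrightarrow> e i \<in> N (k i)"
  shows "\<exists>\<Xi> W. W \<in> carrier A \<and> (\<forall>i<m. U (k i) (\<Xi> i) \<and> e i = \<Xi> i \<otimes> W)"
proof -
  have "\<forall>i<m. e i \<in> N (k i)" using assms by blast
  then show ?thesis
  proof (induction m)
    case 0 then show ?case by auto
  next
    case (Suc m)
    then obtain \<Xi> W where 1: "W \<in> carrier A" "\<And>i. i < m \<Longrightarrow> U (k i) (\<Xi> i)" "\<And>i. i < m \<Longrightarrow> e i = \<Xi> i \<otimes> W"
      by (metis less_SucI)
    obtain \<zeta> z where 2: "U (k m) \<zeta>" "z \<in> carrier A" "e m = \<zeta> \<otimes> z" using Suc(2) by (auto simp: N_def)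
    let ?W = "u\<^sub>1 \<otimes> W \<oplus> u\<^sub>2 \<otimes> z"
    let ?\<Xi> = "\<lambda>i. if i < m then \<Xi> i \<otimes> u\<^sub>1\<^sup>\<star> else \<zeta> \<otimes> u\<^sub>2\<^sup>\<star>"
    have W: "?W \<in> carrier A" using 1 2 u_R by simp
    have "U (k i) (?\<Xi> i) \<and> e i = ?\<Xi> i \<otimes> ?W" if "i < Suc m" for i
    proof (cases "i < m")
      case True
      then show ?thesis using 1(2,3)[OF True] 1(1) 2 common_factor(1)[of "\<Xi> i" \<zeta> W z] U_closed U_right u_R R_sub(7) by auto
    next
      case False
      then have "i = m" using that by simp
      then show ?thesis using 1(1) 2 common_factor(2)[of \<zeta> \<zeta> W z] U_closed U_right u_R R_sub(7) by auto
    qed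
    then show ?case using W by (intro exI[of _ ?\<Xi>] exI[of _ ?W]) simp
  qed
qed

end

text \<open>\<open>q = \<Sum> X\<^sub>t\<close> is a sum of monomials which is positive in the GNS representation of \<open>\<phi>\<close>.\<close>

locale toeplitz_form = toeplitz_faithful A \<phi> R S u\<^sub>1 u\<^sub>2 for A :: "'a cstar" (structure) and \<phi> R S u\<^sub>1 u\<^sub>2 +
  fixes n :: nat and X :: "nat \<Rightarrow> 'a" and a b :: "nat \<Rightarrow> nat"
  assumes X: "t < n \<Longrightarrow> monomial (a t) (b t) (X t)"
    and form_nonneg: "(\<And>i. i < (m::nat) \<Longrightarrow> \<exists>k. U k (\<Xi> i)) \<Longrightarrow> 0 \<le> Re (\<phi> ((lsum \<Xi> m)\<^sup>\<star> \<otimes> lsum X n \<otimes> lsum \<Xi> m))"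
begin

lemma X_closed [simp]: "t < n \<Longrightarrow> X t \<in> carrier A" using X monomial_closed by blast

lemma form_expand:
  assumes st: "state A \<chi>" and y: "\<And>i. i < m \<Longrightarrow> y i \<in> carrier A"
  shows "\<chi> ((lsum y m)\<^sup>\<star> \<otimes> lsum X n \<otimes> lsum y m) = (\<Sum>i<m. \<Sum>j<m. \<Sum>t<n. \<chi> ((y i)\<^sup>\<star> \<otimes> X t \<otimes> y j))"
proof -
  interpret c: cstar_state A \<chi> using st by unfold_locales
  have "(lsum y m)\<^sup>\<star> \<otimes> lsum X n \<otimes> lsum y m = lsum (\<lambda>i. lsum (\<lambda>j. lsum (\<lambda>t. (y i)\<^sup>\<star> \<otimes> X t \<otimes> y j) n) m) m"
  proof -
    have "lsum y m \<in> carrier A" "lsum X n \<in> carrier A" using y by (auto intro: lsum_closed)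
    then have "(lsum y m)\<^sup>\<star> \<otimes> lsum X n \<otimes> lsum y m = lsum (\<lambda>i. (y i)\<^sup>\<star> \<otimes> lsum X n \<otimes> lsum y m) m"
      using y by (simp add: lsum_star lsum_mult_right)
    also have "\<dots> = lsum (\<lambda>i. lsum (\<lambda>j. (y i)\<^sup>\<star> \<otimes> lsum X n \<otimes> y j) m) m"
      using y \<open>lsum X n \<in> carrier A\<close> by (intro lsum_cong lsum_mult_left) auto
    also have "\<dots> = lsum (\<lambda>i. lsum (\<lambda>j. lsum (\<lambda>t. (y i)\<^sup>\<star> \<otimes> X t \<otimes> y j) n) m) m"
      using y by (intro lsum_cong) (simp add: lsum_mult_left lsum_mult_right)
    finally show ?thesis .
  qed
  then show ?thesis using y by (simp add: c.\<phi>_lsum lsum_closed)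
qed

text \<open>The passage from \<phi> to an arbitrary state. The restricted sum c lies in R, since its
  terms pair equal levels. For \<phi> the omitted terms vanish by \<open>monomial_pairing\<close>,
  so \<phi>(x* c x) is a value of the given form and has nonnegative real part. Faithfulness on R
  makes the real part of c a positive element, and this can be conjugated by any W and evaluated in
  any state.\<close>

lemma diagonal_nonneg:
  assumes st: "state A \<psi>" and W: "W \<in> carrier A" and \<Xi>: "\<And>i. i < (m::nat) \<Longrightarrow> U (k i) (\<Xi> i)"
  shows "0 \<le> Re (\<Sum>i<m. \<Sum>j<m. \<Sum>t<n. if a t \<le> k i \<and> b t \<le> k j \<and> k i + b t = k j + a t
    then \<psi> ((\<Xi> i \<otimes> W)\<^sup>\<star> \<otimes> X t \<otimes> (\<Xi> j \<otimes> W)) else 0)"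
proof -
  interpret p: cstar_state A \<psi> using st by unfold_locales
  define good where "good i j t \<longleftrightarrow> a t \<le> k i \<and> b t \<le> k j \<and> k i + b t = k j + a t" for i j t :: nat
  define Y where "Y i j t = (if good i j t then (\<Xi> i)\<^sup>\<star> \<otimes> X t \<otimes> \<Xi> j else \<zero>)" for i j t :: nat
  define c where "c = lsum (\<lambda>i. lsum (\<lambda>j. lsum (\<lambda>t. Y i j t) n) m) m"
  have YR: "Y i j t \<in> R" if "i < m" "j < m" "t < n" for i j t
    using monomial_pairing(1)[OF X[OF that(3)] \<Xi>[OF that(1)] \<Xi>[OF that(2)]] R_sub(2) by (auto simp: Y_def good_def)
  have cR: "c \<in> R" unfolding c_def by (intro lsum_in R_sub(2,4) YR)
  have \<Xi>c: "\<Xi> i \<in> carrier A" if "i < m" for i using \<Xi> U_closed that by blast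
  have expand: "\<chi> (x\<^sup>\<star> \<otimes> c \<otimes> x) = (\<Sum>i<m. \<Sum>j<m. \<Sum>t<n. if good i j t then \<chi> ((\<Xi> i \<otimes> x)\<^sup>\<star> \<otimes> X t \<otimes> (\<Xi> j \<otimes> x)) else 0)"
    if st: "state A \<chi>" and x: "x \<in> carrier A" for \<chi> x
  proof -
    interpret c: cstar_state A \<chi> using st by unfold_locales
    have "x\<^sup>\<star> \<otimes> c \<otimes> x = lsum (\<lambda>i. lsum (\<lambda>j. lsum (\<lambda>t. x\<^sup>\<star> \<otimes> Y i j t \<otimes> x) n) m) m"
      unfolding c_def using YR x by (simp add: lsum_mult_left lsum_mult_right lsum_closed cong: lsum_cong)
    also have "\<dots> = lsum (\<lambda>i. lsum (\<lambda>j. lsum (\<lambda>t. if good i j t then (\<Xi> i \<otimes> x)\<^sup>\<star> \<otimes> X t \<otimes> (\<Xi> j \<otimes> x) else \<zero>) n) m) m"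
      using \<Xi>c x by (intro lsum_cong) (simp add: Y_def star_mult m_assoc)
    finally show ?thesis using \<Xi>c x by (simp add: c.\<phi>_lsum lsum_closed if_distrib cong: if_cong)
  qed
  \<comment> \<open>Only real parts are controlled, so c is replaced by twice its real part.\<close>
  define h where "h = c \<oplus> c\<^sup>\<star>"
  have cc: "c \<in> carrier A" using cR by simp
  have hs: "h \<in> R" "h\<^sup>\<star> = h" using cR R_sub(4,7) cc by (auto simp: h_def star_add a_comm)
  have hval: "Re (\<chi> (x\<^sup>\<star> \<otimes> h \<otimes> x)) = 2 * Re (\<chi> (x\<^sup>\<star> \<otimes> c \<otimes> x))" if st: "state A \<chi>" and x: "x \<in> carrier A" for \<chi> x
  proof -
    interpret c: cstar_state A \<chi> using st by unfold_locales
    have "x\<^sup>\<star> \<otimes> h \<otimes> x = x\<^sup>\<star> \<otimes> c \<otimes> x \<oplus> (x\<^sup>\<star> \<otimes> c \<otimes> x)\<^sup>\<star>" unfolding h_def using x cc by algebra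
    then show ?thesis using x cc by (simp add: c.\<phi>_add c.\<phi>_star)
  qed
  have "h \<in> P"
  proof (rule faithful_pos[OF hs])
    fix x assume x: "x \<in> R"
    have Ux: "U (k i) (\<Xi> i \<otimes> x)" if "i < m" for i using \<Xi>[OF that] x U_right by blast
    have "\<phi> (x\<^sup>\<star> \<otimes> c \<otimes> x) = (\<Sum>i<m. \<Sum>j<m. \<Sum>t<n. \<phi> ((\<Xi> i \<otimes> x)\<^sup>\<star> \<otimes> X t \<otimes> (\<Xi> j \<otimes> x)))"
      unfolding expand[OF state R_carrier[OF x]]
      by (intro sum.cong refl) (use monomial_pairing(2)[OF X Ux Ux] in \<open>auto simp: good_def\<close>)
    also have "\<dots> = \<phi> ((lsum (\<lambda>i. \<Xi> i \<otimes> x) m)\<^sup>\<star> \<otimes> lsum X n \<otimes> lsum (\<lambda>i. \<Xi> i \<otimes> x) m)"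
      using \<Xi>c x by (intro form_expand[OF state, symmetric]) auto
    finally have "0 \<le> Re (\<phi> (x\<^sup>\<star> \<otimes> c \<otimes> x))" using form_nonneg[of m "\<lambda>i. \<Xi> i \<otimes> x"] Ux by auto
    then show "0 \<le> Re (\<phi> (x\<^sup>\<star> \<otimes> h \<otimes> x))" using hval[OF state] x by simp
  qed
  then have "0 \<le> Re (\<psi> (W\<^sup>\<star> \<otimes> h \<otimes> W))" using p.\<phi>_P(1) P_conj W by blast
  then show ?thesis unfolding good_def[symmetric] using hval[OF st W] expand[OF st W] by simp
qed

text \<open>The \<open>m\<close>-th Fejer mean of \<open>q\<close> with respect to the degree is the average over \<open>i, j < m\<close> of the
  components of degree \<open>i - j\<close>. In row \<open>i\<close> the vector \<open>1\<close> is split as \<open>r\<^bsub>i+d\<^esub> + \<Sum> (r\<^sub>k - r\<^bsub>k+1\<^esub>)\<close>, where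
  \<open>r\<^sub>k\<close> is almost the orthogonal projection of \<open>1\<close> to \<open>N k\<close> (a Wold decomposition); components whose levels
  differ by more than \<open>i - j\<close> are almost orthogonal, and those on a common diagonal are handled by
  \<open>diagonal_nonneg\<close>.\<close>

lemma fejer_sum_bound:
  assumes st: "state A \<psi>" and d: "\<And>t. t < n \<Longrightarrow> a t \<le> d \<and> b t \<le> d"
    and B: "\<And>t. t < n \<Longrightarrow> \<parallel>X t\<parallel> \<le> B" "0 \<le> B" and \<delta>: "0 < \<delta>" "\<delta> \<le> 1"
  shows "- (real (m * m * n * Suc (m + d) * Suc (m + d)) * (12 * \<delta> * B))
    \<le> Re (\<Sum>i<m. \<Sum>j<m. \<Sum>t<n. if a t + j = b t + i then \<psi> (X t) else 0)"
proof -
  interpret p: cstar_state A \<psi> using st by unfold_locales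
  \<comment> \<open>For k = 0 the projection of 1 is 1 itself, because \<open>N\<close> 0 is
    everything. Taking it exactly makes the decomposition of 1 below exact, not just
    approximate.\<close>
  have "\<exists>r. r \<in> N k \<and> p.sn (\<one> \<ominus> r) \<le> 1 + \<delta> \<and> (\<forall>t\<in>N k. cmod (p.ip (\<one> \<ominus> r) t) \<le> \<delta> * p.sn t) \<and> (k = 0 \<longrightarrow> r = \<one>)" for k
  proof (cases "k = 0")
    case True
    have "p.sn t \<ge> 0" if "t \<in> N 0" for t using that p.sn_nonneg N_closed by blast
    then show ?thesis using True N_0 \<delta> N_closed by (intro exI[of _ \<one>]) auto
  next
    case False
    obtain r where "r \<in> N k" "p.sn (\<one> \<ominus> r) \<le> p.sn \<one> + \<delta>" "\<And>t. t \<in> N k \<Longrightarrow> cmod (p.ip (\<one> \<ominus> r) t) \<le> \<delta> * p.sn t"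
      by (rule p.approximate_projection[of "N k" \<one> \<delta>]) (use N_closed N_zero N_add N_cscale \<delta> in auto)
    then show ?thesis using False by auto
  qed
  then obtain r where r: "\<And>k. r k \<in> N k" "\<And>k. p.sn (\<one> \<ominus> r k) \<le> 1 + \<delta>"
    "\<And>k t. t \<in> N k \<Longrightarrow> cmod (p.ip (\<one> \<ominus> r k) t) \<le> \<delta> * p.sn t" "r 0 = \<one>" by metis
  have rc: "r k \<in> carrier A" for k using r(1) N_closed by blast
  have rn: "p.sn (r k) \<le> 3" for k
  proof -
    have "r k = \<one> \<ominus> (\<one> \<ominus> r k)" using rc[of k] by algebra
    then show ?thesis using p.sn_minus[of \<one> "\<one> \<ominus> r k"] r(2)[of k] rc[of k] \<delta> by simp
  qed
  \<comment> \<open>The index g is the depth below the top level i + d of row i, so e i g lives on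
    level i + d - g. Counting from the top makes equal depths in rows i and j differ by i - j
    levels, the degree of the component considered. Beyond the bottom level the entry is 0.\<close>
  define e where "e i g = (if g = 0 then r (i + d) else if g \<le> i + d then r (i + d - g) \<ominus> r (Suc (i + d - g)) else \<zero>)" for i g
  have eN: "e i g \<in> N (i + d - g)" for i g
  proof -
    have "r k \<ominus> r (Suc k) \<in> N k" for k
      using N_add[OF r(1)[of k] N_cscale[of "r (Suc k)" k "-1"]] r(1)[of "Suc k"] N_antimono[of k "Suc k"] rc
      by (auto simp: minus_cscale)
    then show ?thesis using r(1) N_zero by (auto simp: e_def)
  qed
  have ec: "e i g \<in> carrier A" for i g using eN N_closed by blast
  have en: "p.sn (e i g) \<le> 6" for i g
  proof -
    have "p.sn (r k \<ominus> r l) \<le> 6" for k l using p.sn_minus[OF rc rc, of k l] rn[of k] rn[of l] by linarith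
    then show ?thesis using rn[of "i + d"] by (simp add: e_def)
  qed
  \<comment> \<open>Both approximate projections in the difference contribute \<delta>, since t lies
    in both right ideals.\<close>
  have eo: "cmod (p.ip (e i g) t) \<le> 2 * \<delta> * p.sn t" if g: "0 < g" and t: "t \<in> N (Suc (i + d - g))" for i g t
  proof (cases "g \<le> i + d")
    case True
    have tc: "t \<in> carrier A" using t N_closed by blast
    have 1: "cmod (p.ip (\<one> \<ominus> r (Suc (i + d - g))) t) \<le> \<delta> * p.sn t" using r(3)[OF t] .
    have 2: "cmod (p.ip (\<one> \<ominus> r (i + d - g)) t) \<le> \<delta> * p.sn t" using r(3) t N_antimono[of "i + d - g" "Suc (i + d - g)"] by auto
    have "p.ip (e i g) t = p.ip (\<one> \<ominus> r (Suc (i + d - g))) t - p.ip (\<one> \<ominus> r (i + d - g)) t"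
      using g True tc rc by (simp add: e_def p.ip_minus_left)
    then show ?thesis using 1 2 norm_triangle_ineq4[of "p.ip (\<one> \<ominus> r (Suc (i + d - g))) t" "p.ip (\<one> \<ominus> r (i + d - g)) t"] by simp
  next
    case False
    have tc: "t \<in> carrier A" using t N_closed by blast
    then show ?thesis using False g p.sn_nonneg[OF tc] \<delta> by (simp add: e_def)
  qed
  have esum: "lsum (e i) (Suc g) = r (i + d - g)" for i g
  proof (induction g)
    case 0 then show ?case using rc by (simp add: e_def)
  next
    case (Suc g)
    show ?case
    proof (cases "Suc g \<le> i + d")
      case True
      then have s: "Suc (i + d - Suc g) = i + d - g" by simp
      then have "e i (Suc g) = r (i + d - Suc g) \<ominus> r (i + d - g)" using True by (simp add: e_def)
      then have "lsum (e i) (Suc (Suc g)) = r (i + d - g) \<oplus> (r (i + d - Suc g) \<ominus> r (i + d - g))"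
        using Suc by (simp only: lsum.simps(2)[of _ "Suc g"])
      also have "\<dots> = r (i + d - Suc g)" using rc[of "i + d - g"] rc[of "i + d - Suc g"] by algebra
      finally show ?thesis .
    next
      case False
      then show ?thesis using Suc rc by (simp add: e_def)
    qed
  qed
  \<comment> \<open>Row i has the depths 0 to i + d, and i < m; a common range that covers all rows
    lets the sums be interchanged.\<close>
  define G where "G = Suc (m + d)"
  have unit: "lsum (e i) G = \<one>" if "i < m" for i using esum[of i "m + d"] that r(4) by (simp add: G_def)
  \<comment> \<open>The constant is 2 \<delta> from \<open>eo\<close> times the bound 6 B for the
    seminorm of x applied to an entry.\<close>
  have small: "cmod (p.ip (e i g) (x \<otimes> e j g')) \<le> 12 * \<delta> * B"
    if "0 < g" "x \<in> carrier A" "\<parallel>x\<parallel> \<le> B" "x \<otimes> e j g' \<in> N (Suc (i + d - g))" for i j g g' x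
  proof -
    have "p.sn (x \<otimes> e j g') \<le> \<parallel>x\<parallel> * p.sn (e j g')" using p.sn_mult that ec by blast
    also have "\<dots> \<le> B * 6" using that en ec p.sn_nonneg B(2) by (intro mult_mono) auto
    finally have "2 * \<delta> * p.sn (x \<otimes> e j g') \<le> 2 * \<delta> * (B * 6)" using \<delta> by (intro mult_left_mono) auto
    moreover have "2 * \<delta> * (B * 6) = 12 * \<delta> * B" by simp
    ultimately show ?thesis using eo[OF that(1,4)] by linarith
  qed
  \<comment> \<open>The shift by the degree carries level j + d - g' to at least i + d - g', which
    is strictly above the level i + d - g of the left entry when g' < g.\<close>
  have cross0: "cmod (p.ip (e i g) (x \<otimes> e j g')) \<le> 12 * \<delta> * B"
    if m: "monomial a' b' x" "\<parallel>x\<parallel> \<le> B" and ab: "a' + j = b' + i" and g: "g' < g" for i j g g' x a' b'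
  proof (cases "g \<le> i + d")
    case True
    have "x \<otimes> e j g' \<in> N (a' + ((j + d - g') - b'))" using N_monomial[OF m(1) eN] .
    moreover have "Suc (i + d - g) \<le> a' + ((j + d - g') - b')" using ab g True by linarith
    ultimately have "x \<otimes> e j g' \<in> N (Suc (i + d - g))" using N_antimono by blast
    then show ?thesis using small m monomial_closed g by simp
  next
    case False
    then have "e i g = \<zero>" using g by (simp add: e_def)
    then show ?thesis using monomial_closed[OF m(1)] ec B \<delta> by simp
  qed
  define T where "T i j t g g' = p.ip (e i g) (X t \<otimes> e j g')" for i j t g g'
  have cross: "cmod (T i j t g g') \<le> 12 * \<delta> * B" if t: "t < n" and ab: "a t + j = b t + i" and g: "g \<noteq> g'" for i j t g g'
  proof (cases "g' < g")
    case True then show ?thesis unfolding T_def using cross0[OF X[OF t] B(1)[OF t] ab] by simp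
  next
    case False
    \<comment> \<open>For g < g' the adjoint monomial is used, which exchanges the two rows.\<close>
    have "T i j t g g' = cnj (p.ip (e j g') ((X t)\<^sup>\<star> \<otimes> e i g))"
      using p.ip_commute[of "e j g'" "(X t)\<^sup>\<star> \<otimes> e i g"] p.ip_mult_left[of "(X t)\<^sup>\<star>" "e i g" "e j g'"] t ec by (simp add: T_def)
    then show ?thesis using cross0[OF monomial_star[OF X[OF t]] _ ab[symmetric], of g g'] B(1)[OF t] t False g by simp
  qed
  \<comment> \<open>The terms in which the monomial does not drop below level 0 and the levels match
    exactly; these are the terms that \<open>diagonal_nonneg\<close> can handle.\<close>
  define good where "good i j t g \<longleftrightarrow> g \<le> i + d \<and> g \<le> j + d \<and> a t \<le> i + d - g \<and> b t \<le> j + d - g \<and> a t + j = b t + i" for i j t g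
  \<comment> \<open>If u is longer than the level of the left entry, the right vector lies in
    \<open>N (a t)\<close>, above that level, and the two are almost orthogonal. Such a failure
    requires g > 0, because a t \<le> d; this is why the rows start at level i + d.\<close>
  have bad: "cmod (T i j t g g) \<le> 12 * \<delta> * B" if t: "t < n" and ab: "a t + j = b t + i" and ng: "\<not> good i j t g" for i j t g
  proof (cases "g \<le> i + d \<and> g \<le> j + d")
    case True
    then have at: "i + d - g < a t" using ng ab by (auto simp: good_def)
    then have g: "0 < g" using d[OF t] by (cases g) auto
    have "X t \<otimes> e j g \<in> N (a t + ((j + d - g) - b t))" using N_monomial[OF X[OF t] eN] .
    moreover have "Suc (i + d - g) \<le> a t + ((j + d - g) - b t)" using at by simp
    ultimately have "X t \<otimes> e j g \<in> N (Suc (i + d - g))" using N_antimono by blast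
    then show ?thesis unfolding T_def using small[OF g, of "X t"] t B(1)[OF t] by simp
  next
    case False
    then have "e i g = \<zero> \<or> e j g = \<zero>" by (auto simp: e_def)
    then show ?thesis using t ec B \<delta> by (auto simp: T_def)
  qed
  have diag: "0 \<le> Re (\<Sum>i<m. \<Sum>j<m. \<Sum>t<n. if good i j t g then T i j t g g else 0)" for g
  proof -
    obtain \<Xi> W where W: "W \<in> carrier A" "\<And>i. i < m \<Longrightarrow> U (i + d - g) (\<Xi> i)" "\<And>i. i < m \<Longrightarrow> e i g = \<Xi> i \<otimes> W"
      using N_common_factor[of m "\<lambda>i. e i g" "\<lambda>i. i + d - g", OF eN] by blast
    \<comment> \<open>Below the bottom, i + d - g is truncated to 0 and would pass the level
      conditions. The vector is therefore set to 0 there.\<close>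
    define \<Xi>' where "\<Xi>' i = (if g \<le> i + d then \<Xi> i else \<zero>)" for i
    have \<Xi>': "U (i + d - g) (\<Xi>' i)" if "i < m" for i using W that U_zero by (auto simp: \<Xi>'_def)
    have \<Xi>'c: "\<Xi>' i \<in> carrier A" if "i < m" for i using \<Xi>' that U_closed by blast
    have "(if good i j t g then T i j t g g else 0) =
      (if a t \<le> i + d - g \<and> b t \<le> j + d - g \<and> (i + d - g) + b t = (j + d - g) + a t
       then \<psi> ((\<Xi>' i \<otimes> W)\<^sup>\<star> \<otimes> X t \<otimes> (\<Xi>' j \<otimes> W)) else 0)" if ij: "i < m" "j < m" "t < n" for i j t
    proof (cases "g \<le> i + d \<and> g \<le> j + d")
      case True
      then have "((i + d - g) + b t = (j + d - g) + a t) = (a t + j = b t + i)" by linarith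
      moreover have "T i j t g g = \<psi> ((\<Xi>' i \<otimes> W)\<^sup>\<star> \<otimes> X t \<otimes> (\<Xi>' j \<otimes> W))"
        using True W ij \<Xi>'c[of i] \<Xi>'c[of j] by (simp add: T_def p.ip_def \<Xi>'_def m_assoc)
      ultimately show ?thesis using True by (simp add: good_def)
    next
      case False
      then have "\<Xi>' i = \<zero> \<or> \<Xi>' j = \<zero>" by (auto simp: \<Xi>'_def)
      then have "\<psi> ((\<Xi>' i \<otimes> W)\<^sup>\<star> \<otimes> X t \<otimes> (\<Xi>' j \<otimes> W)) = 0" using ij W(1) \<Xi>'c by auto
      moreover have "\<not> good i j t g" using False by (auto simp: good_def)
      ultimately show ?thesis by simp
    qed
    then have "(\<Sum>i<m. \<Sum>j<m. \<Sum>t<n. if good i j t g then T i j t g g else 0) =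
      (\<Sum>i<m. \<Sum>j<m. \<Sum>t<n. if a t \<le> i + d - g \<and> b t \<le> j + d - g \<and> (i + d - g) + b t = (j + d - g) + a t
       then \<psi> ((\<Xi>' i \<otimes> W)\<^sup>\<star> \<otimes> X t \<otimes> (\<Xi>' j \<otimes> W)) else 0)" by (intro sum.cong) auto
    then show ?thesis using diagonal_nonneg[OF st W(1), of m "\<lambda>i. i + d - g" \<Xi>'] \<Xi>' by simp
  qed
  define Q where "Q i j t g g' = (if a t + j = b t + i then T i j t g g' else 0)" for i j t g g'
  \<comment> \<open>\<open>Q\<close> is the full expansion of the Fejer sum over pairs of depths,
    \<open>Z\<close> its good diagonal part. The difference has at most m m n G G terms, each
    bounded by 12 \<delta> B.\<close>
  define Z where "Z i j t g g' = (if g = g' \<and> good i j t g then T i j t g g' else 0)" for i j t g g'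
  have QZ: "cmod (Q i j t g g' - Z i j t g g') \<le> 12 * \<delta> * B" if "t < n" for i j t g g'
  proof (cases "g = g'")
    case True
    then show ?thesis using bad[OF that, of j i g] B(2) \<delta> by (auto simp: Q_def Z_def) (auto simp: good_def)
  next
    case False
    then show ?thesis using cross[OF that, of j i g g'] B(2) \<delta> by (auto simp: Q_def Z_def)
  qed
  have F: "(\<Sum>i<m. \<Sum>j<m. \<Sum>t<n. if a t + j = b t + i then \<psi> (X t) else 0) = (\<Sum>i<m. \<Sum>j<m. \<Sum>t<n. \<Sum>g<G. \<Sum>g'<G. Q i j t g g')"
  proof (intro sum.cong refl)
    fix i j t assume ij: "i \<in> {..<m}" "j \<in> {..<m}" "t \<in> {..<n}"
    have "\<psi> (X t) = p.ip (lsum (e i) G) (X t \<otimes> lsum (e j) G)" using unit ij by (simp add: p.ip_def)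
    also have "\<dots> = (\<Sum>g'<G. \<Sum>g<G. T i j t g g')" using ij ec by (simp add: lsum_mult_left p.ip_lsum_left p.ip_lsum_right T_def lsum_closed)
    also have "\<dots> = (\<Sum>g<G. \<Sum>g'<G. T i j t g g')" by (rule sum.swap)
    finally show "(if a t + j = b t + i then \<psi> (X t) else 0) = (\<Sum>g<G. \<Sum>g'<G. Q i j t g g')" by (simp add: Q_def)
  qed
  have "(\<Sum>i<m. \<Sum>j<m. \<Sum>t<n. \<Sum>g<G. \<Sum>g'<G. Z i j t g g') = (\<Sum>i<m. \<Sum>j<m. \<Sum>t<n. \<Sum>g<G. if good i j t g then T i j t g g else 0)"
  proof (intro sum.cong refl)
    fix i j t g assume "g \<in> {..<G}"
    then show "(\<Sum>g'<G. Z i j t g g') = (if good i j t g then T i j t g g else 0)"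
      using sum.delta[of "{..<G}" g "\<lambda>g'. if good i j t g then T i j t g g' else 0"] by (simp add: Z_def if_distrib cong: if_cong)
  qed
  also have "\<dots> = (\<Sum>i<m. \<Sum>j<m. \<Sum>g<G. \<Sum>t<n. if good i j t g then T i j t g g else 0)" by (intro sum.cong refl sum.swap)
  also have "\<dots> = (\<Sum>i<m. \<Sum>g<G. \<Sum>j<m. \<Sum>t<n. if good i j t g then T i j t g g else 0)" by (intro sum.cong refl sum.swap)
  also have "\<dots> = (\<Sum>g<G. \<Sum>i<m. \<Sum>j<m. \<Sum>t<n. if good i j t g then T i j t g g else 0)" by (rule sum.swap)
  finally have Zpos: "0 \<le> Re (\<Sum>i<m. \<Sum>j<m. \<Sum>t<n. \<Sum>g<G. \<Sum>g'<G. Z i j t g g')" using diag by (simp add: sum_nonneg)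
  have "cmod ((\<Sum>i<m. \<Sum>j<m. \<Sum>t<n. \<Sum>g<G. \<Sum>g'<G. Q i j t g g') - (\<Sum>i<m. \<Sum>j<m. \<Sum>t<n. \<Sum>g<G. \<Sum>g'<G. Z i j t g g'))
    \<le> real m * (real m * (real n * (real G * (real G * (12 * \<delta> * B)))))"
    unfolding sum_subtractf[symmetric]
    by (intro order_trans[OF norm_sum] order_trans[OF sum_bounded_above[where K = "real m * (real n * (real G * (real G * (12 * \<delta> * B))))"]]
        order_trans[OF sum_bounded_above[where K = "real n * (real G * (real G * (12 * \<delta> * B)))"]]
        order_trans[OF sum_bounded_above[where K = "real G * (real G * (12 * \<delta> * B))"]]
        order_trans[OF sum_bounded_above[where K = "real G * (12 * \<delta> * B)"]]
        order_trans[OF sum_bounded_above[where K = "12 * \<delta> * B"]] QZ) auto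
  then have "\<bar>Re ((\<Sum>i<m. \<Sum>j<m. \<Sum>t<n. \<Sum>g<G. \<Sum>g'<G. Q i j t g g') - (\<Sum>i<m. \<Sum>j<m. \<Sum>t<n. \<Sum>g<G. \<Sum>g'<G. Z i j t g g'))\<bar>
    \<le> real m * (real m * (real n * (real G * (real G * (12 * \<delta> * B)))))" using abs_Re_le_cmod order_trans by blast
  then have "- (real m * (real m * (real n * (real G * (real G * (12 * \<delta> * B)))))) \<le> Re (\<Sum>i<m. \<Sum>j<m. \<Sum>t<n. \<Sum>g<G. \<Sum>g'<G. Q i j t g g')"
    using Zpos by (simp only: minus_complex.simps abs_le_iff) linarith
  then show ?thesis unfolding F G_def[symmetric] by (simp only: of_nat_mult mult.assoc)
qed

text \<open>For fixed m the constant in front of \<delta> is fixed, and the Fejer sum does not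
  depend on \<delta>, so \<delta> may tend to 0.\<close>

lemma fejer_sum_nonneg:
  assumes st: "state A \<psi>"
  shows "0 \<le> Re (\<Sum>i<m. \<Sum>j<m. \<Sum>t<n. if a t + j = b t + i then \<psi> (X t) else 0)"
proof -
  define d where "d = (\<Sum>t<n. a t + b t)"
  have d: "a t \<le> d \<and> b t \<le> d" if "t < n" for t
    using member_le_sum[of t "{..<n}" "\<lambda>t. a t + b t"] that by (simp add: d_def)
  define B where "B = (\<Sum>t<n. \<parallel>X t\<parallel>)"
  have B: "\<parallel>X t\<parallel> \<le> B" if "t < n" for t
    unfolding B_def using that nrm_nonneg by (intro member_le_sum) auto
  have B0: "0 \<le> B" unfolding B_def using nrm_nonneg by (intro sum_nonneg) auto
  define K where "K = real (m * m * n * Suc (m + d) * Suc (m + d)) * (12 * B)"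
  define F where "F = (\<Sum>i<m. \<Sum>j<m. \<Sum>t<n. if a t + j = b t + i then \<psi> (X t) else 0)"
  have K0: "0 \<le> K" using B0 by (simp add: K_def)
  have le: "- (K * \<delta>) \<le> Re F" if "0 < \<delta>" "\<delta> \<le> 1" for \<delta>
    using fejer_sum_bound[OF st d B B0 that, of m] by (simp add: K_def F_def mult.assoc mult.commute mult.left_commute)
  have "0 \<le> Re F"
  proof (rule ccontr)
    assume n: "\<not> 0 \<le> Re F"
    define \<delta> where "\<delta> = min 1 (- Re F / (2 * (K + 1)))"
    have "0 < - Re F / (2 * (K + 1))" using n K0 by (intro divide_pos_pos) auto
    then have \<delta>: "0 < \<delta>" "\<delta> \<le> 1" "\<delta> \<le> - Re F / (2 * (K + 1))" by (auto simp: \<delta>_def)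
    have "K * \<delta> \<le> (K + 1) * (- Re F / (2 * (K + 1)))" using \<delta> K0 by (intro mult_mono) auto
    also have "\<dots> = - Re F / 2" using K0 by (simp add: field_simps)
    finally show False using le[OF \<delta>(1,2)] n by linarith
  qed
  then show ?thesis by (simp add: F_def)
qed

text \<open>Each component occurs m times in the Fejer sum, up to an error bounded independently of
  m, so m Re \<psi>(q) is bounded below by a constant for all m.\<close>

theorem form_positive:
  assumes st: "state A \<psi>"
  shows "0 \<le> Re (\<psi> (lsum X n))"
proof -
  interpret p: cstar_state A \<psi> using st by unfold_locales
  define d where "d = (\<Sum>t<n. a t + b t)"
  have d: "a t \<le> d \<and> b t \<le> d" if "t < n" for t
    using member_le_sum[of t "{..<n}" "\<lambda>t. a t + b t"] that by (simp add: d_def)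
  define K where "K = (\<Sum>t<n. 2 * real d * \<bar>Re (\<psi> (X t))\<bar>)"
  have bound: "- K \<le> real m * Re (\<psi> (lsum X n))" for m
  proof -
    define c where "c t = (\<Sum>i<m. \<Sum>j<m. of_bool (a t + j = b t + i) :: real)" for t
    have "Re (\<Sum>i<m. \<Sum>j<m. \<Sum>t<n. if a t + j = b t + i then \<psi> (X t) else 0) =
      (\<Sum>i<m. \<Sum>j<m. \<Sum>t<n. of_bool (a t + j = b t + i) * Re (\<psi> (X t)))"
      unfolding Re_sum by (intro sum.cong refl) simp
    also have "\<dots> = (\<Sum>i<m. \<Sum>t<n. \<Sum>j<m. of_bool (a t + j = b t + i) * Re (\<psi> (X t)))" by (intro sum.cong refl sum.swap)
    also have "\<dots> = (\<Sum>t<n. \<Sum>i<m. \<Sum>j<m. of_bool (a t + j = b t + i) * Re (\<psi> (X t)))" by (rule sum.swap)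
    also have "\<dots> = (\<Sum>t<n. c t * Re (\<psi> (X t)))" by (simp add: c_def sum_distrib_right)
    finally have "0 \<le> (\<Sum>t<n. c t * Re (\<psi> (X t)))" using fejer_sum_nonneg[OF st, of m] by simp
    moreover have "(\<Sum>t<n. c t * Re (\<psi> (X t))) \<le> (\<Sum>t<n. real m * Re (\<psi> (X t)) + 2 * real d * \<bar>Re (\<psi> (X t))\<bar>)"
    proof (rule sum_mono)
      fix t assume "t \<in> {..<n}"
      then have "\<bar>c t - real m\<bar> \<le> 2 * real d" unfolding c_def using d card_shifted_pairs by simp
      then have "\<bar>(c t - real m) * Re (\<psi> (X t))\<bar> \<le> 2 * real d * \<bar>Re (\<psi> (X t))\<bar>"
        unfolding abs_mult by (intro mult_right_mono) auto
      then show "c t * Re (\<psi> (X t)) \<le> real m * Re (\<psi> (X t)) + 2 * real d * \<bar>Re (\<psi> (X t))\<bar>" by (simp add: algebra_simps)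
    qed
    moreover have "(\<Sum>t<n. real m * Re (\<psi> (X t)) + 2 * real d * \<bar>Re (\<psi> (X t))\<bar>) = real m * Re (\<psi> (lsum X n)) + K"
      by (simp add: K_def sum.distrib sum_distrib_left p.\<phi>_lsum)
    ultimately show ?thesis by linarith
  qed
  show ?thesis
  proof (rule ccontr)
    assume n: "\<not> 0 \<le> Re (\<psi> (lsum X n))"
    obtain m :: nat where "K / (- Re (\<psi> (lsum X n))) < m" using reals_Archimedean2 by blast
    then have "K < real m * (- Re (\<psi> (lsum X n)))" using n by (simp add: field_simps)
    then show False using bound[of m] by simp
  qed
qed

end

context toeplitz_faithful
begin

text \<open>If x is in the kernel, h = - x* x induces the zero form, which counts as nonnegative.
  Approximating h by words and applying \<open>form_positive\<close> shows that every state is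
  nonnegative at - x* x; but some state is strictly positive at x* x.\<close>

theorem D_gns_faithful:
  assumes states: "\<And>x. x \<in> carrier A \<Longrightarrow> x \<noteq> \<zero> \<Longrightarrow> \<exists>\<psi>. state A \<psi> \<and> \<psi> (x\<^sup>\<star> \<otimes> x) \<noteq> 0"
    and x: "x \<in> D" and null: "\<And>y. y \<in> D \<Longrightarrow> sn (x \<otimes> y) = 0"
  shows "x = \<zero>"
proof (rule ccontr)
  assume "x \<noteq> \<zero>"
  have Dc: "y \<in> carrier A" if "y \<in> D" for y using that D_sub unital_cstar_subalgebraD(1) by blast
  have xc: "x \<in> carrier A" using x Dc by blast
  obtain \<psi> where st: "state A \<psi>" "\<psi> (x\<^sup>\<star> \<otimes> x) \<noteq> 0" using states[OF xc \<open>x \<noteq> \<zero>\<close>] by blast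
  interpret p: cstar_state A \<psi> using st(1) by unfold_locales
  define s :: complex where "s = -1"
  define h where "h = s \<cdot> (x\<^sup>\<star> \<otimes> x)"
  have hD: "h \<in> D" using unital_cstar_subalgebraD(5,6,7)[OF D_sub] x by (simp add: h_def)
  have hc: "h \<in> carrier A" using hD Dc by blast
  have hnull: "\<phi> (y\<^sup>\<star> \<otimes> h \<otimes> y) = 0" if y: "y \<in> D" for y
  proof -
    have "y\<^sup>\<star> \<otimes> h \<otimes> y = s \<cdot> ((x \<otimes> y)\<^sup>\<star> \<otimes> (x \<otimes> y))" unfolding h_def using Dc[OF y] xc by algebra
    moreover have "\<phi> ((x \<otimes> y)\<^sup>\<star> \<otimes> (x \<otimes> y)) = 0" using null[OF y] \<phi>_square_zero_iff[of "x \<otimes> y"] Dc[OF y] xc by simp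
    ultimately show ?thesis using Dc[OF y] xc by (simp add: \<phi>_cscale)
  qed
  have approx: "- (2 * e) \<le> Re (\<psi> h)" if e: "0 < e" for e
  proof -
    obtain q where q: "q \<in> words" "\<parallel>h \<ominus> q\<parallel> < e" using hD D_le_clos_words closD e by blast
    have qc: "q \<in> carrier A" using q words_closed by blast
    \<comment> \<open>Adding e compensates the error \<parallel>h - q\<parallel> < e in the form, at
      the price of another e in the value of \<psi>.\<close>
    define q' where "q' = q \<oplus> sc (of_real e)"
    have q'w: "q' \<in> words" unfolding q'_def using q words_add words_monomial monomial_scalar by blast
    obtain n X a b where q'X: "q' = lsum X n" and X': "\<And>t. t < n \<Longrightarrow> monomial (a t) (b t) (X t)" using words_lsum[OF q'w] by metis
    have "toeplitz_form A \<phi> R S u\<^sub>1 u\<^sub>2 n X a b"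
    proof unfold_locales
      fix m :: nat and \<Xi> :: "nat \<Rightarrow> 'a" assume \<Xi>: "\<And>i. i < m \<Longrightarrow> \<exists>k. U k (\<Xi> i)"
      define y where "y = lsum \<Xi> m"
      have yD: "y \<in> D" unfolding y_def
        by (rule lsum_in) (use unital_cstar_subalgebraD(2,4)[OF D_sub] \<Xi> U_in_D in blast)+
      have yc: "y \<in> carrier A" using yD Dc by blast
      have "y\<^sup>\<star> \<otimes> q' \<otimes> y = y\<^sup>\<star> \<otimes> h \<otimes> y \<ominus> y\<^sup>\<star> \<otimes> ((h \<ominus> q) \<otimes> y) \<oplus> y\<^sup>\<star> \<otimes> (sc (of_real e) \<otimes> y)"
        unfolding q'_def using yc hc qc sc_closed[of "of_real e"] by algebra
      then have "\<phi> (y\<^sup>\<star> \<otimes> q' \<otimes> y) = - ip y ((h \<ominus> q) \<otimes> y) + e * sq y"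
        using hnull[OF yD] yc hc qc by (simp add: \<phi>_add \<phi>_minus ip_def sc_mult_left cscale_mult_right \<phi>_cscale ip_self[unfolded ip_def])
      moreover have "cmod (ip y ((h \<ominus> q) \<otimes> y)) \<le> e * sq y"
      proof -
        have "cmod (ip y ((h \<ominus> q) \<otimes> y)) \<le> sn y * sn ((h \<ominus> q) \<otimes> y)" using cauchy_schwarz yc hc qc by simp
        also have "\<dots> \<le> sn y * (e * sn y)"
          using sn_mult[of "h \<ominus> q" y] q yc hc qc sn_nonneg[OF yc]
          by (intro mult_left_mono order_trans[OF sn_mult] mult_right_mono) auto
        finally show ?thesis using sn_sq[OF yc] by (simp add: power2_eq_square mult.left_commute)
      qed
      ultimately show "0 \<le> Re (\<phi> ((lsum \<Xi> m)\<^sup>\<star> \<otimes> lsum X n \<otimes> lsum \<Xi> m))"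
        using complex_Re_le_cmod[of "ip y ((h \<ominus> q) \<otimes> y)"] by (simp add: y_def q'X[symmetric])
    qed (use X' in auto)
    then interpret toeplitz_form A \<phi> R S u\<^sub>1 u\<^sub>2 n X a b .
    have "0 \<le> Re (\<psi> q')" using form_positive[OF st(1)] by (simp add: q'X)
    moreover have "\<psi> q' = \<psi> h - \<psi> (h \<ominus> q) + e" using hc qc by (simp add: q'_def p.\<phi>_add p.\<phi>_minus p.\<phi>_sc)
    moreover have "cmod (\<psi> (h \<ominus> q)) \<le> e" using p.\<phi>_le_nrm[of "h \<ominus> q"] hc qc q by simp
    ultimately show ?thesis using abs_Re_le_cmod[of "\<psi> (h \<ominus> q)"] by simp
  qed
  have "0 \<le> Re (\<psi> h)"
  proof (rule ccontr)
    assume "\<not> 0 \<le> Re (\<psi> h)"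
    then show False using approx[of "- Re (\<psi> h) / 4"] by simp
  qed
  then have "Re (\<psi> (x\<^sup>\<star> \<otimes> x)) \<le> 0" using xc by (simp add: h_def s_def p.\<phi>_cscale)
  then show False using p.\<phi>_P[OF star_mult_P[OF xc]] st(2) by (simp add: complex_eq_iff)
qed

end

section \<open>Freeness\<close>

lemma nonpos_if_le_mult:
  fixes x M :: real
  assumes "\<And>e. 0 < e \<Longrightarrow> x \<le> e * M" "0 \<le> M"
  shows "x \<le> 0"
proof (rule ccontr)
  assume "\<not> x \<le> 0"
  then have e: "0 < x / (2 * (M + 1))" using assms(2) by simp
  have "x \<le> x / (2 * (M + 1)) * M" using assms(1)[OF e] .
  also have "\<dots> \<le> x / (2 * (M + 1)) * (M + 1)" using e by (intro mult_left_mono) auto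
  also have "\<dots> = x / 2" using assms(2) by (simp add: field_simps)
  finally show False using \<open>\<not> x \<le> 0\<close> by simp
qed

context cstar_state
begin

text \<open>Closedness uses \<phi>: if x is within e of a scalar c, then \<phi>(x) is within e of c,
  so x is within 2e of the fixed scalar \<phi>(x).\<close>

lemma unital_cstar_subalgebra_scalars: "unital_cstar_subalgebra A (range sc)"
proof -
  have "nrm_closed A (range sc)" unfolding nrm_closed_def
  proof (intro ballI impI)
    fix x assume x: "x \<in> carrier A" and a: "\<forall>e>0. \<exists>s\<in>range sc. \<parallel>x \<ominus> s\<parallel> < e"
    have "\<parallel>x \<ominus> sc (\<phi> x)\<parallel> \<le> 2 * e" if "e > 0" for e
    proof -
      obtain c where c: "\<parallel>x \<ominus> sc c\<parallel> < e" using a \<open>e > 0\<close> by blast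
      have "cmod (\<phi> x - c) \<le> e" using \<phi>_le_nrm[of "x \<ominus> sc c"] x c by (simp add: \<phi>_minus \<phi>_sc)
      then have "\<parallel>sc c \<ominus> sc (\<phi> x)\<parallel> \<le> e" using nrm_sc_le[of "c - \<phi> x"] by (simp add: sc_diff norm_minus_commute)
      then show ?thesis using nrm_minus_triangle[of x "sc c" "sc (\<phi> x)"] x c by simp
    qed
    then have "\<parallel>x \<ominus> sc (\<phi> x)\<parallel> \<le> 0" using nonpos_if_le_mult[of _ 2] by (simp add: mult.commute)
    then have "x = sc (\<phi> x)" using x nrm_nonneg[of "x \<ominus> sc (\<phi> x)"] nrm_eq_0_iff[of "x \<ominus> sc (\<phi> x)"] minus_eq_zero_iff by simp
    then show "x \<in> range sc" by blast
  qed
  moreover have "\<zero> \<in> range sc" "\<one> \<in> range sc" using sc_0 sc_1 by (metis rangeI)+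
  ultimately show ?thesis unfolding unital_cstar_subalgebra_def cstar_subalgebra_def
    by (auto simp: sc_add sc_mult_left cscale_sc star_sc)
qed

end

section \<open>The C*-algebra generated by S and its position relative to R\<close>

context toeplitz
begin

lemma S_star_S': "S\<^sup>\<star> \<otimes> S = \<one>"
  using S_star_S[OF R_sub(3)] by simp

lemma S_star_null: "sn (S\<^sup>\<star>) = 0"
  using S_null[OF R_sub(3)] by simp

lemma toeplitz_scalars: "toeplitz A \<phi> (range sc) S"
proof unfold_locales
  fix a assume "a \<in> range sc"
  then obtain c where c: "a = sc c" by blast
  show "S\<^sup>\<star> \<otimes> a \<otimes> S = sc (\<phi> a)" using S_star_S' by (simp add: c sc_mult_right cscale_mult_left \<phi>_sc) (simp add: sc_def)
  show "sn (S\<^sup>\<star> \<otimes> a) = 0" using S_star_null by (simp add: c sc_mult_right sn_cscale)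
qed (use unital_cstar_subalgebra_scalars in auto)

sublocale K: toeplitz A \<phi> "range sc" S
  by (rule toeplitz_scalars)

text \<open>The C*-algebra generated by \<open>S\<close> is the instance of the construction of \<open>D\<close> in which \<open>R\<close> consists
  of the scalars.\<close>

abbreviation C :: "'a set" where "C \<equiv> K.D"

lemma C_carrier: "c \<in> C \<Longrightarrow> c \<in> carrier A"
  using unital_cstar_subalgebraD(1)[OF K.D_sub] by blast

lemma S_in_C: "S \<in> C"
  using cstar_generated_base[of "range sc \<union> {S}"] by (auto simp: K.D_def)

lemma K_U_factor: "K.U k u \<Longrightarrow> 0 < k \<Longrightarrow> \<exists>z\<in>carrier A. u = S \<otimes> z"
proof (induction rule: K.U.induct)
  case (U_step a k u)
  then obtain c where "a = sc c" by blast
  then show ?case using U_step K.U_closed[of k u] by (intro bexI[of _ "c \<cdot> u"]) (auto simp: sc_mult_left cscale_mult_right)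
next
  case (U_add k u v)
  then show ?case by (metis S_closed a_closed r_distr)
qed simp

text \<open>Over the scalars a monomial is a multiple of S^a S*^b, hence a scalar or a word that
  begins with S or ends with S*. The state distinguishes the cases: it vanishes on the last
  two.\<close>

lemma K_monomial_cases:
  assumes "K.monomial a b x"
  obtains (scalar) c where "x = sc c"
    | (left) z where "z \<in> carrier A" "x = S \<otimes> z" "\<phi> x = 0"
    | (right) z where "z \<in> carrier A" "x = z \<otimes> S\<^sup>\<star>" "\<phi> x = 0"
proof -
  obtain u v where uv: "K.U a u" "K.U b v" "x = u \<otimes> v\<^sup>\<star>" using assms by (auto simp: K.monomial_def)
  have c: "u \<in> carrier A" "v \<in> carrier A" using uv K.U_closed by auto
  consider "0 < a" | "a = 0" "0 < b" | "a = 0" "b = 0" by blast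
  then show ?thesis
  proof cases
    case 1
    obtain z where z: "z \<in> carrier A" "u = S \<otimes> z" using K_U_factor[OF uv(1) 1] by blast
    have "x = S \<otimes> (z \<otimes> v\<^sup>\<star>)" using z c by (simp add: uv m_assoc)
    moreover have "\<phi> x = 0" using K.\<phi>_U_mult[OF uv(1) 1] c by (simp add: uv)
    ultimately show ?thesis using left[of "z \<otimes> v\<^sup>\<star>"] z c by simp
  next
    case 2
    obtain z where z: "z \<in> carrier A" "v = S \<otimes> z" using K_U_factor[OF uv(2) 2(2)] by blast
    have x: "x = (u \<otimes> z\<^sup>\<star>) \<otimes> S\<^sup>\<star>" using z c by (simp add: uv m_assoc star_mult)
    have "\<phi> x = 0" unfolding x using S_star_null z c by (intro \<phi>_mult_null_right) auto
    then show ?thesis using right[of "u \<otimes> z\<^sup>\<star>"] x z c by simp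
  next
    case 3
    then obtain s t where "u = sc s" "v = sc t" using K.U_0_in_R uv by blast
    then show ?thesis using scalar[of "s * cnj t"] by (simp add: uv star_sc sc_mult_left cscale_sc)
  qed
qed

text \<open>On vectors that S* annihilates, the compression of c is the scalar \<phi>(c): words
  beginning with S or ending with S* contribute nothing, and the remaining scalars pass to the norm
  closure.\<close>

lemma C_pairing:
  assumes x: "x \<in> carrier A" "sn (S\<^sup>\<star> \<otimes> x) = 0" and y: "y \<in> carrier A" "sn (S\<^sup>\<star> \<otimes> y) = 0" and c: "c \<in> C"
  shows "ip x (c \<otimes> y) = \<phi> c * ip x y"
proof -
  have w: "ip x (q \<otimes> y) = \<phi> q * ip x y" if "q \<in> K.words" for q using that
  proof (induction rule: K.words.induct)
    case (words_monomial a b q)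
    then show ?case
    proof (cases rule: K_monomial_cases)
      case (scalar c) then show ?thesis using x y by (simp add: sc_mult_left ip_cscale_right \<phi>_sc)
    next
      case (left z)
      have "ip x (q \<otimes> y) = ip (S\<^sup>\<star> \<otimes> x) (z \<otimes> y)" using left x y by (simp add: ip_mult_left m_assoc)
      also have "\<dots> = 0" using cauchy_schwarz[of "S\<^sup>\<star> \<otimes> x" "z \<otimes> y"] left x y by simp
      finally show ?thesis using left by simp
    next
      case (right z)
      have "sn (z \<otimes> (S\<^sup>\<star> \<otimes> y)) = 0" using right y by (intro sn_mult_null[of z]) auto
      then have "ip x (q \<otimes> y) = 0" using cauchy_schwarz[of x "q \<otimes> y"] right x y by (simp add: m_assoc)
      then show ?thesis using right by simp
    qed
  next
    case (words_add q r)
    then show ?case using x y K.words_closed by (simp add: l_distr ip_add_right \<phi>_add distrib_right)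
  qed
  have cc: "c \<in> carrier A" using c C_carrier by blast
  define M where "M = 2 * (sn x * sn y)"
  have M: "0 \<le> M" using sn_nonneg x y by (simp add: M_def)
  have "cmod (ip x (c \<otimes> y) - \<phi> c * ip x y) \<le> e * M" if e: "0 < e" for e
  proof -
    obtain q where q: "q \<in> K.words" "\<parallel>c \<ominus> q\<parallel> < e" using K.D_le_clos_words c closD e by blast
    have qc: "q \<in> carrier A" using q K.words_closed by blast
    define h where "h = c \<ominus> q"
    have hc: "h \<in> carrier A" "\<parallel>h\<parallel> \<le> e" using qc cc q by (auto simp: h_def)
    have "c \<otimes> y = h \<otimes> y \<oplus> q \<otimes> y" unfolding h_def using cc qc y(1) by algebra
    then have "ip x (c \<otimes> y) = ip x (h \<otimes> y) + ip x (q \<otimes> y)" using hc qc x y by (simp add: ip_add_right)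
    moreover have "\<phi> c = \<phi> h + \<phi> q" using cc qc by (simp add: h_def \<phi>_minus)
    ultimately have eq: "ip x (c \<otimes> y) - \<phi> c * ip x y = ip x (h \<otimes> y) - \<phi> h * ip x y"
      using w[OF q(1)] by (simp add: algebra_simps)
    have "cmod (ip x (h \<otimes> y)) \<le> sn x * (e * sn y)"
    proof -
      have "sn (h \<otimes> y) \<le> e * sn y"
        using sn_mult[OF hc(1) y(1)] mult_right_mono[OF hc(2) sn_nonneg[OF y(1)]] by simp
      then show ?thesis using cauchy_schwarz[of x "h \<otimes> y"] x y hc sn_nonneg[OF x(1)] mult_left_mono[of "sn (h \<otimes> y)" "e * sn y" "sn x"] by simp
    qed
    moreover have "cmod (\<phi> h * ip x y) \<le> e * (sn x * sn y)"
      unfolding norm_mult using \<phi>_le_nrm[OF hc(1)] hc(2) cauchy_schwarz[OF x(1) y(1)] e by (intro mult_mono) auto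
    moreover have "e * M = sn x * (e * sn y) + e * (sn x * sn y)" by (simp add: M_def)
    ultimately show ?thesis unfolding eq using norm_triangle_ineq4[of "ip x (h \<otimes> y)" "\<phi> h * ip x y"] by linarith
  qed
  then have "cmod (ip x (c \<otimes> y) - \<phi> c * ip x y) \<le> 0"
    using M by (rule nonpos_if_le_mult)
  then show ?thesis by simp
qed

lemma sn_eq_0_clos:
  assumes T: "T \<subseteq> carrier A" and f: "f \<in> carrier A" and z: "\<And>s. s \<in> T \<Longrightarrow> sn (f \<otimes> s) = 0" and x: "x \<in> clos T"
  shows "sn (f \<otimes> x) = 0"
proof -
  have xc: "x \<in> carrier A" using x clos_carrier by blast
  have "sn (f \<otimes> x) \<le> e * \<parallel>f\<parallel>" if e: "0 < e" for e
  proof -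
    obtain q where q: "q \<in> T" "\<parallel>x \<ominus> q\<parallel> < e" using x closD e by blast
    have qc: "q \<in> carrier A" using q T by blast
    have "f \<otimes> x = f \<otimes> (x \<ominus> q) \<oplus> f \<otimes> q" using f xc qc by algebra
    then have "sn (f \<otimes> x) \<le> sn (f \<otimes> (x \<ominus> q)) + sn (f \<otimes> q)" using sn_triangle f xc qc by simp
    also have "\<dots> \<le> \<parallel>f\<parallel> * sn (x \<ominus> q)" using sn_mult[of f "x \<ominus> q"] z[OF q(1)] f xc qc by simp
    also have "\<dots> \<le> \<parallel>f\<parallel> * e" using sn_le_nrm[of "x \<ominus> q"] q f xc qc nrm_nonneg[OF f] by (intro mult_left_mono) auto
    finally show ?thesis by (simp add: mult.commute)
  qed
  then have "sn (f \<otimes> x) \<le> 0" using nrm_nonneg[OF f] by (rule nonpos_if_le_mult)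
  then show ?thesis using sn_nonneg[of "f \<otimes> x"] f xc by simp
qed

lemma S_star_centered: "a \<in> R \<Longrightarrow> \<phi> a = 0 \<Longrightarrow> u \<in> carrier A \<Longrightarrow> S\<^sup>\<star> \<otimes> (a \<otimes> (S \<otimes> u)) = \<zero>"
  using S_star_S[of a] by (metis S_closed R_carrier l_null m_assoc m_closed sc_0 star_closed)

lemma centered: "a \<in> R \<Longrightarrow> a \<ominus> sc (\<phi> a) \<in> R" "a \<in> R \<Longrightarrow> \<phi> (a \<ominus> sc (\<phi> a)) = 0"
  using R_sub(9,10) by (auto simp: \<phi>_minus \<phi>_sc)

text \<open>The leading letter is split into a centred part and a scalar. On the centred part, which
  S* annihilates, \<open>C_pairing\<close> gives the squared seminorm as a multiple of \<phi>(c* c)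
  = 0. In the scalar part the next S is absorbed into c.\<close>

lemma C_null_U:
  assumes "U k u" "c \<in> C" "\<And>y. y \<in> C \<Longrightarrow> sn (c \<otimes> y) = 0"
  shows "sn (c \<otimes> u) = 0"
  using assms
proof (induction arbitrary: c rule: U.induct)
  case (U_base a)
  have cc: "c \<in> carrier A" "a \<in> carrier A" using U_base C_carrier by auto
  define b where "b = a \<ominus> sc (\<phi> a)"
  have b: "b \<in> R" "\<phi> b = 0" using centered U_base by (auto simp: b_def)
  have cs: "c\<^sup>\<star> \<otimes> c \<in> C" using U_base unital_cstar_subalgebraD(5,7)[OF K.D_sub] by blast
  have "sn c = 0" using U_base(3)[OF unital_cstar_subalgebraD(3)[OF K.D_sub]] cc by simp
  then have "\<phi> (c\<^sup>\<star> \<otimes> c) = 0" using \<phi>_square_zero_iff cc by simp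
  then have "ip b (c\<^sup>\<star> \<otimes> c \<otimes> b) = 0" using C_pairing[OF _ S_null _ S_null cs, of b b] b by simp
  then have 1: "sn (c \<otimes> b) = 0" using \<phi>_square_zero_iff[of "c \<otimes> b"] cc b by (simp add: ip_def star_mult m_assoc)
  have 2: "sn (c \<otimes> sc (\<phi> a)) = 0" using \<open>sn c = 0\<close> cc by (simp add: sc_mult_right sn_cscale)
  have "c \<otimes> a = c \<otimes> b \<oplus> c \<otimes> sc (\<phi> a)" unfolding b_def using cc sc_closed[of "\<phi> a"] by algebra
  then show ?case using 1 2 sn_triangle[of "c \<otimes> b" "c \<otimes> sc (\<phi> a)"] sn_nonneg[of "c \<otimes> a"] cc b by simp
next
  case (U_step a k u)
  have cc: "c \<in> carrier A" "a \<in> carrier A" "u \<in> carrier A" using U_step C_carrier U_closed by auto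
  define b where "b = a \<ominus> sc (\<phi> a)"
  have b: "b \<in> R" "\<phi> b = 0" using centered U_step by (auto simp: b_def)
  have bc: "b \<in> carrier A" using b by simp
  have cs: "c\<^sup>\<star> \<otimes> c \<in> C" using U_step unital_cstar_subalgebraD(5,7)[OF K.D_sub] by blast
  have "sn c = 0" using U_step(5)[OF unital_cstar_subalgebraD(3)[OF K.D_sub]] cc by simp
  then have "\<phi> (c\<^sup>\<star> \<otimes> c) = 0" using \<phi>_square_zero_iff cc by simp
  define x where "x = b \<otimes> (S \<otimes> u)"
  have xc: "x \<in> carrier A" "sn (S\<^sup>\<star> \<otimes> x) = 0" using S_star_centered[OF b cc(3)] bc cc by (auto simp: x_def)
  have "ip x (c\<^sup>\<star> \<otimes> c \<otimes> x) = 0" using C_pairing[OF xc xc cs] \<open>\<phi> (c\<^sup>\<star> \<otimes> c) = 0\<close> by simp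
  then have 1: "sn (c \<otimes> x) = 0" using \<phi>_square_zero_iff[of "c \<otimes> x"] cc xc by (simp add: ip_def star_mult m_assoc)
  \<comment> \<open>This is why c is arbitrary in the induction: c S belongs to C and is again null
    on C.\<close>
  have "sn ((c \<otimes> S) \<otimes> u) = 0"
  proof (rule U_step.IH)
    show "c \<otimes> S \<in> C" using U_step S_in_C unital_cstar_subalgebraD(5)[OF K.D_sub] by blast
    show "sn (c \<otimes> S \<otimes> y) = 0" if "y \<in> C" for y
      using U_step(5)[of "S \<otimes> y"] that S_in_C unital_cstar_subalgebraD(5)[OF K.D_sub] cc C_carrier by (simp add: m_assoc)
  qed
  then have 2: "sn (\<phi> a \<cdot> ((c \<otimes> S) \<otimes> u)) = 0" using cc by (simp add: sn_cscale)
  have "c \<otimes> (a \<otimes> (S \<otimes> u)) = c \<otimes> x \<oplus> c \<otimes> (sc (\<phi> a) \<otimes> (S \<otimes> u))" unfolding x_def b_def using cc S_closed sc_closed[of "\<phi> a"] by algebra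
  also have "c \<otimes> (sc (\<phi> a) \<otimes> (S \<otimes> u)) = \<phi> a \<cdot> ((c \<otimes> S) \<otimes> u)" using cc by (simp add: sc_mult_left cscale_mult_right m_assoc)
  finally have "sn (c \<otimes> (a \<otimes> (S \<otimes> u))) \<le> sn (c \<otimes> x) + sn (\<phi> a \<cdot> ((c \<otimes> S) \<otimes> u))"
    using sn_triangle cc xc by simp
  then show ?case using 1 2 sn_nonneg[of "c \<otimes> (a \<otimes> (S \<otimes> u))"] cc by simp
next
  case (U_add k u v)
  have "c \<in> carrier A" "u \<in> carrier A" "v \<in> carrier A" using U_add C_carrier U_closed by auto
  then show ?case using U_add sn_triangle[of "c \<otimes> u" "c \<otimes> v"] sn_nonneg[of "c \<otimes> (u \<oplus> v)"] by (simp add: r_distr)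
qed

text \<open>An element of C that acts as 0 on the GNS space of C also does so on that of D. Hence
  faithfulness for C follows from faithfulness for D.\<close>

lemma C_null_D:
  assumes c: "c \<in> C" "\<And>y. y \<in> C \<Longrightarrow> sn (c \<otimes> y) = 0" and x: "x \<in> D"
  shows "sn (c \<otimes> x) = 0"
proof -
  have cc: "c \<in> carrier A" using c C_carrier by blast
  have "sn (c \<otimes> q) = 0" if "q \<in> words" for q using that
  proof (induction rule: words.induct)
    case (words_monomial a b q)
    then obtain u v where uv: "U a u" "U b v" "q = u \<otimes> v\<^sup>\<star>" by (auto simp: monomial_def)
    have uc: "u \<in> carrier A" "v \<in> carrier A" using uv U_closed by auto
    show ?case
    proof (cases "b = 0")
      case True
      then have "v\<^sup>\<star> \<in> R" using U_0_in_R uv R_sub(7) by blast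
      then show ?thesis using C_null_U[OF _ c] U_right uv by blast
    next
      case False
      then have "sn ((c \<otimes> u) \<otimes> v\<^sup>\<star>) = 0" using U_null[OF uv(2)] cc uc by (intro sn_mult_null) auto
      then show ?thesis using cc uc by (simp add: uv m_assoc)
    qed
  next
    case (words_add q r)
    then show ?case using words_closed cc sn_triangle[of "c \<otimes> q" "c \<otimes> r"] sn_nonneg[of "c \<otimes> (q \<oplus> r)"] by (simp add: r_distr)
  qed
  then show ?thesis using sn_eq_0_clos[of words c x] words_closed cc x D_le_clos_words by blast
qed

text \<open>Null summands are allowed because a word z S*, applied to a vector x with S* x null,
  produces the null vector z S* x and not an element of the range.\<close>

definition S_range :: "'a set" where
  "S_range = {S \<otimes> z \<oplus> l | z l. z \<in> carrier A \<and> l \<in> carrier A \<and> sn l = 0}"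

lemma S_range_sub: "S_range \<subseteq> carrier A" by (auto simp: S_range_def)

lemma S_range_add: "x \<in> S_range \<Longrightarrow> y \<in> S_range \<Longrightarrow> x \<oplus> y \<in> S_range"
proof -
  assume "x \<in> S_range" "y \<in> S_range"
  then obtain z l z' l' where "x = S \<otimes> z \<oplus> l" "z \<in> carrier A" "l \<in> carrier A" "sn l = 0"
    "y = S \<otimes> z' \<oplus> l'" "z' \<in> carrier A" "l' \<in> carrier A" "sn l' = 0" by (auto simp: S_range_def)
  moreover have "x \<oplus> y = S \<otimes> (z \<oplus> z') \<oplus> (l \<oplus> l')" using calculation by (simp add: r_distr a_ac)
  moreover have "sn (l \<oplus> l') = 0" using calculation sn_triangle[of l l'] sn_nonneg[of "l \<oplus> l'"] by simp
  ultimately show ?thesis unfolding S_range_def by blast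
qed

text \<open>A reduced word whose first letter is a centred element of \<open>C\<close> lies, up to null vectors, in the
  closure of the range of \<open>S\<close>.\<close>

lemma C_centered_mult:
  assumes c: "c \<in> C" "\<phi> c = 0" and x: "x \<in> carrier A" "sn (S\<^sup>\<star> \<otimes> x) = 0"
  shows "c \<otimes> x \<in> clos S_range"
proof -
  have w: "(q \<ominus> sc (\<phi> q)) \<otimes> x \<in> S_range" if "q \<in> K.words" for q using that
  proof (induction rule: K.words.induct)
    case (words_monomial a b q)
    then show ?case
    proof (cases rule: K_monomial_cases)
      case (scalar c)
      have "\<zero> = S \<otimes> \<zero> \<oplus> \<zero>" by simp
      then have "\<zero> \<in> S_range" unfolding S_range_def using sn_zero zero_closed by blast
      then show ?thesis using scalar x by (simp add: \<phi>_sc)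
    next
      case (left z)
      have "(q \<ominus> sc (\<phi> q)) \<otimes> x = S \<otimes> (z \<otimes> x) \<oplus> \<zero>" using left x by (simp add: minus_eq m_assoc)
      then show ?thesis unfolding S_range_def using left x sn_zero by blast
    next
      case (right z)
      have "(q \<ominus> sc (\<phi> q)) \<otimes> x = S \<otimes> \<zero> \<oplus> z \<otimes> (S\<^sup>\<star> \<otimes> x)" using right x by (simp add: minus_eq m_assoc)
      moreover have "sn (z \<otimes> (S\<^sup>\<star> \<otimes> x)) = 0" using right x by (intro sn_mult_null[of z]) auto
      moreover have "z \<otimes> (S\<^sup>\<star> \<otimes> x) \<in> carrier A" using right x by simp
      ultimately show ?thesis unfolding S_range_def by blast
    qed
  next
    case (words_add q r)
    have qr: "q \<in> carrier A" "r \<in> carrier A" using words_add K.words_closed by auto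
    have "sc (\<phi> (q \<oplus> r)) = sc (\<phi> q) \<oplus> sc (\<phi> r)" using qr by (simp add: \<phi>_add sc_add)
    then have "((q \<oplus> r) \<ominus> sc (\<phi> (q \<oplus> r))) \<otimes> x = (q \<ominus> sc (\<phi> q)) \<otimes> x \<oplus> (r \<ominus> sc (\<phi> r)) \<otimes> x"
      using qr x(1) sc_closed[of "\<phi> q"] sc_closed[of "\<phi> r"] by simp algebra
    then show ?case using words_add S_range_add by simp
  qed
  have cc: "c \<in> carrier A" using c C_carrier by blast
  have "\<exists>s\<in>S_range. \<parallel>c \<otimes> x \<ominus> s\<parallel> < e" if e: "0 < e" for e
  proof -
    define e' where "e' = e / (2 * (\<parallel>x\<parallel> + 1))"
    have e': "0 < e'" using e nrm_nonneg[OF x(1)] by (simp add: e'_def)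
    obtain q where q: "q \<in> K.words" "\<parallel>c \<ominus> q\<parallel> < e'" using K.D_le_clos_words c closD e' by blast
    have qc: "q \<in> carrier A" using q K.words_closed by blast
    have "cmod (\<phi> q) \<le> e'" using \<phi>_le_nrm[of "c \<ominus> q"] q cc qc c(2) by (simp add: \<phi>_minus)
    then have 1: "\<parallel>sc (\<phi> q)\<parallel> \<le> e'" using nrm_sc_le[of "\<phi> q"] by simp
    have "c \<otimes> x \<ominus> (q \<ominus> sc (\<phi> q)) \<otimes> x = ((c \<ominus> q) \<oplus> sc (\<phi> q)) \<otimes> x"
      using cc qc x(1) sc_closed[of "\<phi> q"] by algebra
    then have "\<parallel>c \<otimes> x \<ominus> (q \<ominus> sc (\<phi> q)) \<otimes> x\<parallel> \<le> (e' + e') * \<parallel>x\<parallel>"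
      using nrm_mult_le[OF _ x(1) nrm_add_le[of "c \<ominus> q" "sc (\<phi> q)" e' e'] order_refl] cc qc q 1 by simp
    also have "\<dots> < (e' + e') * (\<parallel>x\<parallel> + 1)" using e' by simp
    also have "\<dots> = e' * (2 * (\<parallel>x\<parallel> + 1))" by (simp add: algebra_simps)
    also have "\<dots> = e" unfolding e'_def using nrm_nonneg[OF x(1)] by (intro nonzero_eq_divide_eq[THEN iffD1]) auto
    finally show ?thesis using w[OF q(1)] by blast
  qed
  then show ?thesis using cc x by (simp add: clos_def)
qed

text \<open>The range of S is orthogonal to R in the GNS space, since S* a* is null.\<close>

lemma \<phi>_R_S_range: assumes a: "a \<in> R" and x: "x \<in> clos S_range" shows "\<phi> (a \<otimes> x) = 0"
proof -
  have xc: "x \<in> carrier A" using x clos_carrier by blast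
  have z: "\<phi> (a \<otimes> s) = 0" if s: "s \<in> S_range" for s
  proof -
    obtain z l where s: "s = S \<otimes> z \<oplus> l" "z \<in> carrier A" "l \<in> carrier A" "sn l = 0" using s by (auto simp: S_range_def)
    have "\<phi> ((a \<otimes> S) \<otimes> z) = 0" using S_null[of "a\<^sup>\<star>"] R_sub(7)[OF a] a s by (intro \<phi>_mult_null_left) (auto simp: star_mult)
    moreover have "\<phi> (a \<otimes> l) = 0" using \<phi>_mult_null_right a s by simp
    ultimately show ?thesis using a s by (simp add: r_distr \<phi>_add m_assoc)
  qed
  have "cmod (\<phi> (a \<otimes> x)) \<le> e * \<parallel>a\<parallel>" if e: "0 < e" for e
  proof -
    obtain q where q: "q \<in> S_range" "\<parallel>x \<ominus> q\<parallel> < e" using x closD e by blast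
    have qc: "q \<in> carrier A" using q S_range_sub by blast
    have "a \<otimes> x = a \<otimes> (x \<ominus> q) \<oplus> a \<otimes> q" using a[THEN R_carrier] xc qc by algebra
    then have "\<phi> (a \<otimes> x) = \<phi> (a \<otimes> (x \<ominus> q))" using z[OF q(1)] a xc qc by (simp add: \<phi>_add)
    also have "cmod \<dots> \<le> \<parallel>a\<parallel> * e" using \<phi>_le_nrm[of "a \<otimes> (x \<ominus> q)"] nrm_mult_le[of a "x \<ominus> q" "\<parallel>a\<parallel>" e] a xc qc q by simp
    finally show ?thesis by (simp add: mult.commute)
  qed
  then have "cmod (\<phi> (a \<otimes> x)) \<le> 0" using nrm_nonneg a by (intro nonpos_if_le_mult[of _ "\<parallel>a\<parallel>"]) auto
  then show ?thesis by simp
qed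

text \<open>On the range of S the reason is S* a S = \<phi>(a) = 0; null summands stay null and the
  closure follows by continuity.\<close>

lemma R_centered_S_range: assumes a: "a \<in> R" "\<phi> a = 0" and x: "x \<in> clos S_range" shows "sn (S\<^sup>\<star> \<otimes> (a \<otimes> x)) = 0"
proof -
  have "sn ((S\<^sup>\<star> \<otimes> a) \<otimes> x) = 0"
  proof (rule sn_eq_0_clos[OF S_range_sub _ _ x])
    fix s assume "s \<in> S_range"
    then obtain z l where s: "s = S \<otimes> z \<oplus> l" "z \<in> carrier A" "l \<in> carrier A" "sn l = 0" by (auto simp: S_range_def)
    have "(S\<^sup>\<star> \<otimes> a) \<otimes> s = (S\<^sup>\<star> \<otimes> (a \<otimes> (S \<otimes> z))) \<oplus> (S\<^sup>\<star> \<otimes> a) \<otimes> l" using a s by (simp add: r_distr m_assoc)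
    then have "(S\<^sup>\<star> \<otimes> a) \<otimes> s = (S\<^sup>\<star> \<otimes> a) \<otimes> l" using S_star_centered a s by simp
    then show "sn ((S\<^sup>\<star> \<otimes> a) \<otimes> s) = 0" using sn_mult_null a s by simp
  qed (use a in auto)
  then show ?thesis using a x clos_carrier by (simp add: m_assoc)
qed

text \<open>Letters are prepended to the word. While the first letter is in R, or the word is empty,
  S* annihilates the product, and \<open>C_centered_mult\<close> carries such a product into the
  closed range of S. From there a centred letter of R leads back to the first situation. In each
  case \<phi> vanishes by orthogonality.\<close>

lemma free_R_C: "free_pair A \<phi> R C"
proof -
  let ?p = "\<lambda>w. foldr (\<lambda>(k, x) y. x \<otimes> y) w \<one>"
  have main: "?p w \<in> carrier A \<and> (w = [] \<or> fst (hd w) \<longrightarrow> sn (S\<^sup>\<star> \<otimes> ?p w) = 0) \<and>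
      (w \<noteq> [] \<and> \<not> fst (hd w) \<longrightarrow> ?p w \<in> clos S_range) \<and> (w \<noteq> [] \<longrightarrow> \<phi> (?p w) = 0)"
    if "distinct_adj (map fst w)" "\<forall>(k, x)\<in>set w. x \<in> (if k then R else C) \<and> \<phi> x = 0" for w :: "(bool \<times> 'a) list"
    using that
  proof (induction w)
    case Nil then show ?case using S_star_null by simp
  next
    case (Cons l w)
    obtain k x where l: "l = (k, x)" by (cases l)
    have IH: "?p w \<in> carrier A \<and> (w = [] \<or> fst (hd w) \<longrightarrow> sn (S\<^sup>\<star> \<otimes> ?p w) = 0) \<and>
      (w \<noteq> [] \<and> \<not> fst (hd w) \<longrightarrow> ?p w \<in> clos S_range)"
      using Cons by (auto simp: distinct_adj_Cons)
    have adj: "w \<noteq> [] \<Longrightarrow> fst (hd w) \<noteq> k" using Cons(2) by (cases w) (auto simp: l)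
    show ?case
    proof (cases k)
      case True
      then have x: "x \<in> R" "\<phi> x = 0" using Cons(3) by (auto simp: l)
      show ?thesis
      proof (cases "w = []")
        case True
        then show ?thesis using x \<open>k\<close> S_null by (simp add: l)
      next
        case False
        then have "?p w \<in> clos S_range" using IH adj True by simp
        then show ?thesis using x True IH \<phi>_R_S_range[OF x(1)] R_centered_S_range[OF x] by (simp add: l)
      qed
    next
      case False
      then have x: "x \<in> C" "\<phi> x = 0" using Cons(3) by (auto simp: l)
      have "sn (S\<^sup>\<star> \<otimes> ?p w) = 0" using IH adj False by blast
      then have k0: "x \<otimes> ?p w \<in> clos S_range" using C_centered_mult x IH by blast
      then have "\<phi> (x \<otimes> ?p w) = 0" using \<phi>_R_S_range[OF R_sub(3) k0] clos_carrier by simp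
      then show ?thesis using False IH k0 x C_carrier by (simp add: l)
    qed
  qed
  show ?thesis unfolding free_pair_def using main by blast
qed

end

section \<open>Pure infiniteness\<close>

context cstar_algebra
begin

text \<open>Finite sums of x* r x. For a projection r in a simple algebra some such sum dominates 1,
  see \<open>simple_full\<close>.\<close>

inductive_set conj_sums :: "'a \<Rightarrow> 'a set" for r where
  conj_sums_base: "x \<in> carrier A \<Longrightarrow> x\<^sup>\<star> \<otimes> r \<otimes> x \<in> conj_sums r"
| conj_sums_add: "h \<in> conj_sums r \<Longrightarrow> k \<in> conj_sums r \<Longrightarrow> h \<oplus> k \<in> conj_sums r"

lemma conj_sums_closed: "h \<in> conj_sums r \<Longrightarrow> r \<in> carrier A \<Longrightarrow> h \<in> carrier A"
  by (induction rule: conj_sums.induct) auto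

lemma conj_sums_conj: "h \<in> conj_sums r \<Longrightarrow> r \<in> carrier A \<Longrightarrow> b \<in> carrier A \<Longrightarrow> b\<^sup>\<star> \<otimes> h \<otimes> b \<in> conj_sums r"
proof (induction rule: conj_sums.induct)
  case (conj_sums_base x)
  have "b\<^sup>\<star> \<otimes> (x\<^sup>\<star> \<otimes> r \<otimes> x) \<otimes> b = (x \<otimes> b)\<^sup>\<star> \<otimes> r \<otimes> (x \<otimes> b)" using conj_sums_base by (simp add: star_mult m_assoc)
  then show ?case using conj_sums.conj_sums_base[of "x \<otimes> b" r] conj_sums_base by simp
next
  case (conj_sums_add h k)
  then show ?case using conj_sums.conj_sums_add conj_sums_closed by (simp add: r_distr l_distr)
qed

lemma conj_sums_cscale: assumes "h \<in> conj_sums r" "r \<in> carrier A" "0 \<le> c" shows "of_real c \<cdot> h \<in> conj_sums r"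
proof -
  define s where "s = complex_of_real (sqrt c)"
  have s: "cnj s = s" "s * s = of_real c" using assms(3) by (simp_all add: s_def of_real_mult[symmetric] del: of_real_mult)
  have "(sc s)\<^sup>\<star> \<otimes> h \<otimes> sc s = of_real c \<cdot> h" using conj_sums_closed[OF assms(1,2)] s
    by (simp add: star_sc sc_mult_left sc_mult_right cscale_mult_left cscale_cscale)
  then show ?thesis using conj_sums_conj[OF assms(1,2), of "sc s"] by simp
qed

text \<open>The two-sided ideal through which simplicity is used. Describing it by t* t \<le> h,
  instead of by sums of a r b, means that an element of it near 1 yields at once an inequality for
  h.\<close>

definition dominated :: "'a \<Rightarrow> 'a set" where
  "dominated r = {t \<in> carrier A. \<exists>h\<in>conj_sums r. h \<ominus> t\<^sup>\<star> \<otimes> t \<in> P}"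

text \<open>The parallelogram identity: (s + t)* (s + t) \<le> 2 s* s + 2 t* t.\<close>

lemma dominated_add:
  assumes r: "r \<in> carrier A" and s: "s \<in> dominated r" and t: "t \<in> dominated r" shows "s \<oplus> t \<in> dominated r"
proof -
  obtain h where h: "h \<in> conj_sums r" "h \<ominus> s\<^sup>\<star> \<otimes> s \<in> P" using s by (auto simp: dominated_def)
  obtain k where k: "k \<in> conj_sums r" "k \<ominus> t\<^sup>\<star> \<otimes> t \<in> P" using t by (auto simp: dominated_def)
  have c: "s \<in> carrier A" "t \<in> carrier A" "h \<in> carrier A" "k \<in> carrier A" using s t h k r conj_sums_closed by (auto simp: dominated_def)
  have "(h \<oplus> h) \<oplus> (k \<oplus> k) \<ominus> (s \<oplus> t)\<^sup>\<star> \<otimes> (s \<oplus> t) =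
    ((h \<ominus> s\<^sup>\<star> \<otimes> s) \<oplus> (h \<ominus> s\<^sup>\<star> \<otimes> s)) \<oplus> ((k \<ominus> t\<^sup>\<star> \<otimes> t) \<oplus> (k \<ominus> t\<^sup>\<star> \<otimes> t)) \<oplus> (s \<ominus> t)\<^sup>\<star> \<otimes> (s \<ominus> t)"
    using c by algebra
  also have "\<dots> \<in> P" using h k c by (intro P_add star_mult_P) auto
  finally show ?thesis unfolding dominated_def using conj_sums_add h k c by blast
qed

lemma dominated_left:
  assumes r: "r \<in> carrier A" and t: "t \<in> dominated r" and b: "b \<in> carrier A" shows "b \<otimes> t \<in> dominated r"
proof -
  obtain h where h: "h \<in> conj_sums r" "h \<ominus> t\<^sup>\<star> \<otimes> t \<in> P" using t by (auto simp: dominated_def)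
  have c: "t \<in> carrier A" "h \<in> carrier A" using t h r conj_sums_closed by (auto simp: dominated_def)
  define n where "n = \<parallel>b\<parallel>\<^sup>2"
  define m where "m = complex_of_real n"
  have 1: "m \<cdot> (h \<ominus> t\<^sup>\<star> \<otimes> t) \<in> P" unfolding m_def using h by (intro P_cscale) (auto simp: n_def)
  have 2: "t\<^sup>\<star> \<otimes> (sc m \<ominus> b\<^sup>\<star> \<otimes> b) \<otimes> t \<in> P" unfolding m_def n_def using nrm_sq_minus_star_mult_P[OF b] c by (intro P_conj) auto
  have "t\<^sup>\<star> \<otimes> (sc m \<ominus> b\<^sup>\<star> \<otimes> b) \<otimes> t = t\<^sup>\<star> \<otimes> (sc m \<otimes> t) \<ominus> (b \<otimes> t)\<^sup>\<star> \<otimes> (b \<otimes> t)" using b c sc_closed[of m] by algebra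
  also have "t\<^sup>\<star> \<otimes> (sc m \<otimes> t) = m \<cdot> (t\<^sup>\<star> \<otimes> t)" using c by (simp add: sc_mult_left cscale_mult_right)
  finally have e: "t\<^sup>\<star> \<otimes> (sc m \<ominus> b\<^sup>\<star> \<otimes> b) \<otimes> t = m \<cdot> (t\<^sup>\<star> \<otimes> t) \<ominus> (b \<otimes> t)\<^sup>\<star> \<otimes> (b \<otimes> t)" .
  have "m \<cdot> h \<ominus> (b \<otimes> t)\<^sup>\<star> \<otimes> (b \<otimes> t) = m \<cdot> (h \<ominus> t\<^sup>\<star> \<otimes> t) \<oplus> t\<^sup>\<star> \<otimes> (sc m \<ominus> b\<^sup>\<star> \<otimes> b) \<otimes> t"
    unfolding e using b c by algebra
  also have "\<dots> \<in> P" using 1 2 by (rule P_add)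
  finally have "m \<cdot> h \<ominus> (b \<otimes> t)\<^sup>\<star> \<otimes> (b \<otimes> t) \<in> P" .
  moreover have "m \<cdot> h \<in> conj_sums r" unfolding m_def using h r by (intro conj_sums_cscale) (auto simp: n_def)
  ultimately show ?thesis unfolding dominated_def using b c by blast
qed

lemma dominated_right:
  assumes r: "r \<in> carrier A" and t: "t \<in> dominated r" and b: "b \<in> carrier A" shows "t \<otimes> b \<in> dominated r"
proof -
  obtain h where h: "h \<in> conj_sums r" "h \<ominus> t\<^sup>\<star> \<otimes> t \<in> P" using t by (auto simp: dominated_def)
  have c: "t \<in> carrier A" "h \<in> carrier A" using t h r conj_sums_closed by (auto simp: dominated_def)
  have "b\<^sup>\<star> \<otimes> h \<otimes> b \<ominus> (t \<otimes> b)\<^sup>\<star> \<otimes> (t \<otimes> b) = b\<^sup>\<star> \<otimes> (h \<ominus> t\<^sup>\<star> \<otimes> t) \<otimes> b" using b c by algebra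
  also have "\<dots> \<in> P" using h b by (intro P_conj)
  finally show ?thesis unfolding dominated_def using conj_sums_conj[OF h(1) r b] b c by blast
qed

lemma ideal_clos_dominated:
  assumes r: "r \<in> carrier A" "r\<^sup>\<star> = r" "r \<otimes> r = r"
  shows "ideal (clos (dominated r)) A" "r \<in> clos (dominated r)"
proof -
  have sub: "dominated r \<subseteq> carrier A" by (auto simp: dominated_def)
  have "r \<ominus> r\<^sup>\<star> \<otimes> r = \<zero>" using r by simp
  moreover have "r \<in> conj_sums r" using conj_sums_base[OF one_closed, of r] r by simp
  ultimately have "r \<in> dominated r" using r P_zero unfolding dominated_def by (metis (mono_tags, lifting) mem_Collect_eq)
  then show rJ: "r \<in> clos (dominated r)" using clos_base[OF sub] by blast
  have add: "x \<oplus> y \<in> clos (dominated r)" if "x \<in> clos (dominated r)" "y \<in> clos (dominated r)" for x y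
    using clos_add[OF sub dominated_add[OF r(1)]] that by blast
  have left: "b \<otimes> x \<in> clos (dominated r)" if "x \<in> clos (dominated r)" "b \<in> carrier A" for b x
    using clos_mult_left[OF sub sub that(2) dominated_left[OF r(1) _ that(2)] that(1)] .
  have right: "x \<otimes> b \<in> clos (dominated r)" if "x \<in> clos (dominated r)" "b \<in> carrier A" for b x
    using clos_mult_right[OF sub sub that(2) dominated_right[OF r(1) _ that(2)] that(1)] .
  have inv: "\<ominus> x \<in> clos (dominated r)" if "x \<in> clos (dominated r)" for x
    using left[OF that, of "sc (-1)"] clos_carrier[OF that] by (simp add: sc_mult_left a_inv_cscale)
  show "ideal (clos (dominated r)) A"
  proof (rule idealI)
    show "subgroup (clos (dominated r)) (add_monoid A)"
      by (rule add.subgroupI) (use clos_carrier rJ inv add in auto)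
  qed (use left right ring_axioms in auto)
qed

lemma simple_full:
  assumes s: "simple_cstar A" and r: "r \<in> carrier A" "r\<^sup>\<star> = r" "r \<otimes> r = r" "r \<noteq> \<zero>"
  obtains h where "h \<in> conj_sums r" "h \<ominus> \<one> \<in> P"
proof -
  have sub: "dominated r \<subseteq> carrier A" by (auto simp: dominated_def)
  have "clos (dominated r) = carrier A"
    using s ideal_clos_dominated[OF r(1-3)] nrm_closed_clos[OF sub] r(4) unfolding simple_cstar_def by blast
  then have "\<one> \<in> clos (dominated r)" by simp
  \<comment> \<open>With distance 1/4 the real part term d + d* has norm at most 1/2.\<close>
  then obtain t where t: "t \<in> dominated r" "\<parallel>\<one> \<ominus> t\<parallel> < 1/4" using closD[of \<one> "dominated r" "1/4"] by auto
  obtain h where h: "h \<in> conj_sums r" "h \<ominus> t\<^sup>\<star> \<otimes> t \<in> P" using t by (auto simp: dominated_def)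
  have c: "t \<in> carrier A" "h \<in> carrier A" using t h r conj_sums_closed by (auto simp: dominated_def)
  define d where "d = \<one> \<ominus> t"
  have d: "d \<in> carrier A" "\<parallel>d\<parallel> \<le> 1/4" using t c by (auto simp: d_def)
  have td: "t = \<one> \<ominus> d" unfolding d_def using c by algebra
  have "sc (of_real (1/2)) \<ominus> (d \<oplus> d\<^sup>\<star>) \<in> P"
    using nrm_add_le[of d "d\<^sup>\<star>" "1/4" "1/4"] d by (intro P_self_adjoint_ball) (auto simp: star_add a_comm)
  then have "(sc (1/2) \<ominus> (d \<oplus> d\<^sup>\<star>)) \<oplus> d\<^sup>\<star> \<otimes> d \<in> P" using star_mult_P[OF d(1)] P_add by simp
  then have "(h \<ominus> t\<^sup>\<star> \<otimes> t) \<oplus> ((sc (1/2) \<ominus> (d \<oplus> d\<^sup>\<star>)) \<oplus> d\<^sup>\<star> \<otimes> d) \<in> P" using h P_add by blast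
  moreover have "(h \<ominus> t\<^sup>\<star> \<otimes> t) \<oplus> ((sc (1/2) \<ominus> (d \<oplus> d\<^sup>\<star>)) \<oplus> d\<^sup>\<star> \<otimes> d) = h \<ominus> (\<one> \<ominus> sc (1/2))"
    unfolding td using d(1) c(2) sc_closed[of "1/2"] by algebra
  moreover have "\<one> \<ominus> sc (1/2) = sc (1/2)" using sc_diff[of 1 "1/2"] by simp
  ultimately have hP: "h \<ominus> sc (1/2) \<in> P" by simp
  have "(h \<oplus> h) \<ominus> \<one> = (h \<ominus> sc (1/2)) \<oplus> (h \<ominus> sc (1/2))"
  proof -
    have "(h \<ominus> sc (1/2)) \<oplus> (h \<ominus> sc (1/2)) = (h \<oplus> h) \<ominus> (sc (1/2) \<oplus> sc (1/2))" using c sc_closed[of "1/2"] by algebra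
    then show ?thesis by (simp add: sc_add)
  qed
  then have "(h \<oplus> h) \<ominus> \<one> \<in> P" using P_add[OF hP hP] by simp
  then show ?thesis using that conj_sums_add h by blast
qed

text \<open>The shift \<open>u\<close> with \<open>u* u = p\<close> moves \<open>r\<close> to infinitely many pairwise orthogonal copies \<open>u\<^sup>k r u*\<^sup>k\<close>
  below \<open>p\<close>.\<close>

lemma infinite_projection_isometries:
  assumes s: "simple_cstar A" and p: "infinite_projection A p"
  obtains v w where "v \<in> carrier A" "w \<in> carrier A" "v\<^sup>\<star> \<otimes> v = \<one>" "w\<^sup>\<star> \<otimes> w = \<one>" "v\<^sup>\<star> \<otimes> w = \<zero>" "p \<otimes> v = v"
proof -
  obtain q u where pp: "p \<in> carrier A" "p\<^sup>\<star> = p" "p \<otimes> p = p" and qq: "q \<in> carrier A" "q\<^sup>\<star> = q" "q \<otimes> q = q"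
    and qp: "p \<ominus> q \<in> P" "q \<noteq> p" and u: "u \<in> carrier A" "u\<^sup>\<star> \<otimes> u = p" "u \<otimes> u\<^sup>\<star> = q"
    using p by (auto simp: infinite_projection_def projections_def cle_iff)
  \<comment> \<open>Conjugating p - q by 1 - p leaves - (1 - p) q (1 - p), which must be positive,
    so q (1 - p) = 0.\<close>
  have "q \<otimes> p = q"
  proof -
    define e where "e = \<one> \<ominus> p"
    have e: "e \<in> carrier A" "e\<^sup>\<star> = e" using pp by (auto simp: e_def star_minus)
    have pe: "p \<otimes> e = \<zero>"
    proof -
      have "p \<otimes> e = p \<ominus> p \<otimes> p" unfolding e_def using pp(1) by algebra
      then show ?thesis using pp by simp
    qed
    have "e\<^sup>\<star> \<otimes> (p \<ominus> q) \<otimes> e = e \<otimes> (p \<otimes> e) \<ominus> e \<otimes> q \<otimes> e" unfolding e(2) using e(1) pp(1) qq(1) by algebra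
    also have "\<dots> = \<ominus> (e \<otimes> q \<otimes> e)" using pe e qq by (simp add: minus_eq)
    finally have "\<ominus> (e \<otimes> q \<otimes> e) \<in> P" using P_conj[OF qp(1) e(1)] by simp
    moreover have eqe: "e \<otimes> q \<otimes> e = (q \<otimes> e)\<^sup>\<star> \<otimes> (q \<otimes> e)"
    proof -
      have "(q \<otimes> e)\<^sup>\<star> \<otimes> (q \<otimes> e) = e \<otimes> (q \<otimes> q) \<otimes> e" using e qq(1,2) by (simp add: star_mult m_assoc)
      then show ?thesis by (simp add: qq(3))
    qed
    ultimately have "(q \<otimes> e)\<^sup>\<star> \<otimes> (q \<otimes> e) = \<zero>" using P_antisym star_mult_P e qq by (metis m_closed)
    then have "q \<otimes> e = \<zero>" using star_mult_zero_iff e qq by simp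
    moreover have "q \<otimes> e = q \<ominus> q \<otimes> p" unfolding e_def using pp(1) qq(1) by algebra
    ultimately show ?thesis using minus_eq_zero_iff[of q "q \<otimes> p"] pp qq by simp
  qed
  then have pq: "p \<otimes> q = q" using pp qq by (metis star_mult)
  have up: "u \<otimes> p = u"
  proof -
    have "(u \<ominus> u \<otimes> p)\<^sup>\<star> \<otimes> (u \<ominus> u \<otimes> p) = u\<^sup>\<star> \<otimes> u \<ominus> u\<^sup>\<star> \<otimes> u \<otimes> p \<ominus> p\<^sup>\<star> \<otimes> (u\<^sup>\<star> \<otimes> u) \<oplus> p\<^sup>\<star> \<otimes> (u\<^sup>\<star> \<otimes> u) \<otimes> p"
      using u(1) pp(1) by algebra
    also have "\<dots> = \<zero>" using pp by (simp add: u(2) minus_eq r_neg l_neg a_assoc)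
    finally have "u \<ominus> u \<otimes> p = \<zero>" using star_mult_zero_iff[of "u \<ominus> u \<otimes> p"] u pp by simp
    then show ?thesis using minus_eq_zero_iff[of u "u \<otimes> p"] u pp by simp
  qed
  have qu: "q \<otimes> u = u" using u up pp by (metis m_assoc star_closed)
  have pu: "p \<otimes> u = u" using pq qu pp(1) qq(1) u(1) by (metis m_assoc)
  \<comment> \<open>The defect projection of the shift u. It is nonzero, and u* r = 0 makes it
    wandering: its translates under powers of u are orthogonal.\<close>
  define r where "r = p \<ominus> q"
  have rc: "r \<in> carrier A" "r\<^sup>\<star> = r" using pp qq by (auto simp: r_def star_minus)
  have rr: "r \<otimes> r = r"
  proof -
    have "r \<otimes> r = p \<otimes> p \<ominus> p \<otimes> q \<ominus> q \<otimes> p \<oplus> q \<otimes> q" unfolding r_def using pp(1) qq(1) by algebra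
    also have "\<dots> = p \<ominus> q \<ominus> q \<oplus> q" by (simp add: pp(3) qq(3) pq \<open>q \<otimes> p = q\<close>)
    also have "\<dots> = r" unfolding r_def using pp(1) qq(1) by algebra
    finally show ?thesis .
  qed
  have r0: "r \<noteq> \<zero>" using qp(2) minus_eq_zero_iff[of p q] pp qq by (auto simp: r_def)
  have pr: "p \<otimes> r = r"
  proof -
    have "p \<otimes> r = p \<otimes> p \<ominus> p \<otimes> q" unfolding r_def using pp(1) qq(1) by algebra
    then show ?thesis by (simp add: pp pq r_def)
  qed
  have ur: "u\<^sup>\<star> \<otimes> r = \<zero>"
  proof -
    have "r \<otimes> u = p \<otimes> u \<ominus> q \<otimes> u" unfolding r_def using pp(1) qq(1) u(1) by algebra
    then have "r \<otimes> u = \<zero>" using u by (simp add: pu qu)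
    then show ?thesis using star_mult[of r u] rc u by simp
  qed
  \<comment> \<open>Only u* u = p is known, so powers of u are isometric on the range of p alone;
    that range is invariant under u.\<close>
  have shift: "p \<otimes> (u [^] k \<otimes> y) = u [^] k \<otimes> y \<and> (u [^] k)\<^sup>\<star> \<otimes> (u [^] k \<otimes> y) = y"
    if "y \<in> carrier A" "p \<otimes> y = y" for k :: nat and y using that
  proof (induction k arbitrary: y)
    case 0 then show ?case by simp
  next
    case (Suc k)
    have py: "p \<otimes> (u \<otimes> y) = u \<otimes> y" using pu pp(1) u(1) Suc(2) by (metis m_assoc)
    have eq: "u [^] Suc k \<otimes> y = u [^] k \<otimes> (u \<otimes> y)" using u Suc by (simp add: m_assoc)
    have "(u [^] Suc k)\<^sup>\<star> \<otimes> (u [^] Suc k \<otimes> y) = u\<^sup>\<star> \<otimes> ((u [^] k)\<^sup>\<star> \<otimes> (u [^] k \<otimes> (u \<otimes> y)))"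
      unfolding eq using u Suc by (simp add: star_mult m_assoc)
    also have "\<dots> = u\<^sup>\<star> \<otimes> (u \<otimes> y)" using Suc(1)[of "u \<otimes> y"] u Suc(2) py by simp
    also have "\<dots> = y" using u Suc by (simp add: m_assoc[symmetric])
    finally show ?case using Suc(1)[of "u \<otimes> y"] u Suc(2) py eq by simp
  qed
  \<comment> \<open>Each summand x* r x of h is realised as v* v by an element on its own translate
    of r. The parameters k and n are the first level used and the first free level: v = u^k z and
    (u^n)* v = 0 make v orthogonal to anything that starts at level n.\<close>
  have tower: "\<exists>v z n. v \<in> carrier A \<and> z \<in> carrier A \<and> k \<le> n \<and> v\<^sup>\<star> \<otimes> v = h \<and> p \<otimes> v = v \<and> v = u [^] k \<otimes> z \<and> (u [^] n)\<^sup>\<star> \<otimes> v = \<zero>"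
    if "h \<in> conj_sums r" for h and k :: nat using that
  proof (induction arbitrary: k rule: conj_sums.induct)
    case (conj_sums_base x)
    define v where "v = u [^] k \<otimes> (r \<otimes> x)"
    have rx: "r \<otimes> x \<in> carrier A" "p \<otimes> (r \<otimes> x) = r \<otimes> x" using rc conj_sums_base pr pp by (auto simp: m_assoc[symmetric])
    have vc: "v \<in> carrier A" using u rx by (simp add: v_def)
    have "v\<^sup>\<star> \<otimes> v = (r \<otimes> x)\<^sup>\<star> \<otimes> ((u [^] k)\<^sup>\<star> \<otimes> (u [^] k \<otimes> (r \<otimes> x)))" using u rx by (simp add: v_def star_mult m_assoc)
    also have "\<dots> = x\<^sup>\<star> \<otimes> (r \<otimes> r) \<otimes> x" using shift[OF rx] rc conj_sums_base by (simp add: star_mult m_assoc)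
    finally have "v\<^sup>\<star> \<otimes> v = x\<^sup>\<star> \<otimes> r \<otimes> x" by (simp add: rr)
    moreover have "(u [^] Suc k)\<^sup>\<star> \<otimes> v = u\<^sup>\<star> \<otimes> ((u [^] k)\<^sup>\<star> \<otimes> (u [^] k \<otimes> (r \<otimes> x)))" using u rx by (simp add: v_def star_mult m_assoc)
    moreover have "u\<^sup>\<star> \<otimes> (r \<otimes> x) = \<zero>" using ur u rc conj_sums_base by (simp add: m_assoc[symmetric])
    ultimately show ?case using shift[OF rx, of k] vc rx
      by (intro exI[of _ v] exI[of _ "r \<otimes> x"] exI[of _ "Suc k"]) (auto simp: v_def)
  next
    case (conj_sums_add h h')
    obtain v z n where 1: "v \<in> carrier A" "z \<in> carrier A" "k \<le> n" "v\<^sup>\<star> \<otimes> v = h" "p \<otimes> v = v" "v = u [^] k \<otimes> z" "(u [^] n)\<^sup>\<star> \<otimes> v = \<zero>"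
      using conj_sums_add(3) by blast
    obtain v' z' n' where 2: "v' \<in> carrier A" "z' \<in> carrier A" "n \<le> n'" "v'\<^sup>\<star> \<otimes> v' = h'" "p \<otimes> v' = v'" "v' = u [^] n \<otimes> z'" "(u [^] n')\<^sup>\<star> \<otimes> v' = \<zero>"
      using conj_sums_add(4) by blast
    have uc: "u [^] j \<in> carrier A" for j :: nat using u by simp
    have "v'\<^sup>\<star> \<otimes> v = z'\<^sup>\<star> \<otimes> ((u [^] n)\<^sup>\<star> \<otimes> v)" using 1(1) 2(2) uc by (simp add: 2(6) star_mult m_assoc)
    then have o: "v'\<^sup>\<star> \<otimes> v = \<zero>" using 1(7) 2 by simp
    then have o': "v\<^sup>\<star> \<otimes> v' = \<zero>" using star_mult[of "v'\<^sup>\<star>" v] 1 2 by simp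
    have "(v \<oplus> v')\<^sup>\<star> \<otimes> (v \<oplus> v') = v\<^sup>\<star> \<otimes> v \<oplus> v\<^sup>\<star> \<otimes> v' \<oplus> (v'\<^sup>\<star> \<otimes> v \<oplus> v'\<^sup>\<star> \<otimes> v')" using 1(1) 2(1) by algebra
    then have a: "(v \<oplus> v')\<^sup>\<star> \<otimes> (v \<oplus> v') = h \<oplus> h'" using 1(1) 2(1) by (simp add: o o' 1(4)[symmetric] 2(4)[symmetric])
    have b: "p \<otimes> (v \<oplus> v') = v \<oplus> v'" using 1(1,5) 2(1,5) pp by (simp add: r_distr)
    have "u [^] n = u [^] k \<otimes> u [^] (n - k)" using nat_pow_mult[OF u(1), of k "n - k"] 1(3) by simp
    then have c: "v \<oplus> v' = u [^] k \<otimes> (z \<oplus> u [^] (n - k) \<otimes> z')" using 1(2) 2(2) uc by (simp add: 1(6) 2(6) r_distr m_assoc)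
    have "u [^] n' = u [^] n \<otimes> u [^] (n' - n)" using nat_pow_mult[OF u(1), of n "n' - n"] 2(3) by simp
    then have "(u [^] n')\<^sup>\<star> \<otimes> v = (u [^] (n' - n))\<^sup>\<star> \<otimes> ((u [^] n)\<^sup>\<star> \<otimes> v)" using uc 1(1) by (simp add: star_mult m_assoc)
    then have "(u [^] n')\<^sup>\<star> \<otimes> v = \<zero>" using 1(7) uc by simp
    then have d: "(u [^] n')\<^sup>\<star> \<otimes> (v \<oplus> v') = \<zero>" using 2(7) 1(1) 2(1) uc by (simp add: r_distr)
    show ?case using a b c d 1 2 uc
      by (intro exI[of _ "v \<oplus> v'"] exI[of _ "z \<oplus> u [^] (n - k) \<otimes> z'"] exI[of _ n'] conjI) (auto)
  qed
  obtain h where h: "h \<in> conj_sums r" "h \<ominus> \<one> \<in> P" using simple_full[OF s rc rr r0] by blast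
  have hc: "h \<in> carrier A" using conj_sums_closed h rc by blast
  \<comment> \<open>The second element starts at the first free level of the first one, so that both
    realise h with orthogonal ranges.\<close>
  obtain v n where v: "v \<in> carrier A" "v\<^sup>\<star> \<otimes> v = h" "p \<otimes> v = v" "(u [^] (n::nat))\<^sup>\<star> \<otimes> v = \<zero>" using tower[OF h(1), of 0] by blast
  obtain w z where w: "w \<in> carrier A" "z \<in> carrier A" "w\<^sup>\<star> \<otimes> w = h" "w = u [^] n \<otimes> z" using tower[OF h(1), of n] by blast
  have "w\<^sup>\<star> \<otimes> v = z\<^sup>\<star> \<otimes> ((u [^] n)\<^sup>\<star> \<otimes> v)" using v(1) w(2) u(1) by (simp add: w(4) star_mult m_assoc)
  then have "w\<^sup>\<star> \<otimes> v = \<zero>" using v w by simp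
  then have o: "v\<^sup>\<star> \<otimes> w = \<zero>" using star_mult[of "w\<^sup>\<star>" v] v w by simp
  \<comment> \<open>Since h is at least 1, right multiplication by h^(-1/2) makes both elements
    isometries without moving their ranges out of that of p.\<close>
  obtain y where y: "y \<in> P" "y \<otimes> h \<otimes> y = \<one>" using P_inverse_sqrt[OF hc h(2)] by blast
  have yc: "y \<in> carrier A" "y\<^sup>\<star> = y" using y P_carrier P_star by auto
  have e: "(a \<otimes> y)\<^sup>\<star> \<otimes> (b \<otimes> y) = y \<otimes> (a\<^sup>\<star> \<otimes> b) \<otimes> y" if "a \<in> carrier A" "b \<in> carrier A" for a b
    using that yc by (simp add: star_mult m_assoc)
  show ?thesis
  proof (rule that)
    show "(v \<otimes> y)\<^sup>\<star> \<otimes> (v \<otimes> y) = \<one>" "(w \<otimes> y)\<^sup>\<star> \<otimes> (w \<otimes> y) = \<one>" "(v \<otimes> y)\<^sup>\<star> \<otimes> (w \<otimes> y) = \<zero>"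
      using e v w y o yc by auto
    show "p \<otimes> (v \<otimes> y) = v \<otimes> y" using v pp yc by (metis m_assoc)
  qed (use v w yc in auto)
qed

text \<open>For 0 \<le> x \<le> y with y orthogonal to g, the element g x g lies between 0 and g y g
  = 0, so x^(1/2) g = 0. The annihilator of a negative part contains the positive part and stands in
  for the hereditary subalgebra generated by it.\<close>

lemma hereditary_annihilator:
  assumes g: "g \<in> carrier A" "g\<^sup>\<star> = g"
  shows "hereditary_subalgebra A {x \<in> carrier A. g \<otimes> x = \<zero> \<and> x \<otimes> g = \<zero>}" (is "hereditary_subalgebra A ?H")
proof -
  have "nrm_closed A ?H" unfolding nrm_closed_def
  proof (intro ballI impI)
    fix x assume x: "x \<in> carrier A" and a: "\<forall>e>0. \<exists>s\<in>?H. \<parallel>x \<ominus> s\<parallel> < e"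
    have cl: "x \<in> clos ?H" using x a by (simp add: clos_def)
    have sub: "?H \<subseteq> carrier A" "{\<zero>} \<subseteq> carrier A" by auto
    have "y = \<zero>" if "y \<in> clos {\<zero>}" for y
    proof -
      have "\<parallel>y\<parallel> < e" if "0 < e" for e using closD[OF \<open>y \<in> clos {\<zero>}\<close> that] clos_carrier[OF \<open>y \<in> clos {\<zero>}\<close>] by (simp add: minus_eq)
      then have "\<parallel>y\<parallel> \<le> 0" by (meson less_irrefl not_le)
      then show ?thesis using nrm_nonneg nrm_eq_0_iff clos_carrier[OF that] by (metis order_antisym)
    qed
    moreover have "g \<otimes> x \<in> clos {\<zero>}" by (rule clos_mult_left[OF sub g(1) _ cl]) auto
    moreover have "x \<otimes> g \<in> clos {\<zero>}" by (rule clos_mult_right[OF sub g(1) _ cl]) auto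
    ultimately show "x \<in> ?H" using x by blast
  qed
  moreover have "x\<^sup>\<star> \<in> ?H" if x: "x \<in> ?H" for x
  proof -
    have c: "x \<in> carrier A" "g \<otimes> x = \<zero>" "x \<otimes> g = \<zero>" using x by auto
    have "g \<otimes> x\<^sup>\<star> = \<zero>" using star_mult[OF c(1) g(1)] c(3) g(2) by simp
    moreover have "x\<^sup>\<star> \<otimes> g = \<zero>" using star_mult[OF g(1) c(1)] c(2) g(2) by simp
    ultimately show ?thesis using c by simp
  qed
  moreover have "x \<otimes> y \<in> ?H" if x: "x \<in> ?H" "y \<in> ?H" for x y
  proof -
    have "g \<otimes> (x \<otimes> y) = \<zero>" using m_assoc[of g x y] x g by simp
    moreover have "(x \<otimes> y) \<otimes> g = x \<otimes> (y \<otimes> g)" using x g by (simp add: m_assoc)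
    ultimately show ?thesis using x g by auto
  qed
  ultimately have 1: "cstar_subalgebra A ?H"
    unfolding cstar_subalgebra_def using g by (auto simp: l_distr r_distr cscale_mult_left cscale_mult_right)
  have "x \<in> ?H" if x: "x \<in> P" and y: "y \<in> P" "y \<in> ?H" and le: "y \<ominus> x \<in> P" for x y
  proof -
    obtain k where k: "k \<in> P" "k \<otimes> k = x" using P_sqrt[OF x] by blast
    have c: "k \<in> carrier A" "k\<^sup>\<star> = k" "x \<in> carrier A" "y \<in> carrier A" using k(1) x y P_carrier P_star by auto
    have "g\<^sup>\<star> \<otimes> (y \<ominus> x) \<otimes> g = (g \<otimes> y) \<otimes> g \<ominus> g \<otimes> x \<otimes> g" unfolding g(2) using g(1) c(3,4) by algebra
    then have "\<ominus> (g \<otimes> x \<otimes> g) \<in> P" using P_conj[OF le g(1)] y g c by (simp add: minus_eq)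
    moreover have "g \<otimes> x \<otimes> g \<in> P" using P_conj[OF x g(1)] g by simp
    ultimately have "g \<otimes> x \<otimes> g = \<zero>" using P_antisym by blast
    then have "(k \<otimes> g)\<^sup>\<star> \<otimes> (k \<otimes> g) = \<zero>" using c g by (simp add: star_mult m_assoc k(2)[symmetric])
    then have kg: "k \<otimes> g = \<zero>" using star_mult_zero_iff c g by simp
    then have "x \<otimes> g = \<zero>" using c g by (simp add: m_assoc k(2)[symmetric])
    moreover have "g \<otimes> x = \<zero>" using g c P_star[OF x] star_mult[of x g] calculation by simp
    ultimately show ?thesis using c by simp
  qed
  then show ?thesis unfolding hereditary_subalgebra_def pos_elems_eq_P cle_iff using 1 by blast
qed

text \<open>Let f and g be the positive and negative parts of b - (1 - \<epsilon>); f is nonzero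
  because b has norm 1. The annihilator of g then contains an infinite projection p, and an isometry
  v with p v = v satisfies g v = 0. So v* b v - (1 - \<epsilon>) = v* f v is positive, while v* b v
  \<le> 1.\<close>

lemma purely_infinite_isometry:
  assumes s: "simple_cstar A" and pi: "purely_infinite A" and b: "b \<in> P" "\<parallel>b\<parallel> = 1" and \<epsilon>: "0 < \<epsilon>" "\<epsilon> < 1"
  obtains v where "v \<in> carrier A" "v\<^sup>\<star> \<otimes> v = \<one>" "\<parallel>v\<^sup>\<star> \<otimes> b \<otimes> v \<ominus> \<one>\<parallel> \<le> \<epsilon>"
proof -
  have bc: "b \<in> carrier A" "b\<^sup>\<star> = b" using b P_carrier P_star by auto
  define c where "c = sc (of_real (1 - \<epsilon>))"
  have cc: "c \<in> carrier A" "c\<^sup>\<star> = c" by (auto simp: c_def star_sc)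
  obtain f g where fg: "f \<in> P" "g \<in> P" "b \<ominus> c = f \<ominus> g" "f \<otimes> g = \<zero>" "g \<otimes> f = \<zero>"
    using jordan_decomposition[of "b \<ominus> c"] bc cc by (auto simp: star_minus)
  have fgc: "f \<in> carrier A" "g \<in> carrier A" "g\<^sup>\<star> = g" using fg P_carrier P_star by auto
  let ?H = "{x \<in> carrier A. g \<otimes> x = \<zero> \<and> x \<otimes> g = \<zero>}"
  have "f \<noteq> \<zero>"
  proof
    assume "f = \<zero>"
    then have "c \<ominus> b = g" using fg(3) fgc bc cc a_inv_minus[of b c] by (simp add: minus_eq)
    then have "\<parallel>b\<parallel> \<le> 1 - \<epsilon>" using P_dominated[OF b(1), of "1 - \<epsilon>"] fg(2) \<epsilon> by (simp add: c_def)
    then show False using b \<epsilon> by simp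
  qed
  then have "?H \<noteq> {\<zero>}" using fg fgc by blast
  then obtain p where p: "p \<in> ?H" "infinite_projection A p"
    using pi hereditary_annihilator[OF fgc(2,3)] unfolding purely_infinite_def by blast
  have pp: "p \<in> carrier A" "p\<^sup>\<star> = p" "g \<otimes> p = \<zero>" using p by (auto simp: infinite_projection_def projections_def)
  obtain v where v: "v \<in> carrier A" "v\<^sup>\<star> \<otimes> v = \<one>" "p \<otimes> v = v"
    using infinite_projection_isometries[OF s p(2)] by blast
  have gv: "g \<otimes> v = \<zero>" using v pp fgc by (metis l_null m_assoc)
  have "v\<^sup>\<star> \<otimes> (b \<ominus> c) \<otimes> v = v\<^sup>\<star> \<otimes> f \<otimes> v \<ominus> v\<^sup>\<star> \<otimes> (g \<otimes> v)" unfolding fg(3) using v(1) fgc(1,2) by algebra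
  also have "\<dots> = v\<^sup>\<star> \<otimes> f \<otimes> v" using gv v fgc by (simp add: minus_eq)
  finally have 1: "v\<^sup>\<star> \<otimes> (b \<ominus> c) \<otimes> v \<in> P" using P_conj[OF fg(1) v(1)] by simp
  have "v\<^sup>\<star> \<otimes> (b \<ominus> c) \<otimes> v = v\<^sup>\<star> \<otimes> b \<otimes> v \<ominus> v\<^sup>\<star> \<otimes> (c \<otimes> v)" using v(1) bc(1) cc(1) by algebra
  also have "v\<^sup>\<star> \<otimes> (c \<otimes> v) = c" using v by (simp add: c_def sc_mult_left cscale_mult_right) (simp add: sc_def)
  finally have 1: "v\<^sup>\<star> \<otimes> b \<otimes> v \<ominus> c \<in> P" using 1 by simp
  define h where "h = \<one> \<ominus> v\<^sup>\<star> \<otimes> b \<otimes> v"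
  have hc: "h \<in> carrier A" using v bc by (simp add: h_def)
  have "\<one> \<ominus> b \<in> P" using P_self_adjoint_ball[of b 1] bc b by simp
  moreover have "v\<^sup>\<star> \<otimes> (\<one> \<ominus> b) \<otimes> v = h"
  proof -
    have "v\<^sup>\<star> \<otimes> (\<one> \<ominus> b) \<otimes> v = v\<^sup>\<star> \<otimes> v \<ominus> v\<^sup>\<star> \<otimes> b \<otimes> v" using v(1) bc(1) by algebra
    then show ?thesis by (simp add: v(2) h_def)
  qed
  ultimately have hP: "h \<in> P" using P_conj v by metis
  have "sc (of_real \<epsilon>) \<ominus> h = v\<^sup>\<star> \<otimes> b \<otimes> v \<ominus> (\<one> \<ominus> sc (of_real \<epsilon>))" unfolding h_def using v(1) bc(1) sc_closed[of "of_real \<epsilon>"] by algebra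
  also have "\<one> \<ominus> sc (of_real \<epsilon>) = c" using sc_diff[of 1 "of_real \<epsilon>"] by (simp add: c_def)
  finally have "\<parallel>h\<parallel> \<le> \<epsilon>" using P_dominated[OF hP] 1 \<epsilon> by simp
  then have "\<parallel>v\<^sup>\<star> \<otimes> b \<otimes> v \<ominus> \<one>\<parallel> \<le> \<epsilon>" using nrm_minus_commute[of \<one> "v\<^sup>\<star> \<otimes> b \<otimes> v"] v bc by (simp add: h_def)
  then show ?thesis using that v by blast
qed

end

section \<open>Ultrapowers\<close>

definition ultrafilter :: "'i filter \<Rightarrow> bool" where
  "ultrafilter \<omega> \<longleftrightarrow> \<omega> \<noteq> bot \<and> (\<forall>P. eventually P \<omega> \<or> eventually (\<lambda>i. \<not> P i) \<omega>)"

text \<open>Zorn's lemma for the reversed order, since smaller filters are finer. A minimal proper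
  filter is an ultrafilter: its restriction to the set where P holds is either improper or the
  filter itself.\<close>

lemma ultrafilter_below:
  fixes F :: "'i filter"
  assumes "F \<noteq> bot"
  obtains \<omega> where "ultrafilter \<omega>" "\<omega> \<le> F"
proof -
  define \<F> where "\<F> = {G. G \<le> F \<and> G \<noteq> bot}"
  have "\<exists>m\<in>\<F>. \<forall>a\<in>\<F>. a \<le> m \<longrightarrow> a = m"
  proof (rule predicate_Zorn[where P = "\<lambda>a b. b \<le> a"])
    show "partial_order_on \<F> (relation_of (\<lambda>a b. b \<le> a) \<F>)"
      by (auto simp: partial_order_on_def preorder_on_def refl_on_def trans_def antisym_def relation_of_def)
    fix C assume C: "C \<in> Chains (relation_of (\<lambda>a b. b \<le> a) \<F>)"
    then have CF: "C \<subseteq> \<F>" and tot: "\<And>a b. a \<in> C \<Longrightarrow> b \<in> C \<Longrightarrow> a \<le> b \<or> b \<le> a"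
      by (auto simp: Chains_def relation_of_def)
    show "\<exists>u\<in>\<F>. \<forall>a\<in>C. u \<le> a"
    proof (cases "C = {}")
      case True then show ?thesis using assms by (auto simp: \<F>_def)
    next
      case False
      have fin: "Inf X \<in> C" if "finite X" "X \<noteq> {}" "X \<subseteq> C" for X using that
      proof (induction rule: finite_ne_induct)
        case (insert x X)
        then have "x \<in> C" "Inf X \<in> C" by auto
        then show ?case using tot[of x "Inf X"] by (auto simp: inf_absorb1 inf_absorb2)
      qed simp
      have "Inf C \<noteq> bot"
      proof (rule Inf_filter_not_bot)
        fix X assume X: "X \<subseteq> C" "finite X"
        show "Inf X \<noteq> bot"
        proof (cases "X = {}")
          case True
          show ?thesis
          proof
            assume "Inf X = bot"
            then have "F \<le> bot" using True top_greatest[of F] by simp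
            then show False using assms by (simp add: bot_unique)
          qed
        next
          case False then show ?thesis using fin[OF X(2) False X(1)] CF by (auto simp: \<F>_def)
        qed
      qed
      moreover have "Inf C \<le> F" using False CF by (auto simp: \<F>_def intro: Inf_lower2)
      ultimately show ?thesis by (intro bexI[of _ "Inf C"]) (auto simp: \<F>_def intro: Inf_lower)
    qed
  qed
  then obtain \<omega> where \<omega>: "\<omega> \<in> \<F>" "\<And>a. a \<in> \<F> \<Longrightarrow> a \<le> \<omega> \<Longrightarrow> a = \<omega>" by blast
  have "eventually P \<omega> \<or> eventually (\<lambda>i. \<not> P i) \<omega>" for P
  proof (cases "inf \<omega> (principal {i. P i}) = bot")
    case True
    then have "eventually (\<lambda>_. False) (inf \<omega> (principal {i. P i}))" by simp
    then show ?thesis unfolding eventually_inf_principal by simp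
  next
    case False
    then have "inf \<omega> (principal {i. P i}) = \<omega>" using \<omega> by (intro \<omega>(2)) (auto simp: \<F>_def intro: le_infI1)
    then have "eventually P \<omega>" using eventually_inf_principal[of P \<omega> "{i. P i}"] by simp
    then show ?thesis by simp
  qed
  then show ?thesis using that[of \<omega>] \<omega>(1) by (auto simp: \<F>_def ultrafilter_def)
qed

text \<open>The limit is the supremum of the numbers that are eventually lower bounds; an
  ultrafilter decides each inequality.\<close>

lemma ultrafilter_bounded_limit:
  fixes f :: "'i \<Rightarrow> real"
  assumes u: "ultrafilter \<omega>" and b: "\<And>i. \<bar>f i\<bar> \<le> M"
  obtains l where "(f \<longlongrightarrow> l) \<omega>"
proof -
  define T where "T = {x. eventually (\<lambda>i. x \<le> f i) \<omega>}"
  have nb: "\<omega> \<noteq> bot" using u by (simp add: ultrafilter_def)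
  have "eventually (\<lambda>i. - M \<le> f i) \<omega>" using b by (auto intro!: always_eventually simp: abs_le_iff) (metis minus_le_iff)
  then have ne: "T \<noteq> {}" by (auto simp: T_def)
  have "x \<le> M" if "x \<in> T" for x
  proof -
    obtain i where "x \<le> f i" using \<open>x \<in> T\<close> eventually_happens'[OF nb] by (auto simp: T_def)
    then show ?thesis using b[of i] by simp
  qed
  then have bdd: "bdd_above T" by (rule bdd_aboveI)
  have "(f \<longlongrightarrow> Sup T) \<omega>"
  proof (rule order_tendstoI)
    fix a assume "a < Sup T"
    then obtain x where "x \<in> T" "a < x" using less_cSup_iff[OF ne bdd] by blast
    then show "eventually (\<lambda>i. a < f i) \<omega>" by (auto simp: T_def elim: eventually_mono)
  next
    fix a assume a: "Sup T < a"
    then have "a \<notin> T" using cSup_upper[OF _ bdd] by (meson not_le)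
    then show "eventually (\<lambda>i. f i < a) \<omega>" using u by (auto simp: T_def ultrafilter_def not_le)
  qed
  then show ?thesis using that by blast
qed

lemma ultrafilter_bounded_limit_complex:
  fixes f :: "'i \<Rightarrow> complex"
  assumes u: "ultrafilter \<omega>" and b: "\<And>i. cmod (f i) \<le> M"
  obtains l where "(f \<longlongrightarrow> l) \<omega>"
proof -
  obtain x where x: "((\<lambda>i. Re (f i)) \<longlongrightarrow> x) \<omega>"
    by (rule ultrafilter_bounded_limit[OF u, of "\<lambda>i. Re (f i)" M]) (use b abs_Re_le_cmod order_trans in blast)+
  obtain y where y: "((\<lambda>i. Im (f i)) \<longlongrightarrow> y) \<omega>"
    by (rule ultrafilter_bounded_limit[OF u, of "\<lambda>i. Im (f i)" M]) (use b abs_Im_le_cmod order_trans in blast)+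
  have "((\<lambda>i. Complex (Re (f i)) (Im (f i))) \<longlongrightarrow> Complex x y) \<omega>" using x y by (rule tendsto_Complex)
  then show ?thesis using that by simp
qed

locale ultra = cstar_algebra A for A :: "'a cstar" (structure) +
  fixes \<omega> :: "'i filter"
  assumes ultrafilter: "ultrafilter \<omega>"
begin

lemma \<omega>_nonbot [simp]: "\<omega> \<noteq> bot"
  using ultrafilter unfolding ultrafilter_def by (rule conjunct1)

definition bdd :: "('i \<Rightarrow> 'a) set" where
  "bdd = {f. (\<forall>i. f i \<in> carrier A) \<and> (\<exists>M. \<forall>i. \<parallel>f i\<parallel> \<le> M)}"

text \<open>The coset of f in the ultrapower, described by convergence instead of translates of the
  null ideal. All operations of the quotient are transferred to representatives in this
  form.\<close>

definition cl :: "('i \<Rightarrow> 'a) \<Rightarrow> ('i \<Rightarrow> 'a) set" where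
  "cl f = {g \<in> bdd. ((\<lambda>i. \<parallel>g i \<ominus> f i\<parallel>) \<longlongrightarrow> 0) \<omega>}"

lemma bdd_carrier [simp]: "f \<in> bdd \<Longrightarrow> f i \<in> carrier A" by (simp add: bdd_def)

lemma bddI: "\<lbrakk>\<And>i. f i \<in> carrier A; \<And>i. \<parallel>f i\<parallel> \<le> M\<rbrakk> \<Longrightarrow> f \<in> bdd"
  unfolding bdd_def by blast

lemma bdd_bound: assumes "f \<in> bdd" shows "\<exists>M\<ge>0. \<forall>i. \<parallel>f i\<parallel> \<le> M"
proof -
  obtain M where M: "\<forall>i. \<parallel>f i\<parallel> \<le> M" using assms unfolding bdd_def by blast
  have "0 \<le> \<parallel>f undefined\<parallel>" using nrm_nonneg assms by simp
  also have "\<dots> \<le> M" using M by blast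
  finally show ?thesis using M by blast
qed

lemma bdd_add: assumes "f \<in> bdd" "g \<in> bdd" shows "(\<lambda>i. f i \<oplus> g i) \<in> bdd"
proof -
  obtain M K where "\<forall>i. \<parallel>f i\<parallel> \<le> M" "\<forall>i. \<parallel>g i\<parallel> \<le> K" using bdd_bound assms by meson
  then show ?thesis using assms by (intro bddI[of _ "M + K"] nrm_add_le) auto
qed

lemma bdd_mult: assumes "f \<in> bdd" "g \<in> bdd" shows "(\<lambda>i. f i \<otimes> g i) \<in> bdd"
proof -
  obtain M K where "\<forall>i. \<parallel>f i\<parallel> \<le> M" "\<forall>i. \<parallel>g i\<parallel> \<le> K" using bdd_bound assms by meson
  then show ?thesis using assms by (intro bddI[of _ "M * K"] nrm_mult_le) auto
qed

lemma bdd_cscale: assumes "f \<in> bdd" shows "(\<lambda>i. c \<cdot> f i) \<in> bdd"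
proof -
  obtain M where "\<forall>i. \<parallel>f i\<parallel> \<le> M" using bdd_bound assms by meson
  then show ?thesis using assms by (intro bddI[of _ "cmod c * M"]) (auto simp: nrm_cscale mult_left_mono)
qed

lemma bdd_star: assumes "f \<in> bdd" shows "(\<lambda>i. (f i)\<^sup>\<star>) \<in> bdd"
proof -
  obtain M where "\<forall>i. \<parallel>f i\<parallel> \<le> M" using bdd_bound assms by meson
  then show ?thesis using assms by (intro bddI[of _ M]) auto
qed

lemma bdd_const: "x \<in> carrier A \<Longrightarrow> (\<lambda>i. x) \<in> bdd"
  by (rule bddI[of _ "\<parallel>x\<parallel>"]) auto

lemma bdd_minus: "f \<in> bdd \<Longrightarrow> g \<in> bdd \<Longrightarrow> (\<lambda>i. f i \<ominus> g i) \<in> bdd"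
  using bdd_add[OF _ bdd_cscale[of g "-1"], of f] by (simp add: minus_cscale)

lemma tendsto_0_squeeze:
  assumes "(g \<longlongrightarrow> 0) \<omega>" "\<And>i. 0 \<le> f i" "\<And>i. f i \<le> (g i :: real)" shows "(f \<longlongrightarrow> 0) \<omega>"
  by (rule tendsto_sandwich[of "\<lambda>_. 0" _ _ g]) (use assms in auto)

lemma carrier_ell_infty: "carrier (ell_infty A) = bdd" by (simp add: ell_infty_def bdd_def del: bdd_carrier)

lemma ultra_class_eq: assumes f: "f \<in> bdd" shows "ultra_class A \<omega> f = cl f"
proof -
  have "ultra_class A \<omega> f = {\<lambda>i. h i \<oplus> f i | h. h \<in> bdd \<and> ((\<lambda>i. \<parallel>h i\<parallel>) \<longlongrightarrow> 0) \<omega>}"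
    unfolding ultra_class_def a_r_coset_def' ultra_null_def carrier_ell_infty by (auto simp: ell_infty_def)
  also have "\<dots> = cl f"
  proof (intro subset_antisym subsetI)
    fix g assume "g \<in> {\<lambda>i. h i \<oplus> f i | h. h \<in> bdd \<and> ((\<lambda>i. \<parallel>h i\<parallel>) \<longlongrightarrow> 0) \<omega>}"
    then obtain h where h: "g = (\<lambda>i. h i \<oplus> f i)" "h \<in> bdd" "((\<lambda>i. \<parallel>h i\<parallel>) \<longlongrightarrow> 0) \<omega>" by blast
    have "h i \<oplus> f i \<ominus> f i = h i" for i using bdd_carrier[OF f, of i] bdd_carrier[OF h(2), of i] by algebra
    then show "g \<in> cl f" using h f bdd_add by (simp add: cl_def)
  next
    fix g assume g: "g \<in> cl f"
    then have gb: "g \<in> bdd" by (simp add: cl_def)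
    have "(g i \<ominus> f i) \<oplus> f i = g i" for i using bdd_carrier[OF f, of i] bdd_carrier[OF gb, of i] by algebra
    then have "g = (\<lambda>i. (g i \<ominus> f i) \<oplus> f i)" by auto
    then show "g \<in> {\<lambda>i. h i \<oplus> f i | h. h \<in> bdd \<and> ((\<lambda>i. \<parallel>h i\<parallel>) \<longlongrightarrow> 0) \<omega>}"
      using g bdd_minus[OF gb f] unfolding cl_def by (intro CollectI exI[of _ "\<lambda>i. g i \<ominus> f i"]) auto
  qed
  finally show ?thesis .
qed

lemma cl_self: "f \<in> bdd \<Longrightarrow> f \<in> cl f" by (simp add: cl_def)

lemma cl_bdd: "g \<in> cl f \<Longrightarrow> g \<in> bdd" by (simp add: cl_def)

lemma cl_eq_iff: assumes f: "f \<in> bdd" and g: "g \<in> bdd"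
  shows "cl f = cl g \<longleftrightarrow> ((\<lambda>i. \<parallel>f i \<ominus> g i\<parallel>) \<longlongrightarrow> 0) \<omega>"
proof
  assume "cl f = cl g" then show "((\<lambda>i. \<parallel>f i \<ominus> g i\<parallel>) \<longlongrightarrow> 0) \<omega>" using cl_self[OF f] by (simp add: cl_def)
next
  assume fg: "((\<lambda>i. \<parallel>f i \<ominus> g i\<parallel>) \<longlongrightarrow> 0) \<omega>"
  have step: "((\<lambda>i. \<parallel>h i \<ominus> b i\<parallel>) \<longlongrightarrow> 0) \<omega>"
    if "((\<lambda>i. \<parallel>h i \<ominus> a i\<parallel>) \<longlongrightarrow> 0) \<omega>" "((\<lambda>i. \<parallel>a i \<ominus> b i\<parallel>) \<longlongrightarrow> 0) \<omega>" "h \<in> bdd" "a \<in> bdd" "b \<in> bdd" for h a b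
    by (rule tendsto_0_squeeze[where g = "\<lambda>i. \<parallel>h i \<ominus> a i\<parallel> + \<parallel>a i \<ominus> b i\<parallel>"])
      (use tendsto_add[OF that(1,2)] that nrm_nonneg nrm_minus_triangle in auto)
  have gf: "((\<lambda>i. \<parallel>g i \<ominus> f i\<parallel>) \<longlongrightarrow> 0) \<omega>" using fg f g by (simp add: nrm_minus_commute)
  show "cl f = cl g" unfolding cl_def using step fg gf f g by blast
qed

lemma cl_eqI: "g \<in> cl f \<Longrightarrow> f \<in> bdd \<Longrightarrow> cl g = cl f"
  using cl_eq_iff[of g f] by (auto simp: cl_def)

abbreviation Q where "Q \<equiv> ultrapower A \<omega>"

lemma ultra_null_eq_cl: "ultra_null A \<omega> = cl (\<lambda>i. \<zero>)"
  unfolding ultra_null_def carrier_ell_infty cl_def by (auto simp: minus_eq)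

lemma Q_carrier: "carrier Q = cl ` bdd"
proof -
  have "carrier Q = (\<Union>f\<in>bdd. {ultra_class A \<omega> f})"
    unfolding ultrapower_def cstar_quotient_def ring.defs FactRing_def A_RCOSETS_def' ultra_class_def
    by (simp add: carrier_ell_infty)
  then show ?thesis using ultra_class_eq by auto
qed

lemma Q_zero: "\<zero>\<^bsub>Q\<^esub> = cl (\<lambda>i. \<zero>)"
  unfolding ultrapower_def cstar_quotient_def ring.defs FactRing_def by (simp add: ultra_null_eq_cl)

lemma Q_one: "\<one>\<^bsub>Q\<^esub> = cl (\<lambda>i. \<one>)"
proof -
  have "\<one>\<^bsub>Q\<^esub> = ultra_class A \<omega> (\<lambda>i. \<one>)"
    unfolding ultrapower_def cstar_quotient_def ring.defs FactRing_def ultra_class_def by (simp add: ell_infty_def)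
  then show ?thesis using ultra_class_eq bdd_const by simp
qed

lemma Q_mult: assumes f: "f \<in> bdd" and g: "g \<in> bdd" shows "cl f \<otimes>\<^bsub>Q\<^esub> cl g = cl (\<lambda>i. f i \<otimes> g i)"
proof -
  have eq: "cl (\<lambda>i. a i \<otimes> b i) = cl (\<lambda>i. f i \<otimes> g i)" if ab: "a \<in> cl f" "b \<in> cl g" for a b
  proof -
    have bd: "a \<in> bdd" "b \<in> bdd" using ab cl_bdd by auto
    obtain M where M: "\<forall>i. \<parallel>a i\<parallel> \<le> M" "0 \<le> M" using bdd_bound bd by meson
    obtain K where K: "\<forall>i. \<parallel>g i\<parallel> \<le> K" "0 \<le> K" using bdd_bound g by meson
    have "((\<lambda>i. \<parallel>a i \<otimes> b i \<ominus> f i \<otimes> g i\<parallel>) \<longlongrightarrow> 0) \<omega>"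
    proof (rule tendsto_0_squeeze)
      show "((\<lambda>i. M * \<parallel>b i \<ominus> g i\<parallel> + \<parallel>a i \<ominus> f i\<parallel> * K) \<longlongrightarrow> 0) \<omega>"
        using ab unfolding cl_def by (auto intro!: tendsto_eq_intros)
      fix i
      have e: "a i \<otimes> b i \<ominus> f i \<otimes> g i = a i \<otimes> (b i \<ominus> g i) \<oplus> (a i \<ominus> f i) \<otimes> g i"
        using bd[THEN bdd_carrier, of i] f[THEN bdd_carrier, of i] g[THEN bdd_carrier, of i] by algebra
      show "\<parallel>a i \<otimes> b i \<ominus> f i \<otimes> g i\<parallel> \<le> M * \<parallel>b i \<ominus> g i\<parallel> + \<parallel>a i \<ominus> f i\<parallel> * K"
        unfolding e using bd f g M K by (intro nrm_add_le nrm_mult_le) auto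
    qed (use bd f g nrm_nonneg in auto)
    then show ?thesis using cl_eq_iff bdd_mult bd f g by simp
  qed
  have "cl f \<otimes>\<^bsub>Q\<^esub> cl g = (\<Union>a\<in>cl f. \<Union>b\<in>cl g. ultra_class A \<omega> (\<lambda>i. a i \<otimes> b i))"
    unfolding ultrapower_def cstar_quotient_def ring.defs FactRing_def rcoset_mult_def ultra_class_def by (simp add: ell_infty_def)
  also have "\<dots> = (\<Union>a\<in>cl f. \<Union>b\<in>cl g. cl (\<lambda>i. f i \<otimes> g i))"
    by (intro SUP_cong refl) (use eq ultra_class_eq bdd_mult cl_bdd in auto)
  also have "\<dots> = cl (\<lambda>i. f i \<otimes> g i)" using cl_self f g by blast
  finally show ?thesis .
qed

lemma Q_add: assumes f: "f \<in> bdd" and g: "g \<in> bdd" shows "cl f \<oplus>\<^bsub>Q\<^esub> cl g = cl (\<lambda>i. f i \<oplus> g i)"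
proof -
  have "cl f \<oplus>\<^bsub>Q\<^esub> cl g = (\<Union>a\<in>cl f. \<Union>b\<in>cl g. {\<lambda>i. a i \<oplus> b i})"
    unfolding ultrapower_def cstar_quotient_def ring.defs FactRing_def set_add_def' by (simp add: ell_infty_def)
  also have "\<dots> = cl (\<lambda>i. f i \<oplus> g i)"
  proof (intro subset_antisym subsetI)
    fix h assume "h \<in> (\<Union>a\<in>cl f. \<Union>b\<in>cl g. {\<lambda>i. a i \<oplus> b i})"
    then obtain a b where ab: "a \<in> cl f" "b \<in> cl g" "h = (\<lambda>i. a i \<oplus> b i)" by blast
    have bd: "a \<in> bdd" "b \<in> bdd" using ab cl_bdd by auto
    have "((\<lambda>i. \<parallel>a i \<oplus> b i \<ominus> (f i \<oplus> g i)\<parallel>) \<longlongrightarrow> 0) \<omega>"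
    proof (rule tendsto_0_squeeze)
      show "((\<lambda>i. \<parallel>a i \<ominus> f i\<parallel> + \<parallel>b i \<ominus> g i\<parallel>) \<longlongrightarrow> 0) \<omega>"
        using ab unfolding cl_def by (auto intro!: tendsto_eq_intros)
      fix i
      have e: "a i \<oplus> b i \<ominus> (f i \<oplus> g i) = (a i \<ominus> f i) \<oplus> (b i \<ominus> g i)"
        using bd[THEN bdd_carrier, of i] f[THEN bdd_carrier, of i] g[THEN bdd_carrier, of i] by algebra
      show "\<parallel>a i \<oplus> b i \<ominus> (f i \<oplus> g i)\<parallel> \<le> \<parallel>a i \<ominus> f i\<parallel> + \<parallel>b i \<ominus> g i\<parallel>"
        unfolding e using bd f g by (intro nrm_add_le) auto
    qed (use bd f g nrm_nonneg in auto)
    then show "h \<in> cl (\<lambda>i. f i \<oplus> g i)" using ab bd bdd_add by (simp add: cl_def)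
  next
    fix h assume h: "h \<in> cl (\<lambda>i. f i \<oplus> g i)"
    have hb: "h \<in> bdd" using h cl_bdd by blast
    have e: "(h i \<ominus> g i) \<ominus> f i = h i \<ominus> (f i \<oplus> g i)" "(h i \<ominus> g i) \<oplus> g i = h i" for i
      using hb[THEN bdd_carrier, of i] f[THEN bdd_carrier, of i] g[THEN bdd_carrier, of i] by algebra+
    have "(\<lambda>i. h i \<ominus> g i) \<in> cl f" using h bdd_minus[OF hb g] e(1) by (simp add: cl_def)
    moreover have "h = (\<lambda>i. (h i \<ominus> g i) \<oplus> g i)" using e(2) by simp
    ultimately show "h \<in> (\<Union>a\<in>cl f. \<Union>b\<in>cl g. {\<lambda>i. a i \<oplus> b i})" using cl_self[OF g] by blast
  qed
  finally show ?thesis .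
qed

lemma Q_cscale: assumes f: "f \<in> bdd" shows "cscale Q c (cl f) = cl (\<lambda>i. c \<cdot> f i)"
proof -
  have "cscale Q c (cl f) = (\<Union>n\<in>cl (\<lambda>i. \<zero>). \<Union>b\<in>cl f. {\<lambda>i. n i \<oplus> c \<cdot> b i})"
    unfolding ultrapower_def cstar_quotient_def ring.defs cstar.defs set_add_def' ultra_null_eq_cl by (simp add: ell_infty_def)
  also have "\<dots> = cl (\<lambda>i. c \<cdot> f i)"
  proof (intro subset_antisym subsetI)
    fix h assume "h \<in> (\<Union>n\<in>cl (\<lambda>i. \<zero>). \<Union>b\<in>cl f. {\<lambda>i. n i \<oplus> c \<cdot> b i})"
    then obtain n b where ab: "n \<in> cl (\<lambda>i. \<zero>)" "b \<in> cl f" "h = (\<lambda>i. n i \<oplus> c \<cdot> b i)" by blast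
    have bd: "n \<in> bdd" "b \<in> bdd" using ab cl_bdd by auto
    have "((\<lambda>i. \<parallel>n i \<oplus> c \<cdot> b i \<ominus> c \<cdot> f i\<parallel>) \<longlongrightarrow> 0) \<omega>"
    proof (rule tendsto_0_squeeze)
      show "((\<lambda>i. \<parallel>n i \<ominus> \<zero>\<parallel> + cmod c * \<parallel>b i \<ominus> f i\<parallel>) \<longlongrightarrow> 0) \<omega>"
        using ab unfolding cl_def by (auto intro!: tendsto_eq_intros)
      fix i
      have e: "n i \<oplus> c \<cdot> b i \<ominus> c \<cdot> f i = (n i \<ominus> \<zero>) \<oplus> c \<cdot> (b i \<ominus> f i)"
        using bd[THEN bdd_carrier, of i] f[THEN bdd_carrier, of i] by (simp add: cscale_minus_right) (simp add: minus_eq a_assoc)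
      show "\<parallel>n i \<oplus> c \<cdot> b i \<ominus> c \<cdot> f i\<parallel> \<le> \<parallel>n i \<ominus> \<zero>\<parallel> + cmod c * \<parallel>b i \<ominus> f i\<parallel>"
        unfolding e using bd f by (intro nrm_add_le) (auto simp: nrm_cscale)
    qed (use bd f nrm_nonneg in auto)
    then show "h \<in> cl (\<lambda>i. c \<cdot> f i)" using ab bd bdd_add bdd_cscale by (simp add: cl_def)
  next
    fix h assume h: "h \<in> cl (\<lambda>i. c \<cdot> f i)"
    have hb: "h \<in> bdd" using h cl_bdd by blast
    have e: "(h i \<ominus> c \<cdot> f i) \<ominus> \<zero> = h i \<ominus> c \<cdot> f i" "(h i \<ominus> c \<cdot> f i) \<oplus> c \<cdot> f i = h i" for i
      using hb[THEN bdd_carrier, of i] cscale_closed[OF f[THEN bdd_carrier, of i], of c] by algebra+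
    have "(\<lambda>i. h i \<ominus> c \<cdot> f i) \<in> cl (\<lambda>i. \<zero>)" using h bdd_minus[OF hb bdd_cscale[OF f]] e(1) by (simp add: cl_def)
    moreover have "h = (\<lambda>i. (h i \<ominus> c \<cdot> f i) \<oplus> c \<cdot> f i)" using e(2) by simp
    ultimately show "h \<in> (\<Union>n\<in>cl (\<lambda>i. \<zero>). \<Union>b\<in>cl f. {\<lambda>i. n i \<oplus> c \<cdot> b i})" using cl_self[OF f] by blast
  qed
  finally show ?thesis .
qed

lemma Q_star: assumes f: "f \<in> bdd" shows "star Q (cl f) = cl (\<lambda>i. (f i)\<^sup>\<star>)"
proof -
  have "star Q (cl f) = (\<lambda>g i. (g i)\<^sup>\<star>) ` cl f"
    unfolding ultrapower_def cstar_quotient_def ring.defs cstar.defs by (simp add: ell_infty_def)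
  also have "\<dots> = cl (\<lambda>i. (f i)\<^sup>\<star>)"
  proof -
    have st: "(\<lambda>i. (g i)\<^sup>\<star>) \<in> cl (\<lambda>i. (h i)\<^sup>\<star>)" if "g \<in> cl h" "h \<in> bdd" for g h
    proof -
      have "\<parallel>(g i)\<^sup>\<star> \<ominus> (h i)\<^sup>\<star>\<parallel> = \<parallel>g i \<ominus> h i\<parallel>" for i
        using nrm_star[of "g i \<ominus> h i"] that cl_bdd by (simp add: star_minus)
      then show ?thesis using that bdd_star by (auto simp: cl_def)
    qed
    show ?thesis
    proof (intro subset_antisym subsetI)
      fix h assume "h \<in> (\<lambda>g i. (g i)\<^sup>\<star>) ` cl f" then show "h \<in> cl (\<lambda>i. (f i)\<^sup>\<star>)" using st f by blast
    next
      fix h assume h: "h \<in> cl (\<lambda>i. (f i)\<^sup>\<star>)"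
      have "(\<lambda>i. (h i)\<^sup>\<star>) \<in> cl f" using st[OF h bdd_star[OF f]] f by simp
      moreover have "h = (\<lambda>i. ((h i)\<^sup>\<star>)\<^sup>\<star>)" using cl_bdd[OF h] by simp
      ultimately show "h \<in> (\<lambda>g i. (g i)\<^sup>\<star>) ` cl f" by (intro image_eqI[of _ _ "\<lambda>i. (h i)\<^sup>\<star>"])
    qed
  qed
  finally show ?thesis .
qed

lemma nrm_limit: assumes "f \<in> bdd" obtains l where "((\<lambda>i. \<parallel>f i\<parallel>) \<longlongrightarrow> l) \<omega>"
proof -
  obtain M where M: "\<forall>i. \<parallel>f i\<parallel> \<le> M" using bdd_bound assms by meson
  have "\<bar>\<parallel>f i\<parallel>\<bar> \<le> M" for i using M nrm_nonneg[of "f i"] assms by simp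
  then show ?thesis using ultrafilter_bounded_limit[OF ultrafilter, of "\<lambda>i. \<parallel>f i\<parallel>" M] that by blast
qed

text \<open>Replacing f by 0 where its norm is at least r changes nothing along the ultrafilter, and
  the bound r then holds at every index.\<close>

lemma cl_truncate:
  assumes f: "f \<in> bdd" and l: "((\<lambda>i. \<parallel>f i\<parallel>) \<longlongrightarrow> l) \<omega>" and r: "l < r"
  obtains g where "g \<in> cl f" "\<And>i. \<parallel>g i\<parallel> \<le> r"
proof -
  define g where "g i = (if \<parallel>f i\<parallel> < r then f i else \<zero>)" for i
  have "0 \<le> l" using l by (rule tendsto_lowerbound) (use f nrm_nonneg in auto)
  then have g: "\<And>i. \<parallel>g i\<parallel> \<le> r" using r by (auto simp: g_def)
  then have gb: "g \<in> bdd" using f by (intro bddI[of _ r]) (auto simp: g_def)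
  have "eventually (\<lambda>i. \<parallel>g i \<ominus> f i\<parallel> = 0) \<omega>"
    using order_tendstoD(2)[OF l r] by (rule eventually_mono) (use f in \<open>simp add: g_def\<close>)
  then have "((\<lambda>i. \<parallel>g i \<ominus> f i\<parallel>) \<longlongrightarrow> 0) \<omega>" by (rule tendsto_eventually)
  then show ?thesis using that g gb by (simp add: cl_def)
qed

text \<open>The infimum in the quotient norm is the limit of the pointwise norms: no representative
  has a smaller supremum, and truncation comes arbitrarily close.\<close>

lemma Q_nrm:
  assumes f: "f \<in> bdd" shows "((\<lambda>i. \<parallel>f i\<parallel>) \<longlongrightarrow> nrm Q (cl f)) \<omega>"
proof -
  obtain l where l: "((\<lambda>i. \<parallel>f i\<parallel>) \<longlongrightarrow> l) \<omega>" using nrm_limit[OF f] by blast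
  have def: "nrm Q (cl f) = (INF g\<in>cl f. SUP i. \<parallel>g i\<parallel>)"
    unfolding ultrapower_def cstar_quotient_def ring.defs cstar.defs by (simp add: ell_infty_def)
  have sup: "\<parallel>g i\<parallel> \<le> (SUP i. \<parallel>g i\<parallel>)" if "g \<in> bdd" for g i
  proof -
    obtain M where M: "\<forall>i. \<parallel>g i\<parallel> \<le> M" using bdd_bound \<open>g \<in> bdd\<close> by meson
    then show ?thesis by (intro cSUP_upper bdd_aboveI[of _ M]) auto
  qed
  have lower: "l \<le> (SUP i. \<parallel>g i\<parallel>)" if g: "g \<in> cl f" for g
  proof -
    have gb: "g \<in> bdd" using g cl_bdd by blast
    have "((\<lambda>i. \<parallel>f i\<parallel> - \<parallel>g i \<ominus> f i\<parallel>) \<longlongrightarrow> l - 0) \<omega>" using l g by (intro tendsto_diff) (auto simp: cl_def)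
    then have "l - 0 \<le> (SUP i. \<parallel>g i\<parallel>)"
    proof (rule tendsto_upperbound)
      have "\<parallel>f i\<parallel> - \<parallel>g i \<ominus> f i\<parallel> \<le> (SUP i. \<parallel>g i\<parallel>)" for i
        using nrm_le_minus[of "f i" "g i"] nrm_minus_commute[of "f i" "g i"] sup[OF gb, of i] f gb by simp
      then show "eventually (\<lambda>i. \<parallel>f i\<parallel> - \<parallel>g i \<ominus> f i\<parallel> \<le> (SUP i. \<parallel>g i\<parallel>)) \<omega>" by simp
    qed simp
    then show ?thesis by simp
  qed
  have "nrm Q (cl f) \<le> r" if r: "l < r" for r
  proof -
    obtain g where g: "g \<in> cl f" "\<And>i. \<parallel>g i\<parallel> \<le> r" using cl_truncate[OF f l r] by blast
    have "nrm Q (cl f) \<le> (SUP i. \<parallel>g i\<parallel>)" unfolding def using lower g(1) by (intro cINF_lower bdd_belowI[of _ l]) auto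
    also have "\<dots> \<le> r" using g(2) by (intro cSUP_least) auto
    finally show ?thesis .
  qed
  then have "nrm Q (cl f) \<le> l" by (rule dense_ge)
  moreover have "l \<le> nrm Q (cl f)" unfolding def using lower cl_self[OF f] by (intro cINF_greatest) auto
  ultimately show ?thesis using l by simp
qed

end

section \<open>Unital subalgebras as C*-algebras in their own right\<close>

context cstar_algebra
begin

lemma ring_subalgebra:
  assumes T: "unital_cstar_subalgebra A T"
  shows "ring (A\<lparr>carrier := T\<rparr>)"
proof -
  note D = unital_cstar_subalgebraD[OF T]
  have c: "x \<in> carrier A" if "x \<in> T" for x using D(1) that by blast
  show ?thesis
  proof (rule ringI)
    show "abelian_group (A\<lparr>carrier := T\<rparr>)"
    proof (rule abelian_groupI)
      fix x assume "x \<in> carrier (A\<lparr>carrier := T\<rparr>)"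
      then have x: "x \<in> T" by simp
      then show "\<exists>y\<in>carrier (A\<lparr>carrier := T\<rparr>). y \<oplus>\<^bsub>A\<lparr>carrier := T\<rparr>\<^esub> x = \<zero>\<^bsub>A\<lparr>carrier := T\<rparr>\<^esub>"
        using D(6)[OF x, of "-1"] a_inv_cscale[OF c[OF x]] l_neg[OF c[OF x]] by (intro bexI[of _ "\<ominus> x"]) auto
    qed (use D(2,4) c in \<open>auto simp: a_ac\<close>)
    show "monoid (A\<lparr>carrier := T\<rparr>)"
      by (rule monoidI) (use D(3,5) c in \<open>auto simp: m_assoc\<close>)
  qed (use c in \<open>auto simp: l_distr r_distr\<close>)
qed

text \<open>The additive inverse is defined by a description over the carrier, so it has to be
  recomputed when the carrier shrinks.\<close>

lemma a_inv_subalgebra: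
  assumes T: "unital_cstar_subalgebra A T" and x: "x \<in> T"
  shows "\<ominus>\<^bsub>A\<lparr>carrier := T\<rparr>\<^esub> x = \<ominus> x"
proof -
  interpret T: ring "A\<lparr>carrier := T\<rparr>" by (rule ring_subalgebra[OF T])
  have xc: "x \<in> carrier A" using unital_cstar_subalgebraD(1)[OF T] x by blast
  have "\<ominus> x \<in> T" using unital_cstar_subalgebraD(6)[OF T x, of "-1"] a_inv_cscale[OF xc] by simp
  then show ?thesis using T.minus_equality[of "\<ominus> x" x] x xc by (simp add: l_neg)
qed

lemma minus_subalgebra:
  assumes T: "unital_cstar_subalgebra A T" and y: "y \<in> T"
  shows "x \<ominus>\<^bsub>A\<lparr>carrier := T\<rparr>\<^esub> y = x \<ominus> y"
  by (simp add: a_minus_def a_inv_subalgebra[OF T y])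

lemma cstar_algebra_subalgebra:
  assumes T: "unital_cstar_subalgebra A T"
  shows "cstar_algebra (A\<lparr>carrier := T\<rparr>)"
proof -
  note D = unital_cstar_subalgebraD[OF T]
  have c: "x \<in> carrier A" if "x \<in> T" for x using D(1) that by blast
  have "cstar_algebra_axioms (A\<lparr>carrier := T\<rparr>)"
  proof (rule cstar_algebra_axioms.intro)
    fix f :: "nat \<Rightarrow> 'a"
    assume f: "\<And>n. f n \<in> carrier (A\<lparr>carrier := T\<rparr>)"
      and cauchy: "\<And>e. 0 < e \<Longrightarrow> \<exists>N. \<forall>m\<ge>N. \<forall>n\<ge>N. nrm (A\<lparr>carrier := T\<rparr>) (f m \<ominus>\<^bsub>A\<lparr>carrier := T\<rparr>\<^esub> f n) < e"
    have fT: "f n \<in> T" for n using f[of n] by simp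
    have "\<exists>N. \<forall>m\<ge>N. \<forall>n\<ge>N. \<parallel>f m \<ominus> f n\<parallel> < e" if "0 < e" for e
      using cauchy[OF that] minus_subalgebra[OF T fT] by simp
    then obtain x where x: "x \<in> carrier A" "(\<lambda>n. \<parallel>f n \<ominus> x\<parallel>) \<longlonglongrightarrow> 0"
      using complete[of f] c[OF fT] by blast
    have "x \<in> T"
    proof (rule nrm_closedD[OF D(8) x(1)])
      fix e :: real assume "0 < e"
      then obtain n where "\<parallel>f n \<ominus> x\<parallel> < e" using order_tendstoD(2)[OF x(2)] eventually_happens'[of sequentially] by fastforce
      then show "\<exists>s\<in>T. \<parallel>x \<ominus> s\<parallel> < e" using fT c x nrm_minus_commute by (intro bexI[of _ "f n"]) auto
    qed
    then show "\<exists>x\<in>carrier (A\<lparr>carrier := T\<rparr>). (\<lambda>n. nrm (A\<lparr>carrier := T\<rparr>) (f n \<ominus>\<^bsub>A\<lparr>carrier := T\<rparr>\<^esub> x)) \<longlonglongrightarrow> 0"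
      using x(2) minus_subalgebra[OF T] by (intro bexI[of _ x]) auto
  qed (use D(6,7) c in \<open>auto simp: cscale_add_right cscale_add_left cscale_cscale cscale_mult_left cscale_mult_right
      star_add star_cscale star_mult nrm_nonneg nrm_eq_0_iff nrm_triangle nrm_cscale nrm_mult cstar_identity\<close>)
  then show ?thesis by (rule cstar_algebra.intro[OF ring_subalgebra[OF T]])
qed

text \<open>The explicit rate matters: for the completeness of the ultrapower, limits are taken at
  each index separately and must be approached uniformly.\<close>

lemma geometric_limit:
  assumes f: "\<And>n. f n \<in> carrier A" and step: "\<And>n. \<parallel>f (Suc n) \<ominus> f n\<parallel> \<le> (1/2) ^ n"
  obtains x where "x \<in> carrier A" "\<And>n. \<parallel>f n \<ominus> x\<parallel> \<le> 2 * (1/2) ^ n"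
proof -
  define t :: "nat \<Rightarrow> real" where "t n = - (2 * (1/2) ^ n)" for n
  have ts: "t (Suc n) - t n = (1/2) ^ n" for n by (simp add: t_def)
  have "t \<longlonglongrightarrow> - (2 * 0)" unfolding t_def by (intro tendsto_intros LIMSEQ_power_zero) auto
  then have "convergent t" by (rule convergentI)
  then obtain x where x: "x \<in> carrier A" "(\<lambda>n. \<parallel>f n \<ominus> x\<parallel>) \<longlonglongrightarrow> 0"
    using limit_exists[of f t] f step ts by auto
  have tel: "\<parallel>f n \<ominus> f (n + k)\<parallel> \<le> t (n + k) - t n" for n k
  proof (induction k)
    case 0 then show ?case using f by simp
  next
    case (Suc k)
    have "\<parallel>f n \<ominus> f (n + Suc k)\<parallel> \<le> \<parallel>f n \<ominus> f (n + k)\<parallel> + \<parallel>f (n + k) \<ominus> f (Suc (n + k))\<parallel>"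
      using nrm_minus_triangle[OF f f f] by simp
    then show ?case using Suc step[of "n + k"] ts[of "n + k"] nrm_minus_commute[OF f f] by simp
  qed
  have "\<parallel>f n \<ominus> x\<parallel> \<le> 2 * (1/2) ^ n" for n
  proof (rule LIMSEQ_le_const)
    show "(\<lambda>k. 2 * (1/2) ^ n + \<parallel>f (n + k) \<ominus> x\<parallel>) \<longlonglongrightarrow> 2 * (1/2) ^ n"
      using tendsto_add[OF tendsto_const LIMSEQ_ignore_initial_segment[OF x(2), of n], of "2 * (1/2) ^ n"] by (simp add: add.commute)
    show "\<exists>N. \<forall>k\<ge>N. \<parallel>f n \<ominus> x\<parallel> \<le> 2 * (1/2) ^ n + \<parallel>f (n + k) \<ominus> x\<parallel>"
    proof (intro exI allI impI)
      fix k
      have "t (n + k) - t n \<le> 2 * (1/2) ^ n" by (simp add: t_def)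
      then show "\<parallel>f n \<ominus> x\<parallel> \<le> 2 * (1/2) ^ n + \<parallel>f (n + k) \<ominus> x\<parallel>"
        using nrm_minus_triangle[OF f f x(1), of n "n + k"] tel[of n k] by simp
    qed
  qed
  then show ?thesis using that x by blast
qed

end

context cstar_state
begin

lemma vector_state:
  assumes y: "y \<in> carrier A" "sn y = 1"
  shows "state A (\<lambda>x. \<phi> (y\<^sup>\<star> \<otimes> x \<otimes> y))"
proof -
  have "\<phi> (y\<^sup>\<star> \<otimes> y) = 1" using ip_self[OF y(1)] sn_sq[OF y(1)] y(2) by (simp add: ip_def)
  moreover have "\<phi> (y\<^sup>\<star> \<otimes> x \<otimes> y) \<in> \<real>\<^sub>\<ge>\<^sub>0" if "x \<in> pos_elems A" for x
    using \<phi>_P[OF P_conj[of x y]] that y by (simp add: pos_elems_eq_P complex_nonneg_Reals_iff)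
  ultimately show ?thesis using y by (simp add: state_def l_distr r_distr \<phi>_add cscale_mult_left cscale_mult_right \<phi>_cscale)
qed

text \<open>If no unit vector reached half of the squared norm, \<open>faithful_positive\<close>
  would give x* x \<le> c with c half of \<parallel>x\<parallel>^2, contradicting the C*-identity.
  Any factor below 1 would do.\<close>

lemma norming_vector:
  assumes f: "gns_faithful A \<phi>" and x: "x \<in> carrier A"
  shows "\<exists>y\<in>carrier A. sn y = 1 \<and> \<parallel>x\<parallel>\<^sup>2 / 2 \<le> sq (x \<otimes> y)"
proof (cases "x = \<zero>")
  case True then show ?thesis using sq_nonneg by (intro bexI[of _ \<one>]) auto
next
  case False
  then have n: "\<parallel>x\<parallel> > 0" using nrm_eq_0_iff[OF x] nrm_nonneg[OF x] by simp
  define c where "c = \<parallel>x\<parallel>\<^sup>2 / 2"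
  show ?thesis
  proof (rule ccontr)
    assume "\<not> ?thesis"
    then have lt: "sq (x \<otimes> y) < c" if "y \<in> carrier A" "sn y = 1" for y using that unfolding c_def by (meson not_le)
    have le: "sq (x \<otimes> z) \<le> c * sq z" if z: "z \<in> carrier A" for z
    proof (cases "sn z = 0")
      case True
      then have "sn (x \<otimes> z) = 0" using sn_mult_null x z by blast
      then show ?thesis using sn_sq[of "x \<otimes> z"] sn_sq[OF z] True x z by simp
    next
      case False
      define y where "y = of_real (1 / sn z) \<cdot> z"
      have y: "y \<in> carrier A" "sn y = 1" using z False sn_nonneg[OF z] by (auto simp: y_def sn_cscale norm_divide)
      have "x \<otimes> y = of_real (1 / sn z) \<cdot> (x \<otimes> z)" using x z by (simp add: y_def cscale_mult_right)
      then have "sq (x \<otimes> y) = (1 / sn z)\<^sup>2 * sq (x \<otimes> z)" using x z by (simp add: sq_cscale norm_divide power_divide)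
      then have "sq (x \<otimes> z) / sq z < c" using lt[OF y] sn_sq[OF z] by (simp add: power_divide)
      then show ?thesis using False sn_sq[OF z] sq_nonneg[OF z] by (simp add: divide_less_eq split: if_splits)
    qed
    have "sc (of_real c) \<ominus> x\<^sup>\<star> \<otimes> x \<in> P"
    proof (rule faithful_positive[OF f])
      fix z assume z: "z \<in> carrier A"
      have "z\<^sup>\<star> \<otimes> (sc (of_real c) \<ominus> x\<^sup>\<star> \<otimes> x) \<otimes> z = z\<^sup>\<star> \<otimes> (sc (of_real c) \<otimes> z) \<ominus> (x \<otimes> z)\<^sup>\<star> \<otimes> (x \<otimes> z)"
        using x z sc_closed[of "of_real c"] by algebra
      then have "\<phi> (z\<^sup>\<star> \<otimes> (sc (of_real c) \<ominus> x\<^sup>\<star> \<otimes> x) \<otimes> z) = of_real (c * sq z - sq (x \<otimes> z))"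
        using x z ip_self[OF z] ip_self[of "x \<otimes> z"] by (simp add: \<phi>_minus sc_mult_left cscale_mult_right \<phi>_cscale ip_def)
      then show "0 \<le> Re (\<phi> (z\<^sup>\<star> \<otimes> (sc (of_real c) \<ominus> x\<^sup>\<star> \<otimes> x) \<otimes> z))" using le[OF z] by simp
    qed (use x in \<open>auto simp: star_minus star_sc star_mult\<close>)
    then have "\<parallel>x\<^sup>\<star> \<otimes> x\<parallel> \<le> c" using P_dominated[OF star_mult_P[OF x], of c] by (simp add: c_def)
    then show False using cstar_identity[OF x] n by (simp add: c_def)
  qed
qed

end

section \<open>The ultrapower as a C*-algebra, its subalgebras and its states\<close>

context ultra
begin

lemmas Q_simps = Q_mult Q_add Q_cscale Q_star bdd_mult bdd_add bdd_cscale bdd_star bdd_const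

lemma Q_cases: assumes "X \<in> carrier Q" obtains f where "f \<in> bdd" "X = cl f"
  using assms by (auto simp: Q_carrier)

lemma cl_Q [simp, intro]: "f \<in> bdd \<Longrightarrow> cl f \<in> carrier Q" by (simp add: Q_carrier)

lemma ring_Q: "ring Q"
proof (rule ringI)
  show "abelian_group Q"
  proof (rule abelian_groupI)
    fix X assume "X \<in> carrier Q"
    then obtain f where f: "f \<in> bdd" "X = cl f" by (rule Q_cases)
    have "cl (\<lambda>i. (-1) \<cdot> f i) \<oplus>\<^bsub>Q\<^esub> X = cl (\<lambda>i. \<ominus> (f i) \<oplus> f i)" using f by (simp add: Q_simps a_inv_cscale)
    also have "\<dots> = \<zero>\<^bsub>Q\<^esub>" using f by (simp add: Q_zero l_neg)
    finally show "\<exists>Y\<in>carrier Q. Y \<oplus>\<^bsub>Q\<^esub> X = \<zero>\<^bsub>Q\<^esub>" using bdd_cscale f by blast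
  qed (auto elim!: Q_cases simp: Q_zero Q_simps a_ac)
  show "monoid Q"
    by (rule monoidI) (auto elim!: Q_cases simp: Q_one Q_simps m_assoc)
qed (auto elim!: Q_cases simp: Q_simps l_distr r_distr)

lemma Q_a_inv: assumes f: "f \<in> bdd" shows "\<ominus>\<^bsub>Q\<^esub> cl f = cl (\<lambda>i. \<ominus> f i)"
proof -
  interpret Q: ring Q by (rule ring_Q)
  have b: "(\<lambda>i. \<ominus> f i) \<in> bdd" using bdd_cscale[OF f, of "-1"] f by (simp add: a_inv_cscale)
  have "cl (\<lambda>i. \<ominus> f i) \<oplus>\<^bsub>Q\<^esub> cl f = \<zero>\<^bsub>Q\<^esub>" using f b by (simp add: Q_add Q_zero l_neg)
  then show ?thesis using Q.minus_equality f b by blast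
qed

lemma Q_minus: assumes f: "f \<in> bdd" and g: "g \<in> bdd" shows "cl f \<ominus>\<^bsub>Q\<^esub> cl g = cl (\<lambda>i. f i \<ominus> g i)"
proof -
  have b: "(\<lambda>i. \<ominus> g i) \<in> bdd" using bdd_cscale[OF g, of "-1"] g by (simp add: a_inv_cscale)
  show ?thesis unfolding a_minus_def using f b by (simp add: Q_a_inv[OF g] Q_add)
qed

lemma Q_nrm_eqI: "f \<in> bdd \<Longrightarrow> ((\<lambda>i. \<parallel>f i\<parallel>) \<longlongrightarrow> l) \<omega> \<Longrightarrow> nrm Q (cl f) = l"
  using tendsto_unique[OF \<omega>_nonbot] Q_nrm by blast

lemma Q_nrm_le: assumes f: "f \<in> bdd" and "eventually (\<lambda>i. \<parallel>f i\<parallel> \<le> r) \<omega>" shows "nrm Q (cl f) \<le> r"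
  using tendsto_upperbound[OF Q_nrm[OF f] assms(2)] by simp

lemma Q_nrm_eq_0_iff: assumes f: "f \<in> bdd" shows "nrm Q (cl f) = 0 \<longleftrightarrow> cl f = \<zero>\<^bsub>Q\<^esub>"
proof -
  have "f i \<ominus> \<zero> = f i" for i using bdd_carrier[OF f, of i] by algebra
  then have "cl f = \<zero>\<^bsub>Q\<^esub> \<longleftrightarrow> ((\<lambda>i. \<parallel>f i\<parallel>) \<longlongrightarrow> 0) \<omega>" using cl_eq_iff[OF f bdd_const[OF zero_closed]] by (simp add: Q_zero)
  then show ?thesis using Q_nrm[OF f] Q_nrm_eqI[OF f] by metis
qed

text \<open>The strict margin is what truncation needs to give a bound at all indices.\<close>

lemma Q_lift:
  assumes X: "X \<in> carrier Q" and r: "nrm Q X < r"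
  obtains f where "f \<in> bdd" "X = cl f" "\<And>i. \<parallel>f i\<parallel> \<le> r"
proof -
  obtain f where f: "f \<in> bdd" "X = cl f" using X by (rule Q_cases)
  obtain g where g: "g \<in> cl f" "\<And>i. \<parallel>g i\<parallel> \<le> r" using cl_truncate[OF f(1) Q_nrm[OF f(1)]] r f(2) by blast
  then show ?thesis using that[of g] cl_bdd cl_eqI f by metis
qed

text \<open>Along a subsequence with increments below 2^(-n), the differences are lifted with these
  bounds at every index. The pointwise partial sums then converge in A at a common rate, and their
  limit represents the limit of the subsequence.\<close>

lemma Q_complete:
  assumes F: "\<And>n. F n \<in> carrier Q"
    and cauchy: "\<And>e. 0 < e \<Longrightarrow> \<exists>N. \<forall>m\<ge>N. \<forall>n\<ge>N. nrm Q (F m \<ominus>\<^bsub>Q\<^esub> F n) < e"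
  shows "\<exists>X\<in>carrier Q. (\<lambda>n. nrm Q (F n \<ominus>\<^bsub>Q\<^esub> X)) \<longlonglongrightarrow> 0"
proof -
  interpret Q: ring Q by (rule ring_Q)
  have "\<exists>N. \<forall>j. \<forall>m\<ge>N j. \<forall>n\<ge>N j. nrm Q (F m \<ominus>\<^bsub>Q\<^esub> F n) < (1/2) ^ j"
    by (rule choice) (use cauchy in auto)
  then obtain N where N: "\<And>j m n. N j \<le> m \<Longrightarrow> N j \<le> n \<Longrightarrow> nrm Q (F m \<ominus>\<^bsub>Q\<^esub> F n) < (1/2) ^ j" by blast
  \<comment> \<open>Partial sums make the chosen indices increasing, so that both members of the
    n-th difference lie beyond \<open>N n\<close>.\<close>
  define K where "K n = (\<Sum>j\<le>n. N j)" for n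
  have NK: "N n \<le> K n" for n unfolding K_def by (rule member_le_sum) auto
  have NK': "N n \<le> K (Suc n)" for n using NK[of n] by (simp add: K_def)
  have "\<exists>d\<in>bdd. F (K (Suc n)) \<ominus>\<^bsub>Q\<^esub> F (K n) = cl d \<and> (\<forall>i. \<parallel>d i\<parallel> \<le> (1/2) ^ n)" for n
  proof -
    have "F (K (Suc n)) \<ominus>\<^bsub>Q\<^esub> F (K n) \<in> carrier Q" using F by simp
    then obtain d where "d \<in> bdd" "F (K (Suc n)) \<ominus>\<^bsub>Q\<^esub> F (K n) = cl d" "\<And>i. \<parallel>d i\<parallel> \<le> (1/2) ^ n"
      using Q_lift N[OF NK' NK] by blast
    then show ?thesis by blast
  qed
  then obtain d where d: "\<And>n. d n \<in> bdd" "\<And>n. F (K (Suc n)) \<ominus>\<^bsub>Q\<^esub> F (K n) = cl (d n)" "\<And>n i. \<parallel>d n i\<parallel> \<le> (1/2) ^ n"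
    by metis
  obtain h where h: "h \<in> bdd" "F (K 0) = cl h" using F[of "K 0"] by (rule Q_cases)
  define s where "s = rec_nat h (\<lambda>n x i. x i \<oplus> d n i)"
  have s0: "s 0 = h" and sS: "\<And>n. s (Suc n) = (\<lambda>i. s n i \<oplus> d n i)" by (simp_all add: s_def)
  have sb: "s n \<in> bdd" for n by (induction n) (use s0 sS h d bdd_add in auto)
  have sF: "cl (s n) = F (K n)" for n
  proof (induction n)
    case 0 then show ?case using s0 h by simp
  next
    case (Suc n)
    have "cl (s (Suc n)) = F (K n) \<oplus>\<^bsub>Q\<^esub> (F (K (Suc n)) \<ominus>\<^bsub>Q\<^esub> F (K n))" using sb d Suc by (simp add: sS Q_add[symmetric])
    also have "\<dots> = F (K (Suc n))" using F[of "K n"] F[of "K (Suc n)"] by (simp add: Q.minus_eq Q.a_lcomm[of "F (K n)" "F (K (Suc n))"] Q.r_neg)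
    finally show ?case .
  qed
  have "\<exists>x. x \<in> carrier A \<and> (\<forall>n. \<parallel>s n i \<ominus> x\<parallel> \<le> 2 * (1/2) ^ n)" for i
  proof -
    have "\<parallel>s (Suc n) i \<ominus> s n i\<parallel> \<le> (1/2) ^ n" for n
    proof -
      have "s (Suc n) i \<ominus> s n i = d n i" unfolding sS using bdd_carrier[OF sb, of n i] bdd_carrier[OF d(1), of n i] by algebra
      then show ?thesis using d(3) by simp
    qed
    then obtain x where "x \<in> carrier A" "\<And>n. \<parallel>s n i \<ominus> x\<parallel> \<le> 2 * (1/2) ^ n"
      using geometric_limit[of "\<lambda>n. s n i"] sb bdd_carrier by blast
    then show ?thesis by blast
  qed
  then obtain x where x: "\<And>i. x i \<in> carrier A" "\<And>i n. \<parallel>s n i \<ominus> x i\<parallel> \<le> 2 * (1/2) ^ n" by metis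
  obtain M where M: "\<forall>i. \<parallel>h i\<parallel> \<le> M" using bdd_bound[OF h(1)] by blast
  have xb: "x \<in> bdd"
  proof (rule bddI[OF x(1)])
    fix i show "\<parallel>x i\<parallel> \<le> M + 2"
      using nrm_le_minus[of "x i" "h i"] nrm_minus_commute[of "x i" "h i"] x(1)[of i] x(2)[of 0 i] M h(1) s0 by (auto simp: add_mono intro: order_trans)
  qed
  have conv: "nrm Q (F (K n) \<ominus>\<^bsub>Q\<^esub> cl x) \<le> 2 * (1/2) ^ n" for n
    unfolding sF[symmetric] Q_minus[OF sb xb] by (rule Q_nrm_le[OF bdd_minus[OF sb xb]]) (use x in simp)
  have tri: "nrm Q (X \<ominus>\<^bsub>Q\<^esub> Z) \<le> nrm Q (X \<ominus>\<^bsub>Q\<^esub> Y) + nrm Q (Y \<ominus>\<^bsub>Q\<^esub> Z)"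
    if X: "X \<in> carrier Q" and Y: "Y \<in> carrier Q" and Z: "Z \<in> carrier Q" for X Y Z
  proof -
    obtain a where a: "a \<in> bdd" "X = cl a" using X by (rule Q_cases)
    obtain b where b: "b \<in> bdd" "Y = cl b" using Y by (rule Q_cases)
    obtain c where c: "c \<in> bdd" "Z = cl c" using Z by (rule Q_cases)
    show ?thesis unfolding a b c Q_minus[OF a(1) c(1)] Q_minus[OF a(1) b(1)] Q_minus[OF b(1) c(1)]
      by (rule tendsto_le[OF \<omega>_nonbot tendsto_add[OF Q_nrm Q_nrm] Q_nrm]) (use a b c bdd_minus nrm_minus_triangle in auto)
  qed
  have "(\<lambda>m. nrm Q (F m \<ominus>\<^bsub>Q\<^esub> cl x)) \<longlonglongrightarrow> 0"
  proof (rule LIMSEQ_I)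
    fix e :: real assume e: "0 < e"
    obtain n where n: "(1/2::real) ^ n < e / 3" using real_arch_pow_inv[of "e/3" "1/2"] e by auto
    have "norm (nrm Q (F m \<ominus>\<^bsub>Q\<^esub> cl x) - 0) < e" if m: "N n \<le> m" for m
    proof -
      have "nrm Q (F m \<ominus>\<^bsub>Q\<^esub> cl x) \<le> nrm Q (F m \<ominus>\<^bsub>Q\<^esub> F (K n)) + nrm Q (F (K n) \<ominus>\<^bsub>Q\<^esub> cl x)" using tri F xb by blast
      also have "\<dots> < (1/2) ^ n + 2 * (1/2) ^ n" using N[OF m NK] conv[of n] by linarith
      also have "\<dots> < e" using n by simp
      finally have lt: "nrm Q (F m \<ominus>\<^bsub>Q\<^esub> cl x) < e" .
      obtain f where f: "f \<in> bdd" "F m = cl f" using F[of m] by (rule Q_cases)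
      have "0 \<le> nrm Q (F m \<ominus>\<^bsub>Q\<^esub> cl x)" unfolding f(2) Q_minus[OF f(1) xb]
        by (rule tendsto_lowerbound[OF Q_nrm[OF bdd_minus[OF f(1) xb]]]) (use f(1) xb nrm_nonneg in auto)
      then show ?thesis using lt by simp
    qed
    then show "\<exists>no. \<forall>m\<ge>no. norm (nrm Q (F m \<ominus>\<^bsub>Q\<^esub> cl x) - 0) < e" by blast
  qed
  then show ?thesis using xb by blast
qed

theorem cstar_algebra_Q: "cstar_algebra Q"
proof (rule cstar_algebra.intro[OF ring_Q])
  show "cstar_algebra_axioms Q"
  proof (rule cstar_algebra_axioms.intro)
    fix X assume "X \<in> carrier Q"
    then obtain f where f: "f \<in> bdd" "X = cl f" by (rule Q_cases)
    show "0 \<le> nrm Q X" unfolding f(2) by (rule tendsto_lowerbound[OF Q_nrm[OF f(1)]]) (use f(1) nrm_nonneg in auto)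
    show "nrm Q X = 0 \<longleftrightarrow> X = \<zero>\<^bsub>Q\<^esub>" unfolding f(2) by (rule Q_nrm_eq_0_iff[OF f(1)])
    show "nrm Q (star Q X \<otimes>\<^bsub>Q\<^esub> X) = (nrm Q X)\<^sup>2"
      unfolding f(2) Q_star[OF f(1)] Q_mult[OF bdd_star[OF f(1)] f(1)]
    proof (rule Q_nrm_eqI)
      show "((\<lambda>i. \<parallel>(f i)\<^sup>\<star> \<otimes> f i\<parallel>) \<longlongrightarrow> (nrm Q (cl f))\<^sup>2) \<omega>"
        using tendsto_power[OF Q_nrm[OF f(1)], of 2] f(1) by (simp add: cstar_identity)
    qed (use f bdd_mult bdd_star in auto)
    show "nrm Q (cscale Q c X) = cmod c * nrm Q X" for c
      unfolding f(2) Q_cscale[OF f(1)]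
      by (rule Q_nrm_eqI) (use f(1) tendsto_mult_left[OF Q_nrm[OF f(1)], of "cmod c"] bdd_cscale in \<open>auto simp: nrm_cscale\<close>)
  next
    fix X Y assume "X \<in> carrier Q" "Y \<in> carrier Q"
    then obtain f g where f: "f \<in> bdd" "X = cl f" and g: "g \<in> bdd" "Y = cl g" by (metis Q_cases)
    show "nrm Q (X \<oplus>\<^bsub>Q\<^esub> Y) \<le> nrm Q X + nrm Q Y" unfolding f(2) g(2) Q_add[OF f(1) g(1)]
      by (rule tendsto_le[OF \<omega>_nonbot tendsto_add[OF Q_nrm Q_nrm] Q_nrm]) (use f g bdd_add nrm_triangle in auto)
    show "nrm Q (X \<otimes>\<^bsub>Q\<^esub> Y) \<le> nrm Q X * nrm Q Y" unfolding f(2) g(2) Q_mult[OF f(1) g(1)]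
      by (rule tendsto_le[OF \<omega>_nonbot tendsto_mult[OF Q_nrm Q_nrm] Q_nrm]) (use f g bdd_mult nrm_mult in auto)
  next
    fix F :: "nat \<Rightarrow> ('i \<Rightarrow> 'a) set"
    assume "\<And>n. F n \<in> carrier Q" "\<And>e. 0 < e \<Longrightarrow> \<exists>N. \<forall>m\<ge>N. \<forall>n\<ge>N. nrm Q (F m \<ominus>\<^bsub>Q\<^esub> F n) < e"
    then show "\<exists>x\<in>carrier Q. (\<lambda>n. nrm Q (F n \<ominus>\<^bsub>Q\<^esub> x)) \<longlonglongrightarrow> 0" by (rule Q_complete)
  qed (auto elim!: Q_cases simp: Q_simps cscale_add_right cscale_add_left cscale_cscale cscale_mult_left cscale_mult_right
      star_add star_cscale star_mult)
qed

lemma unital_cstar_subalgebra_ultra_sub: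
  assumes B: "unital_cstar_subalgebra A B"
  shows "unital_cstar_subalgebra Q (ultra_sub A \<omega> B)"
proof -
  interpret Q: cstar_algebra Q by (rule cstar_algebra_Q)
  note D = unital_cstar_subalgebraD[OF B]
  define G where "G = {f \<in> bdd. \<forall>i. f i \<in> B}"
  have eq: "ultra_sub A \<omega> B = cl ` G"
    unfolding ultra_sub_def carrier_ell_infty G_def by (intro image_cong refl) (auto simp: ultra_class_eq)
  have "nrm_closed Q (cl ` G)" unfolding nrm_closed_def
  proof (intro ballI impI)
    fix X assume "X \<in> carrier Q" and a: "\<forall>e>0. \<exists>s\<in>cl ` G. nrm Q (X \<ominus>\<^bsub>Q\<^esub> s) < e"
    then obtain f where f: "f \<in> bdd" "X = cl f" by (metis Q_cases)
    \<comment> \<open>A nearest point of B need not exist; one within twice the distance does, and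
      at distance 0 the point itself is taken. The choice does not depend on the approximants, so
      one representative g serves all tolerances.\<close>
    have "\<exists>g. g \<in> B \<and> (\<forall>b\<in>B. \<parallel>f i \<ominus> g\<parallel> \<le> 2 * \<parallel>f i \<ominus> b\<parallel>)" for i
    proof (cases "f i \<in> B")
      case True
      have "f i \<ominus> f i = \<zero>" using f(1) by simp
      moreover have "0 \<le> \<parallel>f i \<ominus> b\<parallel>" if "b \<in> B" for b using nrm_nonneg[OF minus_closed[OF bdd_carrier[OF f(1)]]] D(1) that by blast
      ultimately show ?thesis using True by (intro exI[of _ "f i"]) simp
    next
      case False
      define \<delta> where "\<delta> = (INF b\<in>B. \<parallel>f i \<ominus> b\<parallel>)"
      obtain e where e: "e > 0" "\<And>b. b \<in> B \<Longrightarrow> e \<le> \<parallel>f i \<ominus> b\<parallel>"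
        using nrm_closedD[OF D(8), of "f i"] False f(1) by (metis bdd_carrier not_le)
      have lower: "\<delta> \<le> \<parallel>f i \<ominus> b\<parallel>" if "b \<in> B" for b unfolding \<delta>_def using e that by (intro cINF_lower bdd_belowI[of _ e]) auto
      have "e \<le> \<delta>" unfolding \<delta>_def using e D(2) by (intro cINF_greatest) auto
      then have "\<delta> < 2 * \<delta>" using e by simp
      moreover have "bdd_below ((\<lambda>b. \<parallel>f i \<ominus> b\<parallel>) ` B)" using e by (intro bdd_belowI[of _ e]) auto
      moreover have "B \<noteq> {}" using D(2) by blast
      ultimately obtain g where g: "g \<in> B" "\<parallel>f i \<ominus> g\<parallel> < 2 * \<delta>"
        using cINF_less_iff[of B "\<lambda>b. \<parallel>f i \<ominus> b\<parallel>" "2 * \<delta>"] unfolding \<delta>_def by blast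
      have "\<parallel>f i \<ominus> g\<parallel> \<le> 2 * \<parallel>f i \<ominus> b\<parallel>" if "b \<in> B" for b using lower[OF that] g(2) by linarith
      then show ?thesis using g(1) by blast
    qed
    then obtain g where g: "\<And>i. g i \<in> B" "\<And>i b. b \<in> B \<Longrightarrow> \<parallel>f i \<ominus> g i\<parallel> \<le> 2 * \<parallel>f i \<ominus> b\<parallel>" by metis
    have gc: "g i \<in> carrier A" for i using g(1) D(1) by blast
    obtain M where M: "\<forall>i. \<parallel>f i\<parallel> \<le> M" using bdd_bound[OF f(1)] by blast
    have gb: "g \<in> bdd"
    proof (rule bddI[OF gc])
      fix i
      have "f i \<ominus> \<zero> = f i" using bdd_carrier[OF f(1), of i] by algebra
      then have "\<parallel>f i \<ominus> g i\<parallel> \<le> 2 * \<parallel>f i\<parallel>" using g(2)[OF D(2), of i] by simp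
      moreover have "\<parallel>g i\<parallel> \<le> \<parallel>f i\<parallel> + \<parallel>f i \<ominus> g i\<parallel>" using nrm_le_minus[of "g i" "f i"] nrm_minus_commute[of "g i" "f i"] gc f(1) by simp
      ultimately show "\<parallel>g i\<parallel> \<le> 3 * M" using M[rule_format, of i] by linarith
    qed
    have "((\<lambda>i. \<parallel>f i \<ominus> g i\<parallel>) \<longlongrightarrow> 0) \<omega>"
    proof (rule order_tendstoI)
      fix e :: real assume "0 < e"
      then obtain h where h: "h \<in> G" "nrm Q (X \<ominus>\<^bsub>Q\<^esub> cl h) < e / 2" using a by (metis half_gt_zero imageE)
      have hb: "h \<in> bdd" "\<And>i. h i \<in> B" using h by (auto simp: G_def)
      have "((\<lambda>i. \<parallel>f i \<ominus> h i\<parallel>) \<longlongrightarrow> nrm Q (X \<ominus>\<^bsub>Q\<^esub> cl h)) \<omega>"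
        unfolding f(2) Q_minus[OF f(1) hb(1)] by (rule Q_nrm[OF bdd_minus[OF f(1) hb(1)]])
      then have "eventually (\<lambda>i. \<parallel>f i \<ominus> h i\<parallel> < e / 2) \<omega>" using h(2) by (rule order_tendstoD)
      then show "eventually (\<lambda>i. \<parallel>f i \<ominus> g i\<parallel> < e) \<omega>"
      proof (rule eventually_mono)
        fix i assume "\<parallel>f i \<ominus> h i\<parallel> < e / 2" then show "\<parallel>f i \<ominus> g i\<parallel> < e" using g(2)[OF hb(2), of i i] by simp
      qed
    next
      fix e :: real assume "e < 0"
      then show "eventually (\<lambda>i. e < \<parallel>f i \<ominus> g i\<parallel>) \<omega>" using nrm_nonneg f(1) gc by (intro always_eventually allI) (auto intro: less_le_trans)
    qed
    then have "X = cl g" using cl_eq_iff[OF f(1) gb] f(2) by simp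
    then show "X \<in> cl ` G" using gb g(1) by (auto simp: G_def)
  qed
  moreover have "\<zero>\<^bsub>Q\<^esub> \<in> cl ` G" "\<one>\<^bsub>Q\<^esub> \<in> cl ` G" unfolding Q_zero Q_one using D(2,3) bdd_const by (auto simp: G_def)
  moreover have "X \<oplus>\<^bsub>Q\<^esub> Y \<in> cl ` G" "X \<otimes>\<^bsub>Q\<^esub> Y \<in> cl ` G" if "X \<in> cl ` G" "Y \<in> cl ` G" for X Y
    using that D(4,5) by (auto simp: G_def Q_simps)
  moreover have "cscale Q c X \<in> cl ` G" "star Q X \<in> cl ` G" if "X \<in> cl ` G" for X c
    using that D(6,7) by (auto simp: G_def Q_simps)
  moreover have "cl ` G \<subseteq> carrier Q" by (auto simp: G_def)
  ultimately show ?thesis unfolding eq unital_cstar_subalgebra_def cstar_subalgebra_def by simp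
qed

text \<open>Like \<open>ultra_state\<close>, but for a state that varies with the index; only such
  limits supply enough states.\<close>

definition lim_state :: "('i \<Rightarrow> 'a \<Rightarrow> complex) \<Rightarrow> ('i \<Rightarrow> 'a) set \<Rightarrow> complex" where
  "lim_state \<chi> X = (THE z. \<forall>f\<in>X. ((\<lambda>i. \<chi> i (f i)) \<longlongrightarrow> z) \<omega>)"

lemma ultra_state_eq: "ultra_state \<rho> \<omega> = lim_state (\<lambda>_. \<rho>)"
  by (rule ext) (simp add: ultra_state_def lim_state_def)

lemma lim_state_tendsto:
  assumes \<chi>: "\<And>i. state A (\<chi> i)" and f: "f \<in> bdd"
  shows "((\<lambda>i. \<chi> i (f i)) \<longlongrightarrow> lim_state \<chi> (cl f)) \<omega>"
proof -
  have st: "cstar_state A (\<chi> i)" for i using \<chi> by unfold_locales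
  obtain M where M: "\<forall>i. \<parallel>f i\<parallel> \<le> M" using bdd_bound[OF f] by blast
  have "cmod (\<chi> i (f i)) \<le> M" for i using cstar_state.\<phi>_le_nrm[OF st, of "f i"] M f by (meson bdd_carrier order_trans)
  then obtain z where z: "((\<lambda>i. \<chi> i (f i)) \<longlongrightarrow> z) \<omega>" using ultrafilter_bounded_limit_complex[OF ultrafilter, of "\<lambda>i. \<chi> i (f i)" M] by blast
  have all: "((\<lambda>i. \<chi> i (g i)) \<longlongrightarrow> z) \<omega>" if g: "g \<in> cl f" for g
  proof -
    have gb: "g \<in> bdd" using g cl_bdd by blast
    have "((\<lambda>i. \<chi> i (g i) - \<chi> i (f i)) \<longlongrightarrow> 0) \<omega>"
    proof (rule tendsto_norm_zero_cancel)
      have "norm (\<chi> i (g i) - \<chi> i (f i)) \<le> \<parallel>g i \<ominus> f i\<parallel>" for i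
      proof -
        interpret c: cstar_state A "\<chi> i" by (rule st)
        show ?thesis using c.\<phi>_le_nrm[of "g i \<ominus> f i"] c.\<phi>_minus[of "g i" "f i"] bdd_carrier[OF gb, of i] bdd_carrier[OF f, of i] by simp
      qed
      from this show "((\<lambda>i. norm (\<chi> i (g i) - \<chi> i (f i))) \<longlongrightarrow> 0) \<omega>"
        by (rule tendsto_0_squeeze[of "\<lambda>i. \<parallel>g i \<ominus> f i\<parallel>", rotated 2]) (use g in \<open>simp_all add: cl_def\<close>)
    qed
    from tendsto_add[OF this z] show ?thesis by simp
  qed
  have "lim_state \<chi> (cl f) = z" unfolding lim_state_def
  proof (rule the_equality)
    show "\<forall>f\<in>cl f. ((\<lambda>i. \<chi> i (f i)) \<longlongrightarrow> z) \<omega>" using all by blast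
    show "z' = z" if "\<forall>f\<in>cl f. ((\<lambda>i. \<chi> i (f i)) \<longlongrightarrow> z') \<omega>" for z'
      using that cl_self[OF f] z tendsto_unique[OF \<omega>_nonbot] by blast
  qed
  then show ?thesis using z by simp
qed

lemma lim_state_eqI:
  assumes \<chi>: "\<And>i. state A (\<chi> i)" and f: "f \<in> bdd" and "((\<lambda>i. \<chi> i (f i)) \<longlongrightarrow> z) \<omega>"
  shows "lim_state \<chi> (cl f) = z"
  using tendsto_unique[OF \<omega>_nonbot lim_state_tendsto[OF \<chi> f] assms(3)] .

lemma state_lim_state:
  assumes \<chi>: "\<And>i. state A (\<chi> i)"
  shows "state Q (lim_state \<chi>)"
  unfolding state_def
proof (intro conjI ballI allI)
  have st: "cstar_state A (\<chi> i)" for i using \<chi> by unfold_locales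
  note lt = lim_state_tendsto[OF \<chi>]
  {
    fix X Y assume "X \<in> carrier Q" "Y \<in> carrier Q"
    then obtain f g where f: "f \<in> bdd" "X = cl f" and g: "g \<in> bdd" "Y = cl g" by (metis Q_cases)
    show "lim_state \<chi> (X \<oplus>\<^bsub>Q\<^esub> Y) = lim_state \<chi> X + lim_state \<chi> Y"
      unfolding f(2) g(2) Q_add[OF f(1) g(1)]
      by (rule lim_state_eqI[OF \<chi> bdd_add[OF f(1) g(1)]])
        (use tendsto_add[OF lt[OF f(1)] lt[OF g(1)]] f g cstar_state.\<phi>_add[OF st] in simp)
  }
  {
    fix c X assume "X \<in> carrier Q"
    then obtain f where f: "f \<in> bdd" "X = cl f" by (metis Q_cases)
    show "lim_state \<chi> (cscale Q c X) = c * lim_state \<chi> X"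
      unfolding f(2) Q_cscale[OF f(1)]
      by (rule lim_state_eqI[OF \<chi> bdd_cscale[OF f(1)]])
        (use tendsto_mult_left[OF lt[OF f(1)], of c] f cstar_state.\<phi>_cscale[OF st] in simp)
  }
  {
    fix X assume "X \<in> pos_elems Q"
    then obtain Y where Y: "Y \<in> carrier Q" "X = star Q Y \<otimes>\<^bsub>Q\<^esub> Y" by (auto simp: pos_elems_def)
    then obtain f where f: "f \<in> bdd" "Y = cl f" by (metis Q_cases)
    have X: "X = cl (\<lambda>i. (f i)\<^sup>\<star> \<otimes> f i)" using Y f by (simp add: Q_simps)
    have l: "((\<lambda>i. \<chi> i ((f i)\<^sup>\<star> \<otimes> f i)) \<longlongrightarrow> lim_state \<chi> X) \<omega>" unfolding X by (rule lt) (use f bdd_mult bdd_star in auto)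
    have "0 \<le> Re (lim_state \<chi> X)"
      by (rule tendsto_lowerbound[OF tendsto_Re[OF l]]) (use f cstar_state.\<phi>_P(1)[OF st] star_mult_P in auto)
    moreover have "Im (lim_state \<chi> X) = 0"
    proof -
      have "(\<lambda>i. Im (\<chi> i ((f i)\<^sup>\<star> \<otimes> f i))) = (\<lambda>i. 0)" using f cstar_state.\<phi>_P(2)[OF st] star_mult_P by auto
      then show ?thesis using tendsto_unique[OF \<omega>_nonbot tendsto_Im[OF l]] by simp
    qed
    ultimately show "lim_state \<chi> X \<in> \<real>\<^sub>\<ge>\<^sub>0" by (simp add: complex_nonneg_Reals_iff)
  }
  show "lim_state \<chi> \<one>\<^bsub>Q\<^esub> = 1" unfolding Q_one
    by (rule lim_state_eqI[OF \<chi> bdd_const]) (use cstar_state.\<phi>_one[OF st] in auto)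
qed

text \<open>At each index a norming vector of the representative gives a vector state of A whose
  value at f* f is at least half the squared norm; the limit of these states is at least half of the
  squared norm of X.\<close>

lemma enough_states:
  assumes \<rho>: "state A \<rho>" "gns_faithful A \<rho>" and X: "X \<in> carrier Q" "X \<noteq> \<zero>\<^bsub>Q\<^esub>"
  shows "\<exists>\<psi>. state Q \<psi> \<and> \<psi> (star Q X \<otimes>\<^bsub>Q\<^esub> X) \<noteq> 0"
proof -
  interpret r: cstar_state A \<rho> using \<rho> by unfold_locales
  obtain f where f: "f \<in> bdd" "X = cl f" using X(1) by (rule Q_cases)
  have "\<exists>y. y \<in> carrier A \<and> r.sn y = 1 \<and> \<parallel>f i\<parallel>\<^sup>2 / 2 \<le> r.sq (f i \<otimes> y)" for i
    using r.norming_vector[OF \<rho>(2) bdd_carrier[OF f(1), of i]] by blast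
  then obtain y where y: "\<And>i. y i \<in> carrier A" "\<And>i. r.sn (y i) = 1" "\<And>i. \<parallel>f i\<parallel>\<^sup>2 / 2 \<le> r.sq (f i \<otimes> y i)" by metis
  define \<chi> where "\<chi> i x = \<rho> ((y i)\<^sup>\<star> \<otimes> x \<otimes> y i)" for i x
  have \<chi>: "state A (\<chi> i)" for i unfolding \<chi>_def using r.vector_state y by blast
  have Xe: "star Q X \<otimes>\<^bsub>Q\<^esub> X = cl (\<lambda>i. (f i)\<^sup>\<star> \<otimes> f i)" using f by (simp add: Q_simps)
  have l: "((\<lambda>i. \<chi> i ((f i)\<^sup>\<star> \<otimes> f i)) \<longlongrightarrow> lim_state \<chi> (star Q X \<otimes>\<^bsub>Q\<^esub> X)) \<omega>"
    unfolding Xe by (rule lim_state_tendsto[OF \<chi>]) (use f bdd_mult bdd_star in auto)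
  have val: "Re (\<chi> i ((f i)\<^sup>\<star> \<otimes> f i)) = r.sq (f i \<otimes> y i)" for i
    using f y by (simp add: \<chi>_def r.sq_def r.ip_def star_mult m_assoc)
  have "(nrm Q X)\<^sup>2 / 2 \<le> Re (lim_state \<chi> (star Q X \<otimes>\<^bsub>Q\<^esub> X))"
  proof (rule tendsto_le[OF \<omega>_nonbot tendsto_Re[OF l]])
    show "((\<lambda>i. \<parallel>f i\<parallel>\<^sup>2 / 2) \<longlongrightarrow> (nrm Q X)\<^sup>2 / 2) \<omega>" unfolding f(2) by (intro tendsto_intros Q_nrm f(1)) simp
    show "eventually (\<lambda>i. \<parallel>f i\<parallel>\<^sup>2 / 2 \<le> Re (\<chi> i ((f i)\<^sup>\<star> \<otimes> f i))) \<omega>" unfolding val using y(3) by simp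
  qed
  moreover have "nrm Q X \<noteq> 0" using Q_nrm_eq_0_iff[OF f(1)] X f(2) by simp
  then have "0 < (nrm Q X)\<^sup>2 / 2" by simp
  ultimately have "lim_state \<chi> (star Q X \<otimes>\<^bsub>Q\<^esub> X) \<noteq> 0" by (metis less_le_trans order.irrefl zero_complex.simps(1))
  then show ?thesis using state_lim_state[of \<chi>] \<chi> by (intro exI[of _ "lim_state \<chi>"]) simp
qed

end

section \<open>Isometries from excision\<close>

context cstar_algebra
begin

lemma unital_cstar_subalgebra_of_sub:
  assumes T: "unital_cstar_subalgebra A T" and T': "unital_cstar_subalgebra (A\<lparr>carrier := T\<rparr>) T'"
  shows "unital_cstar_subalgebra A T'"
proof -
  have s: "cstar_subalgebra (A\<lparr>carrier := T\<rparr>) T'" "\<one> \<in> T'" using T' by (auto simp: unital_cstar_subalgebra_def)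
  have sub: "T' \<subseteq> T" using s by (simp add: cstar_subalgebra_def)
  have "nrm_closed A T'" unfolding nrm_closed_def
  proof (intro ballI impI)
    fix x assume x: "x \<in> carrier A" and a: "\<forall>e>0. \<exists>s\<in>T'. \<parallel>x \<ominus> s\<parallel> < e"
    have "x \<in> T" by (rule nrm_closedD[OF unital_cstar_subalgebraD(8)[OF T] x]) (use a sub in blast)
    moreover have "\<forall>e>0. \<exists>s\<in>T'. nrm (A\<lparr>carrier := T\<rparr>) (x \<ominus>\<^bsub>A\<lparr>carrier := T\<rparr>\<^esub> s) < e"
      using a minus_subalgebra[OF T] sub by (metis cstar.select_convs(3) cstar.surjective partial_object.update_convs(1) subsetD)
    ultimately show "x \<in> T'" using s(1) by (simp add: cstar_subalgebra_def nrm_closed_def)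
  qed
  then show ?thesis using s sub unital_cstar_subalgebraD(1)[OF T] unfolding unital_cstar_subalgebra_def cstar_subalgebra_def by auto
qed

lemma unital_cstar_subalgebra_Int:
  assumes T: "unital_cstar_subalgebra A T" and T': "unital_cstar_subalgebra A T'"
  shows "unital_cstar_subalgebra (A\<lparr>carrier := T\<rparr>) (T \<inter> T')"
proof -
  note D = unital_cstar_subalgebraD[OF T] and D' = unital_cstar_subalgebraD[OF T']
  have "nrm_closed (A\<lparr>carrier := T\<rparr>) (T \<inter> T')" unfolding nrm_closed_def
  proof (intro ballI impI)
    fix x assume x: "x \<in> carrier (A\<lparr>carrier := T\<rparr>)"
      and a: "\<forall>e>0. \<exists>s\<in>T \<inter> T'. nrm (A\<lparr>carrier := T\<rparr>) (x \<ominus>\<^bsub>A\<lparr>carrier := T\<rparr>\<^esub> s) < e"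
    have "\<exists>s\<in>T'. \<parallel>x \<ominus> s\<parallel> < e" if e: "0 < e" for e
    proof -
      obtain s where "s \<in> T" "s \<in> T'" "nrm (A\<lparr>carrier := T\<rparr>) (x \<ominus>\<^bsub>A\<lparr>carrier := T\<rparr>\<^esub> s) < e" using a e by blast
      then show ?thesis using minus_subalgebra[OF T, of s x] by auto
    qed
    then have "x \<in> T'" using nrm_closedD[OF D'(8), of x] x D(1) by auto
    then show "x \<in> T \<inter> T'" using x by simp
  qed
  then show ?thesis unfolding unital_cstar_subalgebra_def cstar_subalgebra_def using D(2-7) D'(2-7) by simp
qed

end

context cstar_state
begin

lemma cstar_state_subalgebra:
  assumes T: "unital_cstar_subalgebra A T"
  shows "cstar_state (A\<lparr>carrier := T\<rparr>) \<phi>"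
proof (rule cstar_state.intro[OF cstar_algebra_subalgebra[OF T]])
  have sub: "T \<subseteq> carrier A" using unital_cstar_subalgebraD(1)[OF T] .
  then have "pos_elems (A\<lparr>carrier := T\<rparr>) \<subseteq> pos_elems A" by (auto simp: pos_elems_def)
  then show "cstar_state_axioms (A\<lparr>carrier := T\<rparr>) \<phi>"
    using state sub unfolding cstar_state_axioms_def state_def by (simp add: subset_iff)
qed

lemma sn_subalgebra:
  assumes T: "unital_cstar_subalgebra A T"
  shows "cstar_state.sn (A\<lparr>carrier := T\<rparr>) \<phi> x = sn x"
proof -
  interpret T: cstar_state "A\<lparr>carrier := T\<rparr>" \<phi> by (rule cstar_state_subalgebra[OF T])
  show ?thesis by (simp add: T.sn_def T.sq_def T.ip_def sn_def sq_def ip_def)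
qed

lemma cstar_prob_space_subalgebra:
  assumes T: "unital_cstar_subalgebra A T"
    and f: "\<And>d. d \<in> T \<Longrightarrow> (\<And>x. x \<in> T \<Longrightarrow> sn (d \<otimes> x) = 0) \<Longrightarrow> d = \<zero>"
  shows "cstar_prob_space (A\<lparr>carrier := T\<rparr>) \<phi>"
proof -
  interpret T: cstar_state "A\<lparr>carrier := T\<rparr>" \<phi> by (rule cstar_state_subalgebra[OF T])
  have "gns_faithful (A\<lparr>carrier := T\<rparr>) \<phi>" unfolding T.gns_faithful_iff sn_subalgebra[OF T] using f by auto
  then show ?thesis using T.cstar_algebra_axioms T.state by (simp add: cstar_prob_space_def)
qed

end

lemma eventually_net_filter:
  assumes d: "directed_set \<Lambda> leq"
  shows "net_filter \<Lambda> leq \<noteq> bot" "eventually (\<lambda>l. l \<in> \<Lambda>) (net_filter \<Lambda> leq)"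
proof -
  have ne: "\<Lambda> \<noteq> {}" using d by (simp add: directed_set_def)
  have ev: "eventually P (net_filter \<Lambda> leq) \<longleftrightarrow> (\<exists>l\<in>\<Lambda>. \<forall>m\<in>\<Lambda>. leq l m \<longrightarrow> P m)" for P
  proof -
    have "eventually P (net_filter \<Lambda> leq) \<longleftrightarrow> (\<exists>l\<in>\<Lambda>. eventually P (principal {m \<in> \<Lambda>. leq l m}))"
      unfolding net_filter_def
    proof (rule eventually_INF_base[OF ne])
      fix l m assume "l \<in> \<Lambda>" "m \<in> \<Lambda>"
      then obtain n where "n \<in> \<Lambda>" "leq l n" "leq m n" using d unfolding directed_set_def by blast
      moreover have "{k \<in> \<Lambda>. leq n k} \<subseteq> {k \<in> \<Lambda>. leq l k} \<inter> {k \<in> \<Lambda>. leq m k}"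
        using calculation d \<open>l \<in> \<Lambda>\<close> \<open>m \<in> \<Lambda>\<close> unfolding directed_set_def by blast
      ultimately show "\<exists>x\<in>\<Lambda>. principal {k \<in> \<Lambda>. leq x k} \<le> inf (principal {m \<in> \<Lambda>. leq l m}) (principal {n \<in> \<Lambda>. leq m n})"
        by (intro bexI[of _ n]) auto
    qed
    then show ?thesis unfolding eventually_principal by blast
  qed
  show "eventually (\<lambda>l. l \<in> \<Lambda>) (net_filter \<Lambda> leq)" unfolding ev using ne by blast
  have "\<not> eventually (\<lambda>_. False) (net_filter \<Lambda> leq)" unfolding ev using d unfolding directed_set_def by blast
  then show "net_filter \<Lambda> leq \<noteq> bot" using eventually_False by blast
qed

locale excised_inclusion =
  fixes A :: "'a cstar" (structure) and \<rho> :: "'a \<Rightarrow> complex" and B :: "'a set"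
    and \<Lambda> :: "'l set" and leq :: "'l \<Rightarrow> 'l \<Rightarrow> bool" and b :: "'l \<Rightarrow> 'a"
  assumes inclusion: "cstar_inclusion B A \<rho>"
    and simple: "simple_cstar (A\<lparr>carrier := B\<rparr>)"
    and pure: "purely_infinite (A\<lparr>carrier := B\<rparr>)"
    and directed: "directed_set \<Lambda> leq"
    and b: "\<And>l. l \<in> \<Lambda> \<Longrightarrow> b l \<in> pos_elems (A\<lparr>carrier := B\<rparr>) \<and> nrm A (b l) = 1"
    and excises: "excises A \<rho> (net_filter \<Lambda> leq) b"
    and vanishes: "\<And>a. a \<in> carrier A \<Longrightarrow>
      ((\<lambda>l. \<rho> (a \<otimes> b l \<otimes> star A a)) \<longlongrightarrow> 0) (net_filter \<Lambda> leq)"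

sublocale excised_inclusion \<subseteq> cstar_state A \<rho>
  using inclusion cstar_prob_spaceD(1) unfolding cstar_inclusion_def by blast

context excised_inclusion
begin

lemma B: "unital_cstar_subalgebra A B"
  using inclusion by (simp add: cstar_inclusion_def)

lemma faithful: "gns_faithful A \<rho>"
  using inclusion cstar_prob_spaceD(2) unfolding cstar_inclusion_def by blast

lemmas B_sub = unital_cstar_subalgebraD[OF B]

lemma B_carrier: "x \<in> B \<Longrightarrow> x \<in> carrier A" using B_sub(1) by blast

sublocale B: cstar_algebra "A\<lparr>carrier := B\<rparr>"
  by (rule cstar_algebra_subalgebra[OF B])

lemma B_P_subset: "B.P \<subseteq> P"
  unfolding pos_elems_eq_P[symmetric] B.pos_elems_eq_P[symmetric] using B_sub(1) by (auto simp: pos_elems_def)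

lemma one_not_zero: "\<one> \<noteq> \<zero>"
  using simple by (simp add: simple_cstar_def)

text \<open>Pure infiniteness is applied to B as a hereditary subalgebra of itself; the infinite
  projection found there yields two isometries with orthogonal ranges.\<close>

lemma isometries:
  obtains u w where "u \<in> B" "w \<in> B" "u\<^sup>\<star> \<otimes> u = \<one>" "w\<^sup>\<star> \<otimes> w = \<one>" "u\<^sup>\<star> \<otimes> w = \<zero>"
proof -
  have "hereditary_subalgebra (A\<lparr>carrier := B\<rparr>) B"
    unfolding hereditary_subalgebra_def using B.unital_cstar_subalgebra_carrier
    by (auto simp: unital_cstar_subalgebra_def pos_elems_def B_sub(5,7))
  moreover have "B \<noteq> {\<zero>}" using B_sub(3) one_not_zero by blast
  ultimately obtain p where p: "infinite_projection (A\<lparr>carrier := B\<rparr>) p"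
    using pure unfolding purely_infinite_def by auto
  obtain u w where "u \<in> carrier (A\<lparr>carrier := B\<rparr>)" "w \<in> carrier (A\<lparr>carrier := B\<rparr>)"
    "star (A\<lparr>carrier := B\<rparr>) u \<otimes>\<^bsub>A\<lparr>carrier := B\<rparr>\<^esub> u = \<one>\<^bsub>A\<lparr>carrier := B\<rparr>\<^esub>"
    "star (A\<lparr>carrier := B\<rparr>) w \<otimes>\<^bsub>A\<lparr>carrier := B\<rparr>\<^esub> w = \<one>\<^bsub>A\<lparr>carrier := B\<rparr>\<^esub>"
    "star (A\<lparr>carrier := B\<rparr>) u \<otimes>\<^bsub>A\<lparr>carrier := B\<rparr>\<^esub> w = \<zero>\<^bsub>A\<lparr>carrier := B\<rparr>\<^esub>"
    by (rule B.infinite_projection_isometries[OF simple p])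
  then show ?thesis using that by simp
qed

text \<open>Needed so that cardinalities of finite subsets grow without bound, which makes the
  ultrafilter free and the tolerances tend to 0. The state recovers c from the scalar c, so A
  contains a copy of the complex numbers.\<close>

lemma infinite_carrier: "infinite (carrier A)"
proof
  assume "finite (carrier A)"
  then have "finite (range sc)" by (rule rev_finite_subset) auto
  moreover have "inj sc"
  proof (rule injI)
    fix c d assume "sc c = sc d"
    then have "\<rho> (sc c) = \<rho> (sc d)" by simp
    then show "c = d" by (simp add: \<phi>_sc)
  qed
  ultimately have "finite (UNIV :: complex set)" by (rule finite_imageD)
  then show False using infinite_UNIV_char_0 by blast
qed

text \<open>Since \<open>B\<close> is purely infinite, \<open>b \<ge> 0\<close> of norm \<open>1\<close> can be conjugated close to \<open>1\<close> by an isometry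
  \<open>v \<in> B\<close>; then \<open>s = b\<^sup>1\<^sup>/\<^sup>2 v\<close> inherits both hypotheses on the net.\<close>

lemma approximate_isometry:
  assumes F: "finite F" "F \<subseteq> carrier A" and e: "0 < e"
  obtains s where "s \<in> B" "\<parallel>s\<parallel> \<le> 1"
    "\<And>a. a \<in> F \<Longrightarrow> \<parallel>s\<^sup>\<star> \<otimes> a \<otimes> s \<ominus> sc (\<rho> a)\<parallel> \<le> e" "\<And>a. a \<in> F \<Longrightarrow> sq (s\<^sup>\<star> \<otimes> a) \<le> e"
proof -
  let ?N = "net_filter \<Lambda> leq"
  have ev1: "eventually (\<lambda>l. nrm A (pos_sqrt A (b l) \<otimes> a \<otimes> pos_sqrt A (b l) \<ominus> \<rho> a \<cdot> b l) < e / 2) ?N" if "a \<in> F" for a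
  proof -
    have "((\<lambda>l. nrm A (pos_sqrt A (b l) \<otimes> a \<otimes> pos_sqrt A (b l) \<ominus> \<rho> a \<cdot> b l)) \<longlongrightarrow> 0) ?N"
      using excises F(2) that unfolding excises_def by blast
    then show ?thesis by (rule order_tendstoD) (use e in simp)
  qed
  have ev2: "eventually (\<lambda>l. cmod (\<rho> (a\<^sup>\<star> \<otimes> b l \<otimes> a)) < e) ?N" if "a \<in> F" for a
  proof -
    have ac: "a \<in> carrier A" using that F by blast
    \<comment> \<open>The hypothesis on the net is applied to the adjoint of a, which puts a on the
      right of b as required for the seminorm of b^(1/2) a.\<close>
    have "((\<lambda>l. \<rho> (a\<^sup>\<star> \<otimes> b l \<otimes> a)) \<longlongrightarrow> 0) ?N" using vanishes[of "a\<^sup>\<star>"] ac by simp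
    then have "((\<lambda>l. cmod (\<rho> (a\<^sup>\<star> \<otimes> b l \<otimes> a))) \<longlongrightarrow> 0) ?N" by (rule tendsto_norm_zero)
    then show ?thesis by (rule order_tendstoD) (use e in simp)
  qed
  have "eventually (\<lambda>l. l \<in> \<Lambda> \<and> (\<forall>a\<in>F. nrm A (pos_sqrt A (b l) \<otimes> a \<otimes> pos_sqrt A (b l) \<ominus> \<rho> a \<cdot> b l) < e / 2) \<and>
      (\<forall>a\<in>F. cmod (\<rho> (a\<^sup>\<star> \<otimes> b l \<otimes> a)) < e)) ?N"
    using F(1) ev1 ev2 eventually_net_filter(2)[OF directed] by (intro eventually_conj) (simp_all add: eventually_ball_finite)
  then obtain l where l: "l \<in> \<Lambda>" "\<And>a. a \<in> F \<Longrightarrow> nrm A (pos_sqrt A (b l) \<otimes> a \<otimes> pos_sqrt A (b l) \<ominus> \<rho> a \<cdot> b l) < e / 2"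
    "\<And>a. a \<in> F \<Longrightarrow> cmod (\<rho> (a\<^sup>\<star> \<otimes> b l \<otimes> a)) < e"
    using eventually_happens'[OF eventually_net_filter(1)[OF directed]] by blast
  have bP: "b l \<in> B.P" "nrm A (b l) = 1" using b[OF l(1)] by (auto simp: B.pos_elems_eq_P)
  obtain h where h: "h \<in> B.P" "h \<otimes> h = b l" using B.P_sqrt[OF bP(1)] by auto
  have hB: "h \<in> B" using B.P_carrier[OF h(1)] by simp
  have hP: "h \<in> P" using h(1) B_P_subset by blast
  have hs: "pos_sqrt A (b l) = h" using pos_sqrt_eq[OF hP h(2)] .
  have hc: "h \<in> carrier A" "h\<^sup>\<star> = h" using hP P_carrier P_star by auto
  have bc: "b l \<in> carrier A" using hc by (simp add: h(2)[symmetric])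
  define K where "K = (\<Sum>a\<in>F. cmod (\<rho> a))"
  have K: "cmod (\<rho> a) \<le> K" if "a \<in> F" for a unfolding K_def using that F by (intro member_le_sum) auto
  have K0: "0 \<le> K" unfolding K_def by (intro sum_nonneg) auto
  \<comment> \<open>With K bounding all the |\<rho>(a)|, the error \<rho>(a) (v* b v - 1) is at most
    e/2; the other half of e is left for the excision error. The cap 1/2 ensures \<epsilon> <
    1.\<close>
  define \<epsilon> where "\<epsilon> = min (1/2) (e / (2 * (K + 1)))"
  have \<epsilon>: "0 < \<epsilon>" "\<epsilon> < 1" "\<epsilon> \<le> e / (2 * (K + 1))" using e K0 by (auto simp: \<epsilon>_def)
  obtain v where "v \<in> carrier (A\<lparr>carrier := B\<rparr>)" "star (A\<lparr>carrier := B\<rparr>) v \<otimes>\<^bsub>A\<lparr>carrier := B\<rparr>\<^esub> v = \<one>\<^bsub>A\<lparr>carrier := B\<rparr>\<^esub>"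
    "nrm (A\<lparr>carrier := B\<rparr>) (star (A\<lparr>carrier := B\<rparr>) v \<otimes>\<^bsub>A\<lparr>carrier := B\<rparr>\<^esub> b l \<otimes>\<^bsub>A\<lparr>carrier := B\<rparr>\<^esub> v \<ominus>\<^bsub>A\<lparr>carrier := B\<rparr>\<^esub> \<one>\<^bsub>A\<lparr>carrier := B\<rparr>\<^esub>) \<le> \<epsilon>"
    by (rule B.purely_infinite_isometry[OF simple pure bP(1) _ \<epsilon>(1,2)]) (use bP(2) in simp)
  then have v: "v \<in> B" "v\<^sup>\<star> \<otimes> v = \<one>" "\<parallel>v\<^sup>\<star> \<otimes> b l \<otimes> v \<ominus> \<one>\<parallel> \<le> \<epsilon>"
    using minus_subalgebra[OF B B_sub(3)] by simp_all
  have vc: "v \<in> carrier A" using v B_carrier by blast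
  have vn: "\<parallel>v\<parallel> \<le> 1"
  proof -
    have "\<parallel>v\<parallel>\<^sup>2 \<le> 1" using cstar_identity[OF vc] v(2) nrm_one_le by simp
    then show ?thesis using nrm_nonneg[OF vc] by (simp add: power2_le_iff_abs_le[of 1 "\<parallel>v\<parallel>", simplified] abs_le_square_iff[of "\<parallel>v\<parallel>" 1, simplified, symmetric])
  qed
  have vsn: "\<parallel>v\<^sup>\<star>\<parallel> \<le> 1" using vn vc by simp
  have hn: "\<parallel>h\<parallel> \<le> 1"
  proof -
    have "\<parallel>h\<parallel>\<^sup>2 = 1" using nrm_sq[of h] hc h(2) bP(2) by simp
    then show ?thesis using nrm_nonneg[OF hc(1)] by (simp add: power2_eq_1_iff)
  qed
  define s where "s = h \<otimes> v"
  show ?thesis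
  proof (rule that)
    show "s \<in> B" unfolding s_def using hB v B_sub(5) by blast
    show "\<parallel>s\<parallel> \<le> 1" unfolding s_def using nrm_mult_le[OF hc(1) vc hn vn] by simp
    fix a assume a: "a \<in> F"
    then have ac: "a \<in> carrier A" using F by blast
    define d where "d = h \<otimes> a \<otimes> h \<ominus> \<rho> a \<cdot> b l"
    have d: "d \<in> carrier A" "\<parallel>d\<parallel> \<le> e / 2" using l(2)[OF a] hc ac bc unfolding hs d_def by auto
    have "s\<^sup>\<star> \<otimes> a \<otimes> s = v\<^sup>\<star> \<otimes> (h \<otimes> a \<otimes> h) \<otimes> v" using hc vc ac by (simp add: s_def star_mult m_assoc)
    also have "h \<otimes> a \<otimes> h = d \<oplus> \<rho> a \<cdot> b l" unfolding d_def using hc(1) ac cscale_closed[OF bc, of "\<rho> a"] by algebra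
    finally have "s\<^sup>\<star> \<otimes> a \<otimes> s = v\<^sup>\<star> \<otimes> d \<otimes> v \<oplus> \<rho> a \<cdot> (v\<^sup>\<star> \<otimes> b l \<otimes> v)"
      using d(1) bc vc by (simp add: r_distr l_distr cscale_mult_left cscale_mult_right)
    then have "s\<^sup>\<star> \<otimes> a \<otimes> s \<ominus> sc (\<rho> a) = v\<^sup>\<star> \<otimes> d \<otimes> v \<oplus> \<rho> a \<cdot> (v\<^sup>\<star> \<otimes> b l \<otimes> v \<ominus> \<one>)"
      using d(1) bc vc by (simp add: sc_def cscale_minus_right) (simp add: minus_eq a_assoc)
    moreover have "\<parallel>v\<^sup>\<star> \<otimes> d \<otimes> v\<parallel> \<le> e / 2"
    proof -
      have "\<parallel>v\<^sup>\<star> \<otimes> d \<otimes> v\<parallel> \<le> (1 * (e / 2)) * 1" by (intro nrm_mult_le) (use d vc vn vsn in auto)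
      then show ?thesis by simp
    qed
    moreover have "\<parallel>\<rho> a \<cdot> (v\<^sup>\<star> \<otimes> b l \<otimes> v \<ominus> \<one>)\<parallel> \<le> e / 2"
    proof -
      have "\<parallel>\<rho> a \<cdot> (v\<^sup>\<star> \<otimes> b l \<otimes> v \<ominus> \<one>)\<parallel> = cmod (\<rho> a) * \<parallel>v\<^sup>\<star> \<otimes> b l \<otimes> v \<ominus> \<one>\<parallel>" using bc vc by (simp add: nrm_cscale)
      also have "\<dots> \<le> (K + 1) * (e / (2 * (K + 1)))" using K[OF a] K0 v(3) \<epsilon> bc vc nrm_nonneg by (intro mult_mono) auto
      also have "\<dots> = e / 2" using K0 by (simp add: divide_simps)
      finally show ?thesis .
    qed
    ultimately show "\<parallel>s\<^sup>\<star> \<otimes> a \<otimes> s \<ominus> sc (\<rho> a)\<parallel> \<le> e"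
      using nrm_add_le[of "v\<^sup>\<star> \<otimes> d \<otimes> v" "\<rho> a \<cdot> (v\<^sup>\<star> \<otimes> b l \<otimes> v \<ominus> \<one>)" "e/2" "e/2"] d vc bc by simp
    have "sn (s\<^sup>\<star> \<otimes> a) \<le> sn (h \<otimes> a)"
    proof -
      have "s\<^sup>\<star> \<otimes> a = v\<^sup>\<star> \<otimes> (h \<otimes> a)" using hc vc ac by (simp add: s_def star_mult m_assoc)
      then have "sn (s\<^sup>\<star> \<otimes> a) \<le> \<parallel>v\<^sup>\<star>\<parallel> * sn (h \<otimes> a)" using sn_mult[of "v\<^sup>\<star>" "h \<otimes> a"] hc vc ac by simp
      also have "\<dots> \<le> 1 * sn (h \<otimes> a)" using vsn sn_nonneg hc ac by (intro mult_right_mono) auto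
      finally show ?thesis by simp
    qed
    then have "sq (s\<^sup>\<star> \<otimes> a) \<le> sq (h \<otimes> a)"
      unfolding sn_def by simp
    also have "sq (h \<otimes> a) = Re (\<rho> (a\<^sup>\<star> \<otimes> b l \<otimes> a))"
      using hc ac by (simp add: sq_def ip_def star_mult m_assoc h(2)[symmetric])
    also have "\<dots> \<le> e" using l(3)[OF a] complex_Re_le_cmod[of "\<rho> (a\<^sup>\<star> \<otimes> b l \<otimes> a)"] by simp
    finally show "sq (s\<^sup>\<star> \<otimes> a) \<le> e" .
  qed
qed

end

section \<open>The diagonal copy of A in its ultrapower\<close>

context ultra
begin

definition diag :: "'a \<Rightarrow> ('i \<Rightarrow> 'a) set" where "diag a = cl (\<lambda>_. a)"

lemma diag_closed: "a \<in> carrier A \<Longrightarrow> diag a \<in> carrier Q"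
  by (simp add: diag_def Q_carrier bdd_const)

lemma diag_one: "\<one>\<^bsub>Q\<^esub> = diag \<one>"
  by (simp add: diag_def Q_one)

lemma diag_zero: "\<zero>\<^bsub>Q\<^esub> = diag \<zero>"
  by (simp add: diag_def Q_zero)

lemma diag_mult: "a \<in> carrier A \<Longrightarrow> b \<in> carrier A \<Longrightarrow> diag a \<otimes>\<^bsub>Q\<^esub> diag b = diag (a \<otimes> b)"
  by (simp add: diag_def Q_mult bdd_const)

lemma diag_add: "a \<in> carrier A \<Longrightarrow> b \<in> carrier A \<Longrightarrow> diag a \<oplus>\<^bsub>Q\<^esub> diag b = diag (a \<oplus> b)"
  by (simp add: diag_def Q_add bdd_const)

lemma diag_minus: "a \<in> carrier A \<Longrightarrow> b \<in> carrier A \<Longrightarrow> diag a \<ominus>\<^bsub>Q\<^esub> diag b = diag (a \<ominus> b)"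
  by (simp add: diag_def Q_minus bdd_const)

lemma diag_cscale: "a \<in> carrier A \<Longrightarrow> cscale Q c (diag a) = diag (c \<cdot> a)"
  by (simp add: diag_def Q_cscale bdd_const)

lemma diag_star: "a \<in> carrier A \<Longrightarrow> star Q (diag a) = diag (a\<^sup>\<star>)"
  by (simp add: diag_def Q_star bdd_const)

lemma diag_nrm: "a \<in> carrier A \<Longrightarrow> nrm Q (diag a) = \<parallel>a\<parallel>"
  unfolding diag_def by (intro Q_nrm_eqI bdd_const) auto

lemma diag_inj: "inj_on diag (carrier A)"
proof (rule inj_onI)
  fix a b assume ab: "a \<in> carrier A" "b \<in> carrier A" "diag a = diag b"
  interpret Q: cstar_algebra Q by (rule cstar_algebra_Q)
  have "nrm Q (diag a \<ominus>\<^bsub>Q\<^esub> diag b) = 0" using ab diag_closed[of b] Q.nrm_eq_0_iff[of "\<zero>\<^bsub>Q\<^esub>"] by (simp add: Q.minus_eq Q.r_neg)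
  then have "\<parallel>a \<ominus> b\<parallel> = 0" using ab by (metis diag_minus diag_nrm minus_closed)
  then show "a = b" using ab nrm_eq_0_iff[of "a \<ominus> b"] minus_eq_zero_iff by simp
qed

lemmas diag_simps = diag_mult diag_add diag_minus diag_cscale diag_star diag_nrm

text \<open>The diagonal map is isometric and A is complete, so the image is closed.\<close>

lemma unital_cstar_subalgebra_diag: "unital_cstar_subalgebra Q (diag ` carrier A)"
proof -
  interpret Q: cstar_algebra Q by (rule cstar_algebra_Q)
  have "nrm_closed Q (diag ` carrier A)" unfolding nrm_closed_def
  proof (intro ballI impI)
    fix X assume X: "X \<in> carrier Q" and a: "\<forall>e>0. \<exists>s\<in>diag ` carrier A. nrm Q (X \<ominus>\<^bsub>Q\<^esub> s) < e"
    have "\<exists>f. \<forall>n. f n \<in> carrier A \<and> nrm Q (X \<ominus>\<^bsub>Q\<^esub> diag (f n)) < (1/2) ^ Suc n"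
    proof (intro choice allI)
      fix n :: nat
      have "(0::real) < (1/2) ^ Suc n" by simp
      then show "\<exists>x. x \<in> carrier A \<and> nrm Q (X \<ominus>\<^bsub>Q\<^esub> diag x) < (1/2) ^ Suc n" using a by blast
    qed
    then obtain f where f: "\<And>n. f n \<in> carrier A" "\<And>n. nrm Q (X \<ominus>\<^bsub>Q\<^esub> diag (f n)) < (1/2) ^ Suc n" by blast
    have fQ: "diag (f n) \<in> carrier Q" for n using diag_closed f by blast
    have step: "\<parallel>f (Suc n) \<ominus> f n\<parallel> \<le> (1/2) ^ n" for n
    proof -
      have "\<parallel>f (Suc n) \<ominus> f n\<parallel> = nrm Q (diag (f (Suc n)) \<ominus>\<^bsub>Q\<^esub> diag (f n))" using f by (simp add: diag_simps)
      also have "\<dots> \<le> nrm Q (diag (f (Suc n)) \<ominus>\<^bsub>Q\<^esub> X) + nrm Q (X \<ominus>\<^bsub>Q\<^esub> diag (f n))"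
        using Q.nrm_minus_triangle fQ X by blast
      also have "nrm Q (diag (f (Suc n)) \<ominus>\<^bsub>Q\<^esub> X) = nrm Q (X \<ominus>\<^bsub>Q\<^esub> diag (f (Suc n)))"
        using Q.nrm_minus_commute fQ X by blast
      also have "\<dots> \<le> (1/2) ^ Suc n" using order.strict_trans[OF f(2)[of "Suc n"], of "(1/2) ^ Suc n"] by simp
      finally show ?thesis using f(2)[of n] by simp
    qed
    obtain x where x: "x \<in> carrier A" "\<And>n. \<parallel>f n \<ominus> x\<parallel> \<le> 2 * (1/2) ^ n"
      using geometric_limit[of f] f(1) step by blast
    have "nrm Q (X \<ominus>\<^bsub>Q\<^esub> diag x) \<le> 3 * (1/2) ^ n" for n
    proof -
      have "nrm Q (X \<ominus>\<^bsub>Q\<^esub> diag x) \<le> nrm Q (X \<ominus>\<^bsub>Q\<^esub> diag (f n)) + nrm Q (diag (f n) \<ominus>\<^bsub>Q\<^esub> diag x)"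
        using Q.nrm_minus_triangle fQ X diag_closed[OF x(1)] by blast
      also have "nrm Q (diag (f n) \<ominus>\<^bsub>Q\<^esub> diag x) = \<parallel>f n \<ominus> x\<parallel>" using f x by (simp add: diag_simps)
      finally have "nrm Q (X \<ominus>\<^bsub>Q\<^esub> diag x) \<le> (1/2) ^ Suc n + 2 * (1/2) ^ n" using f(2)[of n] x(2)[of n] by linarith
      moreover have "(0::real) \<le> (1/2) ^ n" by simp
      ultimately show ?thesis unfolding power_Suc by linarith
    qed
    moreover have "(\<lambda>n. 3 * (1/2 :: real) ^ n) \<longlonglongrightarrow> 3 * 0" by (intro tendsto_intros LIMSEQ_power_zero) auto
    ultimately have "nrm Q (X \<ominus>\<^bsub>Q\<^esub> diag x) \<le> 0" using LIMSEQ_le_const[of _ "3 * 0 :: real"] by fastforce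
    then have "X \<ominus>\<^bsub>Q\<^esub> diag x = \<zero>\<^bsub>Q\<^esub>"
      using Q.nrm_eq_0_iff[of "X \<ominus>\<^bsub>Q\<^esub> diag x"] Q.nrm_nonneg[of "X \<ominus>\<^bsub>Q\<^esub> diag x"] X diag_closed[OF x(1)] by (simp add: order.antisym)
    then have "X = diag x" using X diag_closed[OF x(1)] Q.minus_eq_zero_iff by simp
    then show "X \<in> diag ` carrier A" using x by blast
  qed
  then show ?thesis unfolding unital_cstar_subalgebra_def cstar_subalgebra_def
    by (auto simp: diag_closed diag_simps diag_one diag_zero)
qed

end

section \<open>Passage to the ultrapower and construction of the witness\<close>

context excised_inclusion
begin

text \<open>The index i is itself the finite set of elements for which the relations are required,
  with tolerance 1 / (1 + card i). An ultrafilter finer than the filter of large finite subsets of A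
  makes both relations exact for every single a.\<close>

lemma isometry_family:
  obtains \<omega> :: "'a set filter" and s where "ultrafilter \<omega>" "free_ultrafilter \<omega>"
    "\<And>i. s i \<in> B" "\<And>i. \<parallel>s i\<parallel> \<le> 1"
    "\<And>a. a \<in> carrier A \<Longrightarrow> ((\<lambda>i. \<parallel>(s i)\<^sup>\<star> \<otimes> a \<otimes> s i \<ominus> sc (\<rho> a)\<parallel>) \<longlongrightarrow> 0) \<omega>"
    "\<And>a. a \<in> carrier A \<Longrightarrow> ((\<lambda>i. sq ((s i)\<^sup>\<star> \<otimes> a)) \<longlongrightarrow> 0) \<omega>"
proof -
  define e where "e i = inverse (real (Suc (card i)))" for i :: "'a set"
  have e: "0 < e i" for i by (simp add: e_def)
  have "\<exists>s. s \<in> B \<and> \<parallel>s\<parallel> \<le> 1 \<and> (finite i \<and> i \<subseteq> carrier A \<longrightarrow>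
    (\<forall>a\<in>i. \<parallel>s\<^sup>\<star> \<otimes> a \<otimes> s \<ominus> sc (\<rho> a)\<parallel> \<le> e i \<and> sq (s\<^sup>\<star> \<otimes> a) \<le> e i))" for i
  proof (cases "finite i \<and> i \<subseteq> carrier A")
    case True
    then have i: "finite i" "i \<subseteq> carrier A" by auto
    show ?thesis by (rule approximate_isometry[OF i e]) blast
  next
    case False
    \<comment> \<open>An arbitrary default: the ultrafilter gives no weight to these
      indices.\<close>
    then show ?thesis using B_sub(2) by (intro exI[of _ \<zero>]) auto
  qed
  then have "\<exists>s. \<forall>i. s i \<in> B \<and> \<parallel>s i\<parallel> \<le> 1 \<and> (finite i \<and> i \<subseteq> carrier A \<longrightarrow>
    (\<forall>a\<in>i. \<parallel>(s i)\<^sup>\<star> \<otimes> a \<otimes> s i \<ominus> sc (\<rho> a)\<parallel> \<le> e i \<and> sq ((s i)\<^sup>\<star> \<otimes> a) \<le> e i))"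
    by (intro choice allI)
  then obtain s where s: "\<And>i. s i \<in> B" "\<And>i. \<parallel>s i\<parallel> \<le> 1"
    "\<And>i a. \<lbrakk>finite i; i \<subseteq> carrier A; a \<in> i\<rbrakk> \<Longrightarrow> \<parallel>(s i)\<^sup>\<star> \<otimes> a \<otimes> s i \<ominus> sc (\<rho> a)\<parallel> \<le> e i"
    "\<And>i a. \<lbrakk>finite i; i \<subseteq> carrier A; a \<in> i\<rbrakk> \<Longrightarrow> sq ((s i)\<^sup>\<star> \<otimes> a) \<le> e i"
    by blast
  obtain \<omega> where \<omega>: "ultrafilter \<omega>" "\<omega> \<le> finite_subsets_at_top (carrier A)"
    by (rule ultrafilter_below[OF finite_subsets_at_top_neq_bot])
  have large: "eventually (\<lambda>i. finite i \<and> X \<subseteq> i \<and> i \<subseteq> carrier A) \<omega>" if "finite X" "X \<subseteq> carrier A" for X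
    by (rule filter_leD[OF \<omega>(2)]) (use that in \<open>auto simp: eventually_finite_subsets_at_top intro!: exI[of _ X]\<close>)
  have card: "eventually (\<lambda>i. n \<le> card i) \<omega>" for n
  proof -
    obtain X where X: "finite X" "X \<subseteq> carrier A" "card X = n"
      using infinite_arbitrarily_large[OF infinite_carrier] by blast
    show ?thesis using large[OF X(1,2)] by eventually_elim (use X(3) card_mono in blast)
  qed
  \<comment> \<open>Comparing cardinalities covers infinite j as well, for which
    \<open>card j\<close> is 0.\<close>
  have free: "eventually (\<lambda>i. i \<noteq> j) \<omega>" for j
    using card[of "Suc (card j)"] by eventually_elim auto
  have small: "((\<lambda>i. f i) \<longlongrightarrow> 0) \<omega>"
    if f: "\<And>i. 0 \<le> f i" "\<And>i. \<lbrakk>finite i; i \<subseteq> carrier A; a \<in> i\<rbrakk> \<Longrightarrow> f i \<le> e i" "a \<in> carrier A"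
    for f :: "'a set \<Rightarrow> real" and a
  proof (rule order_tendstoI)
    fix r :: real assume "r < 0"
    then show "eventually (\<lambda>i. r < f i) \<omega>" using f(1) by (simp add: less_le_trans)
  next
    fix r :: real assume "0 < r"
    then obtain n where n: "inverse (real (Suc n)) < r" using reals_Archimedean by blast
    have "eventually (\<lambda>i. finite i \<and> {a} \<subseteq> i \<and> i \<subseteq> carrier A) \<omega>" using large[of "{a}"] f(3) by simp
    with card[of n] show "eventually (\<lambda>i. f i < r) \<omega>"
    proof (rule eventually_elim2)
      fix i assume i: "n \<le> card i" "finite i \<and> {a} \<subseteq> i \<and> i \<subseteq> carrier A"
      have "f i \<le> inverse (real (Suc (card i)))" using f(2) i unfolding e_def by blast
      also have "\<dots> \<le> inverse (real (Suc n))" using i by (intro le_imp_inverse_le) auto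
      finally show "f i < r" using n by simp
    qed
  qed
  have sc': "s i \<in> carrier A" for i using s(1) B_carrier by blast
  show ?thesis
  proof (rule that[of \<omega> s])
    show "free_ultrafilter \<omega>" using \<omega>(1) free by (simp add: free_ultrafilter_def ultrafilter_def)
    fix a assume a: "a \<in> carrier A"
    show "((\<lambda>i. \<parallel>(s i)\<^sup>\<star> \<otimes> a \<otimes> s i \<ominus> sc (\<rho> a)\<parallel>) \<longlongrightarrow> 0) \<omega>"
      by (rule small[OF _ s(3) a]) (use sc' a nrm_nonneg in auto)
    show "((\<lambda>i. sq ((s i)\<^sup>\<star> \<otimes> a)) \<longlongrightarrow> 0) \<omega>"
      by (rule small[OF _ s(4) a]) (use sc' a sq_nonneg in auto)
  qed (use \<omega> s in auto)
qed

lemma ultrapower_isometry: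
  obtains \<omega> :: "'a set filter" and S u\<^sub>1 u\<^sub>2 where "free_ultrafilter \<omega>" "ultrafilter \<omega>" "S \<in> ultra_sub A \<omega> B"
    "toeplitz_faithful (ultrapower A \<omega>) (ultra_state \<rho> \<omega>) (ultra.diag A \<omega> ` carrier A) S u\<^sub>1 u\<^sub>2"
proof -
  obtain \<omega> :: "'a set filter" and s where \<omega>: "ultrafilter \<omega>" "free_ultrafilter \<omega>"
    and s: "\<And>i. s i \<in> B" "\<And>i. \<parallel>s i\<parallel> \<le> 1"
    and l1: "\<And>a. a \<in> carrier A \<Longrightarrow> ((\<lambda>i. \<parallel>(s i)\<^sup>\<star> \<otimes> a \<otimes> s i \<ominus> sc (\<rho> a)\<parallel>) \<longlongrightarrow> 0) \<omega>"
    and l2: "\<And>a. a \<in> carrier A \<Longrightarrow> ((\<lambda>i. sq ((s i)\<^sup>\<star> \<otimes> a)) \<longlongrightarrow> 0) \<omega>"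
    by (rule isometry_family) blast
  interpret u: ultra A \<omega> by unfold_locales (rule \<omega>(1))
  interpret Q: cstar_state "ultrapower A \<omega>" "ultra_state \<rho> \<omega>"
    unfolding u.ultra_state_eq by (rule cstar_state.intro[OF u.cstar_algebra_Q cstar_state_axioms.intro[OF u.state_lim_state[OF state]]])
  have \<phi>_diag: "ultra_state \<rho> \<omega> (u.diag a) = \<rho> a" if "a \<in> carrier A" for a
    unfolding u.ultra_state_eq u.diag_def by (rule u.lim_state_eqI[OF state u.bdd_const[OF that]]) simp
  obtain u w where uw: "u \<in> B" "w \<in> B" "u\<^sup>\<star> \<otimes> u = \<one>" "w\<^sup>\<star> \<otimes> w = \<one>" "u\<^sup>\<star> \<otimes> w = \<zero>" by (rule isometries)
  then have uwc: "u \<in> carrier A" "w \<in> carrier A" using B_carrier by auto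
  have sA: "s i \<in> carrier A" for i using s(1) B_carrier by blast
  have sb: "s \<in> u.bdd" using u.bddI[of s 1] sA s(2) by blast
  define S where "S = u.cl s"
  have "toeplitz_faithful (ultrapower A \<omega>) (ultra_state \<rho> \<omega>) (u.diag ` carrier A) S (u.diag u) (u.diag w)"
  proof unfold_locales
    show "unital_cstar_subalgebra (ultrapower A \<omega>) (u.diag ` carrier A)" by (rule u.unital_cstar_subalgebra_diag)
    show "S \<in> carrier (ultrapower A \<omega>)" using sb by (simp add: S_def u.Q_carrier)
    fix X assume "X \<in> u.diag ` carrier A"
    then obtain a where a: "a \<in> carrier A" "X = u.diag a" by blast
    note b = sb u.bdd_const[OF a(1)] u.bdd_star[OF sb] u.bdd_mult[OF u.bdd_star[OF sb] u.bdd_const[OF a(1)]]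
    have m: "star (ultrapower A \<omega>) S \<otimes>\<^bsub>ultrapower A \<omega>\<^esub> X = u.cl (\<lambda>i. (s i)\<^sup>\<star> \<otimes> a)"
      unfolding S_def a(2) u.diag_def u.Q_star[OF sb] by (rule u.Q_mult[OF b(3,2)])
    have "star (ultrapower A \<omega>) S \<otimes>\<^bsub>ultrapower A \<omega>\<^esub> X \<otimes>\<^bsub>ultrapower A \<omega>\<^esub> S = u.cl (\<lambda>i. (s i)\<^sup>\<star> \<otimes> a \<otimes> s i)"
      unfolding m unfolding S_def by (rule u.Q_mult[OF b(4,1)])
    also have "\<dots> = u.cl (\<lambda>_. sc (\<rho> a))"
      by (rule u.cl_eq_iff[THEN iffD2, OF u.bdd_mult[OF b(4,1)] u.bdd_const[OF sc_closed] l1[OF a(1)]])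
    also have "\<dots> = Q.sc (ultra_state \<rho> \<omega> X)"
      unfolding a(2) \<phi>_diag[OF a(1)] unfolding Q.sc_def u.diag_one u.diag_cscale[OF one_closed] unfolding sc_def u.diag_def ..
    finally show "star (ultrapower A \<omega>) S \<otimes>\<^bsub>ultrapower A \<omega>\<^esub> X \<otimes>\<^bsub>ultrapower A \<omega>\<^esub> S = Q.sc (ultra_state \<rho> \<omega> X)" .
    have "ultra_state \<rho> \<omega> (star (ultrapower A \<omega>) (u.cl (\<lambda>i. (s i)\<^sup>\<star> \<otimes> a)) \<otimes>\<^bsub>ultrapower A \<omega>\<^esub> u.cl (\<lambda>i. (s i)\<^sup>\<star> \<otimes> a)) = 0"
      unfolding u.Q_star[OF b(4)] u.Q_mult[OF u.bdd_star[OF b(4)] b(4)] u.ultra_state_eq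
    proof (rule u.lim_state_eqI[OF state u.bdd_mult[OF u.bdd_star[OF b(4)] b(4)]])
      have "\<rho> (((s i)\<^sup>\<star> \<otimes> a)\<^sup>\<star> \<otimes> ((s i)\<^sup>\<star> \<otimes> a)) = of_real (sq ((s i)\<^sup>\<star> \<otimes> a))" for i
        using ip_self[of "(s i)\<^sup>\<star> \<otimes> a"] sA a(1) by (simp add: ip_def)
      then show "((\<lambda>i. \<rho> (((s i)\<^sup>\<star> \<otimes> a)\<^sup>\<star> \<otimes> ((s i)\<^sup>\<star> \<otimes> a))) \<longlongrightarrow> 0) \<omega>"
        using tendsto_of_real[OF l2[OF a(1)], where 'a = complex] by simp
    qed
    then show "Q.sn (star (ultrapower A \<omega>) S \<otimes>\<^bsub>ultrapower A \<omega>\<^esub> X) = 0" unfolding m Q.sn_def Q.sq_def Q.ip_def by simp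
  next
    show "u.diag u \<in> u.diag ` carrier A" "u.diag w \<in> u.diag ` carrier A" using uwc by auto
    show "star (ultrapower A \<omega>) (u.diag u) \<otimes>\<^bsub>ultrapower A \<omega>\<^esub> u.diag u = \<one>\<^bsub>ultrapower A \<omega>\<^esub>"
      "star (ultrapower A \<omega>) (u.diag w) \<otimes>\<^bsub>ultrapower A \<omega>\<^esub> u.diag w = \<one>\<^bsub>ultrapower A \<omega>\<^esub>"
      "star (ultrapower A \<omega>) (u.diag u) \<otimes>\<^bsub>ultrapower A \<omega>\<^esub> u.diag w = \<zero>\<^bsub>ultrapower A \<omega>\<^esub>"
      using uwc uw(3-5) by (simp_all add: u.diag_star u.diag_mult u.diag_one u.diag_zero)
  next
    fix h assume h: "h \<in> u.diag ` carrier A" "star (ultrapower A \<omega>) h = h"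
      and pos: "\<And>x. x \<in> u.diag ` carrier A \<Longrightarrow>
        0 \<le> Re (ultra_state \<rho> \<omega> (star (ultrapower A \<omega>) x \<otimes>\<^bsub>ultrapower A \<omega>\<^esub> h \<otimes>\<^bsub>ultrapower A \<omega>\<^esub> x))"
    obtain a where a: "a \<in> carrier A" "h = u.diag a" using h(1) by blast
    have "a\<^sup>\<star> = a" using h(2) a inj_onD[OF u.diag_inj, of "a\<^sup>\<star>" a] by (simp add: u.diag_star)
    then have "a \<in> P"
    proof (rule faithful_positive[OF faithful a(1)])
      fix x assume x: "x \<in> carrier A"
      show "0 \<le> Re (\<rho> (x\<^sup>\<star> \<otimes> a \<otimes> x))"
        using pos[of "u.diag x"] x a by (simp add: u.diag_star u.diag_mult \<phi>_diag)
    qed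
    then obtain y where y: "y \<in> carrier A" "a = y\<^sup>\<star> \<otimes> y" unfolding pos_elems_eq_P[symmetric] by (auto simp: pos_elems_def)
    have "h = star (ultrapower A \<omega>) (u.diag y) \<otimes>\<^bsub>ultrapower A \<omega>\<^esub> u.diag y" using y by (simp add: a u.diag_star u.diag_mult)
    then show "h \<in> Q.P" using Q.star_mult_P u.diag_closed[OF y(1)] by simp
  qed
  moreover have "S \<in> ultra_sub A \<omega> B" unfolding ultra_sub_def S_def
    by (rule image_eqI[of _ _ s]) (use s(1) sb u.ultra_class_eq[OF sb] in \<open>simp_all add: u.carrier_ell_infty\<close>)
  ultimately show ?thesis using that \<omega> by blast
qed

text \<open>C and D are realised inside the ultrapower, so the inclusion of C into D and \<sigma>
  are identity maps and one state serves for both. The image of the algebra generated by B and C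
  lies in the ultrapower of B because that is a closed subalgebra containing S.\<close>

theorem selfless: "selfless B A \<rho>"
proof -
  obtain \<omega> :: "'a set filter" and S u\<^sub>1 u\<^sub>2 where \<omega>: "free_ultrafilter \<omega>" "ultrafilter \<omega>" and SB: "S \<in> ultra_sub A \<omega> B"
    and T: "toeplitz_faithful (ultrapower A \<omega>) (ultra_state \<rho> \<omega>) (ultra.diag A \<omega> ` carrier A) S u\<^sub>1 u\<^sub>2"
    by (rule ultrapower_isometry)
  interpret u: ultra A \<omega> by unfold_locales (rule \<omega>(2))
  let ?Q = "ultrapower A \<omega>" and ?\<phi> = "ultra_state \<rho> \<omega>"
  interpret T: toeplitz_faithful ?Q ?\<phi> "u.diag ` carrier A" S u\<^sub>1 u\<^sub>2 by (rule T)
  have \<phi>_diag: "?\<phi> (u.diag a) = \<rho> a" if "a \<in> carrier A" for a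
    unfolding u.ultra_state_eq u.diag_def by (rule u.lim_state_eqI[OF state u.bdd_const[OF that]]) simp
  let ?D = "?Q\<lparr>carrier := T.D\<rparr>" and ?C = "?Q\<lparr>carrier := T.C\<rparr>"
  note states = u.enough_states[OF state faithful]
  have base: "u.diag ` carrier A \<subseteq> T.D" "S \<in> T.D"
    using T.cstar_generated_base[of "u.diag ` carrier A \<union> {S}"] by (auto simp: T.D_def)
  have CD: "T.C \<subseteq> T.D" unfolding T.K.D_def
    by (rule T.cstar_generated_least[OF T.D_sub]) (use base(2) in \<open>auto intro: T.unital_cstar_subalgebraD(10)[OF T.D_sub]\<close>)
  have Dps: "cstar_prob_space ?D ?\<phi>"
    by (rule T.cstar_prob_space_subalgebra[OF T.D_sub]) (use T.D_gns_faithful[OF states] in blast)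
  have Cps: "cstar_prob_space ?C ?\<phi>"
  proof (rule T.cstar_prob_space_subalgebra[OF T.K.D_sub])
    fix c assume c: "c \<in> T.C" "\<And>x. x \<in> T.C \<Longrightarrow> T.sn (c \<otimes>\<^bsub>?Q\<^esub> x) = 0"
    \<comment> \<open>Null on C implies null on D, and there the representation is faithful.\<close>
    show "c = \<zero>\<^bsub>?Q\<^esub>" by (rule T.D_gns_faithful[OF states]) (use c CD T.C_null_D[OF c] in auto)
  qed
  have C_ne: "carrier ?C \<noteq> range (\<lambda>z. cscale ?C z \<one>\<^bsub>?C\<^esub>)"
  proof
    assume "carrier ?C = range (\<lambda>z. cscale ?C z \<one>\<^bsub>?C\<^esub>)"
    then obtain z where z: "S = T.sc z" using T.S_in_C by (auto simp: T.sc_def)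
    \<comment> \<open>A scalar that is a null vector is 0, which contradicts S* S = 1.\<close>
    have "cmod z = 0" using T.S_star_null by (simp add: z T.star_sc) (simp add: T.sc_def T.sn_cscale)
    then have "S = \<zero>\<^bsub>?Q\<^esub>" by (simp add: z)
    then have "\<zero>\<^bsub>?Q\<^esub> = \<one>\<^bsub>?Q\<^esub>" using T.S_star_S' by simp
    then have "u.diag \<zero> = u.diag \<one>" by (simp add: u.diag_zero u.diag_one)
    then show False using inj_onD[OF u.diag_inj, of \<zero> \<one>] one_not_zero by auto
  qed
  have iA: "cstar_embedding A ?D u.diag"
    unfolding cstar_embedding_def star_hom_def ring_hom_def
    using base(1) u.diag_inj by (auto simp: u.diag_simps u.diag_one)
  have iC: "cstar_embedding ?C ?D (\<lambda>x. x)"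
    unfolding cstar_embedding_def star_hom_def ring_hom_def using CD by (auto simp: inj_on_def)
  have \<sigma>: "cstar_embedding ?D ?Q (\<lambda>x. x)"
    unfolding cstar_embedding_def star_hom_def ring_hom_def
    using T.unital_cstar_subalgebraD(1)[OF T.D_sub] by (auto simp: inj_on_def)
  interpret D: cstar_algebra ?D using Dps by (simp add: cstar_prob_space_def)
  have gen: "cstar_generated ?D (u.diag ` carrier A \<union> T.C) = T.D"
  proof
    have "u.diag ` carrier A \<union> T.C \<subseteq> carrier ?D" using base CD by simp
    note G = D.unital_cstar_subalgebra_generated[OF this]
    show "cstar_generated ?D (u.diag ` carrier A \<union> T.C) \<subseteq> T.D" using D.unital_cstar_subalgebraD(1)[OF G] by simp
    have "u.diag ` carrier A \<union> {S} \<subseteq> cstar_generated ?D (u.diag ` carrier A \<union> T.C)"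
      using D.cstar_generated_base[of "u.diag ` carrier A \<union> T.C"] T.S_in_C by blast
    from T.cstar_generated_least[OF T.unital_cstar_subalgebra_of_sub[OF T.D_sub G] this]
    show "T.D \<subseteq> cstar_generated ?D (u.diag ` carrier A \<union> T.C)" by (simp only: T.D_def)
  qed
  have free: "free_pair ?D ?\<phi> (u.diag ` carrier A) T.C"
    using T.free_R_C by (simp add: free_pair_def)
  have rfp: "reduced_free_product A \<rho> ?C ?\<phi> ?D ?\<phi> u.diag (\<lambda>x. x)"
    unfolding reduced_free_product_def state_preserving_def using Dps iA iC gen free \<phi>_diag by simp
  have BD: "cstar_generated ?D (u.diag ` B \<union> T.C) \<subseteq> ultra_sub A \<omega> B"
  proof -
    note V = u.unital_cstar_subalgebra_ultra_sub[OF B]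
    have "T.C \<subseteq> ultra_sub A \<omega> B" unfolding T.K.D_def
      by (rule T.cstar_generated_least[OF V]) (use SB T.unital_cstar_subalgebraD(10)[OF V] in auto)
    moreover have "u.diag a \<in> ultra_sub A \<omega> B" if "a \<in> B" for a
      unfolding ultra_sub_def u.diag_def
      by (rule image_eqI[of _ _ "\<lambda>_. a"])
        (use u.ultra_class_eq that B_carrier u.bdd_const in \<open>auto simp: u.carrier_ell_infty\<close>)
    ultimately have "u.diag ` B \<union> T.C \<subseteq> T.D \<inter> ultra_sub A \<omega> B" using base(1) CD B_carrier by blast
    from D.cstar_generated_least[OF T.unital_cstar_subalgebra_Int[OF T.D_sub V] this] show ?thesis by blast
  qed
  have "selfless_witness B A \<rho> \<omega> ?C ?\<phi> ?D ?\<phi> u.diag (\<lambda>x. x) (\<lambda>x. x)"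
    unfolding selfless_witness_def
    using \<omega>(1) Cps C_ne rfp \<sigma> BD by (simp add: state_preserving_def u.diag_def u.ultra_class_eq u.bdd_const)
  then show ?thesis unfolding selfless_def by blast
qed

end

theorem theorem2p7:
  fixes A :: "'a cstar" and \<rho> :: "'a \<Rightarrow> complex" and B :: "'a set"
    and \<Lambda> :: "'l set" and leq :: "'l \<Rightarrow> 'l \<Rightarrow> bool" and b :: "'l \<Rightarrow> 'a"
  assumes "cstar_inclusion B A \<rho>"
    and "simple_cstar (A\<lparr>carrier := B\<rparr>)"
    and "purely_infinite (A\<lparr>carrier := B\<rparr>)"
    and "directed_set \<Lambda> leq"
    and "\<And>l. l \<in> \<Lambda> \<Longrightarrow> b l \<in> pos_elems (A\<lparr>carrier := B\<rparr>) \<and> nrm A (b l) = 1"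
    and "excises A \<rho> (net_filter \<Lambda> leq) b"
    and "\<And>a. a \<in> carrier A \<Longrightarrow>
      ((\<lambda>l. \<rho> (a \<otimes>\<^bsub>A\<^esub> b l \<otimes>\<^bsub>A\<^esub> star A a)) \<longlongrightarrow> 0) (net_filter \<Lambda> leq)"
  shows "selfless B A \<rho>"
  by (rule excised_inclusion.selfless[OF excised_inclusion.intro[OF assms]])

end
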